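(* Assume that $\alpha > -1$ and $\alpha+\beta > -1/2$. Let $1 < p < \infty$ and $\delta \in \mathbb{R}$. Then the maximal operator $M^{\alpha,\beta}_*$ is bounded on $L^p(\mathbb{R}_+,x^{\delta}dx)$ if $$\frac{1}{p} < \alpha + \beta + \frac{1}{2}$$ and (a) in case $\beta \ge 1$, $$-1 < \delta < (2\alpha+2)p-1;$$ (b) in case $0 < \beta < 1$, $$\frac{-\beta}{[\beta \vee (\alpha+\beta+1/2)]\wedge 1} < \delta < (2\alpha+\beta+1)p-1,$$ where the first inequality may be replaced by "$\le$" when $\alpha+\beta > 1/2$; (c) in case $\beta \le 0$, $$-\beta p < \delta < (2\alpha+\beta+1)p-1,$$ where the first inequality may be replaced by "$\le$" when $-\beta \in \mathbb{N}$ or $\alpha+\beta > 1/2$.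
   Context: $\mathbb{R}_+=(0,\infty)$, $\mathbb{N}=\{0,1,2,\ldots\}$; $\vee$ and $\wedge$ denote maximum and minimum; $\alpha,\beta$ are real. Let $d\mu_\alpha(x)=x^{2\alpha+1}dx$ on $\mathbb{R}_+$, and let $J_\nu$ be the Bessel function of the first kind and order $\nu$. For $\alpha>-1$, $\alpha+\beta>-1/2$ and $t,x,z>0$ with $t\ne|x-z|$, $t\ne x+z$, put $$K_t^{\alpha,\beta}(x,z) = \frac{2^{\alpha+\beta}\Gamma(\alpha+\beta+1)}{t^{\alpha+\beta}(xz)^{\alpha}} \int_0^{\infty} J_{\alpha+\beta}(ty)J_{\alpha}(xy) J_{\alpha}(zy) y^{1-\alpha-\beta}\, dy,$$ where the integral converges absolutely if $\alpha+\beta>1/2$ and otherwise is understood as a conditionally convergent (at $\infty$) improper Riemann integral. Define $$M_t^{\alpha,\beta}f(x)=\int_0^{\infty}K^{\alpha,\beta}_t(x,z)f(z)\, d\mu_{\alpha}(z),\qquad M_*^{\alpha,\beta}f(x)=\sup_{t>0}\big|M_t^{\alpha,\beta}f(x)\big|,\qquad x\in\mathbb{R}_+.$$ Boundedness on $L^p(\mathbb{R}_+,x^\delta dx)$ means (including that the operator is well defined there) $\|M_*^{\alpha,\beta}f\|_{L^p(\mathbb{R}_+,x^\delta dx)}\le C\|f\|_{L^p(\mathbb{R}_+,x^\delta dx)}$ with $C$ independent of $f$. *)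

theory Defs
  imports "HOL-Analysis.Analysis"
begin

text \<open>Bessel function of the first kind, by its power series; meant for \<^term>\<open>x > 0\<close>.
  The entire function \<^const>\<open>rGamma\<close> is the reciprocal of \<^const>\<open>Gamma\<close>.\<close>

definition bessel_J :: "real \<Rightarrow> real \<Rightarrow> real" where
  "bessel_J \<nu> x =
     (\<Sum>k. (- 1) ^ k / fact k * rGamma (\<nu> + real k + 1) * (x / 2) powr (2 * real k + \<nu>))"

text \<open>The integral over \<open>(0, \<infinity>)\<close> is the limit, as \<open>R \<rightarrow> \<infinity>\<close>, of the Lebesgue integrals over
  \<open>(0, R]\<close>. For \<^term>\<open>\<alpha> + \<beta> > 1 / 2\<close> the integrand is absolutely integrable and the limit is its
  Lebesgue integral; otherwise it is the improper integral, conditionally convergent at infinity.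
  The value is unspecified when \<^term>\<open>t = \<bar>x - z\<bar>\<close> or \<^term>\<open>t = x + z\<close>; for fixed
  \<open>t\<close> and \<open>x\<close> this concerns finitely many \<open>z\<close> only.\<close>

definition kernel_K :: "real \<Rightarrow> real \<Rightarrow> real \<Rightarrow> real \<Rightarrow> real \<Rightarrow> real" where
  "kernel_K \<alpha> \<beta> t x z =
     2 powr (\<alpha> + \<beta>) * Gamma (\<alpha> + \<beta> + 1) / (t powr (\<alpha> + \<beta>) * (x * z) powr \<alpha>) *
     Lim at_top (\<lambda>R. LBINT y:{0<..R}.
       bessel_J (\<alpha> + \<beta>) (t * y) * bessel_J \<alpha> (x * y) * bessel_J \<alpha> (z * y) * y powr (1 - \<alpha> - \<beta>))"

text \<open>The measure \<open>x\<^sup>\<delta> dx\<close> on the half-line, on the Lebesgue measurable sets; \<open>\<mu>\<^sub>\<alpha>\<close> is the case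
  \<^term>\<open>\<delta> = 2 * \<alpha> + 1\<close>.\<close>

definition power_measure :: "real \<Rightarrow> real measure" where
  "power_measure \<delta> = density (lebesgue_on {0<..}) (\<lambda>x. ennreal (x powr \<delta>))"

definition mean_M :: "real \<Rightarrow> real \<Rightarrow> real \<Rightarrow> (real \<Rightarrow> complex) \<Rightarrow> real \<Rightarrow> complex" where
  "mean_M \<alpha> \<beta> t f x = (LINT z|power_measure (2 * \<alpha> + 1). kernel_K \<alpha> \<beta> t x z *\<^sub>R f z)"

definition maximal_M :: "real \<Rightarrow> real \<Rightarrow> (real \<Rightarrow> complex) \<Rightarrow> real \<Rightarrow> ennreal" where
  "maximal_M \<alpha> \<beta> f x = (SUP t\<in>{0<..}. ennreal (cmod (mean_M \<alpha> \<beta> t f x)))"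

text \<open>Real powers on \<open>[0, \<infinity>]\<close>, for exponents \<^term>\<open>r > 0\<close>.\<close>

definition ennreal_powr :: "ennreal \<Rightarrow> real \<Rightarrow> ennreal" where
  "ennreal_powr u r = (if u = top then top else ennreal (enn2real u powr r))"

definition Lp_norm :: "'a measure \<Rightarrow> real \<Rightarrow> ('a \<Rightarrow> ennreal) \<Rightarrow> ennreal" where
  "Lp_norm M p g = ennreal_powr (\<integral>\<^sup>+ x. ennreal_powr (g x) p \<partial>M) (1 / p)"

definition Lp_space :: "'a measure \<Rightarrow> real \<Rightarrow> ('a \<Rightarrow> complex) set" where
  "Lp_space M p = {f \<in> borel_measurable M. Lp_norm M p (\<lambda>x. ennreal (cmod (f x))) < top}"

text \<open>Being well defined on \<open>L\<^sup>p\<close> means that the integrals defining the means converge absolutely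
  and that the maximal function is measurable. The latter has to be required separately: the
  supremum is over an uncountable set, and \<^const>\<open>nn_integral\<close> of a nonmeasurable function is
  merely a lower integral.\<close>

definition maximal_M_well_defined :: "real \<Rightarrow> real \<Rightarrow> real \<Rightarrow> real \<Rightarrow> bool" where
  "maximal_M_well_defined \<alpha> \<beta> p \<delta> \<longleftrightarrow>
     (\<forall>f \<in> Lp_space (power_measure \<delta>) p.
        (\<forall>t>0. \<forall>x>0. integrable (power_measure (2 * \<alpha> + 1)) (\<lambda>z. kernel_K \<alpha> \<beta> t x z *\<^sub>R f z)) \<and>
        maximal_M \<alpha> \<beta> f \<in> borel_measurable (power_measure \<delta>))"

definition maximal_M_bounded :: "real \<Rightarrow> real \<Rightarrow> real \<Rightarrow> real \<Rightarrow> bool" where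
  "maximal_M_bounded \<alpha> \<beta> p \<delta> \<longleftrightarrow>
     maximal_M_well_defined \<alpha> \<beta> p \<delta> \<and>
     (\<exists>C::real. 0 \<le> C \<and> (\<forall>f \<in> Lp_space (power_measure \<delta>) p.
        Lp_norm (power_measure \<delta>) p (maximal_M \<alpha> \<beta> f)
          \<le> ennreal C * Lp_norm (power_measure \<delta>) p (\<lambda>x. ennreal (cmod (f x)))))"

end

theory Submission
  imports Defs
begin

text \<open>For \<open>\<alpha> > -1/2\<close> and large \<open>\<beta>\<close> the triple Bessel integral is identified by comparing Laplace
transforms in \<open>t\<^sup>2\<close> (Weber's exponential integral and Lerch's theorem): up to powers of \<open>t\<close>,
\<open>x\<close>, \<open>z\<close> it is a function of \<open>(t\<^sup>2 - x\<^sup>2 - z\<^sup>2) / (2 x z)\<close> alone. Differentiating in \<open>t\<close>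
and integrating by parts carry the formula over to smaller \<open>\<alpha> + \<beta>\<close> and \<open>\<alpha>\<close>. The kernel
is homogeneous, so it suffices to bound it at \<open>x = 1\<close>. There the maximal operator is
dominated by three parts: near the diagonal the Hardy--Littlewood maximal function, then a part with
integrable singularities handled by Hoelder's inequality with power weights and Fubini, and at the
end point of the range of \<open>\<delta>\<close> a maximal function of shifted averages, bounded by
interpolation. Since the means are continuous in \<open>t\<close>, the supremum may be taken over
rational \<open>t\<close>.\<close>

text \<open>The kernel enters the estimates through its absolute value only. Its singularities at t
  = |x - z| and t = x + z cost at most a power -si, for any si > 0 with si >= 1/2 - al - be, and 1/p
  < al + be + 1/2 says precisely that some such si has si * p' < 1, p' = p/(p - 1). Hoelder's
  inequality then absorbs them uniformly in t, so that the supremum does no harm away from the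
  diagonal. The limits on delta come from the behaviour of the kernel as y -> 0 and y -> infinity,
  which must fit a weight y^(-a) resp. y^b whose dual power is integrable too. For be <= 0 and delta
  = - be * p the demands b <= be and b > be collide; this forces the separate end point argument.
  Fubini is available only for large al + be, while for al + be near -1/2 the triple integral
  converges conditionally. Hence a formula normalized by 1/Gamma be, which survives be <= 0, and
  convergence that is uniform near every nonsingular t, so that limits can be
  differentiated.\<close>

abbreviation lebesgue_nn_integral :: "(real \<Rightarrow> ennreal) \<Rightarrow> ennreal" (binder "NN " 10) where
 "lebesgue_nn_integral f \<equiv> integral\<^sup>N lborel f"

section \<open>Bessel functions\<close>

definition bessel_coeff :: "real => nat => real" where
 "bessel_coeff nu k = (- 1) ^ k/fact k*rGamma (nu + real k + 1)"

text \<open>Splitting off (x/2) powr nu leaves an entire function of w = x^2/4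
  (\<open>bessel_J_eq\<close>). It makes sense for all real nu and w, so its calculus needs no
  positivity assumptions.\<close>

definition bessel_j :: "real => real => real" where
 "bessel_j nu w = (\<Sum>k. bessel_coeff nu k*w ^ k)"

text \<open>Since \<open>rGamma\<close> is entire, this form without division holds also where nu +
  k + 1 is zero or a negative integer.\<close>

lemma bessel_coeff_Suc:
 "bessel_coeff nu k = - (real k + 1)*(nu + real k + 1)*bessel_coeff nu (Suc k)"
proof -
 have "rGamma (nu + real k + 1) = (nu + real k + 1)*rGamma (nu + real k + 1 + 1)"
  by (rule rGamma_plus1 [symmetric])
 moreover have "(- 1) ^ k/fact k*((nu + real k + 1)*r)
   = - (real k + 1)*(nu + real k + 1)*((- 1) ^ Suc k/fact (Suc k)*r)" for r :: real
  by (simp add: divide_simps) (simp add: algebra_simps)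
 ultimately show ?thesis
  by (simp add: bessel_coeff_def add_ac)
qed

lemma summable_bessel_coeff: "summable (\<lambda>k. bessel_coeff nu k*w ^ k)"
proof -
 \<comment> \<open>Beyond N the factor (k + 1) (nu + k + 1) of \<open>bessel_coeff_Suc\<close> is at
   least 2 |w|, so the terms at least halve.\<close>
 obtain N :: nat where N: "real N > abs nu + 2*abs w + 1"
  using reals_Archimedean2 by blast
 show ?thesis
 proof (rule summable_ratio_test [of "1/2" N])
  fix n assume n: "n \<ge> N"
  then have nN: "real n \<ge> real N" by simp
  have p: "nu + real n + 1 \<ge> 2*abs w + 1" using N nN by linarith
  let ?c = "abs (bessel_coeff nu (Suc n))"
  have "abs (bessel_coeff nu n) = (real n + 1)*(nu + real n + 1)*?c"
   using p by (subst bessel_coeff_Suc) (simp add: abs_mult)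
  moreover have "1*(2*abs w) \<le> (real n + 1)*(nu + real n + 1)"
   using p by (intro mult_mono) auto
  ultimately have "2*abs w*?c \<le> abs (bessel_coeff nu n)"
   by (simp add: mult_right_mono)
  then have "2*abs w*?c*abs w ^ n \<le> abs (bessel_coeff nu n)*abs w ^ n"
   by (rule mult_right_mono) simp
  then show "norm (bessel_coeff nu (Suc n)*w ^ Suc n) \<le> 1/2*norm (bessel_coeff nu n*w ^ n)"
   by (simp add: abs_mult power_abs algebra_simps)
 qed simp
qed

lemma DERIV_bessel_j: "(bessel_j nu has_field_derivative - bessel_j (nu + 1) w) (at w)"
proof -
 have "((\<lambda>w. \<Sum>k. bessel_coeff nu k*w ^ k) has_field_derivative
   (\<Sum>k. diffs (bessel_coeff nu) k*w ^ k)) (at w)"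
  by (rule termdiffs_strong_converges_everywhere) (rule summable_bessel_coeff)
 moreover have "diffs (bessel_coeff nu) k = - bessel_coeff (nu + 1) k" for k
 proof -
  have "(1 + real k)*((- 1) ^ Suc k/fact (Suc k)*r) = - ((- 1) ^ k/fact k*r)" for r :: real
   by (simp add: divide_simps)
  then show ?thesis
   by (simp add: diffs_def bessel_coeff_def add_ac del: power_Suc fact_Suc)
 qed
 ultimately show ?thesis
  using summable_bessel_coeff [of "nu + 1" w]
  by (simp add: bessel_j_def [abs_def] suminf_minus)
qed

lemma continuous_on_bessel_j [continuous_intros]:
 "continuous_on S f ==> continuous_on S (\<lambda>x. bessel_j nu (f x))"
 by (rule continuous_on_compose2 [of UNIV "bessel_j nu"])
   (auto intro!: DERIV_continuous_on has_field_derivative_at_within [OF DERIV_bessel_j])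

lemma bessel_j_recurrence: "bessel_j nu w = (nu + 1)*bessel_j (nu + 1) w - w*bessel_j (nu + 2) w"
proof -
 have s: "(\<lambda>k. bessel_coeff mu k*w ^ k) sums bessel_j mu w" for mu
  unfolding bessel_j_def by (rule summable_sums [OF summable_bessel_coeff])
 have A: "(\<lambda>k. (nu + 1)*(bessel_coeff (nu + 1) k*w ^ k)) sums ((nu + 1)*bessel_j (nu + 1) w)"
  by (intro sums_mult s)
 \<comment> \<open>The series of w * bessel_j (nu + 2) w, delayed by one index so that all three
   series run over the same powers of w.\<close>
 define g where "g k = (case k of 0 => 0 | Suc n => w*(bessel_coeff (nu + 2) n*w ^ n))" for k
 have "(\<lambda>n. g (Suc n)) sums (w*bessel_j (nu + 2) w)"
  unfolding g_def by (auto intro!: sums_mult s)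
 then have B: "g sums (w*bessel_j (nu + 2) w)"
  by (subst (asm) sums_Suc_iff) (simp add: g_def)
 have "(nu + 1)*(bessel_coeff (nu + 1) k*w ^ k) - g k = bessel_coeff nu k*w ^ k" for k
 proof (cases k)
  case 0
  then show ?thesis
   using rGamma_plus1 [of "nu + 1"] by (simp add: g_def bessel_coeff_def add.assoc)
 next
  case (Suc n)
  have r: "rGamma (nu + real n + 2) = (nu + real n + 2)*rGamma (nu + real n + 3)"
   using rGamma_plus1 [of "nu + real n + 2"] by (simp add: add.assoc)
  have "(nu + 1)*bessel_coeff (nu + 1) (Suc n) - bessel_coeff (nu + 2) n = bessel_coeff nu (Suc n)"
  proof -
   have "(nu + 1)*((- 1) ^ Suc n/fact (Suc n)*q) - (- 1) ^ n/fact n*q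
     = (- 1) ^ Suc n/fact (Suc n)*((nu + real n + 2)*q)" for q :: real
    by (simp add: divide_simps) (simp add: algebra_simps)
   then show ?thesis
    using r by (simp add: bessel_coeff_def add_ac del: power_Suc fact_Suc)
  qed
  moreover have "(nu + 1)*(p*w ^ Suc n) - w*(q*w ^ n) = ((nu + 1)*p - q)*w ^ Suc n" for p q
   by (simp add: algebra_simps)
  ultimately show ?thesis
   unfolding Suc g_def by simp
 qed
 then have "(\<lambda>k. bessel_coeff nu k*w ^ k) sums ((nu + 1)*bessel_j (nu + 1) w - w*bessel_j (nu + 2) w)"
  using sums_diff [OF A B] by simp
 then show ?thesis using s sums_unique2 by blast
qed

lemma bessel_J_eq: "x > 0 ==> bessel_J nu x = (x/2) powr nu*bessel_j nu (x^2/4)"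
proof -
 assume x: "x > 0"
 have "bessel_coeff nu k*(x/2) powr (2*real k + nu) =
   (x/2) powr nu*(bessel_coeff nu k*(x^2/4) ^ k)" for k
 proof -
  have "(x/2) powr (2*real k) = (x/2) ^ (2 * k)"
   using x powr_realpow [of "x/2" "2 * k"] by simp
  also have "... = (x^2/4) ^ k" by (simp add: power_mult power_divide)
  finally show ?thesis using x by (simp add: powr_add)
 qed
 then have "bessel_J nu x = (\<Sum>k. (x/2) powr nu*(bessel_coeff nu k*(x^2/4) ^ k))"
  by (simp only: bessel_J_def flip: bessel_coeff_def)
 also have "... = (x/2) powr nu*bessel_j nu (x^2/4)"
  unfolding bessel_j_def by (rule suminf_mult [OF summable_bessel_coeff])
 finally show ?thesis .
qed

lemma DERIV_bessel_J:
 assumes "x > 0"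
 shows "(bessel_J nu has_field_derivative (nu/x*bessel_J nu x - bessel_J (nu + 1) x)) (at x)"
proof -
 have "((\<lambda>x. (x/2) powr nu*bessel_j nu (x^2/4)) has_field_derivative
  (nu*(x/2) powr (nu - 1)*(1/2)*bessel_j nu (x^2/4) + (x/2) powr nu*(- bessel_j (nu+1) (x^2/4)*(x/2)))) (at x)"
  using assms
  by (auto intro!: derivative_eq_intros DERIV_chain2 [OF DERIV_bessel_j] simp del: powr_half_sqrt)
 also have "nu*(x/2) powr (nu - 1)*(1/2)*bessel_j nu (x^2/4) + (x/2) powr nu*(- bessel_j (nu+1) (x^2/4)*(x/2))
   = nu/x*bessel_J nu x - bessel_J (nu + 1) x"
 proof -
  have "nu*(x/2) powr (nu - 1)*(1/2)*a + (x/2) powr nu*(- b*(x/2))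
   = nu/x*((x/2) powr nu*a) - (x/2) powr (nu + 1)*b" for a b
   using assms by (simp add: powr_add powr_diff algebra_simps)
  then show ?thesis using assms by (simp add: bessel_J_eq)
 qed
 finally show ?thesis
  by (rule has_field_derivative_transform_within_open [where S="{0<..}"])
    (use assms in \<open>auto simp: bessel_J_eq\<close>)
qed

lemma bessel_J_recurrence:
 assumes "x > 0"
 shows "bessel_J nu x = 2*(nu + 1)/x*bessel_J (nu + 1) x - bessel_J (nu + 2) x"
proof -
 have "(x/2) powr nu*((nu + 1)*a - x^2/4*b)
   = 2*(nu + 1)/x*((x/2) powr (nu + 1)*a) - (x/2) powr (nu + 2)*b" for a b
  using assms by (simp add: powr_add power2_eq_square field_simps)
 then show ?thesis
  using assms bessel_j_recurrence [of nu "x^2/4"] by (simp add: bessel_J_eq)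
qed

lemma DERIV_bessel_J':
 assumes "x > 0"
 shows "(bessel_J (nu + 1) has_field_derivative (bessel_J nu x - (nu + 1)/x*bessel_J (nu + 1) x)) (at x)"
proof -
 have "(nu + 1)/x*bessel_J (nu + 1) x - bessel_J (nu + 1 + 1) x
   = bessel_J nu x - (nu + 1)/x*bessel_J (nu + 1) x"
  unfolding bessel_J_recurrence [OF assms, of nu] using assms by (simp add: add.assoc field_simps)
 with DERIV_bessel_J [OF assms, of "nu + 1"] show ?thesis by metis
qed

lemma continuous_on_bessel_J [continuous_intros]:
 assumes "continuous_on S f" "\<And>x. x \<in> S ==> f x > 0"
 shows "continuous_on S (\<lambda>x. bessel_J nu (f x))"
proof -
 have "continuous_on {0<..} (bessel_J nu)"
  by (intro continuous_at_imp_continuous_on ballI) (auto intro: DERIV_isCont [OF DERIV_bessel_J])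
 from continuous_on_compose2 [OF this assms(1)] assms(2) show ?thesis by auto
qed

lemma DERIV_powr_bessel_J_order:
 assumes "t > 0" "y > 0"
 shows "((\<lambda>t. t powr (mu + 1)*bessel_J (mu + 1) (t*y)) has_field_derivative
   y*t powr (mu + 1)*bessel_J mu (t*y)) (at t)"
proof -
 have "((\<lambda>t. t powr (mu + 1)*bessel_J (mu + 1) (t*y)) has_field_derivative
  ((mu + 1)*t powr mu*bessel_J (mu + 1) (t*y) + t powr (mu + 1) *
   ((bessel_J mu (t*y) - (mu + 1)/(t*y)*bessel_J (mu + 1) (t*y))*y))) (at t)"
  using assms by (auto intro!: derivative_eq_intros DERIV_chain2 [OF DERIV_bessel_J'])
 moreover have "(mu + 1)*T*b + T*t*((a - (mu + 1)/(t*y)*b)*y) = y*(T*t)*a" for a b T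
  using assms by (simp add: field_simps)
 ultimately show ?thesis
  using assms by (simp only: powr_add powr_one)
qed

lemma DERIV_powr_minus_bessel_J:
 assumes "t > 0" "y > 0"
 shows "((\<lambda>y. y powr (- mu)*bessel_J mu (t*y)) has_field_derivative
   - t*y powr (- mu)*bessel_J (mu + 1) (t*y)) (at y)"
proof -
 have "((\<lambda>y. y powr (- mu)*bessel_J mu (t*y)) has_field_derivative
  ((- mu)*y powr (- mu - 1)*bessel_J mu (t*y) + y powr (-mu) *
   ((mu/(t*y)*bessel_J mu (t*y) - bessel_J (mu + 1) (t*y))*t))) (at y)"
  using assms by (auto intro!: derivative_eq_intros DERIV_chain2 [OF DERIV_bessel_J])
 moreover have "(- mu)*(Y/y)*a + Y*((mu/(t*y)*a - b)*t) = - t*Y*b" for a b Y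
  using assms by (simp add: field_simps)
 ultimately show ?thesis
  using assms by (simp only: powr_diff powr_one)
qed

section \<open>Size and asymptotics of Bessel functions\<close>

lemma bessel_J_bound_small:
 assumes "Y > 0"
 shows "\<exists>C\<ge>0. \<forall>y. 0 < y --> y \<le> Y --> abs (bessel_J nu y) \<le> C*y powr nu"
proof -
 have "compact ((\<lambda>y. bessel_j nu (y^2/4)) ` {0..Y})"
  by (intro compact_continuous_image continuous_intros) auto
 then have "bounded ((\<lambda>y. bessel_j nu (y^2/4)) ` {0..Y})" by (rule compact_imp_bounded)
 then obtain B where "\<forall>v \<in> (\<lambda>y. bessel_j nu (y^2/4)) ` {0..Y}. norm v \<le> B"
  unfolding bounded_iff by blast
 then have B: "abs (bessel_j nu (y^2/4)) \<le> B" if "0 \<le> y" "y \<le> Y" for y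
  using that by auto
 have B0: "B \<ge> 0" using B [of 0] assms by linarith
 show ?thesis
 proof (intro exI [of _ "(1/2) powr nu*B"] conjI allI impI)
  show "0 \<le> (1/2) powr nu*B" using B0 by simp
  fix y :: real assume y: "0 < y" "y \<le> Y"
  have "abs (bessel_J nu y) = (y/2) powr nu*abs (bessel_j nu (y^2/4))"
   using y by (simp add: bessel_J_eq abs_mult)
  also have "... \<le> (y/2) powr nu*B" using B y by (intro mult_left_mono) auto
  also have "(y/2) powr nu = (1/2) powr nu*y powr nu" using y by (simp add: powr_divide)
  finally show "abs (bessel_J nu y) \<le> (1/2) powr nu*B*y powr nu" by (simp add: mult_ac)
 qed
qed

text \<open>f + M/y decreases and f - M/y increases, so both squeeze the same limit; it is obtained
  as the infimum of the former, without Cauchy sequences.\<close>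

lemma limit_if_deriv_inverse_square:
 fixes f f' :: "real => real"
 assumes der: "\<And>y. y \<ge> 1 ==> (f has_field_derivative f' y) (at y)"
  and bd: "\<And>y. y \<ge> 1 ==> abs (f' y) \<le> M/y^2"
 shows "\<exists>L. \<forall>y\<ge>1. abs (f y - L) \<le> M/y"
proof -
 have M: "M \<ge> 0" using bd [of 1] by simp
 have dec: "f b + M/b \<le> f a + M/a" if "1 \<le> a" "a \<le> b" for a b
 proof (rule DERIV_nonpos_imp_nonincreasing [OF that(2), of "\<lambda>y. f y + M/y"])
  fix x assume x: "a \<le> x" "x \<le> b"
  have "((\<lambda>y. f y + M/y) has_field_derivative f' x - M/x^2) (at x)"
   using x that by (auto intro!: derivative_eq_intros der simp: power2_eq_square)
  then show "\<exists>y. ((\<lambda>y. f y + M/y) has_real_derivative y) (at x) \<and> y \<le> 0"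
   using bd [of x] x that by (intro exI conjI) (assumption, simp)
 qed
 have inc: "f a - M/a \<le> f b - M/b" if "1 \<le> a" "a \<le> b" for a b
 proof (rule DERIV_nonneg_imp_nondecreasing [OF that(2), of "\<lambda>y. f y - M/y"])
  fix x assume x: "a \<le> x" "x \<le> b"
  have "((\<lambda>y. f y - M/y) has_field_derivative f' x + M/x^2) (at x)"
   using x that by (auto intro!: derivative_eq_intros der simp: power2_eq_square)
  then show "\<exists>y. ((\<lambda>y. f y - M/y) has_real_derivative y) (at x) \<and> 0 \<le> y"
   using bd [of x] x that by (intro exI conjI) (assumption, simp)
 qed
 have cross: "f a - M/a \<le> f b + M/b" if "1 \<le> a" "1 \<le> b" for a b
 proof -
  have "f a - M/a \<le> f (max a b) - M/max a b" using that by (intro inc) auto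
  also have "... \<le> f (max a b) + M/max a b" using M that by simp
  also have "... \<le> f b + M/b" using that by (intro dec) auto
  finally show ?thesis .
 qed
 define L where "L = (INF y\<in>{1..}. f y + M/y)"
 have "f a - M/a \<le> L" if "a \<ge> 1" for a
  unfolding L_def using that by (intro cINF_greatest cross) auto
 moreover have "L \<le> f a + M/a" if "a \<ge> 1" for a
  unfolding L_def using that cross [of 1] by (intro cINF_lower bdd_belowI2 [where m="f 1 - M/1"]) auto
 ultimately show ?thesis
  by (intro exI [of _ L]) (auto simp: abs_le_iff algebra_simps)
qed

text \<open>The equation is v'' = (c/y^2 - 1) v. The energy v^2 + V^2 has derivative 2 c v V/y^2, at
  most |c|/y^2 times the energy itself, which the damping factor exp (|c|/y) compensates; that
  factor stays between 1 and exp |c|.\<close>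

lemma bounded_of_perturbed_oscillator:
 fixes v V :: "real => real"
 assumes v: "\<And>y. y \<ge> 1 ==> (v has_field_derivative V y) (at y)"
  and V: "\<And>y. y \<ge> 1 ==> (V has_field_derivative c/y^2 * v y - v y) (at y)"
 shows "\<exists>B. \<forall>y\<ge>1. abs (v y) \<le> B"
proof -
 define E where "E y = ((v y)^2 + (V y)^2)*exp (abs c/y)" for y
 have dE: "(E has_field_derivative
   exp (abs c/y)/y^2*(2*c * v y*V y - abs c*((v y)^2 + (V y)^2))) (at y)" if "y \<ge> 1" for y
  unfolding E_def using that
  by (auto intro!: derivative_eq_intros v V simp: power2_eq_square field_simps)
 have ub: "2*c*a*b - abs c*(a^2 + b^2) \<le> 0" for a b :: real
 proof -
  have "abs (2*(a*b)) \<le> a^2 + b^2"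
   using zero_le_power2 [of "a + b"] zero_le_power2 [of "a - b"]
   by (simp add: power2_sum power2_diff abs_le_iff)
  then have "abs c*abs (2*(a*b)) \<le> abs c*(a^2 + b^2)" by (rule mult_left_mono) simp
  moreover have "2*c*a*b \<le> abs c*abs (2*(a*b))"
   using abs_ge_self [of "c*(2*(a*b))"] by (simp add: abs_mult mult_ac)
  ultimately show ?thesis by linarith
 qed
 have le: "E y \<le> E 1" if "y \<ge> 1" for y
 proof (rule DERIV_nonpos_imp_nonincreasing [OF that])
  fix x :: real assume x: "1 \<le> x"
  show "\<exists>D. (E has_real_derivative D) (at x) \<and> D \<le> 0"
   by (rule exI, rule conjI, rule dE [OF x], rule mult_nonneg_nonpos [OF _ ub]) simp
 qed
 have "abs (v y) \<le> sqrt (E 1)" if "y \<ge> 1" for y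
 proof -
  have "(v y)^2 \<le> ((v y)^2 + (V y)^2)*1" by simp
  also have "... \<le> E y"
   unfolding E_def using that by (intro mult_left_mono) auto
  finally show ?thesis using le [OF that] by (intro real_le_rsqrt) simp
 qed
 then show ?thesis by blast
qed

text \<open>Variation of constants: rotating (v, V) back by the angle y gives coordinates with
  derivative O(1/y^2), which converge at rate 1/y by \<open>limit_if_deriv_inverse_square\<close>.
  Polar coordinates of the limit are amplitude and phase.\<close>

lemma cos_of_perturbed_oscillator:
 fixes v V :: "real => real"
 assumes v: "\<And>y. y \<ge> 1 ==> (v has_field_derivative V y) (at y)"
  and V: "\<And>y. y \<ge> 1 ==> (V has_field_derivative c/y^2 * v y - v y) (at y)"
 shows "\<exists>rh th C. \<forall>y\<ge>1. abs (v y - rh*cos (y - th)) \<le> C/y"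
proof -
 obtain B where B: "\<And>y. y \<ge> 1 ==> abs (v y) \<le> B"
  using bounded_of_perturbed_oscillator [OF v V] by blast
 have bd: "abs (c/y^2 * v y * s) \<le> abs c*B/y^2" if "y \<ge> 1" "abs s \<le> 1" for y s
 proof -
  have "abs c/y^2*abs (v y)*abs s \<le> abs c/y^2*B*1"
   using that B [of y] by (intro mult_mono mult_left_mono) auto
  then show ?thesis by (simp add: abs_mult)
 qed
 have "\<exists>L. \<forall>y\<ge>1. abs ((v y*cos y - V y * sin y) - L) \<le> abs c*B/y"
 proof (rule limit_if_deriv_inverse_square)
  fix y :: real assume y: "y \<ge> 1"
  show "((\<lambda>y. v y*cos y - V y * sin y) has_field_derivative c/y^2 * v y*(- sin y)) (at y)"
   using y by (auto intro!: derivative_eq_intros v V simp: algebra_simps)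
  show "abs (c/y^2 * v y*(- sin y)) \<le> abs c*B/y^2" using y by (intro bd) auto
 qed
 then obtain a where a: "\<And>y. y \<ge> 1 ==> abs ((v y*cos y - V y * sin y) - a) \<le> abs c*B/y" by blast
 have "\<exists>L. \<forall>y\<ge>1. abs ((v y * sin y + V y*cos y) - L) \<le> abs c*B/y"
 proof (rule limit_if_deriv_inverse_square)
  fix y :: real assume y: "y \<ge> 1"
  show "((\<lambda>y. v y * sin y + V y*cos y) has_field_derivative c/y^2 * v y*cos y) (at y)"
   using y by (auto intro!: derivative_eq_intros v V simp: algebra_simps)
  show "abs (c/y^2 * v y*cos y) \<le> abs c*B/y^2" using y by (intro bd) auto
 qed
 then obtain b where b: "\<And>y. y \<ge> 1 ==> abs ((v y * sin y + V y*cos y) - b) \<le> abs c*B/y" by blast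
 obtain rh th where pol: "a = rh*cos th" "b = rh * sin th" using polar_Ex by blast
 have "abs (v y - rh*cos (y - th)) \<le> 2*(abs c*B)/y" if y: "y \<ge> 1" for y
 proof -
  define p where "p = v y*cos y - V y * sin y"
  define q where "q = v y * sin y + V y*cos y"
  have "p*cos y + q * sin y = v y*((sin y)^2 + (cos y)^2)"
   unfolding p_def q_def power2_eq_square by (simp only: algebra_simps)
  then have v: "v y = p*cos y + q * sin y" by simp
  have "v y - rh*cos (y - th) = (p - a)*cos y + (q - b) * sin y"
   unfolding v pol cos_diff by (simp add: algebra_simps)
  also have "abs (...) \<le> abs (p - a)*abs (cos y) + abs (q - b)*abs (sin y)"
   by (metis abs_mult abs_triangle_ineq)
  also have "... \<le> (abs c*B/y)*1 + (abs c*B/y)*1"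
   using a [OF y] b [OF y] unfolding p_def q_def by (intro add_mono mult_mono) auto
  finally show ?thesis by (simp add: mult_ac)
 qed
 then show ?thesis by blast
qed

text \<open>sqrt y * J_nu satisfies v'' = ((nu^2 - 1/4)/y^2 - 1) v, and k^2 - k = nu^2 - 1/4 for k =
  nu + 1/2. Amplitude and phase remain unspecified; the oscillation alone makes the later tails
  converge.\<close>

lemma bessel_J_asymp:
 "\<exists>rh th C. \<forall>y\<ge>1. abs (sqrt y*bessel_J nu y - rh*cos (y - th)) \<le> C/y"
proof -
 define k where "k = nu + 1/2"
 define v where "v y = sqrt y*bessel_J nu y" for y
 define w where "w y = sqrt y*bessel_J (nu + 1) y" for y
 \<comment> \<open>The derivative of v, written with J_(nu+1) so that differentiating it again takes
   only the first order formulas.\<close>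
 define V where "V y = k/y * v y - w y" for y
 have dv: "(v has_field_derivative V y) (at y)" if "y \<ge> 1" for y
 proof -
  have "(v has_field_derivative (inverse (sqrt y)/2*bessel_J nu y
    + sqrt y*(nu/y*bessel_J nu y - bessel_J (nu + 1) y))) (at y)"
   unfolding v_def using that by (auto intro!: derivative_eq_intros DERIV_bessel_J)
  moreover have "inverse (sqrt y) = sqrt y/y" using that by (simp add: inverse_eq_divide real_div_sqrt field_simps)
  then have "inverse (sqrt y)/2*p + sqrt y*(nu/y*p - q) = k/y*(sqrt y*p) - sqrt y*q" for p q
   using that by (simp only: k_def) (simp add: field_simps)
  ultimately show ?thesis by (simp only: V_def v_def w_def)
 qed
 have dw: "(w has_field_derivative v y - k/y*w y) (at y)" if "y \<ge> 1" for y
 proof -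
  have "(w has_field_derivative (inverse (sqrt y)/2*bessel_J (nu+1) y
    + sqrt y*(bessel_J nu y - (nu + 1)/y*bessel_J (nu + 1) y))) (at y)"
   unfolding w_def using that by (auto intro!: derivative_eq_intros DERIV_bessel_J')
  moreover have "inverse (sqrt y) = sqrt y/y" using that by (simp add: inverse_eq_divide real_div_sqrt field_simps)
  then have "inverse (sqrt y)/2*q + sqrt y*(p - (nu + 1)/y*q) = sqrt y*p - k/y*(sqrt y*q)" for p q
   using that by (simp only: k_def) (simp add: field_simps)
  ultimately show ?thesis by (simp only: v_def w_def)
 qed
 have dV: "(V has_field_derivative (k^2 - k)/y^2 * v y - v y) (at y)" if "y \<ge> 1" for y
 proof -
  have "(V has_field_derivative (- k/y^2 * v y + k/y*V y - (v y - k/y*w y))) (at y)"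
   unfolding V_def [abs_def] using that
   by (auto intro!: derivative_eq_intros dv dw simp: V_def power2_eq_square)
     (simp add: field_simps)
  moreover have "- k/y^2 * v y + k/y*V y - (v y - k/y*w y) = (k^2 - k)/y^2 * v y - v y"
   using that unfolding V_def by (simp add: power2_eq_square field_simps)
  ultimately show ?thesis by (simp only:)
 qed
 show ?thesis
  using cos_of_perturbed_oscillator [OF dv dV] by (simp add: v_def)
qed

lemma bessel_J_bound_large:
 assumes "Y > 0"
 shows "\<exists>C\<ge>0. \<forall>y\<ge>Y. abs (bessel_J nu y) \<le> C/sqrt y"
proof -
 obtain rh th C where C: "\<And>y. y \<ge> 1 ==> abs (sqrt y*bessel_J nu y - rh*cos (y - th)) \<le> C/y"
  using bessel_J_asymp by blast
 have "continuous_on {Y..max Y 1} (\<lambda>y. sqrt y*bessel_J nu y)"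
  using assms by (intro continuous_intros) auto
 then have "bounded ((\<lambda>y. sqrt y*bessel_J nu y) ` {Y..max Y 1})"
  by (intro compact_imp_bounded compact_continuous_image) auto
 then obtain D where "\<forall>v\<in>((\<lambda>y. sqrt y*bessel_J nu y) ` {Y..max Y 1}). norm v \<le> D"
  unfolding bounded_iff by blast
 then have D: "abs (sqrt y*bessel_J nu y) \<le> D" if "Y \<le> y" "y \<le> max Y 1" for y using that by auto
 define K where "K = max D (abs rh + abs C)"
 have K: "abs (sqrt y*bessel_J nu y) \<le> K" if "Y \<le> y" for y
 proof (cases "y \<ge> 1")
  case True
  have "abs (rh*cos (y - th)) \<le> abs rh*1" unfolding abs_mult by (intro mult_left_mono) auto
  moreover have "C/y \<le> abs C"
  proof -
   have "C/y \<le> abs C/y" using True by (intro divide_right_mono) auto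
   also have "... \<le> abs C/1" using True by (intro divide_left_mono) auto
   finally show ?thesis by simp
  qed
  ultimately show ?thesis using C [OF True] unfolding K_def by linarith
 next
  case False
  with D [of y] that show ?thesis unfolding K_def by auto
 qed
 then have "0 \<le> K" by (rule order_trans [OF abs_ge_zero]) (rule order_refl)
 moreover have "abs (bessel_J nu y) \<le> K/sqrt y" if "y \<ge> Y" for y
  using K [OF that] assms that by (simp add: abs_mult field_simps)
 ultimately show ?thesis by blast
qed

lemma integral_powr_minus:
 fixes s R S :: real
 assumes "s > 0" "0 < R" "R \<le> S"
 shows "((\<lambda>y. y powr (- s - 1)) has_integral (R powr (- s) - S powr (- s))/s) {R..S}"
proof -
 have "((\<lambda>y. y powr (- s - 1)) has_integral (- (S powr (- s))/s - (- (R powr (- s))/s))) {R..S}"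
 proof (rule fundamental_theorem_of_calculus [where f="\<lambda>y. - (y powr (- s))/s"])
  fix y assume "y \<in> {R..S}"
  then have "((\<lambda>y. - (y powr (- s))/s) has_real_derivative y powr (- s - 1)) (at y)"
   using assms by (auto intro!: derivative_eq_intros)
  then show "((\<lambda>y. - (y powr (- s))/s) has_vector_derivative y powr (- s - 1)) (at y within {R..S})"
   by (simp add: has_real_derivative_iff_has_vector_derivative has_vector_derivative_at_within)
 qed (use assms in auto)
 then show ?thesis by (simp add: diff_divide_distrib)
qed

text \<open>One integration by parts. The bounds for the boundary term at S and for the remaining
  integral cancel in S, which leaves a bound by the value at R alone, uniform in S.\<close>

lemma oscillating_integral_bound:
 fixes s R S Om ph :: real
 assumes "s > 0" "0 < R" "R \<le> S" "Om \<noteq> 0"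
 shows "abs (integral {R..S} (\<lambda>y. y powr (- s)*cos (Om*y + ph))) \<le> 2 * R powr (- s)/abs Om"
proof -
 define g where "g y = y powr (- s)*cos (Om*y + ph)" for y
 define h where "h y = s*y powr (- s - 1)*(sin (Om*y + ph)/Om)" for y
 define F where "F y = y powr (- s)*(sin (Om*y + ph)/Om)" for y
 have "((\<lambda>y. g y - h y) has_integral F S - F R) {R..S}"
 proof (rule fundamental_theorem_of_calculus [where f=F])
  fix y assume "y \<in> {R..S}"
  then have "(F has_real_derivative g y - h y) (at y)"
   unfolding F_def [abs_def] g_def h_def using assms
   by (auto intro!: derivative_eq_intros simp: diff_divide_distrib)
  then show "(F has_vector_derivative g y - h y) (at y within {R..S})"
   by (simp add: has_real_derivative_iff_has_vector_derivative has_vector_derivative_at_within)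
 qed (use assms in auto)
 moreover have ih: "h integrable_on {R..S}"
  unfolding h_def using assms by (intro integrable_continuous_interval continuous_intros) auto
 ultimately have "(g has_integral F S - F R + integral {R..S} h) {R..S}"
  using has_integral_add [of "\<lambda>y. g y - h y" "F S - F R" "{R..S}" h] by (simp add: integrable_integral)
 then have eq: "integral {R..S} g = F S - F R + integral {R..S} h" by (rule integral_unique)
 have sinb: "abs (sin w/Om) \<le> 1/abs Om" for w
  by (simp add: divide_right_mono)
 have Fb: "abs (F y) \<le> y powr (- s)*(1/abs Om)" for y
  unfolding F_def abs_mult using sinb by (intro mult_mono) auto
 have "norm (integral {R..S} h) \<le> integral {R..S} (\<lambda>y. s*y powr (- s - 1)*(1/abs Om))"
 proof (rule integral_norm_bound_integral [OF ih])
  show "(\<lambda>y. s*y powr (- s - 1)*(1/abs Om)) integrable_on {R..S}"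
   using assms by (intro integrable_continuous_interval continuous_intros) auto
  fix y assume "y \<in> {R..S}"
  show "norm (h y) \<le> s*y powr (- s - 1)*(1/abs Om)"
   unfolding h_def real_norm_def abs_mult [of "s*_"] using sinb assms by (intro mult_mono) auto
 qed
 also have "... = (R powr (- s) - S powr (- s))*(1/abs Om)"
  using integral_unique [OF integral_powr_minus [OF assms(1-3)]] assms by simp
 finally have hb: "abs (integral {R..S} h) \<le> (R powr (- s) - S powr (- s))*(1/abs Om)" by simp
 have "abs (integral {R..S} g) \<le> abs (F S) + abs (F R) + abs (integral {R..S} h)" unfolding eq by linarith
 also have "... \<le> S powr (- s)*(1/abs Om) + R powr (- s)*(1/abs Om) + (R powr (- s) - S powr (- s))*(1/abs Om)"
  using Fb hb by (intro add_mono) auto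
 also have "... = 2 * R powr (- s)/abs Om" by (simp add: diff_divide_distrib)
 finally show ?thesis by (simp add: g_def [abs_def])
qed

section \<open>The integral of three Bessel functions\<close>

text \<open>mu stands for al + be but stays a separate parameter: differentiation in t moves mu
  alone, and the recurrence for small al moves mu and al independently.\<close>

definition bessel_triple :: "real => real => real => real => real => real => real" where
 "bessel_triple mu al t x z y =
   bessel_J mu (t*y)*bessel_J al (x*y)*bessel_J al (z*y)*y powr (1 - mu)"

lemma cos_triple_product:
 fixes a b c :: real
 shows "cos a*cos b*cos c = (cos (a + b + c) + cos (a + b - c) + cos (a - b + c) + cos (a - b - c))/4"
 by (simp add: cos_add cos_diff sin_add sin_diff algebra_simps)

lemma continuous_on_bessel_triple:
 assumes "t > 0" "x > 0" "z > 0" "S \<subseteq> {0<..}"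
 shows "continuous_on S (bessel_triple mu al t x z)"
 unfolding bessel_triple_def [abs_def] using assms
 by (intro continuous_intros) auto

lemma product_diff_bound:
 fixes p q d :: "nat => real"
 assumes M: "\<And>i. abs (p i) \<le> M" "\<And>i. abs (q i) \<le> M" and d: "\<And>i. abs (q i - p i) \<le> d i"
 shows "abs (q 0*q 1*q 2 - p 0*p 1*p 2) \<le> M^2*(d 0 + d 1 + d 2)"
proof -
 have M0: "M \<ge> 0" using M(1) [of 0] by linarith
 have b: "abs (u * v * w) \<le> M^2*e" if "abs u \<le> M" "abs v \<le> M" "abs w \<le> e" for u v w e
  unfolding abs_mult power2_eq_square using that M0 by (intro mult_mono) auto
 have "q 0*q 1*q 2 - p 0*p 1*p 2
   = q 1*q 2*(q 0 - p 0) + p 0*q 2*(q 1 - p 1) + p 0*p 1*(q 2 - p 2)"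
  by (simp add: algebra_simps)
 also have "abs (...) \<le> abs (q 1*q 2*(q 0 - p 0)) + abs (p 0*q 2*(q 1 - p 1)) + abs (p 0*p 1*(q 2 - p 2))"
  by linarith
 also have "... \<le> M^2*d 0 + M^2*d 1 + M^2*d 2"
  using M d by (intro add_mono b)
 finally show ?thesis by (simp add: algebra_simps)
qed

text \<open>With each Bessel function replaced by its cosine, the integrand is y powr (-(mu + 1/2))
  times cosines of the four frequencies t + x + z, t + x - z, t - x + z, t - x - z, none of which
  vanishes; the error carries one more factor 1/y. The constants are uniform for t near t0, as
  needed to differentiate in t.\<close>

lemma bessel_triple_tail:
 assumes mu: "mu > -1/2" and pos: "x > 0" "z > 0" "t0 > 0" and ne: "t0 \<noteq> abs (x - z)" "t0 \<noteq> x + z"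
 shows "\<exists>et>0. \<exists>C. \<exists>R0>0. \<forall>t. abs (t - t0) < et --> t > 0 \<and>
  (\<forall>R\<ge>R0. \<forall>S\<ge>R. abs (integral {R..S} (bessel_triple mu al t x z)) \<le> C * R powr (- (mu + 1/2)))"
proof -
 define s where "s = mu + 1/2"
 have s: "s > 0" using mu by (simp add: s_def)
 \<comment> \<open>Half the smallest absolute frequency at t0; moving t by less than m changes each
   frequency by less than m.\<close>
 define m where "m = Min {abs (t0 + x + z), abs (t0 + x - z), abs (t0 - x + z), abs (t0 - x - z)}/2"
 have m: "m > 0" unfolding m_def using pos ne by auto
 define et where "et = min (t0/2) m"
 have m_le: "2*m \<le> abs (t0 + x + z)" "2*m \<le> abs (t0 + x - z)" "2*m \<le> abs (t0 - x + z)" "2*m \<le> abs (t0 - x - z)"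
  unfolding m_def by auto
 obtain rh1 th1 C1 where 1: "\<And>y. y \<ge> 1 ==> abs (sqrt y*bessel_J mu y - rh1*cos (y - th1)) \<le> C1/y"
  using bessel_J_asymp by blast
 obtain rh2 th2 C2 where 2: "\<And>y. y \<ge> 1 ==> abs (sqrt y*bessel_J al y - rh2*cos (y - th2)) \<le> C2/y"
  using bessel_J_asymp by blast
 have C0: "C1 \<ge> 0" "C2 \<ge> 0" using 1 [of 1] 2 [of 1] by auto
 define M where "M = max (abs rh1 + C1) (abs rh2 + C2)"
 \<comment> \<open>For y >= W and t > t0/2 the arguments t y, x y, z y are all at least 1, where the
   asymptotics apply.\<close>
 define W where "W = 2/t0 + 1/x + 1/z"
 have W: "W > 0" "2/t0 \<le> W" "1/x \<le> W" "1/z \<le> W" unfolding W_def using pos by (auto intro!: add_pos_pos)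
 define N where "N = abs (rh1*rh2*rh2)"
 define K where "K = M^2*(C1*(2/t0) + C2/x + C2/z)"
 have K: "K \<ge> 0" unfolding K_def using C0 pos by (intro mult_nonneg_nonneg add_nonneg_nonneg) auto
 define C where "C = (t0/2*x*z) powr (- 1/2)*(2*N/m + K/s)"
 have main: "t > 0 \<and> (\<forall>R\<ge>W. \<forall>S\<ge>R. abs (integral {R..S} (bessel_triple mu al t x z)) \<le> C * R powr (- s))"
  if t: "abs (t - t0) < et" for t
 proof -
  have t2: "t > t0/2" "abs (t - t0) < m" using t unfolding et_def by (auto simp: abs_if split: if_splits)
  with pos have tp: "t > 0" by linarith
  have om: "m \<le> abs (t + x + z)" "m \<le> abs (t + x - z)" "m \<le> abs (t - x + z)" "m \<le> abs (t - x - z)"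
   using m_le t2 by linarith+
  define p where "p y i = (if i = 0 then rh1*cos (t*y - th1) else if i = 1 then rh2*cos (x*y - th2)
    else rh2*cos (z*y - th2))" for y and i :: nat
  define q where "q y i = (if i = 0 then sqrt (t*y)*bessel_J mu (t*y) else if i = 1 then sqrt (x*y)*bessel_J al (x*y)
    else sqrt (z*y)*bessel_J al (z*y))" for y and i :: nat
  define d where "d y i = (if i = 0 then C1/(t*y) else if i = 1 then C2/(x*y) else C2/(z*y))" for y and i :: nat
  define P where "P y = p y 0*p y 1*p y 2" for y
  define Q where "Q y = q y 0*q y 1*q y 2" for y
  have diff: "abs (Q y - P y) \<le> K/y" if y: "y \<ge> W" for y
  proof -
   have yp: "y > 0" using y W by linarith
   have y1: "t*y \<ge> 1" "x*y \<ge> 1" "z*y \<ge> 1"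
   proof -
    have "y \<ge> 2/t0" "y \<ge> 1/x" "y \<ge> 1/z" using y W by linarith+
    then show "x*y \<ge> 1" "z*y \<ge> 1" using pos by (simp_all add: field_simps)
    have "1 \<le> t0/2*y" using \<open>y \<ge> 2/t0\<close> pos by (simp add: field_simps)
    also have "... \<le> t*y" using t2 yp by (intro mult_right_mono) auto
    finally show "t*y \<ge> 1" .
   qed
   have pM: "abs (p y i) \<le> M" for i
   proof -
    have r: "abs (rh*cos w) \<le> abs rh" for rh w :: real
     unfolding abs_mult using mult_left_mono [OF abs_cos_le_one, of "abs rh" w] by simp
    show ?thesis unfolding p_def M_def using r C0 by (auto simp: le_max_iff_disj intro: order_trans add_increasing2)
   qed
   have dq: "abs (q y i - p y i) \<le> d y i" for i
    unfolding q_def p_def d_def using 1 2 y1 by auto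
   have qM: "abs (q y i) \<le> M" for i
   proof -
    have r: "abs (rh*cos w) \<le> abs rh" for rh w :: real
     unfolding abs_mult using mult_left_mono [OF abs_cos_le_one, of "abs rh" w] by simp
    have dle: "C/w \<le> C" if "C \<ge> 0" "w \<ge> 1" for C w :: real
     using mult_left_mono [OF that(2,1)] that by (simp add: field_simps)
    have "abs (sqrt w*bessel_J mu w) \<le> abs rh1 + C1" if "w \<ge> 1" for w
     using 1 [OF that] r [of rh1 "w - th1"] dle [OF C0(1) that] by linarith
    moreover have "abs (sqrt w*bessel_J al w) \<le> abs rh2 + C2" if "w \<ge> 1" for w
     using 2 [OF that] r [of rh2 "w - th2"] dle [OF C0(2) that] by linarith
    ultimately show ?thesis unfolding q_def M_def using y1 by (auto simp: le_max_iff_disj)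
   qed
   have "abs (Q y - P y) \<le> M^2*(d y 0 + d y 1 + d y 2)"
    unfolding Q_def P_def by (rule product_diff_bound) (rule pM qM dq)+
   also have "... \<le> M^2*((C1*(2/t0) + C2/x + C2/z)/y)"
   proof (intro mult_left_mono)
    have "C1/(t*y) \<le> C1/(t0/2*y)"
     using C0 t2 yp pos tp by (intro divide_left_mono mult_right_mono) auto
    then show "d y 0 + d y 1 + d y 2 \<le> (C1*(2/t0) + C2/x + C2/z)/y"
     unfolding d_def by (simp add: add_divide_distrib mult_ac)
   qed simp
   finally show ?thesis unfolding K_def by simp
  qed
  define c where "c = (t*x*z) powr (- 1/2)"
  have c: "0 \<le> c" "c \<le> (t0/2*x*z) powr (- 1/2)"
   unfolding c_def using pos t2 by (auto intro!: powr_mono2' mult_right_mono)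
  have f: "bessel_triple mu al t x z y = c*(y powr (- s)*Q y)" if "y > 0" for y
  proof -
   have e: "bessel_J mu (t*y) = (t*y) powr (- 1/2)*q y 0" "bessel_J al (x*y) = (x*y) powr (- 1/2)*q y 1"
    "bessel_J al (z*y) = (z*y) powr (- 1/2)*q y 2"
    unfolding q_def using that pos tp by (simp_all add: powr_minus powr_half_sqrt field_simps)
   have "(t*y) powr (- 1/2)*(x*y) powr (- 1/2)*(z*y) powr (- 1/2)*y powr (1 - mu) = c*y powr (- s)"
   proof -
    have "y powr (- 1/2)*y powr (- 1/2)*y powr (- 1/2)*y powr (1 - mu) = y powr (- s)"
    proof -
     have "(- 1/2) + (- 1/2) + (- 1/2) + (1 - mu) = - s" by (simp add: s_def)
     then show ?thesis by (simp only: powr_add [symmetric])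
    qed
    then show ?thesis using that pos tp by (simp add: c_def powr_mult mult_ac)
   qed
   moreover have "bessel_triple mu al t x z y
    = (t*y) powr (- 1/2)*(x*y) powr (- 1/2)*(z*y) powr (- 1/2)*y powr (1 - mu)*Q y"
    unfolding bessel_triple_def e Q_def by (simp only: mult_ac)
   ultimately show ?thesis by (simp only: mult.assoc)
  qed
  have "abs (integral {R..S} (bessel_triple mu al t x z)) \<le> C * R powr (- s)" if R: "R \<ge> W" "S \<ge> R" for R S
  proof -
   have Rp: "R > 0" using R W by linarith
   define g where "g Om ph y = y powr (- s)*cos (Om*y + ph)" for Om ph y :: real
   define h where "h y = y powr (- s)*(Q y - P y)" for y
   have gi: "g Om ph integrable_on {R..S}" for Om ph
    unfolding g_def using Rp by (intro integrable_continuous_interval continuous_intros) auto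
   have gb: "abs (integral {R..S} (g Om ph)) \<le> 2 * R powr (- s)/m" if "m \<le> abs Om" for Om ph
   proof -
    have "abs (integral {R..S} (g Om ph)) \<le> 2 * R powr (- s)/abs Om"
     unfolding g_def using s Rp R that m by (intro oscillating_integral_bound) auto
    also have "... \<le> 2 * R powr (- s)/m"
     using that m by (intro divide_left_mono mult_pos_pos) auto
    finally show ?thesis .
   qed
   have hi: "h integrable_on {R..S}"
    unfolding h_def Q_def P_def q_def p_def using Rp pos tp
    by (intro integrable_continuous_interval) (auto intro!: continuous_intros)
   have Kb: "norm (integral {R..S} h) \<le> integral {R..S} (\<lambda>y. K*y powr (- s - 1))"
   proof (rule integral_norm_bound_integral [OF hi])
    show "(\<lambda>y. K*y powr (- s - 1)) integrable_on {R..S}"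
     using Rp by (intro integrable_continuous_interval continuous_intros) auto
    fix y assume y: "y \<in> {R..S}"
    have "abs (h y) \<le> y powr (- s)*(K/y)"
     unfolding h_def abs_mult using diff [of y] y R by (intro mult_mono) auto
    also have "... = K*y powr (- s - 1)" using y Rp by (simp add: powr_diff)
    finally show "norm (h y) \<le> K*y powr (- s - 1)" by simp
   qed
   also have "... = K*((R powr (- s) - S powr (- s))/s)"
    using integral_unique [OF integral_powr_minus [OF s Rp R(2)]] by simp
   also have "... \<le> K*(R powr (- s)/s)"
    using K s by (intro mult_left_mono divide_right_mono) auto
   finally have hb: "abs (integral {R..S} h) \<le> K/s * R powr (- s)" by simp
   define ph where "ph \<equiv> \<lambda>i::nat. if i = 0 then - th1 - th2 - th2 else if i = 1 then - th1 else if i = 2 then - th1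
    else - th1 + th2 + th2"
   define G where "G y = g (t + x + z) (ph 0) y + g (t + x - z) (ph 1) y + g (t - x + z) (ph 2) y + g (t - x - z) (ph 3) y" for y
   have fP: "y powr (- s)*P y = rh1*rh2*rh2/4*G y" for y
   proof -
    have "P y = rh1*rh2*rh2*(cos (t*y - th1)*cos (x*y - th2)*cos (z*y - th2))"
     unfolding P_def p_def by simp
    moreover have "t*y - th1 + (x*y - th2) + (z*y - th2) = (t + x + z)*y + ph 0"
     "t*y - th1 + (x*y - th2) - (z*y - th2) = (t + x - z)*y + ph 1"
     "t*y - th1 - (x*y - th2) + (z*y - th2) = (t - x + z)*y + ph 2"
     "t*y - th1 - (x*y - th2) - (z*y - th2) = (t - x - z)*y + ph 3"
     by (simp_all add: ph_def algebra_simps)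
    ultimately have "P y = rh1*rh2*rh2*((cos ((t + x + z)*y + ph 0) + cos ((t + x - z)*y + ph 1)
      + cos ((t - x + z)*y + ph 2) + cos ((t - x - z)*y + ph 3))/4)"
     by (simp only: cos_triple_product)
    moreover have "G y = y powr (- s)*(cos ((t + x + z)*y + ph 0) + cos ((t + x - z)*y + ph 1)
      + cos ((t - x + z)*y + ph 2) + cos ((t - x - z)*y + ph 3))"
     by (simp only: G_def g_def distrib_left)
    ultimately show ?thesis by simp
   qed
   have Gi: "G integrable_on {R..S}" unfolding G_def by (intro integrable_add gi)
   have "integral {R..S} G = integral {R..S} (g (t + x + z) (ph 0)) + integral {R..S} (g (t + x - z) (ph 1))
     + integral {R..S} (g (t - x + z) (ph 2)) + integral {R..S} (g (t - x - z) (ph 3))"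
    unfolding G_def by (simp add: integral_add integrable_add gi)
   then have "abs (integral {R..S} G) \<le> 4*(2 * R powr (- s)/m)"
    using gb [OF om(1), of "ph 0"] gb [OF om(2), of "ph 1"] gb [OF om(3), of "ph 2"] gb [OF om(4), of "ph 3"] by linarith
   then have "N/4*abs (integral {R..S} G) \<le> N/4*(4*(2 * R powr (- s)/m))"
    by (intro mult_left_mono) (auto simp: N_def)
   then have Gb: "N/4*abs (integral {R..S} G) \<le> 2*N/m * R powr (- s)" by (simp add: mult_ac)
   have "integral {R..S} (bessel_triple mu al t x z) = integral {R..S} (\<lambda>y. c*(rh1*rh2*rh2/4*G y + h y))"
   proof (rule integral_cong)
    fix y assume "y \<in> {R..S}"
    then have "y > 0" using Rp by auto
    then show "bessel_triple mu al t x z y = c*(rh1*rh2*rh2/4*G y + h y)"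
     unfolding f [OF \<open>y > 0\<close>] h_def fP [symmetric] by (simp add: algebra_simps)
   qed
   also have "... = c*(rh1*rh2*rh2/4*integral {R..S} G + integral {R..S} h)"
    using integral_add [of "\<lambda>y. rh1*rh2*rh2/4*G y" "{R..S}" h] Gi hi
    by (simp only: integral_mult_right integrable_on_mult_right)
   finally have "abs (integral {R..S} (bessel_triple mu al t x z))
     = c*abs (rh1*rh2*rh2/4*integral {R..S} G + integral {R..S} h)"
    using c(1) by (simp only: abs_mult abs_of_nonneg)
   also have "... \<le> c*(N/4*abs (integral {R..S} G) + abs (integral {R..S} h))"
   proof (intro mult_left_mono c(1))
    have "abs (rh1*rh2*rh2/4*integral {R..S} G) = N/4*abs (integral {R..S} G)"
     unfolding N_def by (simp add: abs_mult)
    then show "abs (rh1*rh2*rh2/4*integral {R..S} G + integral {R..S} h)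
      \<le> N/4*abs (integral {R..S} G) + abs (integral {R..S} h)" by linarith
   qed
   also have "... \<le> c*(2*N/m * R powr (- s) + K/s * R powr (- s))"
    using Gb hb c(1) by (intro mult_left_mono) linarith+
   also have "... = c*((2*N/m + K/s) * R powr (- s))" by (simp add: algebra_simps)
   also have "... \<le> (t0/2*x*z) powr (- 1/2)*((2*N/m + K/s) * R powr (- s))"
    using c(2) K m s by (intro mult_right_mono mult_nonneg_nonneg add_nonneg_nonneg divide_nonneg_nonneg) (auto simp: N_def)
   finally show ?thesis by (simp add: C_def mult_ac)
  qed
  then show ?thesis using tp by blast
 qed
 have "et > 0" unfolding et_def using m pos by auto
 with main W(1) show ?thesis unfolding s_def by blast
qed

section \<open>Gamma integrals, termwise integration, Lerch's theorem\<close>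

lemma has_bochner_integral_of_has_integral:
 fixes f :: "real => real"
 assumes [measurable]: "f \<in> borel_measurable borel" "S \<in> sets borel"
  and nn: "\<And>x. x \<in> S ==> 0 \<le> f x" and I: "(f has_integral I) S"
 shows "has_bochner_integral lborel (\<lambda>x. indicator S x*f x) I"
proof (rule has_bochner_integral_nn_integral)
 show "0 \<le> I" using I nn by (rule has_integral_nonneg)
 have "((\<lambda>x. indicator S x*f x) has_integral I) UNIV"
 proof -
  have "(\<lambda>x. indicator S x*f x) = (\<lambda>x. if x \<in> S then f x else 0)" by (auto simp: indicator_def)
  then show ?thesis using I has_integral_restrict_UNIV [of S f I] by simp
 qed
 then show "(NN x. ennreal (indicator S x*f x)) = ennreal I"
  by (intro nn_integral_has_integral_lborel) (use nn in \<open>auto simp: indicator_def\<close>)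
qed (use nn in \<open>auto simp: indicator_def\<close>)

lemma Gamma_laplace:
 fixes s p :: real
 assumes "s > 0" "p > 0"
 shows "has_bochner_integral lborel (\<lambda>tt. indicator {0<..} tt*(tt powr (s - 1)*exp (- p*tt))) (Gamma s/p powr s)"
proof -
 let ?f = "\<lambda>tt::real. indicator {0..} tt*(tt powr (s - 1)/exp tt)"
 have "has_bochner_integral lborel ?f (Gamma s)"
  using Gamma_integral_real [OF assms(1)] by (intro has_bochner_integral_of_has_integral) auto
 then have *: "integrable lborel ?f" "integral\<^sup>L lborel ?f = Gamma s"
  by (simp_all add: has_bochner_integral_iff)
 let ?g = "\<lambda>tt. ?f (0 + p*tt)"
 have "integrable lborel ?g" using * assms by (intro lborel_integrable_real_affine) auto
 moreover have "integral\<^sup>L lborel ?f = abs p *\<^sub>R integral\<^sup>L lborel ?g"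
  using assms by (intro lborel_integral_real_affine) auto
 ultimately have "has_bochner_integral lborel ?g (Gamma s/p)"
  using * assms by (simp add: has_bochner_integral_iff field_simps)
 then have "has_bochner_integral lborel (\<lambda>tt. (1/p powr (s - 1))*?g tt) ((1/p powr (s - 1))*(Gamma s/p))"
  by (intro has_bochner_integral_mult_right) auto
 also have "(1/p powr (s - 1))*(Gamma s/p) = Gamma s/p powr s"
  using assms by (simp add: powr_diff)
 also have "(\<lambda>tt. (1/p powr (s - 1))*?g tt) = (\<lambda>tt. indicator {0<..} tt*(tt powr (s - 1)*exp (- p*tt)))"
 proof
  fix tt :: real
  show "(1/p powr (s - 1))*?g tt = indicator {0<..} tt*(tt powr (s - 1)*exp (- p*tt))"
   using assms by (cases "tt > 0"; cases "tt = 0")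
    (auto simp: indicator_def powr_mult exp_minus field_simps zero_le_mult_iff)
 qed
 finally show ?thesis .
qed

text \<open>\<open>Gamma_laplace\<close> under tt = y^2; the exponent 2 s - 1 is the one that lets p
  enter as p powr s.\<close>

lemma Gauss_moment:
 fixes s p :: real
 assumes "s > 0" "p > 0"
 shows "has_bochner_integral lborel (\<lambda>y. indicator {0<..} y*(y powr (2 * s - 1)*exp (- p*y^2))) (Gamma s/(2*p powr s))"
proof -
 let ?f = "\<lambda>y::real. y powr (2 * s - 1)*exp (- p*y^2)"
 let ?g' = "\<lambda>tt::real. inverse (sqrt tt)/2"
 have eq: "?f (sqrt tt)*?g' tt = 1/2*(tt powr (s - 1)*exp (- p*tt))" if "tt > 0" for tt
 proof -
  have "(sqrt tt) powr (2 * s - 1)*inverse (sqrt tt) = tt powr (s - 1)"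
  proof -
   have "(sqrt tt) powr (2 * s - 1) = tt powr (s - 1/2)"
    using that by (simp add: powr_half_sqrt [symmetric] powr_powr algebra_simps)
   moreover have "inverse (sqrt tt) = tt powr (- 1/2)"
    using that by (simp add: powr_minus powr_half_sqrt)
   ultimately show ?thesis using that by (simp flip: powr_add)
  qed
  then have "(sqrt tt) powr (2 * s - 1)*inverse (sqrt tt)*(exp (- p*tt)/2) = tt powr (s - 1)*(exp (- p*tt)/2)"
   by simp
  then show ?thesis using that by (simp add: mult_ac)
 qed
 have L: "has_bochner_integral lborel (\<lambda>tt. 1/2*(indicator {0<..} tt*(tt powr (s - 1)*exp (- p*tt)))) (1/2*(Gamma s/p powr s))"
  by (intro has_bochner_integral_mult_right Gamma_laplace assms)
 have eq': "(\<lambda>tt. indicator {0<..} tt *\<^sub>R (?f (sqrt tt)*?g' tt)) = (\<lambda>tt. 1/2*(indicator {0<..} tt*(tt powr (s - 1)*exp (- p*tt))))"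
  using eq by (auto simp: indicator_def fun_eq_iff)
 have int: "set_integrable lborel {0<..} (\<lambda>tt. ?f (sqrt tt)*?g' tt)"
  unfolding set_integrable_def eq' using L by (simp only: has_bochner_integral_iff)
 have val: "(LBINT tt:{0<..}. ?f (sqrt tt)*?g' tt) = 1/2*(Gamma s/p powr s)"
  unfolding set_lebesgue_integral_def eq' using L by (simp only: has_bochner_integral_iff)
 have z: "einterval 0 \<infinity> = {0<..}" unfolding zero_ereal_def by (rule einterval_eq)
 have zz: "x > 0" if "(0::ereal) < ereal x" for x using that by simp
 have B: "((ereal \<circ> sqrt \<circ> real_of_ereal) \<longlongrightarrow> \<infinity>) (at_left \<infinity>)"
  unfolding comp_def at_left_PInf filterlim_filtermap
  using sqrt_at_top by (simp add: tendsto_PInfty_eq_at_top)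
 have A: "((ereal \<circ> sqrt \<circ> real_of_ereal) \<longlongrightarrow> 0) (at_right 0)"
 proof -
  have "((\<lambda>x. ereal (sqrt x)) \<longlongrightarrow> ereal (sqrt 0)) (at_right 0)"
   by (intro tendsto_intros)
  then show ?thesis unfolding zero_ereal_def at_right_ereal filterlim_filtermap comp_def by (simp add: zero_ereal_def)
 qed
 have r: "set_integrable lborel (einterval 0 \<infinity>) ?f"
   "(LBINT x=0..\<infinity>. ?f x) = (LBINT x=0..\<infinity>. (?f (sqrt x)*?g' x))"
  by (rule interval_integral_substitution_nonneg [where g=sqrt and g'="?g'" and a=0 and b=\<infinity>, OF _ _ _ _ _ _ A B];
   use int in \<open>force simp: z intro!: DERIV_real_sqrt continuous_intros dest!: zz\<close>)+
 have "(LBINT x=0..\<infinity>. h x) = (LBINT x:{0<..}. h x)" for h :: "real => real"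
  unfolding interval_lebesgue_integral_def by (simp add: z)
 with r val have "(LBINT x:{0<..}. ?f x) = 1/2*(Gamma s/p powr s)" by simp
 moreover have "integrable lborel (\<lambda>y. indicator {0<..} y*?f y)"
  using r(1) by (simp add: z set_integrable_def)
 ultimately show ?thesis by (simp add: has_bochner_integral_iff set_lebesgue_integral_def)
qed

text \<open>With nonnegative building blocks of known integral, absolute convergence, both pointwise
  and of the integrals, becomes a question about |c k| against W k x and M k.\<close>

lemma has_bochner_integral_termwise:
 fixes W :: "nat => real => real" and c M :: "nat => real"
 assumes W: "\<And>k. has_bochner_integral lborel (W k) (M k)" and W0: "\<And>k x. 0 \<le> W k x"
  and pt: "\<And>x. summable (\<lambda>k. abs (c k)*W k x)" and sm: "summable (\<lambda>k. abs (c k)*M k)"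
 shows "has_bochner_integral lborel (\<lambda>x. \<Sum>k. c k*W k x) (\<Sum>k. c k*M k)"
proof -
 have i: "integrable lborel (\<lambda>x. c k*W k x)" for k
  using W [of k] by (auto simp: has_bochner_integral_iff)
 have n: "(\<integral>x. norm (c k*W k x) \<partial>lborel) = abs (c k)*M k" for k
  using W [of k] W0 by (simp add: abs_mult has_bochner_integral_iff)
 have v: "(\<integral>x. c k*W k x \<partial>lborel) = c k*M k" for k
  using W [of k] by (simp add: has_bochner_integral_iff)
 have "summable (\<lambda>k. norm (c k*W k x))" for x using pt W0 by (simp add: abs_mult)
 then have a: "AE x in lborel. summable (\<lambda>k. norm (c k*W k x))" by simp
 have s: "summable (\<lambda>k. \<integral>x. norm (c k*W k x) \<partial>lborel)" using sm by (simp only: n)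
 show ?thesis
  unfolding has_bochner_integral_iff
  using integrable_suminf [OF i a s] integral_suminf [OF i a s] by (simp only: v)
qed

text \<open>Under v = exp (-tt) the hypothesis says that all moments of a function on [0, 1] vanish,
  and Weierstrass approximation makes it zero. Of the three factors exp (-tt) provided by n >= 3,
  two turn the growth B exp tt into a function tending to 0 as v -> 0, and the third is the
  Jacobian.\<close>

lemma Lerch:
 fixes F :: "real => real"
 assumes cont: "continuous_on {0..} F" and bd: "\<And>tt. tt \<ge> 0 ==> abs (F tt) \<le> B*exp tt"
  and zero: "\<And>n::nat. n \<ge> 3 ==> (LBINT tt:{0<..}. F tt*exp (- real n*tt)) = 0"
  and "tt \<ge> 0"
 shows "F tt = 0"
proof -
 have B: "B \<ge> 0" using bd [of 0] by simp
 define g where "g tt = F tt*exp (- 2*tt)" for tt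
 have gb: "abs (g tt) \<le> B*exp (- tt)" if "tt \<ge> 0" for tt
 proof -
  have "abs (F tt)*exp (- 2*tt) \<le> B*exp tt*exp (- 2*tt)" using bd that by (intro mult_right_mono) auto
  also have "... = B*exp (- tt)" by (simp flip: exp_add)
  finally show ?thesis by (simp add: g_def abs_mult)
 qed
 have gb1: "abs (g tt) \<le> B" if "tt \<ge> 0" for tt
 proof -
  have "B*exp (- tt) \<le> B*1" using that B by (intro mult_left_mono) auto
  with gb [OF that] show ?thesis by simp
 qed
 have gc: "continuous_on {0..} g" unfolding g_def by (intro continuous_intros cont)
 define ph where "ph v = (if v \<le> 0 then 0 else g (- ln v))" for v :: real
 have "continuous_on {0..1} ph"
 proof (rule continuous_on_eq_continuous_within [THEN iffD2, rule_format])
  fix v :: real assume v: "v \<in> {0..1}"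
  show "continuous (at v within {0..1}) ph"
  proof (cases "v = 0")
   case True
   have "(ph \<longlongrightarrow> 0) (at 0 within {0..1})"
   proof (rule Lim_null_comparison)
    have "((\<lambda>v. B * v) \<longlongrightarrow> B*0) (at 0 within {0..1})" by (intro tendsto_intros)
    then show "((\<lambda>v. B * v) \<longlongrightarrow> 0) (at 0 within {0..1})" by simp
    show "\<forall>\<^sub>F x in at 0 within {0..1}. norm (ph x) \<le> B*x"
     unfolding eventually_at_filter
    proof (intro always_eventually allI impI)
     fix x :: real assume x: "x \<noteq> 0" "x \<in> {0..1}"
     then have "- ln x \<ge> 0" by simp
     from gb [OF this] x show "norm (ph x) \<le> B*x" by (simp add: ph_def)
    qed
   qed
   then show ?thesis unfolding True continuous_within by (simp add: ph_def)
  next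
   case False
   have "continuous_on {0<..1} (\<lambda>v. g (- ln v))"
    by (rule continuous_on_compose2 [OF gc]) (auto intro!: continuous_intros)
   then have "continuous_on {0<..1} ph" by (rule continuous_on_eq) (simp add: ph_def)
   then have "continuous (at v within {0<..1}) ph"
    using False v by (auto simp: continuous_on_eq_continuous_within)
   moreover have "at v within {0<..1} = at v within {0..1}"
    using False v by (intro at_within_nhd [of v "{0<..}"]) auto
   ultimately show ?thesis by simp
  qed
 qed
 note phc = this
 have m[measurable]: "(\<lambda>tt. indicator {0<..} tt*g tt) \<in> borel_measurable borel"
 proof -
  have "continuous_on {0<..} g" using gc by (rule continuous_on_subset) auto
  from borel_measurable_continuous_on_indicator [OF _ this] show ?thesis by simp
 qed
 have ei: "has_bochner_integral lborel (\<lambda>tt. indicator {0<..} tt*exp (- p*tt)) (1/p)" if "p > 0" for p :: real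
  using Gamma_laplace [of 1 p] that by (simp add: indicator_def cong: if_cong)
    (auto elim!: has_bochner_integral_cong [THEN iffD1, rotated 3] simp: )
 have ie: "integrable lborel (\<lambda>tt. indicator {0<..} tt*(exp (- tt)*g tt*h tt))"
  if [measurable]: "h \<in> borel_measurable borel" and hb: "\<And>tt. tt > 0 ==> abs (h tt) \<le> C" for h C
 proof (rule Bochner_Integration.integrable_bound [of _ "\<lambda>tt. B*C*(indicator {0<..} tt*exp (- 1*tt))"])
  show "integrable lborel (\<lambda>tt. B*C*(indicator {0<..} tt*exp (- 1*tt)))"
   using ei [of 1] by (intro integrable_mult_right) (simp add: has_bochner_integral_iff)
  have "(\<lambda>tt. exp (- tt)*(indicator {0<..} tt*g tt)*h tt) \<in> borel_measurable lborel" by measurable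
  then show "(\<lambda>tt. indicator {0<..} tt*(exp (- tt)*g tt*h tt)) \<in> borel_measurable lborel" by (simp add: mult_ac)
  have "abs (exp (- tt)*g tt*h tt) \<le> exp (- tt)*B*C" if t: "tt > 0" for tt
   unfolding abs_mult using gb1 [of tt] t hb [of tt] B by (intro mult_mono) auto
  moreover have "C \<ge> 0" using hb [of 1] by simp
  ultimately show "AE tt in lborel. norm (indicator {0<..} tt*(exp (- tt)*g tt*h tt)) \<le> norm (B*C*(indicator {0<..} tt*exp (- 1*tt)))"
   using B by (intro always_eventually) (auto simp: indicator_def abs_mult mult_ac)
 qed
 \<comment> \<open>exp (-tt) g^2, whose integral is the squared L2 norm of \<open>ph\<close> over
   [0, 1]. Replacing one factor g by g minus a polynomial in exp (-tt) leaves that integral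
   unchanged.\<close>
 define w where "w = (\<lambda>tt. indicator {0<..} tt*(exp (- tt)*g tt*(indicator {0<..} tt*g tt)))"
 have wi: "integrable lborel w"
  unfolding w_def by (rule ie [OF m, of B]) (use gb1 in \<open>auto simp: indicator_def\<close>)
 have w0: "w tt \<ge> 0" for tt unfolding w_def by (auto simp: indicator_def mult.assoc)
 have small: "integral\<^sup>L lborel w \<le> e*B" if e: "e > 0" for e
 proof -
  obtain q where q: "real_polynomial_function q" and qe: "\<And>v. v \<in> {0..1} ==> abs (ph v - q v) < e"
   using Stone_Weierstrass_real_polynomial_function [OF compact_Icc phc e] by blast
  from q obtain a N where qa: "q = (\<lambda>x. \<Sum>i\<le>N. a i*x ^ i)"
   using real_polynomial_function_imp_sum by blast
  have mono0: "(LINT tt|lborel. indicator {0<..} tt*(exp (- tt)*g tt*exp (- tt) ^ i)) = 0" for i :: nat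
  proof -
   have "indicator {0<..} tt*(exp (- tt)*g tt*exp (- tt) ^ i) = indicator {0<..} tt *\<^sub>R (F tt*exp (- real (i + 3)*tt))" for tt :: real
   proof -
    have "exp (- tt)*exp (- 2*tt)*exp (- tt) ^ i = exp (- real (i + 3)*tt)"
     by (simp flip: exp_add exp_of_nat_mult add: algebra_simps)
    then have "exp (- tt)*(F tt*exp (- 2*tt))*exp (- tt) ^ i = F tt*exp (- real (i + 3)*tt)"
     by (metis (no_types) mult.assoc mult.commute)
    then show ?thesis by (simp add: g_def)
   qed
   then show ?thesis
    using zero [OF le_add2, of i, unfolded set_lebesgue_integral_def] by (simp only:)
  qed
  have ii: "integrable lborel (\<lambda>tt. indicator {0<..} tt*(exp (- tt)*g tt*exp (- tt) ^ i))" for i :: nat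
   by (rule ie [of _ 1]) (auto simp: power_le_one)
  have qexp: "indicator {0<..} tt*(exp (- tt)*g tt*q (exp (- tt)))
    = (\<Sum>i\<le>N. a i*(indicator {0<..} tt*(exp (- tt)*g tt*exp (- tt) ^ i)))" for tt :: real
   unfolding qa by (simp add: sum_distrib_left mult_ac)
  have q0: "integrable lborel (\<lambda>tt. indicator {0<..} tt*(exp (- tt)*g tt*q (exp (- tt))))"
   "(LINT tt|lborel. indicator {0<..} tt*(exp (- tt)*g tt*q (exp (- tt)))) = 0"
   unfolding qexp using ii mono0 by (auto simp: integral_sum)
  define r where "r = (\<lambda>tt. w tt - indicator {0<..} tt*(exp (- tt)*g tt*q (exp (- tt))))"
  have "integral\<^sup>L lborel w = integral\<^sup>L lborel r"
   unfolding r_def using wi q0 by simp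
  also have "... \<le> (LINT tt|lborel. e*B*(indicator {0<..} tt*exp (- 1*tt)))"
  proof (rule integral_mono)
   show "integrable lborel r" unfolding r_def using wi q0 by simp
   show "integrable lborel (\<lambda>tt. e*B*(indicator {0<..} tt*exp (- 1*tt)))"
    using ei [of 1] by (intro integrable_mult_right) (simp add: has_bochner_integral_iff)
   fix tt :: real
   show "r tt \<le> e*B*(indicator {0<..} tt*exp (- 1*tt))"
   proof (cases "tt > 0")
    case True
    have "ph (exp (- tt)) = g tt" by (simp add: ph_def)
    then have d: "abs (g tt - q (exp (- tt))) \<le> e" using qe [of "exp (- tt)"] True by simp
    have "r tt = exp (- tt)*g tt*(g tt - q (exp (- tt)))"
     using True unfolding r_def w_def by (simp add: algebra_simps)
    also have "... \<le> abs (...)" by simp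
    also have "... \<le> exp (- tt)*B*e"
     unfolding abs_mult using d gb1 [of tt] True B by (intro mult_mono) auto
    finally show ?thesis using True by (simp add: mult_ac)
   qed (simp add: r_def w_def)
  qed
  also have "... = e*B" using ei [of 1] by (simp add: has_bochner_integral_iff)
  finally show ?thesis .
 qed
 have "integral\<^sup>L lborel w \<le> 0"
 proof (rule field_le_epsilon)
  fix e :: real assume "e > 0"
  then have "integral\<^sup>L lborel w \<le> e/(B + 1)*B" using B by (intro small) auto
  also have "... \<le> e" using B \<open>e > 0\<close> by (simp add: field_simps)
  finally show "integral\<^sup>L lborel w \<le> 0 + e" by simp
 qed
 moreover have "integral\<^sup>L lborel w \<ge> 0" using w0 by simp
 ultimately have "integral\<^sup>L lborel w = 0" by simp
 then have ae: "AE tt in lborel. w tt = 0"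
  using integral_nonneg_eq_0_iff_AE [OF wi] w0 by simp
 have pos0: "F t = 0" if t: "t > 0" for t
 proof (rule ccontr)
  assume "F t \<noteq> 0"
  have op: "open ({0<..} \<inter> F -` (- {0}))"
   by (rule continuous_open_preimage) (use cont in \<open>auto intro: continuous_on_subset\<close>)
  have "{0<..} \<inter> F -` (- {0}) \<subseteq> {tt. w tt \<noteq> 0}"
   by (auto simp: w_def g_def)
  moreover have "{tt. w tt \<noteq> 0} \<in> null_sets lborel"
  proof -
   have [measurable]: "w \<in> borel_measurable borel" using borel_measurable_integrable [OF wi] by simp
   have "{tt \<in> space lborel. \<not> w tt = 0} \<in> sets lborel" by measurable
   from AE_iff_null [OF this] ae show ?thesis by simp
  qed
  ultimately have "emeasure lborel ({0<..} \<inter> F -` (- {0})) = 0"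
   by (metis emeasure_mono null_setsD1 null_setsD2 le_zero_eq sets_lborel)
  moreover have "t \<in> {0<..} \<inter> F -` (- {0})" using t \<open>F t \<noteq> 0\<close> by auto
  ultimately show False
   using op open_not_negligible [OF op] negligible_iff_emeasure0 [of "{0<..} \<inter> F -` (- {0})"]
   by (auto simp: borel_open)
 qed
 show ?thesis
 proof (cases "tt = 0")
  case True
  have "(F \<longlongrightarrow> F 0) (at 0 within {0..})" using cont by (auto simp: continuous_on_def)
  then have "(F \<longlongrightarrow> F 0) (at_right 0)" by (rule tendsto_within_subset) auto
  moreover have "(F \<longlongrightarrow> 0) (at_right 0)"
   by (rule tendsto_eventually) (auto simp: eventually_at_filter pos0)
  ultimately have "F 0 = 0" using tendsto_unique trivial_limit_at_right_real by blast
  then show ?thesis by (simp add: True)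
 qed (use pos0 assms(4) in auto)
qed

section \<open>Weber's exponential integrals\<close>

lemma abs_bessel_coeff:
 assumes "nu > -1"
 shows "abs (bessel_coeff nu k) = (- 1) ^ k*bessel_coeff nu k"
proof -
 have "rGamma (nu + real k + 1) \<ge> 0"
  using assms Gamma_real_pos [of "nu + real k + 1"] by (simp add: rGamma_inverse_Gamma)
 then show ?thesis by (simp add: bessel_coeff_def abs_mult)
qed

lemma Gamma_rGamma_cancel: "s > 0 ==> Gamma s*rGamma s = (1::real)"
 using Gamma_real_pos [of s] by (metis less_irrefl rGamma_inverse_Gamma right_inverse)

lemma sums_exp: "(\<lambda>k. x ^ k/fact k) sums exp (x::real)"
 using exp_converges [of x] by (simp add: divide_inverse mult.commute)

text \<open>Termwise: the integral of tt powr (mu + k) * exp (-p tt) contributes Gamma (mu + k + 1),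
  which cancels the reciprocal Gamma of the Bessel coefficient and leaves an exponential series. The
  factor tt powr (mu/2) turns (sqrt tt) powr mu into tt powr mu.\<close>

lemma bessel_J_laplace:
 assumes mu: "mu > -1" and "y > 0" "p > 0"
 shows "has_bochner_integral lborel
  (\<lambda>tt. indicator {0<..} tt*(tt powr (mu/2)*bessel_J mu (y * sqrt tt)*exp (- p*tt)))
  ((y/2) powr mu*p powr (- mu - 1)*exp (- (y^2/(4*p))))"
proof -
 define c where "c k = bessel_coeff mu k*(y^2/4) ^ k" for k
 define W where "W k tt = indicator {0<..} tt*(tt powr (mu + 1 + real k - 1)*exp (- p*tt))" for k tt
 define M where "M k = Gamma (mu + 1 + real k)/p powr (mu + 1 + real k)" for k
 have Weq: "W k tt = indicator {0<..} tt*(tt powr mu*exp (- p*tt))*tt ^ k" for k tt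
  unfolding W_def by (auto simp: indicator_def powr_add powr_realpow)
 have cM: "c k*M k = p powr (- mu - 1)*((- (y^2/(4*p))) ^ k/fact k)" for k
 proof -
  have "rGamma (mu + real k + 1)*Gamma (mu + 1 + real k) = 1"
   using Gamma_rGamma_cancel [of "mu + real k + 1"] mu by (simp add: add_ac mult.commute)
  moreover have "p powr (mu + 1 + real k) = p powr (mu + 1)*p ^ k"
   using assms by (simp add: powr_add powr_realpow)
  moreover have "p powr (- mu - 1) = 1/p powr (mu + 1)"
   using powr_minus_divide [of p "mu + 1"] by simp
  moreover have "(- (y^2/(4*p))) ^ k = (- 1) ^ k*(y^2/4) ^ k/p ^ k"
   by (subst power_minus) (simp add: power_divide power_mult_distrib)
  moreover have "e/f*r*Y*(G/(P*q)) = (r*G)*(1/P*((e*Y/q)/f))" for e f r Y G P q :: real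
   by (simp add: mult_ac)
  ultimately show ?thesis
   unfolding c_def M_def bessel_coeff_def by (simp only: mult_1)
 qed
 have cabs: "abs (c k) = (- 1) ^ k*c k" for k
  unfolding c_def abs_mult abs_bessel_coeff [OF mu] by (simp add: power_abs)
 have "has_bochner_integral lborel (\<lambda>tt. \<Sum>k. c k*W k tt) (\<Sum>k. c k*M k)"
 proof (rule has_bochner_integral_termwise)
  show "has_bochner_integral lborel (W k) (M k)" for k
   unfolding W_def [abs_def] M_def using mu assms by (intro Gamma_laplace) auto
  show "0 \<le> W k tt" for k tt by (simp add: W_def)
  show "summable (\<lambda>k. abs (c k)*W k tt)" for tt
  proof -
   have "summable (\<lambda>k. indicator {0<..} tt*(tt powr mu*exp (- p*tt))*(bessel_coeff mu k*(- (y^2/4*tt)) ^ k))"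
    by (intro summable_mult summable_bessel_coeff)
   also have "(\<lambda>k. indicator {0<..} tt*(tt powr mu*exp (- p*tt))*(bessel_coeff mu k*(- (y^2/4*tt)) ^ k))
     = (\<lambda>k. abs (c k)*W k tt)"
   proof
    fix k
    have e: "(- (y^2/4*tt)) ^ k = (- 1) ^ k*((y^2/4) ^ k*tt ^ k)"
     by (subst power_minus, subst power_mult_distrib, rule refl)
    have a: "i*(t*E)*(b*(s*(w * v))) = s*(b*w)*(i*(t*E) * v)" for i t E b s w v :: real
     by (simp add: mult_ac)
    show "indicator {0<..} tt*(tt powr mu*exp (- p*tt))*(bessel_coeff mu k*(- (y^2/4*tt)) ^ k) = abs (c k)*W k tt"
     unfolding cabs Weq e unfolding c_def by (rule a)
   qed
   finally show ?thesis .
  qed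
  show "summable (\<lambda>k. abs (c k)*M k)"
  proof -
   have "summable (\<lambda>k. p powr (- mu - 1)*((y^2/(4*p)) ^ k/fact k))"
    by (intro summable_mult sums_summable [OF sums_exp])
   also have "(\<lambda>k. p powr (- mu - 1)*((y^2/(4*p)) ^ k/fact k)) = (\<lambda>k. abs (c k)*M k)"
    unfolding cabs mult.assoc cM by (simp add: power_minus [of "y^2/_"] fun_eq_iff)
   finally show ?thesis .
  qed
 qed
 then have "has_bochner_integral lborel (\<lambda>tt. (y/2) powr mu*(\<Sum>k. c k*W k tt)) ((y/2) powr mu*(\<Sum>k. c k*M k))"
  by (intro has_bochner_integral_mult_right) auto
 also have "(\<Sum>k. c k*M k) = p powr (- mu - 1)*exp (- (y^2/(4*p)))"
 proof -
  from sums_mult [OF sums_exp] show ?thesis unfolding cM by (simp add: sums_iff)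
 qed
 also have "(\<lambda>tt. (y/2) powr mu*(\<Sum>k. c k*W k tt))
   = (\<lambda>tt. indicator {0<..} tt*(tt powr (mu/2)*bessel_J mu (y * sqrt tt)*exp (- p*tt)))"
 proof
  fix tt :: real
  show "(y/2) powr mu*(\<Sum>k. c k*W k tt)
   = indicator {0<..} tt*(tt powr (mu/2)*bessel_J mu (y * sqrt tt)*exp (- p*tt))"
  proof (cases "tt > 0")
   case True
   have "(\<Sum>k. c k*W k tt) = (\<Sum>k. (tt powr mu*exp (- p*tt))*(bessel_coeff mu k*(y^2/4*tt) ^ k))"
    unfolding Weq using True by (intro suminf_cong) (simp add: c_def power_mult_distrib power_divide)
   also have "... = (tt powr mu*exp (- p*tt))*bessel_j mu (y^2/4*tt)"
    unfolding bessel_j_def by (intro suminf_mult summable_bessel_coeff)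
   finally have S: "(\<Sum>k. c k*W k tt) = (tt powr mu*exp (- p*tt))*bessel_j mu (y^2/4*tt)" .
   have "bessel_J mu (y * sqrt tt) = (y * sqrt tt/2) powr mu*bessel_j mu (y^2/4*tt)"
    using True assms by (simp add: bessel_J_eq power_mult_distrib)
   moreover have "(y * sqrt tt/2) powr mu = (y/2) powr mu*tt powr (mu/2)"
   proof -
    have "(y * sqrt tt/2) powr mu = (y/2 * sqrt tt) powr mu" by (simp add: mult_ac)
    also have "... = (y/2) powr mu*(tt powr (1/2)) powr mu" using True assms by (subst powr_mult) (auto simp: powr_half_sqrt)
    finally show ?thesis by (simp add: powr_powr)
   qed
   ultimately have J: "bessel_J mu (y * sqrt tt) = (y/2) powr mu*tt powr (mu/2)*bessel_j mu (y^2/4*tt)"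
    by simp
   have sq: "tt powr (mu/2)*tt powr (mu/2) = tt powr mu" using True by (simp flip: powr_add)
   have h: "T*(Y*T*J) = Y*(T*T*J)" for T Y J :: real by (simp add: mult_ac)
   have "tt powr (mu/2)*bessel_J mu (y * sqrt tt) = (y/2) powr mu*(tt powr mu*bessel_j mu (y^2/4*tt))"
    unfolding J by (subst h, subst sq, rule refl)
   then show ?thesis unfolding S using True by simp
  qed (simp add: Weq)
 qed
 finally show ?thesis by (simp add: mult.assoc)
qed

text \<open>The Chu-Vandermonde identity for k + (al + j) over j, with the binomial coefficients of
  real upper entry rewritten by Gamma; every Gamma (al + m + 1) meets its reciprocal.\<close>

lemma Vandermonde_rGamma:
 fixes al :: real and j k :: nat
 assumes "al > -1"
 defines "r \<equiv> \<lambda>m. rGamma (al + real m + 1)"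
 shows "(\<Sum>m\<le>j. if m \<le> k then r m/(fact m*fact (j - m)*fact (k - m)) else 0)
   = Gamma (al + real (j + k) + 1)*(r j/fact j)*(r k/fact k)"
proof -
 have np: "w \<notin> \<int>\<^sub>\<le>\<^sub>0" if "w > 0" for w :: real using that by (auto elim!: nonpos_Ints_cases)
 have cancel: "Gamma (al + real m + 1)*r m = 1" for m
  unfolding r_def using assms(1) by (intro Gamma_rGamma_cancel) simp
 have a: "(real k gchoose m) = (if m \<le> k then fact k/(fact m*fact (k - m)) else 0)" for m
  by (simp add: binomial_gbinomial [symmetric] binomial_fact)
 have b: "((al + real j) gchoose (j - m)) = Gamma (al + real j + 1)*r m/fact (j - m)" if "m \<le> j" for m
 proof -
  have "((al + real j) gchoose (j - m)) = Gamma (al + real j + 1)/(fact (j - m)*Gamma (al + real j - real (j - m) + 1))"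
   using assms(1) by (intro gbinomial_Gamma np) simp
  also have "al + real j - real (j - m) + 1 = al + real m + 1" using that by (simp add: of_nat_diff)
  finally show ?thesis unfolding r_def by (simp add: rGamma_inverse_Gamma field_simps)
 qed
 have "((real k + (al + real j)) gchoose j)
   = Gamma (real k + (al + real j) + 1)/(fact j*Gamma (real k + (al + real j) - real j + 1))"
  using assms(1) by (intro gbinomial_Gamma np) simp
 also have "... = Gamma (al + real (j + k) + 1)*r k/fact j"
  unfolding r_def by (simp add: rGamma_inverse_Gamma field_simps)
 finally have "(\<Sum>m=0..j. (real k gchoose m)*((al + real j) gchoose (j - m))) = Gamma (al + real (j + k) + 1)*r k/fact j"
  by (simp only: gbinomial_Vandermonde)
 then have "r j/fact k*(\<Sum>m=0..j. (real k gchoose m)*((al + real j) gchoose (j - m)))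
   = Gamma (al + real (j + k) + 1)*(r j/fact j)*(r k/fact k)"
  by (simp add: mult_ac)
 moreover have "r j/fact k*(\<Sum>m=0..j. (real k gchoose m)*((al + real j) gchoose (j - m)))
  = (\<Sum>m\<le>j. if m \<le> k then r m/(fact m*fact (j - m)*fact (k - m)) else 0)"
  unfolding sum_distrib_left atLeast0AtMost
 proof (intro sum.cong refl)
  fix m assume m: "m \<in> {..j}"
  have "r j/fact k*(fact k/(fact m*fact (k - m))*(Gamma (al + real j + 1)*r m/fact (j - m)))
   = (Gamma (al + real j + 1)*r j)*(r m/(fact m*fact (j - m)*fact (k - m)))"
   by (simp add: field_simps)
  then show "r j/fact k*((real k gchoose m)*((al + real j) gchoose (j - m)))
    = (if m \<le> k then r m/(fact m*fact (j - m)*fact (k - m)) else 0)"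
   using m by (simp add: a b cancel)
 qed
 ultimately show ?thesis by simp
qed

text \<open>Both sides are parts of degree n in (X, Z): on the left, up to the factor Gamma (al + n
  + 1), of a product of two Bessel series; on the right, of exp (X + Z) times a series in X Z.
  Comparing coefficients of X^j Z^(n-j) leaves \<open>Vandermonde_rGamma\<close>.\<close>

lemma bessel_product_coeff:
 fixes al X Z :: real and n :: nat
 assumes "al > -1"
 defines "r \<equiv> \<lambda>m. rGamma (al + real m + 1)"
 shows "Gamma (al + real n + 1)*(\<Sum>j\<le>n. (X ^ j*(r j/fact j))*(Z ^ (n - j)*(r (n - j)/fact (n - j))))
  = (\<Sum>i\<le>n. (if even i then (X*Z) ^ (i div 2)*r (i div 2)/fact (i div 2) else 0)*((X + Z) ^ (n - i)/fact (n - i)))"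
proof -
 define f where "f m l = (X*Z) ^ m*r m/fact m*(X ^ l*Z ^ (n - 2*m - l)/(fact l*fact (n - 2*m - l)))" for m l :: nat
 have bin: "(X + Z) ^ N/fact N = (\<Sum>l\<le>N. X ^ l*Z ^ (N - l)/(fact l*fact (N - l)))" for N :: nat
  unfolding binomial_ring sum_divide_distrib
  by (intro sum.cong refl) (simp add: binomial_fact field_simps)
 have "(\<Sum>i\<le>n. (if even i then (X*Z) ^ (i div 2)*r (i div 2)/fact (i div 2) else 0)*((X + Z) ^ (n - i)/fact (n - i)))
   = (\<Sum>i\<in>{i. i \<le> n \<and> even i}. (X*Z) ^ (i div 2)*r (i div 2)/fact (i div 2)*((X + Z) ^ (n - i)/fact (n - i)))"
  by (intro sum.mono_neutral_cong_right) auto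
 also have "... = (\<Sum>m\<in>{m. 2*m \<le> n}. (X*Z) ^ m*r m/fact m*((X + Z) ^ (n - 2*m)/fact (n - 2*m)))"
  by (rule sum.reindex_bij_witness [of _ "\<lambda>m. 2*m" "\<lambda>i. i div 2"]) auto
 also have "... = (\<Sum>m\<in>{m. 2*m \<le> n}. \<Sum>l\<le>n - 2*m. f m l)"
  unfolding bin f_def by (simp add: sum_distrib_left)
 also have "... = (\<Sum>(m, l)\<in>Sigma {m. 2*m \<le> n} (\<lambda>m. {..n - 2*m}). f m l)"
  by (rule sum.Sigma) (auto intro: finite_subset [of _ "{..n}"])
 \<comment> \<open>j = l + m is the power of X and n - j that of Z; m runs as far as both
   allow.\<close>
 also have "... = (\<Sum>(j, m)\<in>Sigma {..n} (\<lambda>j. {m. m \<le> j \<and> m \<le> n - j}). f m (j - m))"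
  by (rule sum.reindex_bij_witness [of _ "\<lambda>(j, m). (m, j - m)" "\<lambda>(m, l). (l + m, m)"]) auto
 also have "... = (\<Sum>j\<le>n. \<Sum>m\<in>{m. m \<le> j \<and> m \<le> n - j}. f m (j - m))"
  by (rule sum.Sigma [symmetric]) (auto intro: finite_subset [of _ "{..n}"])
 also have "... = (\<Sum>j\<le>n. X ^ j*Z ^ (n - j)*(\<Sum>m\<le>j. if m \<le> n - j then r m/(fact m*fact (j - m)*fact (n - j - m)) else 0))"
 proof (intro sum.cong refl)
  fix j assume "j \<in> {..n}"
  then have j: "j \<le> n" by simp
  have "(\<Sum>m\<in>{m. m \<le> j \<and> m \<le> n - j}. f m (j - m)) = (\<Sum>m\<in>{m. m \<le> j \<and> m \<le> n - j}. X ^ j*Z ^ (n - j)*(r m/(fact m*fact (j - m)*fact (n - j - m))))"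
  proof (intro sum.cong refl)
   fix m assume m: "m \<in> {m. m \<le> j \<and> m \<le> n - j}"
   then have e: "n - 2*m - (j - m) = n - j - m" using j by auto
   have "X ^ m*X ^ (j - m) = X ^ j" "Z ^ m*Z ^ (n - j - m) = Z ^ (n - j)"
    using m by (metis (mono_tags) le_add_diff_inverse mem_Collect_eq power_add)+
   moreover have "f m (j - m) = (X ^ m*X ^ (j - m))*(Z ^ m*Z ^ (n - j - m))*(r m/(fact m*fact (j - m)*fact (n - j - m)))"
    unfolding f_def e by (simp add: power_mult_distrib mult_ac)
   ultimately show "f m (j - m) = X ^ j*Z ^ (n - j)*(r m/(fact m*fact (j - m)*fact (n - j - m)))" by simp
  qed
  also have "... = (\<Sum>m\<le>j. X ^ j*Z ^ (n - j)*(if m \<le> n - j then r m/(fact m*fact (j - m)*fact (n - j - m)) else 0))"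
   by (rule sum.mono_neutral_cong_left) auto
  finally show "(\<Sum>m\<in>{m. m \<le> j \<and> m \<le> n - j}. f m (j - m))
    = X ^ j*Z ^ (n - j)*(\<Sum>m\<le>j. if m \<le> n - j then r m/(fact m*fact (j - m)*fact (n - j - m)) else 0)"
   by (simp only: sum_distrib_left)
 qed
 also have "... = (\<Sum>j\<le>n. X ^ j*Z ^ (n - j)*(Gamma (al + real n + 1)*(r j/fact j)*(r (n - j)/fact (n - j))))"
 proof (intro sum.cong refl)
  fix j assume "j \<in> {..n}"
  then have "real (j + (n - j)) = real n" by simp
  with Vandermonde_rGamma [OF assms(1), where j=j and k="n - j"]
  show "X ^ j*Z ^ (n - j)*(\<Sum>m\<le>j. if m \<le> n - j then r m/(fact m*fact (j - m)*fact (n - j - m)) else 0)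
   = X ^ j*Z ^ (n - j)*(Gamma (al + real n + 1)*(r j/fact j)*(r (n - j)/fact (n - j)))"
   unfolding r_def by (simp only:)
 qed
 also have "... = Gamma (al + real n + 1)*(\<Sum>j\<le>n. (X ^ j*(r j/fact j))*(Z ^ (n - j)*(r (n - j)/fact (n - j))))"
  unfolding sum_distrib_left by (intro sum.cong refl) (simp add: mult_ac)
 finally show ?thesis by simp
qed

text \<open>Weber's second exponential integral. The product of the two Bessel functions is
  essentially a power series in y^2 whose Gaussian moments bring in Gamma (al + n + 1); by
  \<open>bessel_product_coeff\<close> the result is the Cauchy product of an exponential and a
  modified Bessel series. The Gaussian has the parameter 1/(4 p) that
  \<open>bessel_J_laplace\<close> leaves behind.\<close>

lemma bessel_J_Weber_integral:
 assumes al: "al > -1" and pos: "x > 0" "z > 0" "p > 0"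
 shows "has_bochner_integral lborel
  (\<lambda>y. indicator {0<..} y*(bessel_J al (x*y)*bessel_J al (z*y)*y*exp (- (y^2/(4*p)))))
  (2*p*(p*x*z) powr al*exp (- p*(x^2 + z^2))*(\<Sum>m. (p^2*x^2*z^2) ^ m*rGamma (al + real m + 1)/fact m))"
proof -
 define r where "r m = rGamma (al + real m + 1)" for m
 have r0: "r m > 0" for m
  unfolding r_def using al Gamma_real_pos [of "al + real m + 1"] by (simp add: rGamma_inverse_Gamma)
 define X Z where "X = p*x^2" and "Z = p*z^2"
 have XZ: "X > 0" "Z > 0" using pos by (auto simp: X_def Z_def)
 define d where "d n = (\<Sum>j\<le>n. (bessel_coeff al j*(x^2/4) ^ j)*(bessel_coeff al (n - j)*(z^2/4) ^ (n - j)))" for n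
 define e where "e n = (\<Sum>j\<le>n. (X ^ j*(r j/fact j))*(Z ^ (n - j)*(r (n - j)/fact (n - j))))" for n
 \<comment> \<open>The sign splits off and e n >= 0, so absolute convergence reduces to the series
   with X + Z in place of -(X + Z).\<close>
 have de: "d n*(4*p) ^ n = (- 1) ^ n*e n" for n
  unfolding d_def e_def sum_distrib_left sum_distrib_right
 proof (intro sum.cong refl)
  fix j assume "j \<in> {..n}"
  then obtain k where n: "n = j + k" by (auto simp: le_iff_add)
  have "(x^2/4) ^ j*(4*p) ^ j = X ^ j" "(z^2/4) ^ k*(4*p) ^ k = Z ^ k"
   using power_mult_distrib [of "x^2/4" "4*p" j] power_mult_distrib [of "z^2/4" "4*p" k]
   by (simp_all add: X_def Z_def mult.commute)
  moreover have "(bessel_coeff al j*(x^2/4) ^ j)*(bessel_coeff al k*(z^2/4) ^ k)*(4*p) ^ (j + k)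
   = (bessel_coeff al j*bessel_coeff al k)*((x^2/4) ^ j*(4*p) ^ j)*((z^2/4) ^ k*(4*p) ^ k)"
   by (simp only: power_add mult_ac)
  ultimately show "(bessel_coeff al j*(x^2/4) ^ j)*(bessel_coeff al (n - j)*(z^2/4) ^ (n - j))*(4*p) ^ n
    = (- 1) ^ n*((X ^ j*(r j/fact j))*(Z ^ (n - j)*(r (n - j)/fact (n - j))))"
   unfolding n bessel_coeff_def r_def by (simp add: power_add)
 qed
 have e0: "e n \<ge> 0" for n unfolding e_def using XZ r0 by (intro sum_nonneg mult_nonneg_nonneg divide_nonneg_nonneg) (auto intro: less_imp_le)
 \<comment> \<open>(X Z)^m has degree 2 m in (X, Z), hence the spreading over even indices. Since a
   vanishes at odd ones, the signs (-1)^n can be moved onto the powers of X + Z.\<close>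
 define a where "a i = (if even i then (X*Z) ^ (i div 2)*r (i div 2)/fact (i div 2) else 0)" for i :: nat
 have a0: "a i \<ge> 0" for i unfolding a_def using XZ r0 by (auto intro!: divide_nonneg_nonneg mult_nonneg_nonneg intro: less_imp_le)
 have asum: "summable (\<lambda>m. (X*Z) ^ m*r m/fact m)"
 proof -
  have "summable (\<lambda>m. bessel_coeff al m*(- (X*Z)) ^ m)" by (rule summable_bessel_coeff)
  also have "(\<lambda>m. bessel_coeff al m*(- (X*Z)) ^ m) = (\<lambda>m. (X*Z) ^ m*r m/fact m)"
   unfolding bessel_coeff_def r_def by (subst power_minus) (simp add: fun_eq_iff)
  finally show ?thesis .
 qed
 define A where "A = (\<Sum>m. (X*Z) ^ m*r m/fact m)"
 have a_sums: "a sums A"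
 proof -
  have "(\<lambda>m. a (2*m)) sums A"
   unfolding A_def using summable_sums [OF asum] by (simp add: a_def)
  then show ?thesis
   by (subst (asm) sums_mono_reindex [of "\<lambda>m. 2*m" a])
     (auto simp: strict_mono_def a_def elim!: evenE)
 qed
 have G: "Gamma (al + real n + 1)*e n = (\<Sum>i\<le>n. a i*((X + Z) ^ (n - i)/fact (n - i)))" for n
  unfolding e_def a_def r_def by (rule bessel_product_coeff [OF al])
 have cauchy: "(\<lambda>n. \<Sum>i\<le>n. a i*(w ^ (n - i)/fact (n - i))) sums (A*exp w)" for w :: real
 proof -
  have 1: "summable (\<lambda>k. norm (a k))" using a0 a_sums by (simp add: sums_iff)
  have 2: "summable (\<lambda>k. norm (w ^ k/fact k))"
   using sums_summable [OF sums_exp [of "abs w"]] by (simp add: power_abs)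
  from Cauchy_product_sums [OF 1 2] show ?thesis
   using a_sums sums_exp [of w] by (simp add: sums_iff)
 qed
 define W where "W n y = indicator {0<..} y*(y powr (2*(al + 1 + real n) - 1)*exp (- (1/(4*p))*y^2))" for n y
 define M where "M n = Gamma (al + 1 + real n)/(2*(1/(4*p)) powr (al + 1 + real n))" for n
 have M: "M n = (4*p) powr (al + 1)/2*(Gamma (al + real n + 1)*(4*p) ^ n)" for n
 proof -
  have "(1/(4*p)) powr (al + 1 + real n) = 1/((4*p) powr (al + 1)*(4*p) ^ n)"
   using pos by (simp add: powr_divide powr_add powr_realpow)
  then show ?thesis unfolding M_def by (simp add: add_ac)
 qed
 have dM: "d n*M n = (4*p) powr (al + 1)/2*((- 1) ^ n*(Gamma (al + real n + 1)*e n))" for n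
 proof -
  have "d n*M n = (4*p) powr (al + 1)/2*(Gamma (al + real n + 1)*(d n*(4*p) ^ n))"
   unfolding M by (simp add: mult_ac)
  then show ?thesis unfolding de by (simp add: mult_ac)
 qed
 have Weq: "W n y = indicator {0<..} y*(y powr (2*al + 1)*exp (- (y^2/(4*p))))*(y^2) ^ n" for n y
 proof (cases "y > 0")
  case True
  have "2*(al + 1 + real n) - 1 = (2*al + 1) + real (2*n)" by simp
  then have "y powr (2*(al + 1 + real n) - 1) = y powr (2*al + 1)*(y^2) ^ n"
   using True by (simp only: powr_add powr_realpow power_mult)
  then show ?thesis unfolding W_def by simp
 qed (simp add: W_def)
 have dabs: "abs (d n)*(4*p) ^ n = e n" for n
 proof -
  have "abs (d n*(4*p) ^ n) = e n" unfolding de using e0 by (simp add: abs_mult)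
  then show ?thesis using pos by (simp add: abs_mult)
 qed
 have cs: "(\<lambda>n. d n*w ^ n) sums (bessel_j al (x^2/4*w)*bessel_j al (z^2/4*w))"
  and cs': "summable (\<lambda>n. abs (d n)*w ^ n)" if w: "w \<ge> 0" for w :: real
 proof -
  let ?f = "\<lambda>u v n. bessel_coeff al n*(u * v) ^ n"
  have s: "summable (\<lambda>n. norm (?f u v n))" if "u * v \<ge> 0" for u v
  proof -
   have "summable (\<lambda>n. bessel_coeff al n*(- (u * v)) ^ n)" by (rule summable_bessel_coeff)
   moreover have "norm (?f u v n) = bessel_coeff al n*(- (u * v)) ^ n" for n
   proof -
    have "abs ((u * v) ^ n) = (u * v) ^ n" using that by (intro abs_of_nonneg zero_le_power)
    then show ?thesis
     unfolding real_norm_def abs_mult [of "bessel_coeff al n"] abs_bessel_coeff [OF al]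
     by (subst power_minus) (simp add: mult_ac)
   qed
   ultimately show ?thesis by simp
  qed
  have prod: "(\<lambda>n. \<Sum>j\<le>n. ?f (x^2/4) v j*?f (z^2/4) v (n - j)) sums (bessel_j al (x^2/4 * v)*bessel_j al (z^2/4 * v))" for v
  proof -
   have s': "summable (\<lambda>n. norm (?f u v n))" for u
   proof -
    have "summable (\<lambda>n. norm (?f (abs u) (abs v) n))" by (rule s) simp
    then show ?thesis by (simp add: abs_mult power_abs)
   qed
   show ?thesis unfolding bessel_j_def using Cauchy_product_sums [OF s' s', of "x^2/4" "z^2/4"] by simp
  qed
  have trm: "(\<Sum>j\<le>n. ?f (x^2/4) v j*?f (z^2/4) v (n - j)) = d n * v ^ n" for n v
   unfolding d_def sum_distrib_right
  proof (intro sum.cong refl)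
   fix j assume "j \<in> {..n}"
   then obtain k where n: "n = j + k" by (auto simp: le_iff_add)
   show "?f (x^2/4) v j*?f (z^2/4) v (n - j) = (bessel_coeff al j*(x^2/4) ^ j)*(bessel_coeff al (n - j)*(z^2/4) ^ (n - j)) * v ^ n"
    unfolding n by (simp only: diff_add_inverse power_add power_mult_distrib mult_ac)
  qed
  show "(\<lambda>n. d n*w ^ n) sums (bessel_j al (x^2/4*w)*bessel_j al (z^2/4*w))"
   using prod [of w] by (simp only: trm)
  have sgn: "abs (d n) = (- 1) ^ n*d n" for n
  proof -
   have "abs (d n)*(4*p) ^ n = (- 1) ^ n*d n*(4*p) ^ n"
    unfolding dabs mult.assoc de by simp
   then show ?thesis using pos by simp
  qed
  have "summable (\<lambda>n. d n*(- w) ^ n)" using prod [of "- w"] unfolding trm by (rule sums_summable)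
  also have "(\<lambda>n. d n*(- w) ^ n) = (\<lambda>n. abs (d n)*w ^ n)"
   unfolding sgn by (subst power_minus) (simp add: fun_eq_iff)
  finally show "summable (\<lambda>n. abs (d n)*w ^ n)" .
 qed
 have main: "has_bochner_integral lborel (\<lambda>y. \<Sum>n. d n*W n y) (\<Sum>n. d n*M n)"
 proof (rule has_bochner_integral_termwise)
  show "has_bochner_integral lborel (W n) (M n)" for n
   unfolding W_def [abs_def] M_def using al pos by (intro Gauss_moment) auto
  show "0 \<le> W n y" for n y by (simp add: W_def)
  show "summable (\<lambda>n. abs (d n)*W n y)" for y
  proof -
   have "summable (\<lambda>n. indicator {0<..} y*(y powr (2*al + 1)*exp (- (y^2/(4*p))))*(abs (d n)*(y^2) ^ n))"
    by (intro summable_mult cs') simp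
   then show ?thesis unfolding Weq by (simp only: mult_ac)
  qed
  have "summable (\<lambda>n. (4*p) powr (al + 1)/2*(Gamma (al + real n + 1)*e n))"
   unfolding G using cauchy [of "X + Z"] by (intro summable_mult) (rule sums_summable)
  also have "(\<lambda>n. (4*p) powr (al + 1)/2*(Gamma (al + real n + 1)*e n)) = (\<lambda>n. abs (d n)*M n)"
   unfolding M dabs [symmetric] by (simp add: mult_ac fun_eq_iff)
  finally show "summable (\<lambda>n. abs (d n)*M n)" .
 qed
 have val: "(\<Sum>n. d n*M n) = (4*p) powr (al + 1)/2*(A*exp (- (X + Z)))"
 proof -
  have "(- 1) ^ n*(\<Sum>i\<le>n. a i*((X + Z) ^ (n - i)/fact (n - i)))
    = (\<Sum>i\<le>n. a i*((- (X + Z)) ^ (n - i)/fact (n - i)))" for n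
   unfolding sum_distrib_left
  proof (intro sum.cong refl)
   fix i assume "i \<in> {..n}"
   then obtain k where n: "n = i + k" by (auto simp: le_iff_add)
   show "(- 1) ^ n*(a i*((X + Z) ^ (n - i)/fact (n - i))) = a i*((- (X + Z)) ^ (n - i)/fact (n - i))"
   proof (cases "even i")
    case True
    then have "(- 1) ^ n = ((- 1) ^ k :: real)" unfolding n by (simp add: power_add)
    moreover have "(- (X + Z)) ^ k = (- 1) ^ k*(X + Z) ^ k" by (rule power_minus)
    ultimately show ?thesis unfolding n by (simp del: minus_add_distrib)
   qed (simp add: a_def)
  qed
  then have "(\<lambda>n. (4*p) powr (al + 1)/2*((- 1) ^ n*(\<Sum>i\<le>n. a i*((X + Z) ^ (n - i)/fact (n - i)))))
    sums ((4*p) powr (al + 1)/2*(A*exp (- (X + Z))))"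
   using sums_mult [OF cauchy [of "- (X + Z)"]] by (simp only:)
  then show ?thesis unfolding dM G by (rule sums_unique [symmetric])
 qed
 have fn: "(x/2) powr al*(z/2) powr al*(\<Sum>n. d n*W n y)
   = indicator {0<..} y*(bessel_J al (x*y)*bessel_J al (z*y)*y*exp (- (y^2/(4*p))))" for y
 proof (cases "y > 0")
  case True
  have "(\<Sum>n. d n*W n y) = (\<Sum>n. (y powr (2*al + 1)*exp (- (y^2/(4*p))))*(d n*(y^2) ^ n))"
   unfolding Weq using True by (intro suminf_cong) (simp add: mult_ac)
  also have "... = (y powr (2*al + 1)*exp (- (y^2/(4*p))))*(bessel_j al (x^2/4*y^2)*bessel_j al (z^2/4*y^2))"
   using sums_mult [OF cs [of "y^2"]] by (simp add: sums_iff)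
  finally have 1: "(\<Sum>n. d n*W n y) = ..." .
  have 2: "bessel_J al (u*y) = (u/2) powr al*y powr al*bessel_j al (u^2/4*y^2)" if "u > 0" for u
  proof -
   have "(u*y/2) powr al = (u/2) powr al*y powr al"
    using that True powr_mult [of "u/2" y al] by simp
   then show ?thesis using that True by (simp add: bessel_J_eq power_mult_distrib)
  qed
  have 3: "y powr (2*al + 1) = y powr al*y powr al*y"
  proof -
   have "2*al + 1 = al + al + 1" by simp
   then show ?thesis using True by (simp only: powr_add powr_one)
  qed
  have "a*b*(Y*Y*y*E*(P*Q)) = a*Y*P*(b*Y*Q)*y*E" for a b Y E P Q :: real
   by (simp add: mult_ac)
  from this [of "(x/2) powr al" "(z/2) powr al" "y powr al" "exp (- (y^2/(4*p)))"
    "bessel_j al (x^2/4*y^2)" "bessel_j al (z^2/4*y^2)"]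
  have "(x/2) powr al*(z/2) powr al*(\<Sum>n. d n*W n y)
   = bessel_J al (x*y)*bessel_J al (z*y)*y*exp (- (y^2/(4*p)))"
   unfolding 1 2 [OF pos(1)] 2 [OF pos(2)] 3 .
  then show ?thesis using True by simp
 qed (simp add: Weq)
 have "has_bochner_integral lborel (\<lambda>y. (x/2) powr al*(z/2) powr al*(\<Sum>n. d n*W n y))
   ((x/2) powr al*(z/2) powr al*(\<Sum>n. d n*M n))"
  using main by (intro has_bochner_integral_mult_right) auto
 moreover have "(x/2) powr al*(z/2) powr al*(\<Sum>n. d n*M n)
   = 2*p*(p*x*z) powr al*exp (- p*(x^2 + z^2))*A"
 proof -
  have "(x/2) powr al*(z/2) powr al*(4*p) powr (al + 1) = 4*p*(p*x*z) powr al"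
  proof -
   have "(x/2) powr al*(z/2) powr al*(4*p) powr al = ((x/2)*(z/2)*(4*p)) powr al"
    using pos powr_mult [of "x/2" "z/2" al] powr_mult [of "(x/2)*(z/2)" "4*p" al] by (simp only:)
   also have "(x/2)*(z/2)*(4*p) = p*x*z" by simp
   finally show ?thesis using pos by (simp add: powr_add)
  qed
  moreover have "exp (- (X + Z)) = exp (- p*(x^2 + z^2))" by (simp add: X_def Z_def algebra_simps)
  moreover have "u * v * (w/2*(A*E)) = (u * v * w)/2*E*A" for u v w E by simp
  ultimately show ?thesis unfolding val by (simp only:) simp
 qed
 moreover have "A = (\<Sum>m. (p^2*x^2*z^2) ^ m*rGamma (al + real m + 1)/fact m)"
  unfolding A_def r_def X_def Z_def by (simp add: power2_eq_square mult_ac)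
 ultimately show ?thesis unfolding fn by (simp only:)
qed

section \<open>Moments of the Gegenbauer weight and Poisson's integral\<close>

definition gegenbauer_moment :: "real => nat => real" where
 "gegenbauer_moment al k = (LBINT u:{-1<..<1}. u ^ (2 * k)*(1 - u^2) powr (al - 1/2))"

lemma gegenbauer_weight_integrable:
 assumes "al > -1/2"
 shows "integrable lborel (\<lambda>u::real. indicator {-1<..<1} u*(1 - u^2) powr (al - 1/2))"
proof -
 let ?a = "al + 1/2"
 let ?f = "\<lambda>t. indicator {0<..<1} t*(t powr (?a - 1)*(1 - t) powr (?a - 1))"
 have "((\<lambda>t. t powr (?a - 1)*(1 - t) powr (?a - 1)) has_integral Beta ?a ?a) {0..1}"
  using assms by (intro has_integral_Beta_real) auto
 then have "((\<lambda>t. t powr (?a - 1)*(1 - t) powr (?a - 1)) has_integral Beta ?a ?a) {0<..<1}"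
  by (simp add: has_integral_Icc_iff_Ioo)
 then have "has_bochner_integral lborel ?f (Beta ?a ?a)"
  by (intro has_bochner_integral_of_has_integral) auto
 then have "integrable lborel ?f" by (simp add: has_bochner_integral_iff)
 then have "integrable lborel (\<lambda>u. ?f (1/2 + 1/2*u))" by (intro lborel_integrable_real_affine) auto
 then have "integrable lborel (\<lambda>u. 4 powr (?a - 1)*?f (1/2 + 1/2*u))" by (intro integrable_mult_right)
 also have "(\<lambda>u. 4 powr (?a - 1)*?f (1/2 + 1/2*u)) = (\<lambda>u. indicator {-1<..<1} u*(1 - u^2) powr (al - 1/2))"
 proof
  fix u :: real
  show "4 powr (?a - 1)*?f (1/2 + 1/2*u) = indicator {-1<..<1} u*(1 - u^2) powr (al - 1/2)"
  proof (cases "-1 < u \<and> u < 1")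
   case True
   have "4 powr (?a - 1)*((1/2 + 1/2*u) powr (?a - 1)*(1 - (1/2 + 1/2*u)) powr (?a - 1))
     = (4*((1/2 + 1/2*u)*(1 - (1/2 + 1/2*u)))) powr (?a - 1)"
    using True powr_mult [of "1/2 + 1/2*u" "1 - (1/2 + 1/2*u)" "?a - 1"]
     powr_mult [of 4 "(1/2 + 1/2*u)*(1 - (1/2 + 1/2*u))" "?a - 1"] by simp
   also have "4*((1/2 + 1/2*u)*(1 - (1/2 + 1/2*u))) = 1 - u^2"
    by (simp add: field_simps power2_eq_square)
   finally show ?thesis using True by simp
  next
   case False
   then have "1/2 + 1/2*u \<notin> {0<..<1}" by auto
   with False show ?thesis by (auto simp: indicator_def)
  qed
 qed
 finally show ?thesis .
qed

lemma gegenbauer_weight_mult_integrable: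
 fixes g :: "real => real"
 assumes "al > -1/2" and [measurable]: "g \<in> borel_measurable borel" and b: "\<And>u. -1 < u ==> u < 1 ==> abs (g u) \<le> C"
 shows "integrable lborel (\<lambda>u. indicator {-1<..<1} u*(g u*(1 - u^2) powr (al - 1/2)))"
proof (rule Bochner_Integration.integrable_bound)
 show "integrable lborel (\<lambda>u. C*(indicator {-1<..<1} u*(1 - u^2) powr (al - 1/2)))"
  by (intro integrable_mult_right gegenbauer_weight_integrable assms)
 have "C \<ge> 0" using b [of 0] by simp
 then show "AE u in lborel. norm (indicator {-1<..<1} u*(g u*(1 - u^2) powr (al - 1/2)))
   \<le> norm (C*(indicator {-1<..<1} u*(1 - u^2) powr (al - 1/2)))"
  using b by (intro always_eventually allI) (auto simp: abs_mult indicator_def intro!: mult_right_mono)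
qed simp

lemma gegenbauer_moment_integral:
 assumes "al > -1/2"
 shows "has_bochner_integral lborel (\<lambda>u. indicator {-1<..<1} u*(u ^ (2 * k)*(1 - u^2) powr (al - 1/2))) (gegenbauer_moment al k)"
proof -
 have "abs (u ^ (2 * k)) \<le> 1" if "-1 < u" "u < 1" for u :: real
  using that by (simp add: power_abs power_le_one)
 then have "integrable lborel (\<lambda>u. indicator {-1<..<1} u*(u ^ (2 * k)*(1 - u^2) powr (al - 1/2)))"
  using assms by (intro gegenbauer_weight_mult_integrable [where C=1]) auto
 then show ?thesis
  by (simp add: has_bochner_integral_iff gegenbauer_moment_def set_lebesgue_integral_def)
qed

lemma gegenbauer_moment_0_pos:
 assumes "al > -1/2"
 shows "gegenbauer_moment al 0 > 0"
proof -
 let ?w = "\<lambda>u::real. indicator {-1<..<1} u*(1 - u^2) powr (al - 1/2)"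
 have w: "integrable lborel ?w" by (rule gegenbauer_weight_integrable [OF assms])
 have 1: "u^2 < 1" if "-1 < u" "u < 1" for u :: real using that by (simp add: abs_square_less_1)
 have "integral\<^sup>L lborel ?w \<noteq> 0"
 proof
  assume "integral\<^sup>L lborel ?w = 0"
  then have "AE u in lborel. ?w u = 0"
   using integral_nonneg_eq_0_iff_AE [OF w] by (auto simp: indicator_def)
  then have "AE u in lborel. u \<notin> {-1<..<1::real}"
   by eventually_elim (use 1 in force)
  moreover have "{u \<in> space lborel. \<not> u \<notin> {-1<..<1::real}} = {-1<..<1}" by auto
  ultimately have "{-1<..<1::real} \<in> null_sets lborel"
   using AE_iff_null [of lborel "\<lambda>u. u \<notin> {-1<..<1::real}"] by simp
  then have "emeasure lborel {-1<..<1::real} = 0" by (rule null_setsD1)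
  then show False by (subst (asm) emeasure_lborel_Ioo) auto
 qed
 moreover have "integral\<^sup>L lborel ?w \<ge> 0" by (intro integral_nonneg_AE) (auto simp: indicator_def)
 ultimately show ?thesis by (simp add: gegenbauer_moment_def set_lebesgue_integral_def order_less_le)
qed

text \<open>The primitive u^(2k+1) (1 - u^2) powr (al + 1/2) vanishes at both ends, so its
  derivative, a combination of two consecutive integrands, has integral 0.\<close>

lemma gegenbauer_moment_Suc:
 assumes "al > -1/2"
 shows "(2*real k + 1)*gegenbauer_moment al k = (2*real k + 2 + 2*al)*gegenbauer_moment al (Suc k)"
proof -
 let ?h = "\<lambda>j u. u ^ (2*j)*(1 - u^2) powr (al - 1/2)"
 let ?F = "\<lambda>u. u ^ (2 * k + 1)*(1 - u^2) powr (al + 1/2)"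
 let ?G = "\<lambda>u. (2*real k + 1)*?h k u - (2*real k + 2 + 2*al)*?h (Suc k) u"
 have "(?G has_integral ?F 1 - ?F (-1)) {-1..1}"
 proof (rule fundamental_theorem_of_calculus_interior)
  show "continuous_on {-1..1} ?F"
   using assms by (intro continuous_intros continuous_on_powr') (auto simp: abs_square_le_1)
  fix u :: real assume u: "u \<in> {-1<..<1}"
  then have p: "1 - u^2 > 0" by (simp add: abs_square_less_1 abs_less_iff)
  have "((\<lambda>u. u ^ (2 * k + 1)) has_real_derivative real (2 * k + 1)*u ^ (2 * k)) (at u)"
   using DERIV_pow [of "2 * k + 1" u] by simp
  moreover have "((\<lambda>u. (1 - u^2) powr (al + 1/2)) has_real_derivative
    ((al + 1/2)*(1 - u^2) powr (al + 1/2 - 1)*(- 2*u))) (at u)"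
   using p by (auto intro!: derivative_eq_intros)
  ultimately have "(?F has_real_derivative (real (2 * k + 1)*u ^ (2 * k)*(1 - u^2) powr (al + 1/2)
    + ((al + 1/2)*(1 - u^2) powr (al + 1/2 - 1)*(- 2*u))*u ^ (2 * k + 1))) (at u)"
   by (rule DERIV_mult)
  also have "(1 - u^2) powr (al + 1/2) = (1 - u^2)*(1 - u^2) powr (al - 1/2)"
   using p powr_add [of "1 - u^2" 1 "al - 1/2"] by (simp add: add.commute)
  also have "al + 1/2 - 1 = al - 1/2" by simp
  also have "real (2 * k + 1)*u ^ (2 * k)*((1 - u^2)*(1 - u^2) powr (al - 1/2))
    + ((al + 1/2)*(1 - u^2) powr (al - 1/2)*(- 2*u))*u ^ (2 * k + 1) = ?G u"
   by (simp add: power2_eq_square algebra_simps)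
  finally show "(?F has_vector_derivative ?G u) (at u)"
   by (simp add: has_real_derivative_iff_has_vector_derivative)
 qed simp
 then have 0: "(?G has_integral 0) {-1<..<1}" by (simp add: has_integral_Icc_iff_Ioo)
 have B: "has_bochner_integral lborel (\<lambda>u. indicator {-1<..<1} u *\<^sub>R ?G u)
   ((2*real k + 1)*gegenbauer_moment al k - (2*real k + 2 + 2*al)*gegenbauer_moment al (Suc k))"
 proof -
  have "has_bochner_integral lborel (\<lambda>u. (2*real k + 1)*(indicator {-1<..<1} u*?h k u)
    - (2*real k + 2 + 2*al)*(indicator {-1<..<1} u*?h (Suc k) u))
   ((2*real k + 1)*gegenbauer_moment al k - (2*real k + 2 + 2*al)*gegenbauer_moment al (Suc k))"
   by (intro has_bochner_integral_diff has_bochner_integral_mult_right gegenbauer_moment_integral assms)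
  also have "(\<lambda>u. (2*real k + 1)*(indicator {-1<..<1} u*?h k u)
    - (2*real k + 2 + 2*al)*(indicator {-1<..<1} u*?h (Suc k) u)) = (\<lambda>u. indicator {-1<..<1} u *\<^sub>R ?G u)"
   by (auto simp: indicator_def fun_eq_iff)
  finally show ?thesis .
 qed
 then have "set_integrable lborel {-1<..<1} ?G" unfolding set_integrable_def by (simp only: has_bochner_integral_iff)
 from set_borel_integral_eq_integral(2) [OF this] 0
 have "(LBINT u:{-1<..<1}. ?G u) = 0" by (simp add: integral_unique)
 with B show ?thesis unfolding set_lebesgue_integral_def by (simp only: has_bochner_integral_iff) simp
qed

text \<open>Division by fact (2 * k) matches both later uses: the coefficients of cosh and the
  binomial coefficients of even index.\<close>

lemma gegenbauer_moment_eq: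
 assumes "al > -1/2"
 shows "gegenbauer_moment al k/fact (2 * k) = gegenbauer_moment al 0/(4 ^ k*fact k*pochhammer (al + 1) k)"
proof (induction k)
 case (Suc k)
 have p: "pochhammer (al + 1) k > 0" using assms by (intro pochhammer_pos) simp
 have q: "al + 1 + real k > 0" using assms by simp
 have "gegenbauer_moment al (Suc k) = (2*real k + 1)*gegenbauer_moment al k/(2*(al + 1 + real k))"
  using gegenbauer_moment_Suc [OF assms, of k] q by (simp add: field_simps)
 moreover have "fact (2*Suc k) = 2*(real k + 1)*(2*real k + 1)*(fact (2 * k) :: real)"
  by (simp add: algebra_simps)
 ultimately have "gegenbauer_moment al (Suc k)/fact (2*Suc k)
   = (2*real k + 1)*gegenbauer_moment al k/(2*(al + 1 + real k))/(2*(real k + 1)*(2*real k + 1)*fact (2 * k))"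
  by (simp only:)
 also have "... = gegenbauer_moment al k/fact (2 * k)*(1/(4*(real k + 1)*(al + 1 + real k)))"
  using q by (simp add: divide_simps) (simp add: algebra_simps)
 also have "... = gegenbauer_moment al 0/(4 ^ Suc k*fact (Suc k)*pochhammer (al + 1) (Suc k))"
  unfolding Suc.IH by (simp add: pochhammer_rec' algebra_simps)
 finally show ?case .
qed simp

text \<open>Poisson's integral for the modified Bessel function. The weight is even, so the
  exponential may be replaced by cosh, whose series has nonnegative terms and is integrated by
  \<open>gegenbauer_moment_eq\<close>.\<close>

lemma gegenbauer_exp_integral:
 assumes "al > -1/2"
 shows "(LBINT u:{-1<..<1}. exp (- q*u)*(1 - u^2) powr (al - 1/2))
  = gegenbauer_moment al 0*Gamma (al + 1)*(\<Sum>k. (q^2/4) ^ k*rGamma (al + real k + 1)/fact k)"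
proof -
 let ?h = "\<lambda>u. (1 - u^2) powr (al - 1/2)"
 define E where "E s u = indicator {-1<..<1} u*(exp (s*u)*?h u)" for s u :: real
 have Ei: "integrable lborel (E s)" for s
 proof -
  have b: "abs (exp (s*u)) \<le> exp (abs s)" if "-1 < u" "u < 1" for u
  proof -
   have "s*u \<le> abs s*abs u" by (metis abs_ge_self abs_mult)
   also have "... \<le> abs s*1" using that by (intro mult_left_mono) auto
   finally show ?thesis by simp
  qed
  show ?thesis unfolding E_def using assms b
   by (intro gegenbauer_weight_mult_integrable [where C="exp (abs s)"]) auto
 qed
 have sym: "integral\<^sup>L lborel (E (- q)) = integral\<^sup>L lborel (E q)"
 proof -
  have "integral\<^sup>L lborel (E q) = abs (-1) *\<^sub>R integral\<^sup>L lborel (\<lambda>u. E q (0 + (-1)*u))"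
   by (rule lborel_integral_real_affine) simp
  also have "(\<lambda>u. E q (0 + (-1)*u)) = E (- q)"
   by (auto simp: E_def indicator_def fun_eq_iff)
  finally show ?thesis by simp
 qed
 define W where "W k u = indicator {-1<..<1} u*(u ^ (2 * k)*?h u)" for k u
 define c where "c k = q ^ (2 * k)/fact (2 * k)" for k
 have ch: "(\<lambda>k. w ^ (2 * k)/fact (2 * k)) sums cosh w" for w :: real
 proof -
  have "(\<lambda>n. if even n then w ^ n /\<^sub>R fact n else 0) sums cosh w" by (rule cosh_converges)
  then have "(\<lambda>k. (\<lambda>n. if even n then w ^ n /\<^sub>R fact n else 0) (2 * k)) sums cosh w"
   by (subst sums_mono_reindex) (auto simp: strict_mono_def elim!: evenE)
  then show ?thesis by (simp add: divide_inverse mult.commute)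
 qed
 have Wc: "(\<lambda>k. c k*W k u) sums ((E q u + E (- q) u)/2)" for u
 proof -
  have "(\<lambda>k. indicator {-1<..<1} u*?h u*((q*u) ^ (2 * k)/fact (2 * k))) sums (indicator {-1<..<1} u*?h u*cosh (q*u))"
   by (intro sums_mult ch)
  moreover have "indicator {-1<..<1} u*?h u*cosh (q*u) = (E q u + E (- q) u)/2"
  proof -
   have "i*h*((a + b)/2) = (i*(a*h) + i*(b*h))/2" for i h a b :: real
    by (simp add: field_simps)
   then show ?thesis unfolding E_def cosh_field_def by simp
  qed
  moreover have "indicator {-1<..<1} u*?h u*((q*u) ^ (2 * k)/fact (2 * k)) = c k*W k u" for k
   unfolding c_def W_def power_mult_distrib by simp
  ultimately show ?thesis by (simp only:)
 qed
 have c0: "abs (c k) = c k" for k by (simp add: c_def power_mult)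
 have p: "pochhammer (al + 1) k = Gamma (al + real k + 1)*rGamma (al + 1)" for k
 proof -
  have "al + 1 \<notin> \<int>\<^sub>\<le>\<^sub>0" using assms by (auto elim!: nonpos_Ints_cases)
  from pochhammer_Gamma [OF this, of k] show ?thesis
   by (simp add: rGamma_inverse_Gamma divide_inverse add_ac)
 qed
 have cm: "c k*gegenbauer_moment al k = gegenbauer_moment al 0*Gamma (al + 1)*((q^2/4) ^ k*rGamma (al + real k + 1)/fact k)" for k
 proof -
  have "c k*gegenbauer_moment al k = q ^ (2 * k)*(gegenbauer_moment al k/fact (2 * k))"
   by (simp add: c_def)
  also have "... = gegenbauer_moment al 0*Gamma (al + 1)*((q^2/4) ^ k*rGamma (al + real k + 1)/fact k)"
  proof -
   have "1/pochhammer (al + 1) k = Gamma (al + 1)*rGamma (al + real k + 1)"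
    unfolding p by (simp add: rGamma_inverse_Gamma divide_inverse)
   moreover have "q ^ (2 * k)/4 ^ k = (q^2/4) ^ k" by (simp add: power_mult power_divide)
   moreover have "a*(m/(F*f*P)) = m*(1/P)*(a/F)/f" for a m F f P :: real by (simp add: mult_ac)
   ultimately have "q ^ (2 * k)*(gegenbauer_moment al 0/(4 ^ k*fact k*pochhammer (al + 1) k))
    = gegenbauer_moment al 0*(Gamma (al + 1)*rGamma (al + real k + 1))*(q^2/4) ^ k/fact k"
    by (simp only:)
   then show ?thesis unfolding gegenbauer_moment_eq [OF assms] by (simp only: mult_ac times_divide_eq_right)
  qed
  finally show ?thesis .
 qed
 have sm0: "summable (\<lambda>k. (q^2/4) ^ k*rGamma (al + real k + 1)/fact k)"
 proof -
  have "summable (\<lambda>k. bessel_coeff al k*(- (q^2/4)) ^ k)" by (rule summable_bessel_coeff)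
  moreover have "bessel_coeff al k*(- (q^2/4)) ^ k = (q^2/4) ^ k*rGamma (al + real k + 1)/fact k" for k
   by (subst power_minus) (simp add: bessel_coeff_def)
  ultimately show ?thesis by simp
 qed
 then have sm: "summable (\<lambda>k. c k*gegenbauer_moment al k)" unfolding cm by (rule summable_mult)
 have "has_bochner_integral lborel (\<lambda>u. \<Sum>k. c k*W k u) (\<Sum>k. c k*gegenbauer_moment al k)"
 proof (rule has_bochner_integral_termwise)
  show "has_bochner_integral lborel (W k) (gegenbauer_moment al k)" for k
   unfolding W_def by (rule gegenbauer_moment_integral [OF assms])
  show "0 \<le> W k u" for k u by (simp add: W_def power_mult)
  show "summable (\<lambda>k. abs (c k)*W k u)" for u unfolding c0 using Wc by (rule sums_summable)
  show "summable (\<lambda>k. abs (c k)*gegenbauer_moment al k)" unfolding c0 by (rule sm)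
 qed
 moreover have "(\<lambda>u. \<Sum>k. c k*W k u) = (\<lambda>u. (E q u + E (- q) u)/2)"
  using sums_unique [OF Wc] by (intro ext) simp
 ultimately have "(LBINT u. (E q u + E (- q) u)/2) = (\<Sum>k. c k*gegenbauer_moment al k)"
  by (simp add: has_bochner_integral_iff)
 moreover have "(LBINT u. (E q u + E (- q) u)/2) = integral\<^sup>L lborel (E (- q))"
  using Ei sym by simp
 moreover have "(\<Sum>k. c k*gegenbauer_moment al k) = gegenbauer_moment al 0*Gamma (al + 1)*(\<Sum>k. (q^2/4) ^ k*rGamma (al + real k + 1)/fact k)"
  unfolding cm by (rule suminf_mult [OF sm0])
 moreover have "E (- q) = (\<lambda>u. indicator {-1<..<1} u *\<^sub>R (exp (- q*u)*?h u))"
  by (simp add: E_def fun_eq_iff)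
 ultimately show ?thesis unfolding set_lebesgue_integral_def by (simp only:)
qed

section \<open>Sonine's mean as a function of t^2\<close>

definition sonine_mean :: "real => real => real => real => real => real" where
 "sonine_mean al be x z tt =
   (LBINT u:{-1<..<1}. max 0 (tt - x^2 - z^2 - 2*x*z*u) powr (be - 1)*(1 - u^2) powr (al - 1/2))"

text \<open>By the law of cosines this is the squared third side of a triangle whose sides x, z
  enclose an angle of cosine -u; \<open>sonine_mean\<close> averages over that angle, with tt in the
  role of t^2.\<close>

lemma quadratic_nonneg:
 fixes x z u :: real
 assumes "x > 0" "z > 0" "-1 < u"
 shows "x^2 + z^2 + 2*x*z*u \<ge> 0"
proof -
 have "x^2 + z^2 + 2*x*z*u = (x - z)^2 + 2*x*z*(1 + u)"
  by (simp add: power2_eq_square algebra_simps)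
 then show ?thesis using assms by simp
qed

lemma shifted_Gamma_laplace:
 fixes s p w :: real
 assumes "s > 0" "p > 0" "w \<ge> 0"
 shows "has_bochner_integral lborel (\<lambda>tt. indicator {0<..} tt*(exp (- p*tt)*max 0 (tt - w) powr (s - 1)))
   (exp (- p*w)*(Gamma s/p powr s))"
proof -
 let ?f = "\<lambda>tt. indicator {0<..} tt*(tt powr (s - 1)*exp (- p*tt))"
 have B: "integrable lborel ?f" "integral\<^sup>L lborel ?f = Gamma s/p powr s"
  using Gamma_laplace [OF assms(1,2)] by (simp_all add: has_bochner_integral_iff)
 let ?g = "\<lambda>tt. ?f (- w + 1*tt)"
 have "integrable lborel ?g" using B by (intro lborel_integrable_real_affine) auto
 moreover have "integral\<^sup>L lborel ?f = abs 1 *\<^sub>R integral\<^sup>L lborel ?g" by (intro lborel_integral_real_affine) auto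
 ultimately have "has_bochner_integral lborel ?g (Gamma s/p powr s)" using B by (simp add: has_bochner_integral_iff)
 then have "has_bochner_integral lborel (\<lambda>tt. exp (- p*w)*?g tt) (exp (- p*w)*(Gamma s/p powr s))"
  by (intro has_bochner_integral_mult_right) auto
 also have "(\<lambda>tt. exp (- p*w)*?g tt) = (\<lambda>tt. indicator {0<..} tt*(exp (- p*tt)*max 0 (tt - w) powr (s - 1)))"
 proof
  fix tt :: real
  show "exp (- p*w)*?g tt = indicator {0<..} tt*(exp (- p*tt)*max 0 (tt - w) powr (s - 1))"
  proof (cases "tt > w")
   case True
   have "exp (- p*w)*exp (- p*(- w + 1*tt)) = exp (- p*tt)" by (simp add: algebra_simps flip: exp_add)
   then show ?thesis using True assms(3) by (simp add: max_def)
  qed (auto simp: max_def)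
 qed
 finally show ?thesis .
qed

text \<open>The truncated power of tt - w has the Laplace transform Gamma be * p powr (-be) * exp
  (-p w). Here w is affine in u, so the integration over u is Poisson's integral and reproduces the
  series of \<open>bessel_J_Weber_integral\<close>.\<close>

lemma sonine_mean_laplace:
 assumes al: "al > -1/2" and be: "be > 0" and pos: "x > 0" "z > 0" "p > 0"
 shows "has_bochner_integral lborel (\<lambda>tt. indicator {0<..} tt*(sonine_mean al be x z tt*exp (- p*tt)))
   (Gamma be/p powr be*exp (- p*(x^2 + z^2)) *
   (gegenbauer_moment al 0*Gamma (al + 1)*(\<Sum>k. (p^2*x^2*z^2) ^ k*rGamma (al + real k + 1)/fact k)))"
proof -
 let ?h = "\<lambda>u. (1 - u^2) powr (al - 1/2)"
 let ?w = "\<lambda>u. x^2 + z^2 + 2*x*z*u"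
 define f where "f = (\<lambda>(u, tt). indicator {-1<..<1} u*?h u*(indicator {0<..} tt*(exp (- p*tt)*max 0 (tt - ?w u) powr (be - 1))))"
 have [measurable]: "f \<in> borel_measurable (lborel \<Otimes>\<^sub>M lborel)"
  unfolding f_def by measurable
 have f0: "f v \<ge> 0" for v unfolding f_def by (auto split: prod.splits)
 have inner: "has_bochner_integral lborel (\<lambda>tt. f (u, tt)) (indicator {-1<..<1} u*?h u*(exp (- p*?w u)*(Gamma be/p powr be)))" for u
 proof (cases "u \<in> {-1<..<1}")
  case True
  then show ?thesis unfolding f_def prod.case using pos be quadratic_nonneg [of x z u]
   by (intro has_bochner_integral_mult_right shifted_Gamma_laplace) auto
 qed (simp add: f_def has_bochner_integral_zero)
 define e where "e u = indicator {-1<..<1} u*(exp (- (2*p*x*z)*u)*?h u)" for u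
 have eq: "indicator {-1<..<1} u*?h u*(exp (- p*?w u)*(Gamma be/p powr be))
   = Gamma be/p powr be*exp (- p*(x^2 + z^2))*e u" for u
 proof -
  have "exp (- p*?w u) = exp (- p*(x^2 + z^2))*exp (- (2*p*x*z)*u)"
   by (simp add: algebra_simps flip: exp_add)
  then show ?thesis unfolding e_def by (simp add: mult_ac)
 qed
 have ei: "integrable lborel e"
 proof -
  have "abs (exp (- (2*p*x*z)*u)) \<le> exp (2*p*x*z)" if "-1 < u" "u < 1" for u
  proof -
   have "(2*p*x*z)*(- u) \<le> (2*p*x*z)*1" using that pos by (intro mult_left_mono) auto
   then show ?thesis by simp
  qed
  then show ?thesis unfolding e_def using al
   by (intro gegenbauer_weight_mult_integrable [where C="exp (2*p*x*z)"]) auto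
 qed
 have outer: "integrable lborel (\<lambda>u. LBINT tt. f (u, tt))"
  and outer_val: "(LBINT u. LBINT tt. f (u, tt)) = Gamma be/p powr be*exp (- p*(x^2 + z^2))*integral\<^sup>L lborel e"
 proof -
  have "(LBINT tt. f (u, tt)) = Gamma be/p powr be*exp (- p*(x^2 + z^2))*e u" for u
   using inner [of u] unfolding eq by (simp only: has_bochner_integral_iff)
  then show "integrable lborel (\<lambda>u. LBINT tt. f (u, tt))"
   "(LBINT u. LBINT tt. f (u, tt)) = Gamma be/p powr be*exp (- p*(x^2 + z^2))*integral\<^sup>L lborel e"
   using ei by simp_all
 qed
 have fi: "integrable (lborel \<Otimes>\<^sub>M lborel) f"
 proof (rule lborel_pair.Fubini_integrable)
  show "integrable lborel (\<lambda>u. LBINT tt. norm (f (u, tt)))" using outer f0 by simp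
  show "AE u in lborel. integrable lborel (\<lambda>tt. f (u, tt))" using inner by (simp add: has_bochner_integral_iff)
 qed simp
 have slice: "(LBINT u. f (u, tt)) = indicator {0<..} tt*(sonine_mean al be x z tt*exp (- p*tt))" for tt
 proof -
  have "f (u, tt) = indicator {0<..} tt*exp (- p*tt) *
    (indicator {-1<..<1} u*(max 0 (tt - x^2 - z^2 - 2*x*z*u) powr (be - 1)*?h u))" for u
   unfolding f_def by (simp add: algebra_simps)
  then show ?thesis by (simp add: sonine_mean_def set_lebesgue_integral_def)
 qed
 have fi': "integrable (lborel \<Otimes>\<^sub>M lborel) (case_prod (\<lambda>u tt. f (u, tt)))" using fi by simp
 have "integrable lborel (\<lambda>tt. LBINT u. f (u, tt))"
  using lborel_pair.integrable_snd [OF fi'] .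
 moreover have "(LBINT tt. LBINT u. f (u, tt)) = (LBINT u. LBINT tt. f (u, tt))"
  using lborel_pair.Fubini_integral [OF fi'] .
 moreover have "integral\<^sup>L lborel e = gegenbauer_moment al 0*Gamma (al + 1)*(\<Sum>k. (p^2*x^2*z^2) ^ k*rGamma (al + real k + 1)/fact k)"
 proof -
  have "(2*p*x*z)^2/4 = p^2*x^2*z^2" by (simp add: power_mult_distrib)
  moreover have "e = (\<lambda>u. indicator {-1<..<1} u *\<^sub>R (exp (- (2*p*x*z)*u)*?h u))"
   by (simp add: e_def fun_eq_iff)
  ultimately show ?thesis
   using gegenbauer_exp_integral [OF al, of "2*p*x*z"] unfolding set_lebesgue_integral_def by (simp only:)
 qed
 ultimately show ?thesis unfolding slice has_bochner_integral_iff outer_val by simp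
qed

text \<open>For be > 1 the truncated power is continuous in tt and at most K powr (be - 1) for tt <=
  K, so a multiple of the weight dominates.\<close>

lemma sonine_mean_continuous:
 assumes al: "al > -1/2" and be: "be > 1" and pos: "x > 0" "z > 0"
 shows "continuous_on {0..} (sonine_mean al be x z)"
 unfolding continuous_on_sequentially
proof (intro allI impI ballI, elim conjE)
 fix tt :: real and ttn :: "nat => real" assume tt: "tt \<in> {0..}" "\<forall>n. ttn n \<in> {0..}" and lim: "ttn \<longlonglongrightarrow> tt"
 let ?h = "\<lambda>u. (1 - u^2) powr (al - 1/2)"
 let ?g = "\<lambda>s u. indicator {-1<..<1} u *\<^sub>R (max 0 (s - x^2 - z^2 - 2*x*z*u) powr (be - 1)*?h u)"
 have "Bseq ttn" using lim by (intro convergent_imp_Bseq convergentI)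
 then obtain K where K: "\<And>n. abs (ttn n) \<le> K" unfolding Bseq_def real_norm_def by blast
 show "(sonine_mean al be x z \<circ> ttn) \<longlonglongrightarrow> sonine_mean al be x z tt"
  unfolding sonine_mean_def comp_def set_lebesgue_integral_def
 proof (rule integral_dominated_convergence)
  show "integrable lborel (\<lambda>u. indicator {-1<..<1} u*(K powr (be - 1)*?h u))"
   using al by (intro gegenbauer_weight_mult_integrable [where C="K powr (be - 1)"]) auto
  show "AE u in lborel. (\<lambda>n. ?g (ttn n) u) \<longlonglongrightarrow> ?g tt u"
  proof (intro always_eventually allI)
   fix u
   have "continuous_on UNIV (\<lambda>s. max 0 (s - x^2 - z^2 - 2*x*z*u) powr (be - 1))"
    using be by (intro continuous_on_powr' continuous_intros) auto
   then have "isCont (\<lambda>s. max 0 (s - x^2 - z^2 - 2*x*z*u) powr (be - 1)) tt"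
    by (simp add: continuous_on_eq_continuous_at)
   from isCont_tendsto_compose [OF this lim] show "(\<lambda>n. ?g (ttn n) u) \<longlonglongrightarrow> ?g tt u"
    by (rule tendsto_scaleR [OF tendsto_const tendsto_mult_right])
  qed
  show "AE u in lborel. norm (?g (ttn n) u) \<le> indicator {-1<..<1} u*(K powr (be - 1)*?h u)" for n
  proof (intro always_eventually allI)
   fix u
   show "norm (?g (ttn n) u) \<le> indicator {-1<..<1} u*(K powr (be - 1)*?h u)"
   proof (cases "u \<in> {-1<..<1}")
    case True
    have "max 0 (ttn n - x^2 - z^2 - 2*x*z*u) \<le> K"
     using K [of n] quadratic_nonneg [OF pos, of u] True by auto
    then have "max 0 (ttn n - x^2 - z^2 - 2*x*z*u) powr (be - 1) \<le> K powr (be - 1)"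
     using be by (intro powr_mono2) auto
    then show ?thesis using True by (simp add: abs_mult mult_right_mono)
   qed simp
  qed
 qed auto
qed

lemma powr_le_exp:
 fixes tt s :: real
 assumes "tt \<ge> 0" "s > 0"
 shows "tt powr s \<le> s powr s*exp tt"
proof -
 have "tt/s \<le> exp (tt/s)" using exp_ge_add_one_self [of "tt/s"] by linarith
 then have "(tt/s) powr s \<le> exp (tt/s) powr s" using assms by (intro powr_mono2) auto
 also have "exp (tt/s) powr s = exp tt" using assms by (simp add: powr_def)
 finally show ?thesis using assms by (simp add: powr_divide divide_le_eq mult.commute)
qed

text \<open>Polynomial growth, relaxed to the exponential bound that \<open>Lerch\<close> asks
  for.\<close>

lemma sonine_mean_bound:
 assumes al: "al > -1/2" and be: "be > 1" and pos: "x > 0" "z > 0"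
 shows "\<exists>B. \<forall>tt\<ge>0. abs (sonine_mean al be x z tt) \<le> B*exp tt"
proof (intro exI allI impI)
 fix tt :: real assume tt: "tt \<ge> 0"
 let ?h = "\<lambda>u. (1 - u^2) powr (al - 1/2)"
 have i: "integrable lborel (\<lambda>u. indicator {-1<..<1} u*(tt powr (be - 1)*?h u))"
  using al by (intro gegenbauer_weight_mult_integrable [where C="tt powr (be - 1)"]) auto
 let ?g = "\<lambda>u. indicator {-1<..<1} u *\<^sub>R (max 0 (tt - x^2 - z^2 - 2*x*z*u) powr (be - 1)*?h u)"
 have b: "max 0 (tt - x^2 - z^2 - 2*x*z*u) powr (be - 1) \<le> tt powr (be - 1)" if "-1 < u" for u
  using quadratic_nonneg [OF pos that] tt be by (intro powr_mono2) auto
 have gi: "integrable lborel ?g"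
  unfolding real_scaleR_def using al b
  by (intro gegenbauer_weight_mult_integrable [where C="tt powr (be - 1)"]) auto
 have "abs (sonine_mean al be x z tt) \<le> (LBINT u. norm (?g u))"
  unfolding sonine_mean_def set_lebesgue_integral_def real_norm_def [symmetric] by (rule integral_norm_bound)
 also have "... \<le> (LBINT u. indicator {-1<..<1} u*(tt powr (be - 1)*?h u))"
 proof (rule integral_mono [OF _ i])
  show "integrable lborel (\<lambda>u. norm (?g u))" using gi by (rule integrable_norm)
  fix u :: real
  show "norm (?g u) \<le> indicator {-1<..<1} u*(tt powr (be - 1)*?h u)"
   using b [of u] by (cases "u \<in> {-1<..<1}") (auto simp: abs_mult mult_right_mono)
 qed
 also have "... = tt powr (be - 1)*gegenbauer_moment al 0"
 proof -
  have "(\<lambda>u. indicator {-1<..<1} u*(tt powr (be - 1)*?h u)) = (\<lambda>u. tt powr (be - 1)*(indicator {-1<..<1} u*?h u))"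
   by (simp add: mult_ac fun_eq_iff)
  then show ?thesis by (simp add: gegenbauer_moment_def set_lebesgue_integral_def)
 qed
 also have "... \<le> ((be - 1) powr (be - 1)*exp tt)*gegenbauer_moment al 0"
  using gegenbauer_moment_0_pos [OF al] tt be by (intro mult_right_mono powr_le_exp) auto
 finally show "abs (sonine_mean al be x z tt) \<le> ((be - 1) powr (be - 1)*gegenbauer_moment al 0)*exp tt"
  by (simp add: mult_ac)
qed

lemma powr_integral_from_0:
 fixes a c :: real
 assumes "a > -1" "c \<ge> 0"
 shows "has_bochner_integral lborel (\<lambda>y. indicator {0<..c} y*y powr a) (c powr (a + 1)/(a + 1))"
proof -
 have "((\<lambda>y. y powr a) has_integral (c powr (a + 1)/(a + 1))) {0..c}"
  using assms by (intro has_integral_powr_from_0)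
 then have "has_bochner_integral lborel (\<lambda>y. indicator {0..c} y*y powr a) (c powr (a + 1)/(a + 1))"
  by (intro has_bochner_integral_of_has_integral) auto
 also have "(\<lambda>y. indicator {0..c} y*y powr a) = (\<lambda>y. indicator {0<..c} y*y powr a)"
  by (auto simp: indicator_def fun_eq_iff)
 finally show ?thesis .
qed

lemma powr_integral_to_inf:
 fixes a c :: real
 assumes "a < -1" "c > 0"
 shows "has_bochner_integral lborel (\<lambda>y. indicator {c<..} y*y powr a) (- (c powr (a + 1))/(a + 1))"
proof -
 have "((\<lambda>y. y powr a) has_integral - (c powr (a + 1))/(a + 1)) {c..}"
  using assms by (intro has_integral_powr_to_inf)
 then have h: "has_bochner_integral lborel (\<lambda>y. indicator {c..} y*y powr a) (- (c powr (a + 1))/(a + 1))"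
  by (intro has_bochner_integral_of_has_integral) auto
 have "AE y in lborel. y \<noteq> c" by (rule AE_lborel_singleton)
 then have "AE y in lborel. indicator {c..} y*y powr a = indicator {c<..} y*y powr a"
  by eventually_elim (auto simp: indicator_def)
 then show ?thesis
  using h has_bochner_integral_cong_AE [of "\<lambda>y. indicator {c..} y*y powr a" lborel "\<lambda>y. indicator {c<..} y*y powr a"]
  by simp
qed

lemma bessel_J_bound_min:
 assumes "mu \<ge> 0"
 shows "\<exists>C\<ge>0. \<forall>w>0. abs (bessel_J mu w) \<le> C \<and> abs (bessel_J mu w) \<le> C*w powr mu"
proof -
 obtain C1 where C1: "C1 \<ge> 0" "\<And>w. 0 < w ==> w \<le> 1 ==> abs (bessel_J mu w) \<le> C1*w powr mu"
  using bessel_J_bound_small [of 1 mu] by auto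
 obtain C2 where C2: "C2 \<ge> 0" "\<And>w. w \<ge> 1 ==> abs (bessel_J mu w) \<le> C2/sqrt w"
  using bessel_J_bound_large [of 1 mu] by auto
 have "abs (bessel_J mu w) \<le> max C1 C2 \<and> abs (bessel_J mu w) \<le> max C1 C2*w powr mu" if w: "w > 0" for w
 proof (cases "w \<le> 1")
  case True
  have "w powr mu \<le> 1" using w True assms by (simp add: powr_le1)
  then have "C1*w powr mu \<le> C1*1" using C1 by (intro mult_left_mono)
  moreover have "C1*w powr mu \<le> max C1 C2*w powr mu" by (intro mult_right_mono) auto
  ultimately show ?thesis using C1(2) [OF w True] by auto
 next
  case False
  then have w1: "w \<ge> 1" by simp
  have "C2/sqrt w \<le> C2/1" using w1 C2(1) by (intro divide_left_mono) auto
  then have b: "abs (bessel_J mu w) \<le> max C1 C2" using C2(2) [OF w1] by simp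
  have "max C1 C2*1 \<le> max C1 C2*w powr mu"
   using w1 assms C1(1) by (intro mult_left_mono ge_one_powr_ge_zero) auto
  with b have "abs (bessel_J mu w) \<le> max C1 C2*w powr mu" by linarith
  with b show ?thesis ..
 qed
 then show ?thesis using C1(1) by (intro exI [of _ "max C1 C2"]) auto
qed

lemma bessel_J_product_bound:
 assumes "x > 0" "z > 0"
 shows "\<exists>D\<ge>0. \<forall>y>0. abs (bessel_J al (x*y)*bessel_J al (z*y)) \<le> D*(if y \<le> 1 then y powr (2*al) else 1/y)"
proof -
 have one: "\<exists>C\<ge>0. \<forall>y>0. abs (bessel_J al (w*y)) \<le> C*(if y \<le> 1 then y powr al else 1/sqrt y)" if w: "w > 0" for w
 proof -
  obtain C1 where C1: "C1 \<ge> 0" "\<And>v. 0 < v ==> v \<le> w ==> abs (bessel_J al v) \<le> C1 * v powr al"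
   using bessel_J_bound_small [OF w, of al] by auto
  obtain C2 where C2: "C2 \<ge> 0" "\<And>v. v \<ge> w ==> abs (bessel_J al v) \<le> C2/sqrt v"
   using bessel_J_bound_large [OF w, of al] by auto
  define C where "C = max (C1*w powr al) (C2/sqrt w)"
  have "abs (bessel_J al (w*y)) \<le> C*(if y \<le> 1 then y powr al else 1/sqrt y)" if y: "y > 0" for y
  proof (cases "y \<le> 1")
   case True
   have "abs (bessel_J al (w*y)) \<le> C1*(w*y) powr al" using w y True by (intro C1) auto
   also have "... = C1*w powr al*y powr al" using w y by (simp add: powr_mult)
   also have "... \<le> C*y powr al" unfolding C_def by (intro mult_right_mono) auto
   finally show ?thesis using True by simp
  next
   case False
   have "abs (bessel_J al (w*y)) \<le> C2/sqrt (w*y)" using w y False by (intro C2) auto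
   also have "... = C2/sqrt w*(1/sqrt y)" by (simp add: real_sqrt_mult)
   also have "... \<le> C*(1/sqrt y)" unfolding C_def using y by (intro mult_right_mono) auto
   finally show ?thesis using False by simp
  qed
  moreover have "C \<ge> 0" unfolding C_def using C1(1) by (simp add: le_max_iff_disj)
  ultimately show ?thesis by blast
 qed
 obtain A where A: "A \<ge> 0" "\<And>y. y > 0 ==> abs (bessel_J al (x*y)) \<le> A*(if y \<le> 1 then y powr al else 1/sqrt y)"
  using one [OF assms(1)] by blast
 obtain B where B: "B \<ge> 0" "\<And>y. y > 0 ==> abs (bessel_J al (z*y)) \<le> B*(if y \<le> 1 then y powr al else 1/sqrt y)"
  using one [OF assms(2)] by blast
 have "abs (bessel_J al (x*y)*bessel_J al (z*y)) \<le> (A*B)*(if y \<le> 1 then y powr (2*al) else 1/y)" if y: "y > 0" for y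
 proof -
  let ?m = "if y \<le> 1 then y powr al else 1/sqrt y"
  have "abs (bessel_J al (x*y)*bessel_J al (z*y)) \<le> (A*?m)*(B*?m)"
   unfolding abs_mult using A B y by (intro mult_mono) auto
  also have "... = (A*B)*(?m*?m)" by (simp only: mult_ac)
  also have "?m*?m = (if y \<le> 1 then y powr (2*al) else 1/y)"
   using y by (auto simp flip: powr_add)
  finally show ?thesis .
 qed
 then show ?thesis using A(1) B(1) by (intro exI [of _ "A*B"]) auto
qed

lemma powr_bessel_J_sqrt:
 assumes "y > 0" "tt > 0"
 shows "tt powr (mu/2)*bessel_J mu (y * sqrt tt) = (y/2) powr mu*(tt powr mu*bessel_j mu (y^2/4*tt))"
proof -
 have "(y * sqrt tt/2) powr mu = (y/2) powr mu*tt powr (mu/2)"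
  using assms powr_mult [of "y/2" "sqrt tt" mu] by (simp add: powr_half_sqrt [symmetric] powr_powr)
 then have J: "bessel_J mu (y * sqrt tt) = (y/2) powr mu*tt powr (mu/2)*bessel_j mu (y^2/4*tt)"
  using assms by (simp add: bessel_J_eq power_mult_distrib)
 have sq: "tt powr (mu/2)*tt powr (mu/2) = tt powr mu" using assms by (simp flip: powr_add)
 have h: "T*(Y*T*J) = Y*(T*T*J)" for T Y J :: real by (simp add: mult_ac)
 show ?thesis unfolding J by (subst h, subst sq, rule refl)
qed

text \<open>As functions of tt = t^2, both sides times t powr mu have the same Laplace transform: on
  the left by Fubini, \<open>bessel_J_laplace\<close> in tt and Weber's integral in y, on the right
  by \<open>sonine_mean_laplace\<close>. \<open>Lerch\<close> compares them at integers only. As be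
  >= 2 gives mu > 3/2, the bounded factor J_mu and the decay y powr (-mu) suffice for absolute
  convergence.\<close>

lemma bessel_triple_integral_large:
 assumes al: "al > -1/2" and be: "be \<ge> 2" and pos: "x > 0" "z > 0" "t > 0"
 shows "((\<lambda>R. LBINT y:{0<..R}. bessel_triple (al + be) al t x z y) \<longlongrightarrow>
   2 powr (1 - al - be)/(Gamma be*gegenbauer_moment al 0*Gamma (al + 1))*t powr (- al - be)*(x*z) powr al *
   sonine_mean al be x z (t^2)) at_top"
proof -
 define mu where "mu = al + be"
 have mu: "mu > 3/2" using al be by (simp add: mu_def)
 define ps where "ps y = indicator {0<..} y*(bessel_J al (x*y)*bessel_J al (z*y)*y powr (1 - mu))" for y
 \<comment> \<open>The integrand times t powr mu in the variable tt = t^2, expressed by the entire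
   \<open>bessel_j\<close> so that it is continuous up to tt = 0.\<close>
 define g where "g tt y = (y/2) powr mu*(tt powr mu*bessel_j mu (y^2/4*tt))*ps y" for tt y
 define Y where "Y y = indicator {0<..1} y*y powr (2*al + 1) + indicator {1<..} y*y powr (- mu)" for y
 have psm [measurable]: "ps \<in> borel_measurable borel"
 proof -
  have "continuous_on {0<..} (\<lambda>y. bessel_J al (x*y)*bessel_J al (z*y)*y powr (1 - mu))"
   using pos by (intro continuous_intros) auto
  from borel_measurable_continuous_on_indicator [OF _ this] show ?thesis
   unfolding ps_def [abs_def] by simp
 qed
 have jm [measurable]: "bessel_j mu \<in> borel_measurable borel"
  by (intro borel_measurable_continuous_onI continuous_on_bessel_j continuous_on_id)
 obtain C where C: "C \<ge> 0" "\<And>w. w > 0 ==> abs (bessel_J mu w) \<le> C" "\<And>w. w > 0 ==> abs (bessel_J mu w) \<le> C*w powr mu"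
  using bessel_J_bound_min [of mu] mu by auto
 obtain D where D: "D \<ge> 0" "\<And>y. y > 0 ==> abs (bessel_J al (x*y)*bessel_J al (z*y)) \<le> D*(if y \<le> 1 then y powr (2*al) else 1/y)"
  using bessel_J_product_bound [OF pos(1,2)] by blast
 have Y0: "Y y \<ge> 0" for y by (simp add: Y_def)
 have Yi: "integrable lborel Y"
  unfolding Y_def using powr_integral_from_0 [of "2*al + 1" 1] powr_integral_to_inf [of "- mu" 1] al mu
  by (intro Bochner_Integration.integrable_add) (auto simp: has_bochner_integral_iff)
 \<comment> \<open>One power for each bound of J_mu (w), w = y * sqrt tt: the bound C w powr mu
   serves y <= 1, the bound C serves y > 1.\<close>
 define e where "e tt = tt powr mu + tt powr (mu/2)" for tt
 have e0: "e tt \<ge> 0" for tt by (simp add: e_def)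
 have geq: "g tt y = tt powr (mu/2)*bessel_J mu (y * sqrt tt)*ps y" if "tt > 0" for tt y
 proof (cases "y > 0")
  case True
  show ?thesis unfolding g_def powr_bessel_J_sqrt [OF True that] by (rule refl)
 qed (simp add: g_def ps_def)
 have gb: "abs (g tt y) \<le> C*D*e tt*Y y" if "tt \<ge> 0" for tt y
 proof (cases "tt > 0 \<and> y > 0")
  case False
  then show ?thesis
  proof (cases "y > 0")
   case True
   with False that have "tt = 0" by auto
   then show ?thesis using C D e0 Y0 by (simp add: g_def)
  qed (use C D e0 Y0 in \<open>simp add: g_def ps_def\<close>)
 next
  case True
  then have tt: "tt > 0" and y: "y > 0" by auto
  have sq: "(y * sqrt tt) powr mu = y powr mu*tt powr (mu/2)"
   using tt y by (simp add: powr_mult powr_half_sqrt [symmetric] powr_powr)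
  have dbl: "tt powr (mu/2)*tt powr (mu/2) = tt powr mu" using tt by (simp flip: powr_add)
  have ab: "abs (g tt y) = tt powr (mu/2)*abs (bessel_J mu (y * sqrt tt))*(abs (bessel_J al (x*y)*bessel_J al (z*y))*y powr (1 - mu))"
   unfolding geq [OF tt] ps_def using y by (simp add: abs_mult)
  show ?thesis
  proof (cases "y \<le> 1")
   case True
   have "abs (g tt y) \<le> tt powr (mu/2)*(C*(y powr mu*tt powr (mu/2)))*(D*y powr (2*al)*y powr (1 - mu))"
    unfolding ab using C(1) C(3) [of "y * sqrt tt"] D(1) D(2) [OF y] True tt y
    by (intro mult_mono mult_nonneg_nonneg) (auto simp: sq)
   also have "... = C*D*(tt powr (mu/2)*tt powr (mu/2))*(y powr mu*(y powr (2*al)*y powr (1 - mu)))"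
    by (simp only: mult_ac)
   also have "y powr mu*(y powr (2*al)*y powr (1 - mu)) = Y y"
    using True y by (simp add: Y_def flip: powr_add)
   also have "C*D*(tt powr (mu/2)*tt powr (mu/2))*Y y \<le> C*D*e tt*Y y"
    unfolding dbl using C(1) D(1) Y0 by (intro mult_right_mono mult_left_mono) (auto simp: e_def)
   finally show ?thesis .
  next
   case False
   have "abs (g tt y) \<le> tt powr (mu/2)*C*(D*(1/y)*y powr (1 - mu))"
    unfolding ab using C(1) C(2) [of "y * sqrt tt"] D(1) D(2) [OF y] False tt y
    by (intro mult_mono mult_nonneg_nonneg) auto
   also have "... = C*D*tt powr (mu/2)*(1/y*y powr (1 - mu))" by (simp only: mult_ac)
   also have "1/y*y powr (1 - mu) = Y y"
    using False y by (simp add: Y_def powr_diff powr_minus field_simps)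
   also have "C*D*tt powr (mu/2)*Y y \<le> C*D*e tt*Y y"
    using C(1) D(1) Y0 by (intro mult_right_mono mult_left_mono) (auto simp: e_def)
   finally show ?thesis .
  qed
 qed
 have gm [measurable]: "g tt \<in> borel_measurable borel" for tt unfolding g_def by measurable
 have gi: "integrable lborel (g tt)" if "tt \<ge> 0" for tt
 proof (rule Bochner_Integration.integrable_bound)
  show "integrable lborel (\<lambda>y. C*D*e tt*Y y)" using Yi by (rule integrable_mult_right)
  show "AE y in lborel. norm (g tt y) \<le> norm (C*D*e tt*Y y)"
   using order_trans [OF gb [OF that] abs_ge_self] by simp
 qed simp
 define G where "G tt = integral\<^sup>L lborel (g tt)" for tt
 have Gb: "abs (G tt) \<le> C*D*e tt*integral\<^sup>L lborel Y" if "tt \<ge> 0" for tt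
 proof -
  have "abs (G tt) \<le> (LBINT y. norm (g tt y))"
   unfolding G_def real_norm_def [symmetric] by (rule integral_norm_bound)
  also have "... \<le> (LBINT y. C*D*e tt*Y y)"
   by (intro integral_mono integrable_norm gi that integrable_mult_right Yi) (use gb [OF that] in simp)
  finally show ?thesis by simp
 qed
 have Gc: "continuous_on {0..} G"
  unfolding continuous_on_sequentially
 proof (intro allI impI ballI, elim conjE)
  fix tt :: real and ttn :: "nat => real"
  assume tt: "tt \<in> {0..}" "\<forall>n. ttn n \<in> {0..}" and lim: "ttn \<longlonglongrightarrow> tt"
  have "Bseq ttn" using lim by (intro convergent_imp_Bseq convergentI)
  then obtain K where K: "\<And>n. abs (ttn n) \<le> K" unfolding Bseq_def real_norm_def by blast
  show "(G \<circ> ttn) \<longlonglongrightarrow> G tt"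
   unfolding G_def comp_def
  proof (rule integral_dominated_convergence)
   show "integrable lborel (\<lambda>y. C*D*e K*Y y)" using Yi by (rule integrable_mult_right)
   show "AE y in lborel. (\<lambda>n. g (ttn n) y) \<longlonglongrightarrow> g tt y"
   proof (intro always_eventually allI)
    fix y
    have "continuous_on {0..} (\<lambda>tt. g tt y)"
     unfolding g_def using mu by (intro continuous_intros continuous_on_powr') auto
    then show "(\<lambda>n. g (ttn n) y) \<longlonglongrightarrow> g tt y"
     using tt lim unfolding continuous_on_sequentially comp_def by blast
   qed
   show "AE y in lborel. norm (g (ttn n) y) \<le> C*D*e K*Y y" for n
   proof (intro always_eventually allI)
    fix y
    have "e (ttn n) \<le> e K"
     unfolding e_def using K [of n] tt(2) mu by (intro add_mono powr_mono2) (auto intro: order_trans)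
    then have "C*D*e (ttn n)*Y y \<le> C*D*e K*Y y"
     using C(1) D(1) Y0 by (intro mult_right_mono mult_left_mono) auto
    then show "norm (g (ttn n) y) \<le> C*D*e K*Y y"
     using gb [of "ttn n" y] tt(2) by auto
   qed
  qed auto
 qed
 define A where "A p = (\<Sum>m. (p^2*x^2*z^2) ^ m*rGamma (al + real m + 1)/fact m)" for p
 have lapG: "(LBINT tt:{0<..}. G tt*exp (- p*tt)) = 2 powr (1 - mu)*(x*z) powr al*p powr (- be)*exp (- p*(x^2 + z^2))*A p"
  and lapGi: "set_integrable lborel {0<..} (\<lambda>tt. G tt*exp (- p*tt))"
  if p: "p > 0" for p
 proof -
  define f where "f = (\<lambda>(y, tt). indicator {0<..} tt*(g tt y*exp (- p*tt)))"
  have [measurable]: "f \<in> borel_measurable (lborel \<Otimes>\<^sub>M lborel)"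
   unfolding f_def g_def by measurable
  define E where "E tt = indicator {0<..} tt*(e tt*exp (- p*tt))" for tt
  have Ei: "integrable lborel E"
  proof -
   have "integrable lborel (\<lambda>tt. indicator {0<..} tt*(tt powr (mu + 1 - 1)*exp (- p*tt)) + indicator {0<..} tt*(tt powr (mu/2 + 1 - 1)*exp (- p*tt)))"
    using Gamma_laplace [of "mu + 1" p] Gamma_laplace [of "mu/2 + 1" p] mu p
    by (intro Bochner_Integration.integrable_add) (auto simp: has_bochner_integral_iff)
   also have "(\<lambda>tt. indicator {0<..} tt*(tt powr (mu + 1 - 1)*exp (- p*tt)) + indicator {0<..} tt*(tt powr (mu/2 + 1 - 1)*exp (- p*tt))) = E"
    by (simp add: E_def e_def fun_eq_iff algebra_simps)
   finally show ?thesis .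
  qed
  have fb: "abs (f (y, tt)) \<le> C*D*Y y*E tt" for y tt
  proof (cases "tt > 0")
   case True
   have "abs (g tt y)*exp (- p*tt) \<le> C*D*e tt*Y y*exp (- p*tt)"
    using gb [of tt y] True by (intro mult_right_mono) auto
   then show ?thesis using True by (simp add: f_def E_def abs_mult mult_ac)
  qed (simp add: f_def E_def)
  have fslice: "integrable lborel (\<lambda>tt. f (y, tt))" for y
  proof (rule Bochner_Integration.integrable_bound)
   show "integrable lborel (\<lambda>tt. C*D*Y y*E tt)" using Ei by (rule integrable_mult_right)
   show "AE tt in lborel. norm (f (y, tt)) \<le> norm (C*D*Y y*E tt)"
    using order_trans [OF fb abs_ge_self] by simp
  qed measurable
  have fi: "integrable (lborel \<Otimes>\<^sub>M lborel) f"
  proof (rule lborel_pair.Fubini_integrable)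
   show "integrable lborel (\<lambda>y. LBINT tt. norm (f (y, tt)))"
   proof (rule Bochner_Integration.integrable_bound)
    show "integrable lborel (\<lambda>y. (C*D*integral\<^sup>L lborel E)*Y y)" using Yi by (rule integrable_mult_right)
    show "AE y in lborel. norm (LBINT tt. norm (f (y, tt))) \<le> norm ((C*D*integral\<^sup>L lborel E)*Y y)"
    proof (intro always_eventually allI)
     fix y
     have "(LBINT tt. norm (f (y, tt))) \<le> (LBINT tt. C*D*Y y*E tt)"
      by (intro integral_mono integrable_norm fslice integrable_mult_right Ei) (use fb in simp)
     moreover have "(LBINT tt. norm (f (y, tt))) \<ge> 0" by (intro integral_nonneg_AE) auto
     ultimately show "norm (LBINT tt. norm (f (y, tt))) \<le> norm ((C*D*integral\<^sup>L lborel E)*Y y)"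
      by (simp add: mult_ac)
    qed
   qed measurable
   show "AE y in lborel. integrable lborel (\<lambda>tt. f (y, tt))" using fslice by simp
  qed simp
  have inner: "(LBINT tt. f (y, tt)) = 2 powr (- mu)*p powr (- mu - 1) *
    (indicator {0<..} y*(bessel_J al (x*y)*bessel_J al (z*y)*y*exp (- (y^2/(4*p)))))" for y
  proof (cases "y > 0")
   case True
   have "f (y, tt) = ps y*(indicator {0<..} tt*(tt powr (mu/2)*bessel_J mu (y * sqrt tt)*exp (- p*tt)))" for tt
    by (cases "tt > 0") (simp_all add: f_def geq)
   then have "(LBINT tt. f (y, tt)) = ps y*((y/2) powr mu*p powr (- mu - 1)*exp (- (y^2/(4*p))))"
    using bessel_J_laplace [of mu y p] mu True p by (simp add: has_bochner_integral_iff)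
   also have "(y/2) powr mu = y powr mu*2 powr (- mu)" using True powr_divide [of y 2 mu] powr_minus_divide [of 2 mu] by simp
   also have "ps y*(y powr mu*2 powr (- mu)*p powr (- mu - 1)*exp (- (y^2/(4*p))))
     = 2 powr (- mu)*p powr (- mu - 1)*(bessel_J al (x*y)*bessel_J al (z*y)*(y powr mu*y powr (1 - mu))*exp (- (y^2/(4*p))))"
    using True by (simp add: ps_def mult_ac)
   also have "y powr mu*y powr (1 - mu) = y" using True by (simp flip: powr_add)
   finally show ?thesis using True by simp
  next
   case False
   then have "f (y, tt) = 0" for tt by (simp add: f_def g_def ps_def)
   with False show ?thesis by simp
  qed
  have slice: "(LBINT y. f (y, tt)) = indicator {0<..} tt *\<^sub>R (G tt*exp (- p*tt))" for tt
   by (simp add: f_def G_def)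
  have fi': "integrable (lborel \<Otimes>\<^sub>M lborel) (case_prod (\<lambda>y tt. f (y, tt)))" using fi by simp
  show "set_integrable lborel {0<..} (\<lambda>tt. G tt*exp (- p*tt))"
   unfolding set_integrable_def slice [symmetric] using lborel_pair.integrable_snd [OF fi'] .
  have "(LBINT tt:{0<..}. G tt*exp (- p*tt)) = (LBINT y. LBINT tt. f (y, tt))"
   unfolding set_lebesgue_integral_def slice [symmetric] by (rule lborel_pair.Fubini_integral [OF fi'])
  also have "... = 2 powr (- mu)*p powr (- mu - 1)*(2*p*(p*x*z) powr al*exp (- p*(x^2 + z^2))*A p)"
   unfolding inner A_def using bessel_J_Weber_integral [of al x z p] al pos p by (simp add: has_bochner_integral_iff)
  also have "... = 2 powr (1 - mu)*(x*z) powr al*p powr (- be)*exp (- p*(x^2 + z^2))*A p"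
  proof -
   have 1: "2 powr (- mu)*2 = 2 powr (1 - mu)" using powr_add [of 2 "- mu" 1] by simp
   have 2: "(p*x*z) powr al = p powr al*(x*z) powr al" using pos p by (simp add: powr_mult mult_ac)
   have 3: "p powr (- mu - 1)*p*p powr al = p powr (- be)"
   proof -
    have "p powr (- mu - 1)*p powr 1*p powr al = p powr ((- mu - 1) + 1 + al)" by (simp only: powr_add)
    then show ?thesis using p by (simp add: mu_def)
   qed
   have "a*q*(2*p*(P*X)*E*B) = (a*2)*X*(q*p*P)*E*B" for a q P X E B :: real
    by (simp only: mult_ac)
   then show ?thesis unfolding 2 1 [symmetric] 3 [symmetric] .
  qed
  finally show "(LBINT tt:{0<..}. G tt*exp (- p*tt)) = 2 powr (1 - mu)*(x*z) powr al*p powr (- be)*exp (- p*(x^2 + z^2))*A p" .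
 qed
 define m where "m = Gamma be*gegenbauer_moment al 0*Gamma (al + 1)"
 have m: "m > 0" unfolding m_def using gegenbauer_moment_0_pos [OF al] al be by (intro mult_pos_pos Gamma_real_pos) auto
 \<comment> \<open>The quotient of the two Laplace transforms, in which p has cancelled.\<close>
 define K where "K = 2 powr (1 - mu)/m*(x*z) powr al"
 let ?Q = "sonine_mean al be x z"
 obtain B where B: "\<And>tt. tt \<ge> 0 ==> abs (?Q tt) \<le> B*exp tt"
  using sonine_mean_bound [OF al _ pos(1,2), of be] be by auto
 have GQ: "G tt - K*?Q tt = 0" if tt: "tt \<ge> 0" for tt
 proof (rule Lerch [OF _ _ _ tt])
  show "continuous_on {0..} (\<lambda>tt. G tt - K*?Q tt)"
   using be by (intro continuous_intros Gc sonine_mean_continuous al pos) simp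
  let ?B = "C*D*(mu powr mu + (mu/2) powr (mu/2))*integral\<^sup>L lborel Y + abs K*B"
  show "abs (G s - K*?Q s) \<le> ?B*exp s" if s: "s \<ge> 0" for s
  proof -
   have "e s \<le> (mu powr mu + (mu/2) powr (mu/2))*exp s"
    unfolding e_def distrib_right using s mu by (intro add_mono powr_le_exp) auto
   then have "C*D*e s*integral\<^sup>L lborel Y \<le> C*D*((mu powr mu + (mu/2) powr (mu/2))*exp s)*integral\<^sup>L lborel Y"
    using C(1) D(1) Y0 by (intro mult_right_mono mult_left_mono integral_nonneg_AE) auto
   moreover have "abs (K*?Q s) \<le> abs K*(B*exp s)"
    unfolding abs_mult using B [OF s] by (intro mult_left_mono) auto
   ultimately have "abs (G s - K*?Q s) \<le> C*D*((mu powr mu + (mu/2) powr (mu/2))*exp s)*integral\<^sup>L lborel Y + abs K*(B*exp s)"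
    using Gb [OF s] by linarith
   moreover have "c*d*(q*E)*I + k*(b*E) = (c*d*q*I + k*b)*E" for c d q E I k b :: real
    by (simp add: algebra_simps)
   ultimately show ?thesis by (simp only:)
  qed
  fix n :: nat assume n: "n \<ge> 3"
  then have p: "real n > 0" by simp
  have Qint: "set_integrable lborel {0<..} (\<lambda>tt. ?Q tt*exp (- real n*tt))"
   and Qval: "(LBINT tt:{0<..}. ?Q tt*exp (- real n*tt)) = Gamma be/real n powr be*exp (- real n*(x^2 + z^2)) *
    (gegenbauer_moment al 0*Gamma (al + 1)*A (real n))"
   using sonine_mean_laplace [OF al _ pos(1,2) p, of be] be
   unfolding has_bochner_integral_iff set_integrable_def set_lebesgue_integral_def A_def by simp_all
  have "(LBINT tt:{0<..}. (G tt - K*?Q tt)*exp (- real n*tt))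
    = (LBINT tt:{0<..}. G tt*exp (- real n*tt) - K*(?Q tt*exp (- real n*tt)))"
   by (simp add: left_diff_distrib mult.assoc)
  also have "... = (LBINT tt:{0<..}. G tt*exp (- real n*tt)) - K*(LBINT tt:{0<..}. ?Q tt*exp (- real n*tt))"
  proof -
   have "set_integrable lborel {0<..} (\<lambda>tt. K*(?Q tt*exp (- real n*tt)))"
    by (intro set_integrable_mult_right Qint)
   from set_integral_diff(2) [OF lapGi [OF p] this] show ?thesis by (simp only: set_integral_mult_right)
  qed
  also have "... = 0"
  proof -
   have "K*(Gamma be/real n powr be*exp (- real n*(x^2 + z^2))*(gegenbauer_moment al 0*Gamma (al + 1)*A (real n)))
     = K*(m*(1/real n powr be)*exp (- real n*(x^2 + z^2))*A (real n))"
    unfolding m_def by simp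
   also have "... = 2 powr (1 - mu)*(x*z) powr al*real n powr (- be)*exp (- real n*(x^2 + z^2))*A (real n)"
    unfolding K_def using m by (simp add: powr_minus divide_inverse)
   finally show ?thesis unfolding lapG [OF p] Qval by simp
  qed
  finally show "(LBINT tt:{0<..}. (G tt - K*?Q tt)*exp (- real n*tt)) = 0" .
 qed
 have t2: "t^2 > 0" using pos by simp
 have tri: "indicator {0<..R} y *\<^sub>R bessel_triple (al + be) al t x z y = indicator {..R} y *\<^sub>R (t powr (- mu)*g (t^2) y)" for R y
 proof (cases "y > 0")
  case True
  have "(t^2) powr (mu/2) = t powr mu"
  proof -
   have "t^2 = t powr 2" using pos by simp
   then show ?thesis by (simp add: powr_powr)
  qed
  then have "g (t^2) y = t powr mu*bessel_J mu (y*t)*ps y"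
   unfolding geq [OF t2] using pos by simp
  moreover have "t powr (- mu)*t powr mu = 1" using pos by (simp add: powr_minus)
  ultimately have "t powr (- mu)*g (t^2) y = bessel_J mu (y*t)*ps y"
   by (simp flip: mult.assoc)
  also have "... = bessel_triple (al + be) al t x z y"
   using True by (simp add: ps_def bessel_triple_def mu_def mult_ac diff_diff_eq)
  finally show ?thesis using True by (simp add: indicator_def)
 qed (simp add: g_def ps_def)
 have "((\<lambda>R. LBINT y. indicator {..R} y *\<^sub>R (t powr (- mu)*g (t^2) y)) \<longlongrightarrow> (LBINT y. t powr (- mu)*g (t^2) y)) at_top"
  using gi [of "t^2"] by (intro tendsto_integral_at_top integrable_mult_right) auto
 also have "(LBINT y. t powr (- mu)*g (t^2) y) = t powr (- mu)*(K*?Q (t^2))"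
  using GQ [of "t^2"] by (simp add: G_def)
 also have "... = 2 powr (1 - al - be)/(Gamma be*gegenbauer_moment al 0*Gamma (al + 1))*t powr (- al - be)*(x*z) powr al*?Q (t^2)"
  unfolding K_def m_def mu_def by (simp add: diff_diff_eq)
 finally show ?thesis unfolding set_lebesgue_integral_def tri .
qed

section \<open>The function of (t^2 - x^2 - z^2) / (2 x z)\<close>

definition inner_coeff :: "real => real => nat => real" where
 "inner_coeff al c k = pochhammer (1/2 - al) k*pochhammer (1/2 + al) k/fact k*rGamma (c + real k)"

definition outer_coeff :: "real => real => nat => real" where
 "outer_coeff al be k = rGamma (be - 2*real k)/(4 ^ k*fact k*pochhammer (al + 1) k)"

text \<open>For be > 0 and A different from 1 this is 1/Gamma be times the integral of (A - u) powr
  (be - 1) against the Gegenbauer weight over u < A, a Legendre type function. The series are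
  suitably normalized 2F1 series in (1 + A)/2 and 1/A^2. As Gamma be is absorbed into
  \<open>rGamma\<close>, the formula continues to be <= 0. If -be is a natural number, the
  fractional integral has become a derivative of the weight, and accordingly the function is 0 for A
  > 1.\<close>

definition legendre_Phi :: "real => real => real => real" where
 "legendre_Phi al be A =
  (if A \<le> -1 then 0
   else if A < 1 then 2 powr (al - 1/2)*Gamma (al + 1/2)*(1 + A) powr (al + be - 1/2) *
    (\<Sum>k. inner_coeff al (al + be + 1/2) k*((1 + A)/2) ^ k)
   else gegenbauer_moment al 0*A powr (be - 1)*(\<Sum>k. outer_coeff al be k*(1/A^2) ^ k))"

lemma summable_abs_gbinomial:
 fixes a z :: real
 assumes "abs z < 1"
 shows "summable (\<lambda>n. abs ((a gchoose n)*z ^ n))"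
proof -
 have "summable (\<lambda>n. (a gchoose n)*((1 + abs z)/2) ^ n)"
  using assms by (intro sums_summable [OF gen_binomial_real]) auto
 from powser_insidea [OF this, of z] assms show ?thesis by simp
qed

lemma sonine_mean_eq:
 assumes "x > 0" "z > 0"
 shows "sonine_mean al be x z tt = (2*x*z) powr (be - 1) *
  (LBINT u:{-1<..<1}. max 0 ((tt - x^2 - z^2)/(2*x*z) - u) powr (be - 1)*(1 - u^2) powr (al - 1/2))"
proof -
 have "max 0 (tt - x^2 - z^2 - 2*x*z*u) powr (be - 1)
   = (2*x*z) powr (be - 1)*max 0 ((tt - x^2 - z^2)/(2*x*z) - u) powr (be - 1)" for u
 proof -
  have p: "2*x*z > 0" using assms by simp
  have "2*x*z*max 0 ((tt - x^2 - z^2)/(2*x*z) - u) = max 0 (2*x*z*((tt - x^2 - z^2)/(2*x*z) - u))"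
   using p by (simp add: max_mult_distrib_left)
  also have "2*x*z*((tt - x^2 - z^2)/(2*x*z) - u) = tt - x^2 - z^2 - 2*x*z*u"
   using assms by (simp add: field_simps)
  finally have "max 0 (tt - x^2 - z^2 - 2*x*z*u) = 2*x*z*max 0 ((tt - x^2 - z^2)/(2*x*z) - u)" by simp
  then show ?thesis using p by (simp only: powr_mult)
 qed
 then show ?thesis
  unfolding sonine_mean_def by (simp add: mult.assoc set_integral_mult_right)
qed

text \<open>With u = -1 + s v, s = 1 + A, the integrand becomes a Beta integrand times (1 - w v)
  powr a, where w = s/2 < 1; the binomial series of the last factor is integrated term by
  term.\<close>

lemma sonine_inner:
 assumes al: "al > -1/2" and be: "be > 0" and A: "-1 < A" "A < 1"
 shows "(LBINT u:{-1<..<1}. max 0 (A - u) powr (be - 1)*(1 - u^2) powr (al - 1/2)) = Gamma be*legendre_Phi al be A"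
proof -
 define a where "a = al - 1/2"
 define s where "s = 1 + A"
 define w where "w = s/2"
 have a: "a > -1" using al by (simp add: a_def)
 have s: "0 < s" "s < 2" and w: "0 < w" "w < 1" using A by (auto simp: s_def w_def)
 define f where "f u = indicator {-1<..<1} u*(max 0 (A - u) powr (be - 1)*(1 - u^2) powr a)" for u
 have fs: "f (-1 + s * v) = s powr (be - 1 + a)*2 powr a*(indicator {0<..<1} v * (v powr a*(1 - v) powr (be - 1))*(1 - w * v) powr a)" for v
 proof (cases "0 < v \<and> v < 1")
  case True
  then have v: "0 < v" "v < 1" by auto
  have sv: "0 < s * v" "s * v < s" using v s mult_strict_left_mono [of v 1 s] by auto
  then have in1: "-1 + s * v \<in> {-1<..<1}" unfolding greaterThanLessThan_iff using s by linarith
  have "A - (-1 + s * v) = s*(1 - v)" by (simp add: s_def algebra_simps)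
  then have 1: "max 0 (A - (-1 + s * v)) powr (be - 1) = s powr (be - 1)*(1 - v) powr (be - 1)"
   using s v by (simp add: max_def powr_mult)
  have "1 - (-1 + s * v)^2 = (s * v)*(2*(1 - w * v))"
   by (simp add: w_def power2_eq_square algebra_simps)
  moreover have "w * v < 1" using v w by (metis mult.right_neutral mult_strict_mono' less_imp_le)
  ultimately have 2: "(1 - (-1 + s * v)^2) powr a = s powr a * v powr a*(2 powr a*(1 - w * v) powr a)"
   using s v powr_mult [of "s * v" "2*(1 - w * v)" a] powr_mult [of s v a] powr_mult [of 2 "1 - w * v" a]
   by (simp only:)
  show ?thesis unfolding f_def 1 2 using in1 v by (simp add: powr_add)
 next
  case False
  show ?thesis
  proof (cases "v \<le> 0")
   case True
   then have "s * v \<le> 0" using s by (simp add: mult_le_0_iff)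
   then show ?thesis using True by (auto simp: f_def)
  next
   case False
   with \<open>\<not> (0 < v \<and> v < 1)\<close> have v: "v \<ge> 1" by auto
   have "s*1 \<le> s * v" using v s by (intro mult_left_mono) auto
   then have "max 0 (A - (-1 + s * v)) = 0" by (simp add: s_def)
   then show ?thesis using v by (auto simp: f_def)
  qed
 qed
 define W where "W k v = indicator {0<..<1} v * (v powr (a + real k)*(1 - v) powr (be - 1))" for k v
 define M where "M k = Beta (a + real k + 1) be" for k
 define c where "c k = (a gchoose k)*(- w) ^ k" for k
 have Wi: "has_bochner_integral lborel (W k) (M k)" for k
 proof -
  have "((\<lambda>t. t powr ((a + real k + 1) - 1)*(1 - t) powr (be - 1)) has_integral M k) {0..1}"
   unfolding M_def using a be by (intro has_integral_Beta_real) auto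
  then have "((\<lambda>t. t powr (a + real k)*(1 - t) powr (be - 1)) has_integral M k) {0<..<1}"
   by (simp add: has_integral_Icc_iff_Ioo)
  then show ?thesis unfolding W_def by (intro has_bochner_integral_of_has_integral) auto
 qed
 have Wk: "W k v = v ^ k*W 0 v" for k v
  unfolding W_def by (auto simp: indicator_def powr_add powr_realpow)
 have W0: "W k v \<ge> 0" for k v by (simp add: W_def)
 have M0: "M k \<le> M 0" "M k \<ge> 0" for k
 proof -
  have "W k v \<le> W 0 v" for v
  proof (cases "0 < v \<and> v < 1")
   case True
   then have "v ^ k*W 0 v \<le> 1*W 0 v" using W0 by (intro mult_right_mono power_le_one) auto
   then show ?thesis by (simp add: Wk [of k])
  qed (auto simp: W_def)
  then have "integral\<^sup>L lborel (W k) \<le> integral\<^sup>L lborel (W 0)"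
   using Wi [of k] Wi [of 0] by (intro integral_mono) (auto simp: has_bochner_integral_iff)
  then show "M k \<le> M 0" using Wi [of k] Wi [of 0] by (simp add: has_bochner_integral_iff)
  have "integral\<^sup>L lborel (W k) \<ge> 0" using W0 by simp
  then show "M k \<ge> 0" using Wi [of k] by (simp add: has_bochner_integral_iff)
 qed
 have cs: "summable (\<lambda>k. abs (c k))" unfolding c_def by (rule summable_abs_gbinomial) (use w in auto)
 have cabs: "summable (\<lambda>k. abs (c k * v ^ k))" if "0 \<le> v" "v \<le> 1" for v
 proof (rule summable_comparison_test' [OF cs, of 0])
  fix k
  have "abs (c k) * v ^ k \<le> abs (c k)*1" using that by (intro mult_left_mono power_le_one) auto
  then show "norm (abs (c k * v ^ k)) \<le> abs (c k)" using that by (simp add: abs_mult)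
 qed
 have main: "has_bochner_integral lborel (\<lambda>v. \<Sum>k. c k*W k v) (\<Sum>k. c k*M k)"
 proof (rule has_bochner_integral_termwise [OF Wi W0])
  show "summable (\<lambda>k. abs (c k)*M k)"
   using M0 by (intro summable_comparison_test' [OF summable_mult2 [OF cs, of "M 0"], of 0]) (auto simp: abs_mult mult_left_mono)
  show "summable (\<lambda>k. abs (c k)*W k v)" for v
  proof (cases "0 < v \<and> v < 1")
   case True
   have "summable (\<lambda>k. abs (c k * v ^ k)*W 0 v)" using True by (intro summable_mult2 cabs) auto
   moreover have "abs (c k * v ^ k)*W 0 v = abs (c k)*W k v" for k
    using True by (subst (2) Wk) (simp add: abs_mult)
   ultimately show ?thesis by simp
  qed (auto simp: W_def)
 qed
 have sumW: "(\<Sum>k. c k*W k v) = indicator {0<..<1} v * (v powr a*(1 - v) powr (be - 1))*(1 - w * v) powr a" for v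
 proof (cases "0 < v \<and> v < 1")
  case True
  then have "abs (- (w * v)) < 1" using w mult_strict_mono' [of w 1 v 1] by (simp add: abs_mult)
  from gen_binomial_real [OF this, of a]
  have "(\<lambda>k. (a gchoose k)*(- (w * v)) ^ k) sums ((1 - w * v) powr a)" by simp
  then have "(\<lambda>k. (a gchoose k)*(- (w * v)) ^ k*W 0 v) sums ((1 - w * v) powr a*W 0 v)" by (rule sums_mult2)
  moreover have "(a gchoose k)*(- (w * v)) ^ k*W 0 v = c k*W k v" for k
   unfolding Wk [of k] c_def mult_minus_left [symmetric] power_mult_distrib by (simp only: mult_ac)
  ultimately have "(\<lambda>k. c k*W k v) sums ((1 - w * v) powr a*W 0 v)" by (simp only:)
  then show ?thesis using sums_unique by (force simp: W_def mult_ac)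
 qed (auto simp: W_def)
 have c': "c k*M k = Gamma be*Gamma (a + 1)*(inner_coeff al (al + be + 1/2) k*w ^ k)" for k
 proof -
  have 1: "(a gchoose k)*(- w) ^ k = pochhammer (- a) k/fact k*w ^ k"
  proof -
   have "(- w) ^ k = (- 1) ^ k*w ^ k" by (rule power_minus)
   then show ?thesis by (simp add: gbinomial_pochhammer)
  qed
  have np: "a + 1 \<notin> \<int>\<^sub>\<le>\<^sub>0" using a by (auto elim!: nonpos_Ints_cases)
  have "Gamma (a + 1) > 0" using a by (intro Gamma_real_pos) simp
  then have 2: "Gamma (a + real k + 1) = Gamma (a + 1)*pochhammer (a + 1) k"
   using pochhammer_Gamma [OF np, of k] by (simp add: add_ac)
  have e: "a + real k + 1 + be = al + be + 1/2 + real k" "- a = 1/2 - al" "a + 1 = 1/2 + al"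
   by (simp_all add: a_def)
  have "M k = Gamma (a + 1)*pochhammer (a + 1) k*Gamma be*rGamma (al + be + 1/2 + real k)"
   unfolding M_def Beta_def 2 e(1) rGamma_inverse_Gamma divide_inverse by (rule refl)
  then show ?thesis unfolding c_def 1 inner_coeff_def e(2) e(3) by simp
 qed
 have mn0: "Gamma be*Gamma (a + 1) \<noteq> 0"
 proof -
  have "Gamma (a + 1) > 0" using a by (intro Gamma_real_pos) simp
  then show ?thesis using Gamma_real_pos [OF be] by simp
 qed
 have csum: "summable (\<lambda>k. inner_coeff al (al + be + 1/2) k*w ^ k)"
 proof -
  have "summable (\<lambda>k. abs (c k)*M 0)" using cs by (rule summable_mult2)
  then have "summable (\<lambda>k. c k*M k)"
   by (rule summable_comparison_test' [of _ 0]) (use M0 in \<open>auto simp: abs_mult intro!: mult_left_mono\<close>)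
  then have "summable (\<lambda>k. 1/(Gamma be*Gamma (a + 1))*(c k*M k))" by (rule summable_mult)
  then show ?thesis unfolding c' using mn0 by simp
 qed
 have "integral\<^sup>L lborel f = abs s *\<^sub>R (LBINT v. f (-1 + s * v))"
  using s by (intro lborel_integral_real_affine) auto
 also have "... = s*(s powr (be - 1 + a)*2 powr a*(\<Sum>k. c k*M k))"
  unfolding fs sumW [symmetric] using main s by (simp add: has_bochner_integral_iff)
 also have "(\<Sum>k. c k*M k) = Gamma be*Gamma (a + 1)*(\<Sum>k. inner_coeff al (al + be + 1/2) k*w ^ k)"
  unfolding c' by (rule suminf_mult [OF csum])
 also have "s*(s powr (be - 1 + a)*2 powr a*(Gamma be*Gamma (a + 1)*(\<Sum>k. inner_coeff al (al + be + 1/2) k*w ^ k)))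
   = Gamma be*(2 powr a*Gamma (a + 1)*(s * s powr (be - 1 + a))*(\<Sum>k. inner_coeff al (al + be + 1/2) k*w ^ k))"
  by (simp only: mult_ac)
 also have "s * s powr (be - 1 + a) = s powr (al + be - 1/2)"
 proof -
  have "1 + (be - 1 + a) = al + be - 1/2" by (simp add: a_def)
  then show ?thesis using s powr_add [of s 1 "be - 1 + a"] by (simp only: powr_one)
 qed
 finally show ?thesis
  using A unfolding f_def legendre_Phi_def set_lebesgue_integral_def real_scaleR_def a_def w_def s_def by (simp add: add.commute)
qed

text \<open>For A > 1 the whole weight lies below A: A powr (be - 1) comes out, (1 - u/A) powr (be -
  1) is expanded, and the symmetry of the weight keeps the even terms only.\<close>

lemma sonine_outer:
 assumes al: "al > -1/2" and be: "be > 0" and A: "A > 1"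
 shows "(LBINT u:{-1<..<1}. max 0 (A - u) powr (be - 1)*(1 - u^2) powr (al - 1/2)) = Gamma be*legendre_Phi al be A"
proof -
 let ?h = "\<lambda>u. (1 - u^2) powr (al - 1/2)"
 define f where "f s u = indicator {-1<..<1} u*((1 + s*u) powr (be - 1)*?h u)" for s u
 have iA: "0 < 1/A" "1/A < 1" using A by auto
 have fi: "integrable lborel (f s)" if s: "abs s = 1/A" for s
 proof -
  have b: "abs ((1 + s*u) powr (be - 1)) \<le> (1 - 1/A) powr (be - 1) + (1 + 1/A) powr (be - 1)" if "-1 < u" "u < 1" for u
  proof -
   have "abs (s*u) \<le> 1/A*1" unfolding abs_mult s using that iA by (intro mult_left_mono) auto
   then have "1 - 1/A \<le> 1 + s*u" "1 + s*u \<le> 1 + 1/A" by auto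
   then have "(1 + s*u) powr (be - 1) \<le> (1 + 1/A) powr (be - 1)" if "be \<ge> 1"
    using that iA \<open>1 - 1/A \<le> 1 + s*u\<close> \<open>1 + s*u \<le> 1 + 1/A\<close> by (intro powr_mono2) linarith+
   moreover have "(1 + s*u) powr (be - 1) \<le> (1 - 1/A) powr (be - 1)" if "be \<le> 1"
    using that iA \<open>1 - 1/A \<le> 1 + s*u\<close> by (intro powr_mono2') auto
   ultimately have "(1 + s*u) powr (be - 1) \<le> (1 - 1/A) powr (be - 1) \<or> (1 + s*u) powr (be - 1) \<le> (1 + 1/A) powr (be - 1)"
    using linear by blast
   moreover have "(1 - 1/A) powr (be - 1) \<ge> 0" "(1 + 1/A) powr (be - 1) \<ge> 0" by simp_all
   ultimately show ?thesis unfolding abs_of_nonneg [OF powr_ge_zero] by linarith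
  qed
  show ?thesis unfolding f_def
   by (intro gegenbauer_weight_mult_integrable [OF al _ b]) auto
 qed
 have sym: "integral\<^sup>L lborel (f (1/A)) = integral\<^sup>L lborel (f (- (1/A)))"
 proof -
  have "integral\<^sup>L lborel (f (1/A)) = abs (-1) *\<^sub>R integral\<^sup>L lborel (\<lambda>u. f (1/A) (0 + (-1)*u))"
   by (rule lborel_integral_real_affine) simp
  also have "(\<lambda>u. f (1/A) (0 + (-1)*u)) = f (- (1/A))"
   by (auto simp: f_def indicator_def fun_eq_iff)
  finally show ?thesis by simp
 qed
 define W where "W k u = indicator {-1<..<1} u*(u ^ (2 * k)*?h u)" for k u
 define c where "c k = ((be - 1) gchoose (2 * k))*(1/A) ^ (2 * k)" for k
 have cs: "summable (\<lambda>k. abs (c k))"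
 proof -
  have "summable (\<lambda>n. abs (((be - 1) gchoose n)*(1/A) ^ n))" using iA by (intro summable_abs_gbinomial) auto
  then have "summable ((\<lambda>n. abs (((be - 1) gchoose n)*(1/A) ^ n)) \<circ> (\<lambda>k. 2 * k))"
   by (intro summable_reindex) (auto simp: inj_on_def)
  then show ?thesis by (simp add: c_def comp_def)
 qed
 have Wk: "W k u = u ^ (2 * k)*W 0 u" for k u by (simp add: W_def)
 have W0: "W k u \<ge> 0" for k u by (simp add: W_def power_mult)
 have upow: "u ^ (2 * k) \<le> 1" if "-1 < u" "u < 1" for u :: real and k
 proof -
  have "u^2 \<le> 1" using that by (simp add: abs_square_le_1 abs_le_iff)
  then show ?thesis by (simp add: power_mult power_le_one)
 qed
 have Wi: "has_bochner_integral lborel (W k) (gegenbauer_moment al k)" for k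
  unfolding W_def by (rule gegenbauer_moment_integral [OF al])
 have WW: "W k u \<le> W 0 u" for k u
 proof (cases "-1 < u \<and> u < 1")
  case True
  then have "u ^ (2 * k)*W 0 u \<le> 1*W 0 u" using W0 by (intro mult_right_mono upow) auto
  then show ?thesis by (simp add: Wk [of k])
 qed (auto simp: W_def)
 have M0: "gegenbauer_moment al k \<le> gegenbauer_moment al 0" "gegenbauer_moment al k \<ge> 0" for k
 proof -
  have "integral\<^sup>L lborel (W k) \<le> integral\<^sup>L lborel (W 0)"
   using Wi [of k] Wi [of 0] WW by (intro integral_mono) (auto simp: has_bochner_integral_iff)
  then show "gegenbauer_moment al k \<le> gegenbauer_moment al 0" using Wi [of k] Wi [of 0] by (simp add: has_bochner_integral_iff)
  have "integral\<^sup>L lborel (W k) \<ge> 0" using W0 by simp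
  then show "gegenbauer_moment al k \<ge> 0" using Wi [of k] by (simp add: has_bochner_integral_iff)
 qed
 have main: "has_bochner_integral lborel (\<lambda>u. \<Sum>k. c k*W k u) (\<Sum>k. c k*gegenbauer_moment al k)"
 proof (rule has_bochner_integral_termwise [OF Wi W0])
  show "summable (\<lambda>k. abs (c k)*gegenbauer_moment al k)"
   using M0 by (intro summable_comparison_test' [OF summable_mult2 [OF cs, of "gegenbauer_moment al 0"], of 0]) (auto simp: abs_mult mult_left_mono)
  show "summable (\<lambda>k. abs (c k)*W k u)" for u
   using WW W0 by (intro summable_comparison_test' [OF summable_mult2 [OF cs, of "W 0 u"], of 0]) (auto simp: abs_mult mult_left_mono)
 qed
 have sumW: "(\<Sum>k. c k*W k u) = (f (1/A) u + f (- (1/A)) u)/2" for u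
 proof (cases "-1 < u \<and> u < 1")
  case True
  define y where "y = 1/A*u"
  have "abs y < 1"
  proof -
   have "abs y = 1/A*abs u" unfolding y_def using iA by (simp add: abs_mult)
   also have "... \<le> 1/A*1" using True iA by (intro mult_left_mono) auto
   finally show ?thesis using iA(2) by linarith
  qed
  then have 1: "(\<lambda>n. ((be - 1) gchoose n)*y ^ n) sums (1 + y) powr (be - 1)"
   and 2: "(\<lambda>n. ((be - 1) gchoose n)*(- y) ^ n) sums (1 - y) powr (be - 1)"
   using gen_binomial_real [of y] gen_binomial_real [of "- y"] by auto
  let ?e = "\<lambda>n. (((be - 1) gchoose n)*y ^ n + ((be - 1) gchoose n)*(- y) ^ n)/2"
  have "?e sums (((1 + y) powr (be - 1) + (1 - y) powr (be - 1))/2)"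
   by (intro sums_divide sums_add 1 2)
  then have "(\<lambda>k. ?e (2 * k)) sums (((1 + y) powr (be - 1) + (1 - y) powr (be - 1))/2)"
  proof (subst sums_mono_reindex)
   show "?e n = 0" if "n \<notin> range (\<lambda>k. 2 * k)" for n
   proof -
    have "odd n" using that by (metis dvdE rangeI)
    then show ?thesis by (simp add: power_minus_odd)
   qed
  qed (auto simp: strict_mono_def)
  then have "(\<lambda>k. ?e (2 * k)*W 0 u) sums (((1 + y) powr (be - 1) + (1 - y) powr (be - 1))/2*W 0 u)"
   by (rule sums_mult2)
  moreover have "?e (2 * k)*W 0 u = c k*W k u" for k
  proof -
   have "?e (2 * k) = ((be - 1) gchoose (2 * k))*y ^ (2 * k)" by simp
   then show ?thesis unfolding Wk [of k] c_def y_def power_mult_distrib by (simp only: mult_ac)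
  qed
  moreover have "((1 + y) powr (be - 1) + (1 - y) powr (be - 1))/2*W 0 u = (f (1/A) u + f (- (1/A)) u)/2"
   using True by (simp add: W_def f_def y_def algebra_simps)
  ultimately have "(\<lambda>k. c k*W k u) sums ((f (1/A) u + f (- (1/A)) u)/2)" by (simp only:)
  then show ?thesis by (rule sums_unique [symmetric])
 qed (auto simp: W_def f_def)
 have "integral\<^sup>L lborel (f (- (1/A))) = (LBINT u. (f (1/A) u + f (- (1/A)) u)/2)"
  using fi [of "1/A"] fi [of "- (1/A)"] iA sym by simp
 also have "... = (\<Sum>k. c k*gegenbauer_moment al k)"
  using main unfolding sumW by (simp only: has_bochner_integral_iff)
 finally have val: "integral\<^sup>L lborel (f (- (1/A))) = (\<Sum>k. c k*gegenbauer_moment al k)" .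
 have c': "c k*gegenbauer_moment al k = Gamma be*gegenbauer_moment al 0*(outer_coeff al be k*(1/A^2) ^ k)" for k
 proof -
  have np: "be - 1 + 1 \<notin> \<int>\<^sub>\<le>\<^sub>0" using be by (auto elim!: nonpos_Ints_cases)
  have "((be - 1) gchoose (2 * k)) = Gamma be/(fact (2 * k)*Gamma (be - 2*real k))"
   using gbinomial_Gamma [OF np, of "2 * k"] by (simp add: algebra_simps)
  then have "((be - 1) gchoose (2 * k))*gegenbauer_moment al k = Gamma be*rGamma (be - 2*real k)*(gegenbauer_moment al k/fact (2 * k))"
   by (simp add: rGamma_inverse_Gamma divide_inverse)
  also have "... = Gamma be*gegenbauer_moment al 0 * outer_coeff al be k"
   unfolding gegenbauer_moment_eq [OF al] outer_coeff_def by simp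
  finally have "((be - 1) gchoose (2 * k))*gegenbauer_moment al k = Gamma be*gegenbauer_moment al 0 * outer_coeff al be k" .
  moreover have "(1/A) ^ (2 * k) = (1/A^2) ^ k" by (simp add: power_mult power_one_over)
  moreover have "c k*gegenbauer_moment al k = ((be - 1) gchoose (2 * k))*gegenbauer_moment al k*(1/A) ^ (2 * k)"
   unfolding c_def by (simp only: mult_ac)
  ultimately show ?thesis by (simp only: mult.assoc)
 qed
 have mn0: "Gamma be*gegenbauer_moment al 0 \<noteq> 0"
  using Gamma_real_pos [OF be] gegenbauer_moment_0_pos [OF al] by simp
 have csum: "summable (\<lambda>k. outer_coeff al be k*(1/A^2) ^ k)"
 proof -
  have "summable (\<lambda>k. abs (c k)*gegenbauer_moment al 0)" using cs by (rule summable_mult2)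
  then have "summable (\<lambda>k. c k*gegenbauer_moment al k)"
   by (rule summable_comparison_test' [of _ 0]) (use M0 in \<open>auto simp: abs_mult intro!: mult_left_mono\<close>)
  then have "summable (\<lambda>k. 1/(Gamma be*gegenbauer_moment al 0)*(c k*gegenbauer_moment al k))" by (rule summable_mult)
  then show ?thesis unfolding c' using mn0 by simp
 qed
 have "indicator {-1<..<1} u *\<^sub>R (max 0 (A - u) powr (be - 1)*?h u) = A powr (be - 1)*f (- (1/A)) u" for u
 proof (cases "-1 < u \<and> u < 1")
  case True
  have "max 0 (A - u) = A*(1 - 1/A*u)" using True A by (simp add: max_def field_simps)
  moreover have "1 - 1/A*u \<ge> 0" using True A by (simp add: field_simps)
  ultimately show ?thesis using True A by (simp add: f_def powr_mult)
 qed (auto simp: f_def)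
 then have "(LBINT u:{-1<..<1}. max 0 (A - u) powr (be - 1)*?h u) = A powr (be - 1)*integral\<^sup>L lborel (f (- (1/A)))"
  unfolding set_lebesgue_integral_def by simp
 also have "... = Gamma be*legendre_Phi al be A"
  unfolding val c' using A suminf_mult [OF csum, of "Gamma be*gegenbauer_moment al 0"] by (simp add: legendre_Phi_def mult_ac)
 finally show ?thesis .
qed

lemma sonine_mean_legendre:
 assumes al: "al > -1/2" and be: "be > 0" and pos: "x > 0" "z > 0"
  and A: "A = (tt - x^2 - z^2)/(2*x*z)" "A \<noteq> 1"
 shows "sonine_mean al be x z tt = (2*x*z) powr (be - 1)*(Gamma be*legendre_Phi al be A)"
proof -
 have "(LBINT u:{-1<..<1}. max 0 (A - u) powr (be - 1)*(1 - u^2) powr (al - 1/2)) = Gamma be*legendre_Phi al be A"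
 proof (cases "A \<le> -1")
  case True
  have "(LBINT u:{-1<..<1}. max 0 (A - u) powr (be - 1)*(1 - u^2) powr (al - 1/2)) = (LBINT u:{-1<..<1::real}. 0)"
   by (rule set_lebesgue_integral_cong) (use True in auto)
  then show ?thesis using True by (simp add: legendre_Phi_def)
 next
  case False
  then show ?thesis using sonine_inner [OF al be, of A] sonine_outer [OF al be, of A] A(2) by linarith
 qed
 then show ?thesis using sonine_mean_eq [OF pos] by (simp add: A(1))
qed

section \<open>Growth of the coefficients and derivative of \<open>legendre_Phi\<close>\<close>

lemma bounded_of_ratio_inverse_square:
 fixes q :: "nat => real"
 assumes q0: "\<And>k. q k \<ge> 0" and r: "\<And>k. q (Suc k) \<le> (1 + K/(real k + 1)^2)*q k" and K: "K \<ge> 0"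
 shows "\<exists>C\<ge>0. \<forall>k. q k \<le> C"
proof -
 have sm: "summable (\<lambda>k. 1/(real k + 1)^2)"
  using inverse_squares_sums by (auto simp: sums_iff add.commute)
 have le: "q k \<le> q 0*exp (K*(\<Sum>j<k. 1/(real j + 1)^2))" for k
 proof (induction k)
  case (Suc k)
  have e: "1 + K/(real k + 1)^2 \<le> exp (K*(1/(real k + 1)^2))"
   using exp_ge_add_one_self [of "K*(1/(real k + 1)^2)"] by simp
  have "q (Suc k) \<le> exp (K*(1/(real k + 1)^2))*(q 0*exp (K*(\<Sum>j<k. 1/(real j + 1)^2)))"
   by (rule order_trans [OF r], rule mult_mono [OF e Suc.IH]) (use q0 in auto)
  also have "... = q 0*exp (K*(\<Sum>j<Suc k. 1/(real j + 1)^2))"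
   by (simp add: distrib_left exp_add)
  finally show ?case .
 qed simp
 have "q k \<le> q 0*exp (K*(\<Sum>j. 1/(real j + 1)^2))" for k
 proof -
  have "(\<Sum>j<k. 1/(real j + 1)^2) \<le> (\<Sum>j. 1/(real j + 1)^2)"
   by (intro sum_le_suminf sm) auto
  then have "q 0*exp (K*(\<Sum>j<k. 1/(real j + 1)^2)) \<le> q 0*exp (K*(\<Sum>j. 1/(real j + 1)^2))"
   using q0 K by (intro mult_left_mono) (auto intro: mult_left_mono)
  with le [of k] show ?thesis by linarith
 qed
 then show ?thesis using q0 by (intro exI [of _ "q 0*exp (K*(\<Sum>j. 1/(real j + 1)^2))"]) auto
qed

text \<open>From k to k + 1 the quotient of the two products changes by |(a + k) (b + k)| / ((c + k)
  (si + k)), which is at most 1 + O(1/k^2) because a + b <= c + si; such quotients stay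
  bounded.\<close>

lemma pochhammer_product_bound:
 fixes a b c si :: real
 assumes "c > 0" "si > 0" and le: "a + b \<le> c + si"
 shows "\<exists>C\<ge>0. \<forall>k. abs (pochhammer a k*pochhammer b k) \<le> C*(pochhammer c k*pochhammer si k)"
proof -
 \<comment> \<open>min c 1 * (k + 1) <= c + k, and likewise for si: this makes the error term
   uniform down to k = 0.\<close>
 define K where "K = (abs (c * si - a*b) + (a - b)^2)/(min c 1*min si 1)"
 have mpos: "min c 1*min si 1 > 0" using assms by simp
 have K: "K \<ge> 0" unfolding K_def using mpos by (intro divide_nonneg_pos) auto
 define d where "d k = pochhammer c k*pochhammer si k" for k
 have d: "d k > 0" for k unfolding d_def using assms by (intro mult_pos_pos pochhammer_pos)
 define q where "q k = abs (pochhammer a k*pochhammer b k)/d k" for k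
 have q0: "q k \<ge> 0" for k unfolding q_def using d less_imp_le by (intro divide_nonneg_nonneg) auto
 have ratio: "q (Suc k) \<le> (1 + K/(real k + 1)^2)*q k" for k
 proof -
  define D where "D = (c + real k)*(si + real k)"
  have D: "D > 0" unfolding D_def using assms by (intro mult_pos_pos) auto
  have up: "(a + real k)*(b + real k) \<le> D + abs (c * si - a*b)"
  proof -
   have "(a + real k)*(b + real k) = D - ((c + si - (a + b))*real k + (c * si - a*b))"
    by (simp add: D_def algebra_simps)
   moreover have "(c + si - (a + b))*real k \<ge> 0" using le by (intro mult_nonneg_nonneg) auto
   ultimately show ?thesis by linarith
  qed
  have lo: "- ((a + real k)*(b + real k)) \<le> (a - b)^2"
  proof -
   have "4*((a + real k)*(b + real k)) = (a + b + 2*real k)^2 - (a - b)^2"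
    by (simp add: power2_eq_square algebra_simps)
   moreover have "(a + b + 2*real k)^2 \<ge> 0" "(a - b)^2 \<ge> 0" by simp_all
   ultimately show ?thesis by linarith
  qed
  have "abs ((a + real k)*(b + real k)) \<le> D + (abs (c * si - a*b) + (a - b)^2)"
   using up lo D zero_le_power2 [of "a - b"] abs_ge_zero [of "c * si - a*b"] by linarith
  also have "... \<le> D + K/(real k + 1)^2*D"
  proof -
   have "(min c 1*(real k + 1))*(min si 1*(real k + 1)) \<le> D"
   proof -
    have "min d 1*(real k + 1) \<le> d + real k" if "d > 0" for d
     using that mult_right_mono [of d 1 "real k"] by (auto simp: min_def algebra_simps)
    then show ?thesis unfolding D_def using assms by (intro mult_mono) auto
   qed
   then have "K/(real k + 1)^2*((min c 1*min si 1)*(real k + 1)^2) \<le> K/(real k + 1)^2*D"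
    using K by (intro mult_left_mono) (auto simp: power2_eq_square mult_ac)
   moreover have "K/(real k + 1)^2*((min c 1*min si 1)*(real k + 1)^2) = abs (c * si - a*b) + (a - b)^2"
   proof -
    have "K*(min c 1*min si 1) = abs (c * si - a*b) + (a - b)^2"
     using mpos by (metis K_def less_irrefl nonzero_eq_divide_eq)
    moreover have "K/(real k + 1)^2*(m*(real k + 1)^2) = K*m" for m
     by (simp add: power2_eq_square add_eq_0_iff)
    ultimately show ?thesis by (simp only:)
   qed
   ultimately show ?thesis by linarith
  qed
  finally have m: "abs ((a + real k)*(b + real k))/D \<le> 1 + K/(real k + 1)^2"
   using D by (simp add: pos_divide_le_eq distrib_right)
  have "q (Suc k) = abs ((a + real k)*(b + real k))/D*q k"
   by (simp add: q_def d_def D_def pochhammer_rec' abs_mult mult_ac)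
  also have "... \<le> (1 + K/(real k + 1)^2)*q k" using m q0 by (rule mult_right_mono)
  finally show ?thesis .
 qed
 obtain C where C: "C \<ge> 0" "\<And>k. q k \<le> C" using bounded_of_ratio_inverse_square [OF q0 ratio K] by blast
 have "abs (pochhammer a k*pochhammer b k) \<le> C*d k" for k
  using C(2) [of k] d [of k] by (simp add: q_def pos_divide_le_eq)
 then show ?thesis using C(1) unfolding d_def by blast
qed

text \<open>pochhammer si k / fact k are the coefficients of (1 - v) powr (-si), so this majorizes
  the singularity at v = 1. The two upper parameters add up to 1, whence si >= 1 - c. Asking for si
  > 0 covers the logarithmic and the bounded case as well.\<close>

lemma inner_coeff_bound:
 assumes "c > 0" "si > 0" "si \<ge> 1 - c"
 shows "\<exists>C\<ge>0. \<forall>k. abs (inner_coeff al c k) \<le> C*(pochhammer si k/fact k)"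
proof -
 obtain C where C: "C \<ge> 0" "\<And>k. abs (pochhammer (1/2 - al) k*pochhammer (1/2 + al) k) \<le> C*(pochhammer c k*pochhammer si k)"
  using pochhammer_product_bound [of c si "1/2 - al" "1/2 + al"] assms by auto
 have np: "c \<notin> \<int>\<^sub>\<le>\<^sub>0" using assms by (auto elim!: nonpos_Ints_cases)
 have G: "Gamma c > 0" using assms by simp
 have "abs (inner_coeff al c k) \<le> (C/Gamma c)*(pochhammer si k/fact k)" for k
 proof -
  have p: "pochhammer c k > 0" using assms by (intro pochhammer_pos)
  have r: "rGamma (c + real k) = 1/(Gamma c*pochhammer c k)"
   using pochhammer_Gamma [OF np, of k] G by (simp add: rGamma_inverse_Gamma divide_inverse)
  have "abs (inner_coeff al c k) = abs (pochhammer (1/2 - al) k*pochhammer (1/2 + al) k)/fact k*(1/(Gamma c*pochhammer c k))"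
   unfolding inner_coeff_def r using p G by (simp add: abs_mult)
  also have "... \<le> C*(pochhammer c k*pochhammer si k)/fact k*(1/(Gamma c*pochhammer c k))"
   using C(2) [of k] p G by (intro mult_right_mono divide_right_mono) auto
  also have "... = (C/Gamma c)*(pochhammer si k/fact k)" using p by simp
  finally show ?thesis .
 qed
 then show ?thesis using C(1) G by (intro exI [of _ "C/Gamma c"]) auto
qed

lemma rGamma_minus_nat: "rGamma (z - real n) = rGamma z*(- 1) ^ n*pochhammer (1 - z) n"
proof (induction n)
 case (Suc n)
 have "rGamma (z - real (Suc n)) = (z - real (Suc n))*rGamma (z - real (Suc n) + 1)"
  by (rule rGamma_plus1 [symmetric])
 also have "z - real (Suc n) + 1 = z - real n" by simp
 finally show ?case unfolding Suc.IH by (simp add: pochhammer_rec' algebra_simps)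
qed simp

text \<open>Duplication of the Pochhammer symbol exhibits the hypergeometric parameters (1 - be)/2
  and (2 - be)/2.\<close>

lemma outer_coeff_eq:
 "outer_coeff al be k = rGamma be*(pochhammer ((1 - be)/2) k*pochhammer ((2 - be)/2) k)/(fact k*pochhammer (al + 1) k)"
proof -
 have "pochhammer (1 - be) (2 * k) = 4 ^ k*(pochhammer ((1 - be)/2) k*pochhammer ((2 - be)/2) k)"
  using pochhammer_double [of "(1 - be)/2" k] by (simp add: power_mult add_divide_distrib diff_divide_distrib)
 then have "rGamma (be - 2*real k) = rGamma be*(4 ^ k*(pochhammer ((1 - be)/2) k*pochhammer ((2 - be)/2) k))"
  using rGamma_minus_nat [of be "2 * k"] by simp
 then show ?thesis by (simp add: outer_coeff_def)
qed

text \<open>The upper parameters sum to 3/2 - be against al + 1 below, so the condition on si is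
  that of \<open>inner_coeff_bound\<close> for c = al + be + 1/2: one exponent si serves both sides
  of A = 1.\<close>

lemma outer_coeff_bound:
 assumes "al > -1" "si > 0" "si \<ge> 1/2 - al - be"
 shows "\<exists>C\<ge>0. \<forall>k. abs (outer_coeff al be k) \<le> C*(pochhammer si k/fact k)"
proof -
 have le: "(1 - be)/2 + (2 - be)/2 \<le> al + 1 + si" using assms by (simp add: field_simps)
 have "al + 1 > 0" using assms by simp
 from pochhammer_product_bound [OF this assms(2) le]
 obtain C where C: "C \<ge> 0" "\<And>k. abs (pochhammer ((1 - be)/2) k*pochhammer ((2 - be)/2) k) \<le> C*(pochhammer (al + 1) k*pochhammer si k)"
  by auto
 have "abs (outer_coeff al be k) \<le> (abs (rGamma be)*C)*(pochhammer si k/fact k)" for k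
 proof -
  have p: "pochhammer (al + 1) k > 0" using assms by (intro pochhammer_pos) simp
  have "abs (outer_coeff al be k) = abs (rGamma be)*abs (pochhammer ((1 - be)/2) k*pochhammer ((2 - be)/2) k)/(fact k*pochhammer (al + 1) k)"
   unfolding outer_coeff_eq using p by (simp add: abs_mult)
  also have "... \<le> abs (rGamma be)*(C*(pochhammer (al + 1) k*pochhammer si k))/(fact k*pochhammer (al + 1) k)"
   using C(2) [of k] p by (intro mult_left_mono divide_right_mono) auto
  also have "... = (abs (rGamma be)*C)*(pochhammer si k/fact k)" using p by simp
  finally show ?thesis .
 qed
 then show ?thesis using C(1) by (intro exI [of _ "abs (rGamma be)*C"]) auto
qed

lemma binomial_series_minus:
 fixes si v :: real
 assumes "abs v < 1"
 shows "(\<lambda>k. pochhammer si k/fact k * v ^ k) sums (1 - v) powr (- si)"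
proof -
 have "(\<lambda>k. ((- si) gchoose k)*(- v) ^ k) sums (1 + - v) powr (- si)"
  using assms by (intro gen_binomial_real) simp
 moreover have "((- si) gchoose k)*(- v) ^ k = pochhammer si k/fact k * v ^ k" for k
  by (subst power_minus) (simp add: gbinomial_pochhammer)
 ultimately show ?thesis by simp
qed

lemma power_series_binomial_bound:
 fixes a :: "nat => real"
 assumes a: "\<And>k. abs (a k) \<le> C*(pochhammer si k/fact k)"
 shows "abs v < 1 ==> summable (\<lambda>k. a k * v ^ k)"
  and "0 \<le> v ==> v < 1 ==> abs (\<Sum>k. a k * v ^ k) \<le> C*(1 - v) powr (- si)"
proof -
 have le: "norm (a k * v ^ k) \<le> C*(pochhammer si k/fact k*abs v ^ k)" for k
 proof -
  have "abs (a k)*abs v ^ k \<le> C*(pochhammer si k/fact k)*abs v ^ k" using a by (intro mult_right_mono) auto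
  then show ?thesis by (simp add: abs_mult power_abs)
 qed
 have s: "(\<lambda>k. C*(pochhammer si k/fact k*abs v ^ k)) sums (C*(1 - abs v) powr (- si))" if "abs v < 1"
  using that by (intro sums_mult binomial_series_minus) simp
 show sm: "summable (\<lambda>k. a k * v ^ k)" if "abs v < 1"
  using s [OF that] le by (intro summable_comparison_test' [OF sums_summable]) auto
 show "abs (\<Sum>k. a k * v ^ k) \<le> C*(1 - v) powr (- si)" if "0 \<le> v" "v < 1"
 proof -
  have v: "abs v < 1" "abs v = v" using that by auto
  have "norm (\<Sum>k. a k * v ^ k) \<le> (\<Sum>k. C*(pochhammer si k/fact k*abs v ^ k))"
   using s [OF v(1)] le by (intro norm_suminf_le) (auto simp: sums_iff)
  with s [OF v(1)] show ?thesis by (simp add: sums_iff v)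
 qed
qed

text \<open>With v * D in place of D the differentiated series keeps its indices, and coefficients
  can be compared without a shift.\<close>

lemma DERIV_power_series_times:
 fixes a :: "nat => real"
 assumes sm: "\<And>v. abs v < 1 ==> summable (\<lambda>k. a k * v ^ k)" and v: "abs v < 1"
 shows "\<exists>D. ((\<lambda>v. \<Sum>k. a k * v ^ k) has_real_derivative D) (at v) \<and> (\<lambda>k. real k*a k * v ^ k) sums (v * D)"
proof -
 define r where "r = (1 + abs v)/2"
 have r: "abs r < 1" "abs v < abs r" using v by (auto simp: r_def)
 have D: "((\<lambda>v. \<Sum>k. a k * v ^ k) has_real_derivative (\<Sum>k. diffs a k * v ^ k)) (at v)"
  by (rule termdiffs_strong [OF sm [OF r(1)]]) (use r in simp)
 have "summable (\<lambda>k. diffs a k * v ^ k)"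
 proof (rule termdiff_converges [where K=1])
  show "norm v < 1" using v by simp
  show "summable (\<lambda>n. a n*x ^ n)" if "norm x < 1" for x using sm [of x] that by simp
 qed
 then have "(\<lambda>n. real n*a n * v ^ (n - Suc 0)) sums (\<Sum>k. diffs a k * v ^ k)"
  by (rule diffs_equiv)
 then have "(\<lambda>n. v * (real n*a n * v ^ (n - Suc 0))) sums (v * (\<Sum>k. diffs a k * v ^ k))"
  by (rule sums_mult)
 moreover have "v * (real n*a n * v ^ (n - Suc 0)) = real n*a n * v ^ n" for n
  by (cases n) auto
 ultimately have "(\<lambda>k. real k*a k * v ^ k) sums (v * (\<Sum>k. diffs a k * v ^ k))" by simp
 with D show ?thesis by blast
qed

text \<open>Differentiating a fractional integral lowers its order by one. For be <= 0 there is no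
  integral to differentiate, so this is read off the coefficients: the k-th term is multiplied by c
  + k, resp. be - 2 k, which is one step of the functional equation of
  \<open>rGamma\<close>.\<close>

lemma DERIV_legendre_Phi:
 assumes al: "al > -1" and c: "al + be + 1/2 > 0" and A: "A \<noteq> 1" "A \<noteq> -1"
 shows "(legendre_Phi al (be + 1) has_real_derivative legendre_Phi al be A) (at A)"
proof -
 define c where "c = al + be + 1/2"
 have c0: "c > 0" using c by (simp add: c_def)
 consider "A < -1" | "-1 < A" "A < 1" | "A > 1" using A by linarith
 then show ?thesis
 proof cases
  case 1
  have "((\<lambda>_. 0) has_real_derivative 0) (at A)" by simp
  then have "(legendre_Phi al (be + 1) has_real_derivative 0) (at A)"
   by (rule has_field_derivative_transform_within_open [where S="{..<-1}"]) (use 1 in \<open>auto simp: legendre_Phi_def\<close>)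
  then show ?thesis using 1 by (simp add: legendre_Phi_def)
 next
  case 2
  define K where "K = 2 powr (al - 1/2)*Gamma (al + 1/2)"
  define a where "a = inner_coeff al (c + 1)"
  define v where "v = (1 + A)/2"
  have v: "abs v < 1" "v > 0" using 2 by (auto simp: v_def)
  obtain C where C: "\<And>k. abs (a k) \<le> C*(pochhammer 1 k/fact k)"
   using inner_coeff_bound [of "c + 1" 1 al] c0 unfolding a_def by auto
  note sm = power_series_binomial_bound(1) [OF C]
  obtain D where D: "((\<lambda>v. \<Sum>k. a k * v ^ k) has_real_derivative D) (at v)"
   and Ds: "(\<lambda>k. real k*a k * v ^ k) sums (v * D)"
   using DERIV_power_series_times [OF sm v(1)] by blast
  have chain: "((\<lambda>A. \<Sum>k. a k*((1 + A)/2) ^ k) has_real_derivative D*(1/2)) (at A)"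
   by (rule DERIV_chain2 [where f="\<lambda>v. \<Sum>k. a k * v ^ k"]) (use D in \<open>auto simp: v_def intro!: derivative_eq_intros\<close>)
  have "((\<lambda>A. (1 + A) powr c) has_real_derivative c*(1 + A) powr (c - 1)) (at A)"
   using 2 by (auto intro!: derivative_eq_intros)
  from DERIV_cmult [OF DERIV_mult [OF this chain], of K]
  have der: "((\<lambda>A. K*((1 + A) powr c*(\<Sum>k. a k*((1 + A)/2) ^ k))) has_real_derivative
    K*(c*(1 + A) powr (c - 1)*(\<Sum>k. a k * v ^ k) + D*(1/2)*(1 + A) powr c)) (at A)"
   unfolding v_def .
  have "(\<lambda>k. c*(a k * v ^ k) + real k*a k * v ^ k) sums (c*(\<Sum>k. a k * v ^ k) + v * D)"
   by (intro sums_add sums_mult summable_sums sm v Ds)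
  moreover have "c*(a k * v ^ k) + real k*a k * v ^ k = inner_coeff al c k * v ^ k" for k
  proof -
   have "rGamma (c + real k) = (c + real k)*rGamma (c + 1 + real k)"
    using rGamma_plus1 [of "c + real k"] by (simp add: add_ac)
   then have "inner_coeff al c k = (c + real k)*a k" by (simp add: a_def inner_coeff_def)
   then show ?thesis by (simp add: algebra_simps)
  qed
  ultimately have val: "(\<Sum>k. inner_coeff al c k * v ^ k) = c*(\<Sum>k. a k * v ^ k) + v * D"
   by (simp add: sums_iff)
  have "(1 + A) powr c = (1 + A) powr (c - 1)*(2 * v)"
   using 2 powr_add [of "1 + A" "c - 1" 1] by (simp add: v_def)
  then have "K*(c*(1 + A) powr (c - 1)*(\<Sum>k. a k * v ^ k) + D*(1/2)*(1 + A) powr c)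
    = K*(1 + A) powr (c - 1)*(\<Sum>k. inner_coeff al c k * v ^ k)"
   unfolding val by (simp add: algebra_simps)
  also have "... = legendre_Phi al be A"
   using 2 by (simp add: legendre_Phi_def K_def c_def v_def)
  finally have e: "K*(c*(1 + A) powr (c - 1)*(\<Sum>k. a k * v ^ k) + D*(1/2)*(1 + A) powr c) = legendre_Phi al be A" .
  have f: "K*((1 + y) powr c*(\<Sum>k. a k*((1 + y)/2) ^ k)) = legendre_Phi al (be + 1) y" if "y \<in> {-1<..<1}" for y
  proof -
   have "al + (be + 1) - 1/2 = c" "al + (be + 1) + 1/2 = c + 1" by (simp_all add: c_def)
   note * = this
   show ?thesis unfolding legendre_Phi_def * using that by (simp add: K_def a_def)
  qed
  show ?thesis using der unfolding e
   by (rule has_field_derivative_transform_within_open [where S="{-1<..<1}"]) (use 2 f in auto)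
 next
  case 3
  define K where "K = gegenbauer_moment al 0"
  define b where "b = outer_coeff al (be + 1)"
  define w where "w = 1/A^2"
  have w: "abs w < 1" "w > 0" using 3 by (auto simp: w_def power2_eq_square less_1_mult)
  obtain C where C: "\<And>k. abs (b k) \<le> C*(pochhammer 1 k/fact k)"
   using outer_coeff_bound [of al 1 "be + 1"] al c unfolding b_def by auto
  note sm = power_series_binomial_bound(1) [OF C]
  obtain D where D: "((\<lambda>v. \<Sum>k. b k * v ^ k) has_real_derivative D) (at w)"
   and Ds: "(\<lambda>k. real k*b k*w ^ k) sums (w*D)"
   using DERIV_power_series_times [OF sm w(1)] by blast
  have "((\<lambda>A. 1/A^2) has_real_derivative - (2/A ^ 3)) (at A)"
   using 3 by (auto intro!: derivative_eq_intros simp: power2_eq_square power3_eq_cube)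
  then have chain: "((\<lambda>A. \<Sum>k. b k*(1/A^2) ^ k) has_real_derivative D*(- (2/A ^ 3))) (at A)"
   using D unfolding w_def by (rule DERIV_chain2 [where f="\<lambda>v. \<Sum>k. b k * v ^ k", rotated])
  have "((\<lambda>A. A powr be) has_real_derivative be*A powr (be - 1)) (at A)"
   using 3 by (auto intro!: derivative_eq_intros)
  from DERIV_cmult [OF DERIV_mult [OF this chain], of K]
  have der: "((\<lambda>A. K*(A powr be*(\<Sum>k. b k*(1/A^2) ^ k))) has_real_derivative
    K*(be*A powr (be - 1)*(\<Sum>k. b k*w ^ k) + D*(- (2/A ^ 3))*A powr be)) (at A)"
   unfolding w_def .
  have "(\<lambda>k. be*(b k*w ^ k) - 2*(real k*b k*w ^ k)) sums (be*(\<Sum>k. b k*w ^ k) - 2*(w*D))"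
   by (intro sums_diff sums_mult summable_sums sm w Ds)
  moreover have "be*(b k*w ^ k) - 2*(real k*b k*w ^ k) = outer_coeff al be k*w ^ k" for k
  proof -
   have "rGamma (be - 2*real k) = (be - 2*real k)*rGamma (be + 1 - 2*real k)"
    using rGamma_plus1 [of "be - 2*real k"] by (simp add: algebra_simps)
   then have e: "outer_coeff al be k = (be - 2*real k)*b k" by (simp add: b_def outer_coeff_def)
   show ?thesis unfolding e by (simp add: algebra_simps)
  qed
  ultimately have val: "(\<Sum>k. outer_coeff al be k*w ^ k) = be*(\<Sum>k. b k*w ^ k) - 2*(w*D)"
   by (simp add: sums_iff)
  have pw: "2/A ^ 3*A powr be = A powr (be - 1)*(2*w)"
   using 3 by (simp add: powr_diff w_def power2_eq_square power3_eq_cube mult_ac)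
  have "D*(- X)*P = - (D*(X*P))" for X P by simp
  from this [of "2/A ^ 3" "A powr be"]
  have "D*(- (2/A ^ 3))*A powr be = - (D*(A powr (be - 1)*(2*w)))"
   unfolding pw .
  then have "K*(be*A powr (be - 1)*(\<Sum>k. b k*w ^ k) + D*(- (2/A ^ 3))*A powr be)
    = K*A powr (be - 1)*(\<Sum>k. outer_coeff al be k*w ^ k)"
   unfolding val by (simp only:) (simp add: algebra_simps)
  also have "... = legendre_Phi al be A"
   using 3 by (simp add: legendre_Phi_def K_def w_def)
  finally have e: "K*(be*A powr (be - 1)*(\<Sum>k. b k*w ^ k) + D*(- (2/A ^ 3))*A powr be) = legendre_Phi al be A" .
  show ?thesis using der unfolding e
   by (rule has_field_derivative_transform_within_open [where S="{1<..}"])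
     (use 3 in \<open>auto simp: legendre_Phi_def K_def b_def\<close>)
 qed
qed

section \<open>Differentiation in t and descent in al + be\<close>

lemma DERIV_lborel_integral:
 fixes f f' :: "real => real => real"
 assumes d: "d > 0"
  and fi: "\<And>s. abs (s - t) < d ==> integrable lborel (f s)"
  and der: "\<And>s y. abs (s - t) < d ==> ((\<lambda>s. f s y) has_real_derivative f' s y) (at s)"
  and bd: "\<And>s y. abs (s - t) < d ==> abs (f' s y) \<le> w y"
  and wi: "integrable lborel w" and m: "f' t \<in> borel_measurable lborel"
 shows "((\<lambda>s. integral\<^sup>L lborel (f s)) has_real_derivative integral\<^sup>L lborel (f' t)) (at t)"
 unfolding has_field_derivative_iff tendsto_at_iff_sequentially comp_def
proof (intro allI impI)
 fix X :: "nat => real" assume X: "\<forall>i. X i \<in> UNIV - {t}" "X \<longlonglongrightarrow> t"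
 have "\<forall>\<^sub>F i in sequentially. abs (X i - t) < d"
  using X(2) d by (simp add: tendsto_iff dist_real_def)
 then obtain N where N: "\<And>i. i \<ge> N ==> abs (X i - t) < d" by (auto simp: eventually_sequentially)
 define Y where "Y i = X (i + N)" for i
 have Y: "abs (Y i - t) < d" "Y i \<noteq> t" for i using N X(1) by (auto simp: Y_def)
 have YX: "Y \<longlonglongrightarrow> t" unfolding Y_def using X(2) by (rule LIMSEQ_ignore_initial_segment)
 have ft: "integrable lborel (f t)" using fi d by simp
 have "(\<lambda>i. LBINT y. (f (Y i) y - f t y)/(Y i - t)) \<longlonglongrightarrow> integral\<^sup>L lborel (f' t)"
 proof (rule integral_dominated_convergence [OF m _ wi])
  show "(\<lambda>y. (f (Y i) y - f t y)/(Y i - t)) \<in> borel_measurable lborel" for i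
   using fi [OF Y(1), of i] ft by simp
  show "AE y in lborel. (\<lambda>i. (f (Y i) y - f t y)/(Y i - t)) \<longlonglongrightarrow> f' t y"
  proof (intro always_eventually allI)
   fix y
   have "((\<lambda>s. f s y) has_real_derivative f' t y) (at t)" using der d by simp
   then have "((\<lambda>s. (f s y - f t y)/(s - t)) \<longlongrightarrow> f' t y) (at t)" by (simp add: has_field_derivative_iff)
   then show "(\<lambda>i. (f (Y i) y - f t y)/(Y i - t)) \<longlonglongrightarrow> f' t y"
    unfolding tendsto_at_iff_sequentially comp_def using Y(2) YX by auto
  qed
  show "AE y in lborel. norm ((f (Y i) y - f t y)/(Y i - t)) \<le> w y" for i
  proof (intro always_eventually allI)
   fix y
   have "norm (f (Y i) y - f t y) \<le> w y*norm (Y i - t)"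
   proof (rule field_differentiable_bound [where S="ball t d" and f'="\<lambda>s. f' s y"])
    show "((\<lambda>s. f s y) has_field_derivative f' s y) (at s within ball t d)" if "s \<in> ball t d" for s
     using der [of s y] that by (auto simp: dist_real_def abs_minus_commute intro: has_field_derivative_at_within)
    show "norm (f' s y) \<le> w y" if "s \<in> ball t d" for s
     using bd [of s y] that by (auto simp: dist_real_def abs_minus_commute)
   qed (use Y [of i] d in \<open>auto simp: dist_real_def abs_minus_commute\<close>)
   then show "norm ((f (Y i) y - f t y)/(Y i - t)) \<le> w y"
    using Y(2) [of i] by (simp add: pos_divide_le_eq)
  qed
 qed
 moreover have "(LBINT y. (f (Y i) y - f t y)/(Y i - t)) = (integral\<^sup>L lborel (f (Y i)) - integral\<^sup>L lborel (f t))/(Y i - t)" for i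
  using fi [OF Y(1), of i] ft by simp
 ultimately have "(\<lambda>i. (integral\<^sup>L lborel (f (Y i)) - integral\<^sup>L lborel (f t))/(Y i - t)) \<longlonglongrightarrow> integral\<^sup>L lborel (f' t)"
  by (simp only:)
 then show "(\<lambda>i. (integral\<^sup>L lborel (f (X i)) - integral\<^sup>L lborel (f t))/(X i - t)) \<longlonglongrightarrow> integral\<^sup>L lborel (f' t)"
  unfolding Y_def by (rule LIMSEQ_offset)
qed

lemma bessel_triple_measurable:
 assumes "t > 0" "x > 0" "z > 0"
 shows "(\<lambda>y. indicator {0<..R} y*bessel_triple mu al t x z y) \<in> borel_measurable borel"
proof -
 have "continuous_on {0<..R} (bessel_triple mu al t x z)" by (rule continuous_on_bessel_triple) (use assms in auto)
 from borel_measurable_continuous_on_indicator [OF _ this] show ?thesis by simp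
qed

text \<open>Near y = 0 the power y^mu of J_mu and y^(1 - mu) combine to y, leaving y powr (2 al +
  1), integrable for al > -1 whatever mu is, with a constant uniform for t in a compact
  interval.\<close>

lemma bessel_triple_bound_near_0:
 assumes al: "al > -1" and pos: "x > 0" "z > 0" "0 < a" "a \<le> b"
 shows "\<exists>w. integrable lborel w \<and> (\<forall>t y. a \<le> t --> t \<le> b --> abs (indicator {0<..R} y*bessel_triple mu al t x z y) \<le> w y)"
proof (cases "R > 0")
 case False
 then have "indicator {0<..R} y = (0::real)" for y by (auto simp: indicator_def)
 then show ?thesis by (intro exI [of _ "\<lambda>_. 0"]) auto
next
 case True
 obtain C where C: "C \<ge> 0" "\<And>v. 0 < v ==> v \<le> b * R ==> abs (bessel_J mu v) \<le> C * v powr mu"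
  using bessel_J_bound_small [of "b * R" mu] pos True by auto
 obtain D where D: "D \<ge> 0" "\<And>v. 0 < v ==> v \<le> (x + z) * R ==> abs (bessel_J al v) \<le> D * v powr al"
  using bessel_J_bound_small [of "(x + z) * R" al] pos True by auto
 define K where "K = C*max (a powr mu) (b powr mu)*(D*x powr al)*(D*z powr al)"
 have K0: "K \<ge> 0" unfolding K_def using C(1) D(1) by (intro mult_nonneg_nonneg) (auto simp: le_max_iff_disj)
 have bd: "abs (bessel_triple mu al t x z y) \<le> K*y powr (2*al + 1)" if t: "a \<le> t" "t \<le> b" and y: "0 < y" "y \<le> R" for t y
 proof -
  have tp: "t > 0" using t pos by linarith
  have "abs (bessel_J mu (t*y)) \<le> C*(t*y) powr mu" using tp t y by (intro C mult_mono) auto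
  also have "... = C*(t powr mu*y powr mu)" using tp y by (simp add: powr_mult)
  also have "... \<le> C*(max (a powr mu) (b powr mu)*y powr mu)"
  proof -
   have "t powr mu \<le> max (a powr mu) (b powr mu)"
   proof (cases "mu \<ge> 0")
    case True
    then have "t powr mu \<le> b powr mu" using t tp by (intro powr_mono2) auto
    then show ?thesis by simp
   next
    case False
    then have "t powr mu \<le> a powr mu" using t pos by (intro powr_mono2') auto
    then show ?thesis by simp
   qed
   then show ?thesis using C(1) by (intro mult_left_mono mult_right_mono) auto
  qed
  finally have 1: "abs (bessel_J mu (t*y)) \<le> C*max (a powr mu) (b powr mu)*y powr mu" by (simp add: mult_ac)
  have 2: "abs (bessel_J al (u*y)) \<le> D*u powr al*y powr al" if u: "u > 0" "u \<le> x + z" for u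
  proof -
   have "abs (bessel_J al (u*y)) \<le> D*(u*y) powr al" using u y by (intro D mult_mono) auto
   then show ?thesis using u y by (simp add: powr_mult mult_ac)
  qed
  have "abs (bessel_triple mu al t x z y) = abs (bessel_J mu (t*y))*abs (bessel_J al (x*y))*abs (bessel_J al (z*y))*y powr (1 - mu)"
   by (simp add: bessel_triple_def abs_mult)
  also have "... \<le> (C*max (a powr mu) (b powr mu)*y powr mu)*(D*x powr al*y powr al)*(D*z powr al*y powr al)*y powr (1 - mu)"
  proof -
   have nn: "0 \<le> C*max (a powr mu) (b powr mu)*y powr mu" "0 \<le> D*x powr al*y powr al"
    "0 \<le> D*z powr al*y powr al" using C(1) D(1) by (auto simp: le_max_iff_disj)
   have m: "p*q*r*w \<le> p'*q'*r'*w"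
    if "0 \<le> p" "0 \<le> q" "0 \<le> r" "0 \<le> w" "p \<le> p'" "q \<le> q'" "r \<le> r'" for p q r w p' q' r' :: real
    using that by (intro mult_mono mult_nonneg_nonneg) linarith+
   show ?thesis by (rule m) (use 1 2 [of x] 2 [of z] pos in auto)
  qed
  also have "... = K*(y powr mu*y powr al*y powr al*y powr (1 - mu))"
   unfolding K_def by (simp only: mult_ac)
  also have "y powr mu*y powr al*y powr al*y powr (1 - mu) = y powr (2*al + 1)"
  proof -
   have "2*al + 1 = mu + al + al + (1 - mu)" by simp
   then show ?thesis by (simp only: powr_add)
  qed
  finally show ?thesis .
 qed
 have "integrable lborel (\<lambda>y. K*(indicator {0<..R} y*y powr (2*al + 1)))"
  using powr_integral_from_0 [of "2*al + 1" R] al True by (intro integrable_mult_right) (simp add: has_bochner_integral_iff)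
 then show ?thesis
  using bd K0 by (intro exI [of _ "\<lambda>y. K*(indicator {0<..R} y*y powr (2*al + 1))"]) (auto simp: indicator_def)
qed

lemma bessel_triple_integrable:
 assumes "al > -1" "t > 0" "x > 0" "z > 0"
 shows "set_integrable lborel {0<..R} (bessel_triple mu al t x z)"
proof -
 obtain w where w: "integrable lborel w" "\<And>y. abs (indicator {0<..R} y*bessel_triple mu al t x z y) \<le> w y"
  using bessel_triple_bound_near_0 [of al x z t t R mu] assms by blast
 have "integrable lborel (\<lambda>y. indicator {0<..R} y*bessel_triple mu al t x z y)"
 proof (rule Bochner_Integration.integrable_bound [OF w(1)])
  show "AE y in lborel. norm (indicator {0<..R} y*bessel_triple mu al t x z y) \<le> norm (w y)"
   using order_trans [OF w(2) abs_ge_self] by simp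
 qed (use bessel_triple_measurable [OF assms(2-4)] in simp)
 then show ?thesis by (simp add: set_integrable_def)
qed

definition bessel_truncated :: "real => real => real => real => real => real => real" where
 "bessel_truncated mu al t x z R = (LBINT y:{0<..R}. bessel_triple mu al t x z y)"

lemma bessel_truncated_diff:
 assumes "al > -1" "t > 0" "x > 0" "z > 0" "0 < R" "R \<le> S"
 shows "bessel_truncated mu al t x z S - bessel_truncated mu al t x z R = integral {R..S} (bessel_triple mu al t x z)"
proof -
 have i: "set_integrable lborel {0<..S} (bessel_triple mu al t x z)" using assms by (intro bessel_triple_integrable)
 have u: "{0<..S} = {0<..R} \<union> {R<..S}" using assms by auto
 have 1: "bessel_truncated mu al t x z S = bessel_truncated mu al t x z R + (LBINT y:{R<..S}. bessel_triple mu al t x z y)"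
  unfolding bessel_truncated_def u
  by (rule set_integral_Un) (auto intro!: set_integrable_subset [OF i] simp: u)
 have i2: "set_integrable lborel {R..S} (bessel_triple mu al t x z)"
  using assms by (intro set_integrable_subset [OF i]) auto
 have "(LBINT y:{R<..S}. bessel_triple mu al t x z y) = (LBINT y:{R..S}. bessel_triple mu al t x z y)"
  unfolding set_lebesgue_integral_def
 proof (rule integral_cong_AE)
  have "AE y in lborel. y \<noteq> R" by (rule AE_lborel_singleton)
  then show "AE y in lborel. indicator {R<..S} y *\<^sub>R bessel_triple mu al t x z y = indicator {R..S} y *\<^sub>R bessel_triple mu al t x z y"
   by eventually_elim (auto simp: indicator_def)
  show "(\<lambda>y. indicator {R<..S} y *\<^sub>R bessel_triple mu al t x z y) \<in> borel_measurable lborel"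
   using set_integrable_subset [OF i, of "{R<..S}"] assms by (auto simp: set_integrable_def u)
  show "(\<lambda>y. indicator {R..S} y *\<^sub>R bessel_triple mu al t x z y) \<in> borel_measurable lborel"
   using i2 by (auto simp: set_integrable_def)
 qed
 also have "... = integral {R..S} (bessel_triple mu al t x z)" by (rule set_borel_integral_eq_integral(2) [OF i2])
 finally show ?thesis using 1 by simp
qed

text \<open>The tail bound makes the truncations Cauchy as R grows, at a rate common to all t near
  t0. The limit g is not yet identified.\<close>

lemma bessel_truncated_uniform:
 assumes al: "al > -1" and mu: "mu > -1/2" and pos: "x > 0" "z > 0" "t0 > 0" and ne: "t0 \<noteq> abs (x - z)" "t0 \<noteq> x + z"
 shows "\<exists>et>0. et < t0 \<and> (\<exists>g. \<forall>e>0. \<exists>R0>0. \<forall>t. abs (t - t0) < et -->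
  (\<forall>R\<ge>R0. abs (bessel_truncated mu al t x z R - g t) \<le> e))"
proof -
 obtain et C R0 where et: "et > 0" and R0: "R0 > 0" and tail: "\<And>t. abs (t - t0) < et ==> t > 0 \<and>
  (\<forall>R\<ge>R0. \<forall>S\<ge>R. abs (integral {R..S} (bessel_triple mu al t x z)) \<le> C * R powr (- (mu + 1/2)))"
  using bessel_triple_tail [OF mu pos ne, of al] by blast
 define et' where "et' = min et (t0/2)"
 define T where "T t R = bessel_truncated mu al t x z R" for t R
 have diff: "abs (T t S - T t R) \<le> C * R powr (- (mu + 1/2))" if "abs (t - t0) < et" "R \<ge> R0" "S \<ge> R" for t R S
  using tail [OF that(1)] that R0 bessel_truncated_diff [of al t x z R S mu] al pos by (auto simp: T_def)
 have lim0: "((\<lambda>R. C * R powr (- (mu + 1/2))) \<longlongrightarrow> 0) at_top"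
 proof -
  have "((\<lambda>R. R powr (- (mu + 1/2))) \<longlongrightarrow> 0) at_top"
   using mu by (intro tendsto_neg_powr filterlim_ident) auto
  from tendsto_mult_left [OF this, of C] show ?thesis by simp
 qed
 have conv: "\<exists>l. \<forall>R\<ge>R0. abs (T t R - l) \<le> C * R powr (- (mu + 1/2))" if t: "abs (t - t0) < et" for t
 proof -
  define X where "X n = T t (R0 + real n)" for n :: nat
  have "Cauchy X"
  proof (rule metric_CauchyI)
   fix e :: real assume e: "e > 0"
   have "\<forall>\<^sub>F R in at_top. dist (C * R powr (- (mu + 1/2))) 0 < e" using lim0 e by (rule tendstoD)
   then obtain R1 where R1: "\<And>R. R \<ge> R1 ==> abs (C * R powr (- (mu + 1/2))) < e"
    by (auto simp: eventually_at_top_linorder)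
   obtain N :: nat where N: "real N \<ge> R1" using real_arch_simple by blast
   have *: "abs (X n - X m) < e" if "N \<le> m" "m \<le> n" for m n
   proof -
    have "R0 + real m \<ge> R1" using that N R0 by (auto intro: order_trans [of _ "real N"])
    then show ?thesis using diff [OF t, of "R0 + real m" "R0 + real n"] R1 [of "R0 + real m"] that
     unfolding X_def by auto
   qed
   have "dist (X m) (X n) < e" if "N \<le> m" "N \<le> n" for m n
    using *[of m n] *[of n m] that by (cases "m \<le> n") (auto simp: dist_real_def abs_minus_commute)
   then show "\<exists>M. \<forall>m\<ge>M. \<forall>n\<ge>M. dist (X m) (X n) < e" by blast
  qed
  then obtain l where l: "X \<longlonglongrightarrow> l" by (auto simp: Cauchy_convergent_iff convergent_def)
  have "abs (T t R - l) \<le> C * R powr (- (mu + 1/2))" if R: "R \<ge> R0" for R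
  proof -
   have "(\<lambda>n. abs (X n - T t R)) \<longlonglongrightarrow> abs (l - T t R)" by (intro tendsto_intros l)
   moreover obtain N :: nat where N: "real N \<ge> R" using real_arch_simple by blast
   have "\<forall>n\<ge>N. abs (X n - T t R) \<le> C * R powr (- (mu + 1/2))"
   proof (intro allI impI)
    fix n assume "N \<le> n"
    then have "R0 + real n \<ge> R" using N R0 by (auto intro: order_trans [of _ "real N"])
    then show "abs (X n - T t R) \<le> C * R powr (- (mu + 1/2))" unfolding X_def by (rule diff [OF t R])
   qed
   ultimately have "abs (l - T t R) \<le> C * R powr (- (mu + 1/2))" by (intro LIMSEQ_le_const2) blast+
   then show ?thesis by (simp add: abs_minus_commute)
  qed
  then show ?thesis by blast
 qed
 then obtain g where unif: "\<And>t R. abs (t - t0) < et ==> R \<ge> R0 ==> abs (T t R - g t) \<le> C * R powr (- (mu + 1/2))" by metis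
 have "\<exists>R1>0. \<forall>t. abs (t - t0) < et' --> (\<forall>R\<ge>R1. abs (T t R - g t) \<le> e)" if e: "e > 0" for e
 proof -
  have "\<forall>\<^sub>F R in at_top. dist (C * R powr (- (mu + 1/2))) 0 < e" using lim0 e by (rule tendstoD)
  then obtain R1 where R1: "\<And>R. R \<ge> R1 ==> abs (C * R powr (- (mu + 1/2))) < e"
   by (auto simp: eventually_at_top_linorder)
  have "abs (T t R - g t) \<le> e" if "abs (t - t0) < et'" "R \<ge> max R0 R1" for t R
   using unif [of t R] R1 [of R] that by (auto simp: et'_def)
  then show ?thesis using R0 by (intro exI [of _ "max R0 R1"]) auto
 qed
 moreover have "et' > 0" "et' < t0" using et pos by (auto simp: et'_def)
 ultimately show ?thesis unfolding T_def by blast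
qed

text \<open>Differentiating t powr (mu + 1) * J_(mu+1) (t y) in t produces the factor y, which
  raises y powr (-mu) to the y powr (1 - mu) belonging to mu. The truncation at R keeps questions of
  convergence at infinity out of the differentiation under the integral.\<close>

lemma DERIV_bessel_truncated:
 assumes al: "al > -1" and pos: "x > 0" "z > 0" "t > 0"
 shows "((\<lambda>t. t powr (mu + 1)*bessel_truncated (mu + 1) al t x z R) has_real_derivative
   t powr (mu + 1)*bessel_truncated mu al t x z R) (at t)"
proof -
 define f where "f s y = indicator {0<..R} y*(s powr (mu + 1)*bessel_triple (mu + 1) al s x z y)" for s y
 define f' where "f' s y = indicator {0<..R} y*(s powr (mu + 1)*bessel_triple mu al s x z y)" for s y
 have near: "t/2 \<le> s" "s \<le> 2*t" "s > 0" if "abs (s - t) < t/2" for s using that pos by linarith+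
 obtain w where w: "integrable lborel w"
  "\<And>s y. t/2 \<le> s ==> s \<le> 2*t ==> abs (indicator {0<..R} y*bessel_triple mu al s x z y) \<le> w y"
  using bessel_triple_bound_near_0 [of al x z "t/2" "2*t" R mu] al pos by auto
 define M where "M = max ((t/2) powr (mu + 1)) ((2*t) powr (mu + 1))"
 have M: "s powr (mu + 1) \<le> M" if "t/2 \<le> s" "s \<le> 2*t" for s
 proof (cases "mu + 1 \<ge> 0")
  case True
  then have "s powr (mu + 1) \<le> (2*t) powr (mu + 1)" using that pos by (intro powr_mono2) auto
  then show ?thesis by (simp add: M_def)
 next
  case False
  then have "s powr (mu + 1) \<le> (t/2) powr (mu + 1)" using that pos by (intro powr_mono2') auto
  then show ?thesis by (simp add: M_def)
 qed
 have M0: "M \<ge> 0" using M [of t] pos powr_ge_zero [of t "mu + 1"] by linarith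
 have "((\<lambda>s. integral\<^sup>L lborel (f s)) has_real_derivative integral\<^sup>L lborel (f' t)) (at t)"
 proof (rule DERIV_lborel_integral [where d="t/2" and w="\<lambda>y. M*w y" and f=f and f'=f' and t=t])
  show "integrable lborel (f s)" if "abs (s - t) < t/2" for s
  proof -
   have "integrable lborel (\<lambda>y. s powr (mu + 1)*(indicator {0<..R} y*bessel_triple (mu + 1) al s x z y))"
    using bessel_triple_integrable [of al s x z R "mu + 1"] near [OF that] al pos
    by (intro integrable_mult_right) (simp add: set_integrable_def)
   moreover have "f s = (\<lambda>y. s powr (mu + 1)*(indicator {0<..R} y*bessel_triple (mu + 1) al s x z y))"
    unfolding f_def by (simp only: mult_ac)
   ultimately show ?thesis by (simp only:)
  qed
  show "((\<lambda>s. f s y) has_real_derivative f' s y) (at s)" if "abs (s - t) < t/2" for s y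
  proof (cases "0 < y \<and> y \<le> R")
   case True
   define k where "k = bessel_J al (x*y)*bessel_J al (z*y)*y powr (- mu)"
   have "((\<lambda>s. k*(s powr (mu + 1)*bessel_J (mu + 1) (s*y))) has_real_derivative
    k*(y * s powr (mu + 1)*bessel_J mu (s*y))) (at s)"
    using True near [OF that] by (intro DERIV_cmult DERIV_powr_bessel_J_order) auto
   moreover have "k*(y * s powr (mu + 1)*bessel_J mu (s*y)) = f' s y"
   proof -
    have "y powr (1 - mu) = y*y powr (- mu)" using True powr_add [of y 1 "- mu"] by simp
    then show ?thesis using True by (simp add: f'_def k_def bessel_triple_def mult_ac)
   qed
   moreover have "(\<lambda>s. k*(s powr (mu + 1)*bessel_J (mu + 1) (s*y))) = (\<lambda>s. f s y)"
    using True by (simp add: f_def k_def bessel_triple_def mult_ac fun_eq_iff)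
   ultimately show ?thesis by simp
  next
   case False
   then have "f s y = 0" "f' s y = 0" for s by (auto simp: f_def f'_def)
   then show ?thesis by simp
  qed
  show "abs (f' s y) \<le> M*w y" if "abs (s - t) < t/2" for s y
  proof -
   have "abs (f' s y) = s powr (mu + 1)*abs (indicator {0<..R} y*bessel_triple mu al s x z y)"
    by (simp add: f'_def abs_mult)
   also have "... \<le> M*w y"
    using M [of s] w(2) [of s y] near [OF that] M0 by (intro mult_mono) auto
   finally show ?thesis .
  qed
  show "integrable lborel (\<lambda>y. M*w y)" using w(1) by (rule integrable_mult_right)
  show "f' t \<in> borel_measurable lborel"
  proof -
   have [measurable]: "(\<lambda>y. indicator {0<..R} y*bessel_triple mu al t x z y) \<in> borel_measurable borel"
    by (rule bessel_triple_measurable) (use pos in auto)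
   have "(\<lambda>y. t powr (mu + 1)*(indicator {0<..R} y*bessel_triple mu al t x z y)) \<in> borel_measurable borel"
    by measurable
   moreover have "f' t = (\<lambda>y. t powr (mu + 1)*(indicator {0<..R} y*bessel_triple mu al t x z y))"
    unfolding f'_def by (simp only: mult_ac)
   ultimately show ?thesis by simp
  qed
  show "t/2 > 0" using pos by simp
 qed
 moreover have "integral\<^sup>L lborel (f s) = s powr (mu + 1)*bessel_truncated (mu + 1) al s x z R" for s
 proof -
  have "f s = (\<lambda>y. s powr (mu + 1)*(indicator {0<..R} y *\<^sub>R bessel_triple (mu + 1) al s x z y))"
   by (simp add: f_def fun_eq_iff)
  then show ?thesis by (simp add: bessel_truncated_def set_lebesgue_integral_def)
 qed
 moreover have "integral\<^sup>L lborel (f' t) = t powr (mu + 1)*bessel_truncated mu al t x z R"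
 proof -
  have "f' t = (\<lambda>y. t powr (mu + 1)*(indicator {0<..R} y *\<^sub>R bessel_triple mu al t x z y))"
   by (simp add: f'_def fun_eq_iff)
  then show ?thesis by (simp add: bessel_truncated_def set_lebesgue_integral_def)
 qed
 ultimately show ?thesis by (simp only:)
qed

text \<open>The value found in \<open>bessel_triple_integral_large\<close>; Gamma be has cancelled
  against the one in \<open>sonine_mean_legendre\<close>, so the expression makes sense for be <= 0
  too.\<close>

definition bessel_triple_value :: "real => real => real => real => real => real" where
 "bessel_triple_value al be t x z = 2 powr (- al)/(gegenbauer_moment al 0*Gamma (al + 1))*t powr (- (al + be)) *
   (x*z) powr (al + be - 1)*legendre_Phi al be ((t^2 - x^2 - z^2)/(2*x*z))"

text \<open>Law of cosines: the values -1 and 1 belong to the degenerate triangles with sides t, x,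
  z.\<close>

lemma legendre_argument:
 fixes t x z :: real
 assumes "t > 0" "x > 0" "z > 0"
 shows "(t^2 - x^2 - z^2)/(2*x*z) < -1 \<longleftrightarrow> t < abs (x - z)" "(t^2 - x^2 - z^2)/(2*x*z) = -1 \<longleftrightarrow> t = abs (x - z)"
  "(t^2 - x^2 - z^2)/(2*x*z) < 1 \<longleftrightarrow> t < x + z" "(t^2 - x^2 - z^2)/(2*x*z) = 1 \<longleftrightarrow> t = x + z"
proof -
 have p: "2*x*z > 0" using assms by simp
 have 1: "(t^2 - x^2 - z^2)/(2*x*z) < -1 \<longleftrightarrow> t^2 < (abs (x - z))^2"
  using p by (simp add: pos_divide_less_eq power2_diff algebra_simps)
 then show "(t^2 - x^2 - z^2)/(2*x*z) < -1 \<longleftrightarrow> t < abs (x - z)"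
  using assms by (metis abs_ge_zero less_imp_le power2_less_imp_less power_strict_mono zero_less_numeral)
 have 2: "(t^2 - x^2 - z^2)/(2*x*z) = -1 \<longleftrightarrow> t^2 = (abs (x - z))^2"
  using assms by (simp add: divide_eq_eq power2_diff) (auto simp: algebra_simps)
 then show "(t^2 - x^2 - z^2)/(2*x*z) = -1 \<longleftrightarrow> t = abs (x - z)"
  using assms by (metis abs_ge_zero less_imp_le power2_eq_iff_nonneg)
 have 3: "(t^2 - x^2 - z^2)/(2*x*z) < 1 \<longleftrightarrow> t^2 < (x + z)^2"
  using p by (simp add: pos_divide_less_eq power2_sum algebra_simps)
 then show "(t^2 - x^2 - z^2)/(2*x*z) < 1 \<longleftrightarrow> t < x + z"
  using assms by (metis add_pos_pos less_imp_le power2_less_imp_less power_strict_mono zero_less_numeral)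
 have 4: "(t^2 - x^2 - z^2)/(2*x*z) = 1 \<longleftrightarrow> t^2 = (x + z)^2"
  using assms by (simp add: divide_eq_eq power2_sum) (auto simp: algebra_simps)
 then show "(t^2 - x^2 - z^2)/(2*x*z) = 1 \<longleftrightarrow> t = x + z"
  using assms by (metis add_pos_pos less_imp_le power2_eq_iff_nonneg)
qed

lemma bessel_triple_value_large:
 assumes al: "al > -1/2" and be: "be \<ge> 2" and pos: "x > 0" "z > 0" "t > 0" and ne: "t \<noteq> x + z"
 shows "(bessel_truncated (al + be) al t x z \<longlongrightarrow> bessel_triple_value al be t x z) at_top"
proof -
 let ?A = "(t^2 - x^2 - z^2)/(2*x*z)"
 have A: "?A \<noteq> 1" using legendre_argument(4) [OF pos(3,1,2)] ne by simp
 have "Gamma be > 0" using be by (intro Gamma_real_pos) simp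
 then have G: "Gamma be \<noteq> 0" by simp
 have e1: "2 powr (1 - al - be)*2 powr (be - 1) = 2 powr (- al)"
  by (simp flip: powr_add)
 have e2: "(x*z) powr al*(x*z) powr (be - 1) = (x*z) powr (al + be - 1)"
  by (simp flip: powr_add add: algebra_simps)
 have e3: "(2*x*z) powr (be - 1) = 2 powr (be - 1)*(x*z) powr (be - 1)"
  using pos by (simp add: powr_mult)
 have "p/(G*m*H)*T*X*(q*Y*(G*F)) = (p*q)/(m*H)*T*(X*Y)*F" if "G \<noteq> 0" for p G m H T X q Y F :: real
  using that by simp
 from this [OF G, of "2 powr (1 - al - be)" "gegenbauer_moment al 0" "Gamma (al + 1)" "t powr (- al - be)" "(x*z) powr al"
   "2 powr (be - 1)" "(x*z) powr (be - 1)" "legendre_Phi al be ?A"]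
 have "2 powr (1 - al - be)/(Gamma be*gegenbauer_moment al 0*Gamma (al + 1))*t powr (- al - be)*(x*z) powr al *
   sonine_mean al be x z (t^2) = bessel_triple_value al be t x z"
  unfolding sonine_mean_legendre [OF al _ pos(1,2) refl A, of be] bessel_triple_value_def e1 e2 e3 minus_add_distrib
  using be sonine_mean_legendre [OF al _ pos(1,2) refl A, of be] by (simp add: e3)
 with bessel_triple_integral_large [OF al be pos] show ?thesis
  by (simp add: bessel_truncated_def [abs_def])
qed

text \<open>Multiplied by t powr (mu + 1), the truncations for mu + 1 converge by \<open>IH\<close>,
  and their derivatives, which are the truncations for mu, converge locally uniformly in t. So the
  limit may be differentiated, and \<open>DERIV_legendre_Phi\<close> identifies its
  derivative.\<close>

lemma bessel_triple_value_shift: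
 assumes al: "al > -1/2" and mu: "al + be > -1/2"
  and IH: "\<And>t. t > 0 ==> t \<noteq> abs (x - z) ==> t \<noteq> x + z ==>
   (bessel_truncated (al + (be + 1)) al t x z \<longlongrightarrow> bessel_triple_value al (be + 1) t x z) at_top"
  and pos: "x > 0" "z > 0" "t0 > 0" and ne: "t0 \<noteq> abs (x - z)" "t0 \<noteq> x + z"
 shows "(bessel_truncated (al + be) al t0 x z \<longlongrightarrow> bessel_triple_value al be t0 x z) at_top"
proof -
 define mu where "mu = al + be"
 have al1: "al > -1" using al by simp
 obtain et1 g where et1: "et1 > 0" "et1 < t0" and g: "\<And>e. e > 0 ==> \<exists>R0>0. \<forall>t. abs (t - t0) < et1 -->
  (\<forall>R\<ge>R0. abs (bessel_truncated mu al t x z R - g t) \<le> e)"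
  using bessel_truncated_uniform [OF al1 _ pos ne, of mu] mu unfolding mu_def by blast
 \<comment> \<open>The neighbourhood has to avoid both exceptional radii, since \<open>IH\<close> is
   used at all of its points.\<close>
 define et where "et = min et1 (min \<bar>t0 - \<bar>x - z\<bar>\<bar> \<bar>t0 - (x + z)\<bar>)"
 have et: "et > 0" unfolding et_def using et1 ne by auto
 define S where "S = ball t0 et"
 have S: "t > 0 \<and> t < 2*t0 \<and> t \<noteq> abs (x - z) \<and> t \<noteq> x + z \<and> abs (t - t0) < et1" if "t \<in> S" for t
  using that et1 unfolding S_def et_def by (auto simp: dist_real_def)
 have t0S: "t0 \<in> S" using et by (simp add: S_def)
 define K where "K = (2*t0) powr (mu + 1)"
 define H where "H t = t powr (mu + 1)*bessel_triple_value al (be + 1) t x z" for t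
 \<comment> \<open>The theorem on derivatives of limits is about sequences, so R runs through the
   naturals; the limit along all R is recovered from the uniform bound at the end.\<close>
 define F where "F n t = t powr (mu + 1)*bessel_truncated (mu + 1) al t x z (real n)" for n :: nat and t
 have mu1: "mu + 1 > 0" using mu by (simp add: mu_def)
 have "\<exists>h. \<forall>t\<in>S. (\<lambda>n. F n t) \<longlonglongrightarrow> h t \<and> (h has_derivative (\<lambda>k. t powr (mu + 1)*g t * k)) (at t within S)"
 proof (rule has_derivative_sequence [where f'="\<lambda>n t k. t powr (mu + 1)*bessel_truncated mu al t x z (real n) * k" and ?x0.0=t0 and l="H t0"])
  show "convex S" by (simp add: S_def)
  show "(F n has_derivative (\<lambda>k. t powr (mu + 1)*bessel_truncated mu al t x z (real n) * k)) (at t within S)" if "t \<in> S" for n t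
   using DERIV_bessel_truncated [OF al1 pos(1,2), of t mu "real n"] S [OF that]
   unfolding F_def [abs_def] has_field_derivative_def by (auto intro: has_derivative_at_withinI)
  show "\<forall>\<^sub>F n in sequentially. \<forall>t\<in>S. \<forall>h. norm (t powr (mu + 1)*bessel_truncated mu al t x z (real n)*h - t powr (mu + 1)*g t*h) \<le> e*norm h"
   if e: "e > 0" for e
  proof -
   have K: "K > 0" unfolding K_def using pos by simp
   from g [of "e/K"] e K obtain R0 where R0: "\<And>t R. abs (t - t0) < et1 ==> R \<ge> R0 ==> abs (bessel_truncated mu al t x z R - g t) \<le> e/K"
    by auto
   obtain N :: nat where N: "real N \<ge> R0" using real_arch_simple by blast
   show ?thesis
   proof (rule eventually_sequentiallyI [of N], intro ballI allI)
    fix n t h assume n: "n \<ge> N" and t: "t \<in> S"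
    have "t powr (mu + 1) \<le> K" unfolding K_def using S [OF t] mu1 by (intro powr_mono2) auto
    then have "t powr (mu + 1)*abs (bessel_truncated mu al t x z (real n) - g t) \<le> K*(e/K)"
     using R0 [of t "real n"] S [OF t] N n K by (intro mult_mono) auto
    also have "... = e" using K by simp
    finally have "t powr (mu + 1)*abs (bessel_truncated mu al t x z (real n) - g t)*abs h \<le> e*abs h"
     by (rule mult_right_mono) simp
    moreover have "t powr (mu + 1)*bessel_truncated mu al t x z (real n)*h - t powr (mu + 1)*g t*h
     = t powr (mu + 1)*(bessel_truncated mu al t x z (real n) - g t)*h" by (simp add: algebra_simps)
    ultimately show "norm (t powr (mu + 1)*bessel_truncated mu al t x z (real n)*h - t powr (mu + 1)*g t*h) \<le> e*norm h"
     by (simp add: abs_mult)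
   qed
  qed
  show "t0 \<in> S" by (rule t0S)
  show "(\<lambda>n. F n t0) \<longlonglongrightarrow> H t0"
   unfolding F_def H_def
   using filterlim_compose [OF IH [OF pos(3) ne] filterlim_real_sequentially]
   by (intro tendsto_intros) (simp add: mu_def add.assoc)
 qed
 then obtain h where h: "\<And>t. t \<in> S ==> (\<lambda>n. F n t) \<longlonglongrightarrow> h t"
  and hd: "(h has_derivative (\<lambda>k. t0 powr (mu + 1)*g t0 * k)) (at t0 within S)" using t0S by blast
 have hH: "h t = H t" if t: "t \<in> S" for t
 proof (rule LIMSEQ_unique [OF h [OF t]])
  show "(\<lambda>n. F n t) \<longlonglongrightarrow> H t"
   unfolding F_def H_def
   using filterlim_compose [OF IH filterlim_real_sequentially, of t] S [OF t]
   by (intro tendsto_intros) (simp add: mu_def add.assoc)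
 qed
 have opS: "open S" by (simp add: S_def)
 have d1: "(H has_real_derivative t0 powr (mu + 1)*g t0) (at t0)"
 proof -
  have "(h has_real_derivative t0 powr (mu + 1)*g t0) (at t0)"
   using hd at_within_open [OF t0S opS] by (simp add: has_field_derivative_def)
  then show ?thesis
   by (rule has_field_derivative_transform_within_open [OF _ opS t0S]) (rule hH)
 qed
 define k where "k = 2 powr (- al)/(gegenbauer_moment al 0*Gamma (al + 1))"
 define A where "A t = (t^2 - x^2 - z^2)/(2*x*z)" for t
 have HA: "H t = k*(x*z) powr mu*legendre_Phi al (be + 1) (A t)" if "t \<in> S" for t
 proof -
  have "t powr (mu + 1)*t powr (- (al + (be + 1))) = 1"
   using S [OF that] by (simp add: mu_def powr_minus add.assoc flip: powr_add)
  moreover have "al + (be + 1) - 1 = mu" by (simp add: mu_def)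
  moreover have "T*(k*U*X*P) = (T*U)*(k*X*P)" for T U X P :: real by (simp only: mult_ac)
  ultimately show ?thesis
   unfolding H_def bessel_triple_value_def k_def [symmetric] A_def [symmetric] by (simp only: mult_1)
 qed
 have "(A has_real_derivative t0/(x*z)) (at t0)"
  unfolding A_def [abs_def] using pos by (auto intro!: derivative_eq_intros simp: field_simps)
 moreover have A1: "A t0 \<noteq> 1" "A t0 \<noteq> -1"
  unfolding A_def using legendre_argument(2,4) [OF pos(3,1,2)] ne by auto
 have "(legendre_Phi al (be + 1) has_real_derivative legendre_Phi al be (A t0)) (at (A t0))"
  using al1 mu A1 by (intro DERIV_legendre_Phi) auto
 ultimately have "((\<lambda>t. legendre_Phi al (be + 1) (A t)) has_real_derivative legendre_Phi al be (A t0)*(t0/(x*z))) (at t0)"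
  by (rule DERIV_chain2 [rotated])
 from DERIV_cmult [OF this, of "k*(x*z) powr mu"]
 have "(H has_real_derivative k*(x*z) powr mu*(legendre_Phi al be (A t0)*(t0/(x*z)))) (at t0)"
  by (rule has_field_derivative_transform_within_open [OF _ opS t0S]) (simp add: HA)
 from DERIV_unique [OF d1 this]
 have "t0 powr (mu + 1)*g t0 = k*(x*z) powr mu*(legendre_Phi al be (A t0)*(t0/(x*z)))" .
 moreover have "t0 powr (mu + 1) = t0 powr mu*t0" using pos by (simp add: powr_add)
 moreover have "(x*z) powr mu = (x*z) powr (mu - 1)*(x*z)" using pos powr_add [of "x*z" "mu - 1" 1] by simp
 ultimately have "t0 powr mu*g t0 = k*(x*z) powr (mu - 1)*legendre_Phi al be (A t0)"
  using pos by (simp add: field_simps)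
 then have "g t0 = t0 powr (- mu)*(k*(x*z) powr (mu - 1)*legendre_Phi al be (A t0))"
  using pos by (simp add: powr_minus field_simps)
 then have val: "g t0 = bessel_triple_value al be t0 x z"
  unfolding bessel_triple_value_def k_def A_def mu_def by (simp only: mult_ac)
 have "(bessel_truncated mu al t0 x z \<longlongrightarrow> g t0) at_top"
  unfolding tendsto_iff dist_real_def eventually_at_top_linorder
 proof (intro allI impI)
  fix e :: real assume e: "e > 0"
  from g [of "e/2"] e obtain R0 where R0: "\<And>t R. abs (t - t0) < et1 ==> R \<ge> R0 ==> abs (bessel_truncated mu al t x z R - g t) \<le> e/2"
   by auto
  have "abs (bessel_truncated mu al t0 x z R - g t0) < e" if "R \<ge> R0" for R
   using R0 [of t0 R] that et1 e by auto
  then show "\<exists>N. \<forall>n\<ge>N. abs (bessel_truncated mu al t0 x z n - g t0) < e" by blast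
 qed
 then show ?thesis unfolding val mu_def .
qed

text \<open>Induction on the number n of shifts needed to reach be + n >= 2. Raising b preserves al
  + b > -1/2, so the uniform convergence is available at every step.\<close>

theorem bessel_triple_limit:
 assumes al: "al > -1/2" and mu: "al + be > -1/2" and pos: "x > 0" "z > 0" "t > 0" and ne: "t \<noteq> abs (x - z)" "t \<noteq> x + z"
 shows "(bessel_truncated (al + be) al t x z \<longlongrightarrow> bessel_triple_value al be t x z) at_top"
proof -
 obtain n :: nat where n: "real n \<ge> 2 - be" using real_arch_simple by blast
 have "(bessel_truncated (al + b) al t x z \<longlongrightarrow> bessel_triple_value al b t x z) at_top"
  if "b + real n \<ge> 2" "al + b > -1/2" "t > 0" "t \<noteq> abs (x - z)" "t \<noteq> x + z" for b t
  using that
 proof (induction n arbitrary: b t)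
  case 0
  then show ?case using al pos by (intro bessel_triple_value_large) auto
 next
  case (Suc n)
  show ?case
  proof (rule bessel_triple_value_shift [OF al Suc.prems(2) _ pos(1,2) Suc.prems(3-5)])
   fix t assume "t > 0" "t \<noteq> abs (x - z)" "t \<noteq> x + z"
   then show "(bessel_truncated (al + (b + 1)) al t x z \<longlongrightarrow> bessel_triple_value al (b + 1) t x z) at_top"
    using Suc.prems by (intro Suc.IH) auto
  qed
 qed
 then show ?thesis using n mu pos ne by auto
qed

section \<open>Recurrence reducing al > -1 to al > -1/2\<close>

lemma bessel_product_lowering:
 assumes "nu > 0" "x > 0" "z > 0" "y > 0"
 shows "((\<lambda>y. bessel_J nu (x*y)*bessel_J nu (z*y)) has_real_derivative
   x*z*y/(2*nu)*(bessel_J (nu - 1) (x*y)*bessel_J (nu - 1) (z*y) - bessel_J (nu + 1) (x*y)*bessel_J (nu + 1) (z*y))) (at y)"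
proof -
 define X Z where "X = x*y" and "Z = z*y"
 have p: "X > 0" "Z > 0" using assms by (auto simp: X_def Z_def)
 have rec: "bessel_J (nu - 1) w = 2*nu/w*bessel_J nu w - bessel_J (nu + 1) w" if "w > 0" for w
 proof -
  have e: "nu - 1 + 1 = nu" "nu - 1 + 2 = nu + 1" by simp_all
  show ?thesis using bessel_J_recurrence [OF that, of "nu - 1"] unfolding e .
 qed
 have "((\<lambda>y. bessel_J nu (x*y)*bessel_J nu (z*y)) has_real_derivative
   ((nu/X*bessel_J nu X - bessel_J (nu + 1) X)*x*bessel_J nu Z + (nu/Z*bessel_J nu Z - bessel_J (nu + 1) Z)*z*bessel_J nu X)) (at y)"
  using p unfolding X_def Z_def by (auto intro!: derivative_eq_intros DERIV_chain2 [OF DERIV_bessel_J])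
 also have "(nu/X*bessel_J nu X - bessel_J (nu + 1) X)*x*bessel_J nu Z + (nu/Z*bessel_J nu Z - bessel_J (nu + 1) Z)*z*bessel_J nu X
   = x*z*y/(2*nu)*(bessel_J (nu - 1) X*bessel_J (nu - 1) Z - bessel_J (nu + 1) X*bessel_J (nu + 1) Z)"
 proof -
  have "(nu/(x*y)*a - b)*x*c + (nu/(z*y)*c - d)*z*a
   = x*z*y/(2*nu)*((2*nu/(x*y)*a - b)*(2*nu/(z*y)*c - d) - b*d)" for a b c d
   using assms by (simp add: field_simps)
  then show ?thesis unfolding rec [OF p(1)] rec [OF p(2)] unfolding X_def Z_def .
 qed
 finally show ?thesis by (simp add: X_def Z_def)
qed

text \<open>The derivative of y powr (-mu) J_mu (t y) J_(al+1) (x y) J_(al+1) (z y), integrated over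
  (0, R]. It trades al for al + 2 with the same mu and for al + 1 with mu + 1, both within reach of
  \<open>bessel_triple_limit\<close> when al > -1.\<close>

lemma bessel_truncated_lowering:
 assumes al: "al > -1" and pos: "t > 0" "x > 0" "z > 0" and R: "R > 0"
 shows "bessel_truncated mu al t x z R = bessel_truncated mu (al + 2) t x z R +
   2*(al + 1)/(x*z)*(R powr (- mu)*bessel_J mu (t * R)*(bessel_J (al + 1) (x * R)*bessel_J (al + 1) (z * R))
    + t*bessel_truncated (mu + 1) (al + 1) t x z R)"
proof -
 define F where "F y = y powr (- mu)*bessel_J mu (t*y)*(bessel_J (al + 1) (x*y)*bessel_J (al + 1) (z*y))" for y
 \<comment> \<open>F extended by 0 to y <= 0: J_mu cancels y powr (-mu) and the rest is O(y powr (2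
   al + 2)), so G is continuous at 0 even where D is unbounded.\<close>
 define G where "G y = (if y \<le> 0 then 0 else F y)" for y
 define k where "k = x*z/(2*(al + 1))"
 define D where "D y = k*(bessel_triple mu al t x z y - bessel_triple mu (al + 2) t x z y) - t*bessel_triple (mu + 1) (al + 1) t x z y" for y
 have k: "k > 0" unfolding k_def using al pos by simp
 have der: "(F has_real_derivative D y) (at y)" if y: "y > 0" for y
 proof -
  have yy: "y powr (- mu)*y = y powr (1 - mu)" using y powr_add [of y 1 "- mu"] by (simp add: mult.commute)
  have "((\<lambda>y. bessel_J (al + 1) (x*y)*bessel_J (al + 1) (z*y)) has_real_derivative
   x*z*y/(2*(al + 1))*(bessel_J (al + 1 - 1) (x*y)*bessel_J (al + 1 - 1) (z*y) - bessel_J (al + 1 + 1) (x*y)*bessel_J (al + 1 + 1) (z*y))) (at y)"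
   using al pos y by (intro bessel_product_lowering) auto
  from DERIV_mult [OF DERIV_powr_minus_bessel_J [OF pos(1) y, of mu] this]
  have "(F has_real_derivative (- t*y powr (- mu)*bessel_J (mu + 1) (t*y))*(bessel_J (al + 1) (x*y)*bessel_J (al + 1) (z*y))
   + k*y*(bessel_J al (x*y)*bessel_J al (z*y) - bessel_J (al + 2) (x*y)*bessel_J (al + 2) (z*y))*(y powr (- mu)*bessel_J mu (t*y))) (at y)"
   unfolding F_def [abs_def] k_def by (simp add: add.assoc)
  also have "(- t*y powr (- mu)*bessel_J (mu + 1) (t*y))*(bessel_J (al + 1) (x*y)*bessel_J (al + 1) (z*y))
   + k*y*(bessel_J al (x*y)*bessel_J al (z*y) - bessel_J (al + 2) (x*y)*bessel_J (al + 2) (z*y))*(y powr (- mu)*bessel_J mu (t*y)) = D y"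
  proof -
   have "(- t*Y*b)*(c*d) + k*y*(e*f - g*h)*(Y*a) = k*(a*e*f*(Y*y) - a*g*h*(Y*y)) - t*(b*c*d*Y)" for Y a b c d e f g h
    by (simp add: algebra_simps)
   then show ?thesis unfolding D_def bessel_triple_def yy [symmetric] by (simp only: add.assoc diff_diff_eq) (simp add: algebra_simps)
  qed
  finally show ?thesis .
 qed
 have hG: "(D has_integral G R - G 0) {0..R}"
 proof (rule fundamental_theorem_of_calculus_interior)
  show "(G has_vector_derivative D y) (at y)" if "y \<in> {0<..<R}" for y
  proof -
   have "(G has_real_derivative D y) (at y)"
    by (rule has_field_derivative_transform_within_open [OF der, of y "{0<..}"]) (use that in \<open>auto simp: G_def\<close>)
   then show ?thesis by (simp add: has_real_derivative_iff_has_vector_derivative)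
  qed
  show "continuous_on {0..R} G"
  proof (rule continuous_on_eq_continuous_within [THEN iffD2, rule_format])
   fix y assume y: "y \<in> {0..R}"
   show "continuous (at y within {0..R}) G"
   proof (cases "y = 0")
    case False
    have "(G has_real_derivative D y) (at y)"
     by (rule has_field_derivative_transform_within_open [OF der, of y "{0<..}"]) (use y False in \<open>auto simp: G_def\<close>)
    then show ?thesis by (rule continuous_at_imp_continuous_at_within [OF DERIV_isCont])
   next
    case True
    obtain C where C: "C \<ge> 0" "\<And>v. 0 < v ==> v \<le> t * R ==> abs (bessel_J mu v) \<le> C * v powr mu"
     using bessel_J_bound_small [of "t * R" mu] pos R by auto
    obtain E where E: "E \<ge> 0" "\<And>v. 0 < v ==> v \<le> (x + z) * R ==> abs (bessel_J (al + 1) v) \<le> E * v powr (al + 1)"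
     using bessel_J_bound_small [of "(x + z) * R" "al + 1"] pos R by auto
    define M where "M = C*t powr mu*(E*x powr (al + 1))*(E*z powr (al + 1))"
    have Gb: "abs (G v) \<le> M * v powr (2*(al + 1))" if v: "v \<in> {0..R}" "v \<noteq> 0" for v
    proof -
     have vp: "v > 0" "v \<le> R" using v by auto
     have 1: "abs (bessel_J mu (t * v)) \<le> C*t powr mu * v powr mu"
      using C(2) [of "t * v"] vp pos by (simp add: powr_mult mult_ac)
     have 2: "abs (bessel_J (al + 1) (u * v)) \<le> E*u powr (al + 1) * v powr (al + 1)" if u: "u > 0" "u \<le> x + z" for u
     proof -
      have "abs (bessel_J (al + 1) (u * v)) \<le> E*(u * v) powr (al + 1)" using u vp by (intro E mult_mono) auto
      then show ?thesis using u vp by (simp add: powr_mult mult_ac)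
     qed
     have "abs (G v) = v powr (- mu)*(abs (bessel_J mu (t * v))*(abs (bessel_J (al + 1) (x * v))*abs (bessel_J (al + 1) (z * v))))"
      using vp by (simp add: G_def F_def abs_mult)
     also have "... \<le> v powr (- mu)*((C*t powr mu * v powr mu)*((E*x powr (al + 1) * v powr (al + 1))*(E*z powr (al + 1) * v powr (al + 1))))"
      using C(1) E(1) pos by (intro mult_left_mono mult_mono 1 2 mult_nonneg_nonneg) auto
     also have "... = M*(v powr (- mu) * v powr mu * v powr (al + 1) * v powr (al + 1))"
      unfolding M_def by (simp only: mult_ac)
     also have "v powr (- mu) * v powr mu * v powr (al + 1) * v powr (al + 1) = v powr (2*(al + 1))"
     proof -
      have "2*(al + 1) = - mu + mu + (al + 1) + (al + 1)" by simp
      then show ?thesis by (simp only: powr_add)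
     qed
     finally show ?thesis .
    qed
    have "(G \<longlongrightarrow> 0) (at 0 within {0..R})"
    proof (rule Lim_null_comparison)
     show "\<forall>\<^sub>F v in at 0 within {0..R}. norm (G v) \<le> M * v powr (2*(al + 1))"
      unfolding eventually_at_filter using Gb by (intro always_eventually) auto
     have "continuous_on {0..R} (\<lambda>v. M * v powr (2*(al + 1)))"
      using al by (intro continuous_intros continuous_on_powr') auto
     from this [unfolded continuous_on_def, rule_format, of 0] R
     show "((\<lambda>v. M * v powr (2*(al + 1))) \<longlongrightarrow> 0) (at 0 within {0..R})" by simp
    qed
    then show ?thesis unfolding True continuous_within by (simp add: G_def)
   qed
  qed
 qed (use R in simp)
 have i1: "set_integrable lborel {0<..R} (bessel_triple mu al t x z)" using al pos by (intro bessel_triple_integrable)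
 have i2: "set_integrable lborel {0<..R} (bessel_triple mu (al + 2) t x z)" using al pos by (intro bessel_triple_integrable) auto
 have i3: "set_integrable lborel {0<..R} (bessel_triple (mu + 1) (al + 1) t x z)" using al pos by (intro bessel_triple_integrable) auto
 have i12: "set_integrable lborel {0<..R} (\<lambda>y. k*(bessel_triple mu al t x z y - bessel_triple mu (al + 2) t x z y))"
  by (intro set_integrable_mult_right set_integral_diff(1) i1 i2)
 have i3': "set_integrable lborel {0<..R} (\<lambda>y. t*bessel_triple (mu + 1) (al + 1) t x z y)"
  by (intro set_integrable_mult_right i3)
 have iD: "set_integrable lborel {0<..R} D" unfolding D_def by (intro set_integral_diff(1) i12 i3')
 have vD: "(LBINT y:{0<..R}. D y) = k*(bessel_truncated mu al t x z R - bessel_truncated mu (al + 2) t x z R) - t*bessel_truncated (mu + 1) (al + 1) t x z R"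
  unfolding D_def bessel_truncated_def set_integral_diff(2) [OF i12 i3'] set_integral_mult_right set_integral_diff(2) [OF i1 i2] by (rule refl)
 have "(LBINT y:{0<..R}. D y) = integral {0<..R} D" by (rule set_borel_integral_eq_integral(2) [OF iD])
 also have "... = G R"
 proof -
  have "(D has_integral G R) {0..R}" using hG by (simp add: G_def)
  then have "(D has_integral G R) {0<..R}"
   by (subst has_integral_spike_set_eq [where T="{0..R}"])
    (auto intro: negligible_subset [of "{0}"])
  then show ?thesis by (rule integral_unique)
 qed
 finally have "k*(bessel_truncated mu al t x z R - bessel_truncated mu (al + 2) t x z R) = F R + t*bessel_truncated (mu + 1) (al + 1) t x z R"
  unfolding vD using R by (simp add: G_def)
 then have "bessel_truncated mu al t x z R - bessel_truncated mu (al + 2) t x z R = 1/k*(F R + t*bessel_truncated (mu + 1) (al + 1) t x z R)"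
  using k by (simp add: field_simps)
 moreover have "1/k = 2*(al + 1)/(x*z)" by (simp add: k_def)
 ultimately show ?thesis unfolding F_def by simp
qed

text \<open>al + 2 with be - 2 keeps mu = al + be; al + 1 with be raises it by one. The boundary
  term of \<open>bessel_truncated_lowering\<close> has disappeared in the limit, being O(R powr
  (-(mu + 3/2))).\<close>

definition bessel_triple_limit_value :: "real => real => real => real => real => real" where
 "bessel_triple_limit_value al be t x z =
  (if al > -1/2 then bessel_triple_value al be t x z
   else bessel_triple_value (al + 2) (be - 2) t x z + 2*(al + 1)/(x*z)*(t*bessel_triple_value (al + 1) be t x z))"

lemma bessel_truncated_limit:
 assumes al: "al > -1" and mu: "al + be > -1/2" and pos: "t > 0" "x > 0" "z > 0" and ne: "t \<noteq> abs (x - z)" "t \<noteq> x + z"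
 shows "(bessel_truncated (al + be) al t x z \<longlongrightarrow> bessel_triple_limit_value al be t x z) at_top"
proof (cases "al > -1/2")
 case True
 then show ?thesis using bessel_triple_limit [OF True mu pos(2,3,1) ne] by (simp add: bessel_triple_limit_value_def)
next
 case False
 define mu' where "mu' = al + be"
 have l1: "(bessel_truncated mu' (al + 2) t x z \<longlongrightarrow> bessel_triple_value (al + 2) (be - 2) t x z) at_top"
  using bessel_triple_limit [of "al + 2" "be - 2" x z t] al mu pos ne by (simp add: mu'_def)
 have l2: "(bessel_truncated (mu' + 1) (al + 1) t x z \<longlongrightarrow> bessel_triple_value (al + 1) be t x z) at_top"
  using bessel_triple_limit [of "al + 1" be x z t] al mu pos ne by (simp add: mu'_def add_ac)
 have bnd: "((\<lambda>R. R powr (- mu')*bessel_J mu' (t * R)*(bessel_J (al + 1) (x * R)*bessel_J (al + 1) (z * R))) \<longlongrightarrow> 0) at_top"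
 proof -
  define m where "m = min t (min x z)"
  have m: "m > 0" using pos by (simp add: m_def)
  obtain C where C: "C \<ge> 0" "\<And>v. v \<ge> m ==> abs (bessel_J mu' v) \<le> C/sqrt v"
   using bessel_J_bound_large [OF m, of mu'] by auto
  obtain E where E: "E \<ge> 0" "\<And>v. v \<ge> m ==> abs (bessel_J (al + 1) v) \<le> E/sqrt v"
   using bessel_J_bound_large [OF m, of "al + 1"] by auto
  define M where "M = C/sqrt t*(E/sqrt x*(E/sqrt z))"
  show ?thesis
  proof (rule Lim_null_comparison)
   show "\<forall>\<^sub>F R in at_top. norm (R powr (- mu')*bessel_J mu' (t * R)*(bessel_J (al + 1) (x * R)*bessel_J (al + 1) (z * R)))
     \<le> M * R powr (- (mu' + 3/2))"
   proof (rule eventually_mono [OF eventually_ge_at_top [of 1]])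
    fix R :: real assume R: "R \<ge> 1"
    have ge: "u * R \<ge> m" if "u \<ge> m" for u
     using that R m mult_mono [of m u 1 R] by simp
    have 1: "abs (bessel_J mu' (t * R)) \<le> C/sqrt t*(1/sqrt R)"
     using C(2) [OF ge [of t]] by (simp add: m_def real_sqrt_mult)
    have 2: "abs (bessel_J (al + 1) (x * R)) \<le> E/sqrt x*(1/sqrt R)" "abs (bessel_J (al + 1) (z * R)) \<le> E/sqrt z*(1/sqrt R)"
     using E(2) [OF ge [of x]] E(2) [OF ge [of z]] by (simp_all add: m_def real_sqrt_mult)
    have "norm (R powr (- mu')*bessel_J mu' (t * R)*(bessel_J (al + 1) (x * R)*bessel_J (al + 1) (z * R)))
     = R powr (- mu')*(abs (bessel_J mu' (t * R))*(abs (bessel_J (al + 1) (x * R))*abs (bessel_J (al + 1) (z * R))))"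
     by (simp add: abs_mult)
    also have "... \<le> R powr (- mu')*((C/sqrt t*(1/sqrt R))*((E/sqrt x*(1/sqrt R))*(E/sqrt z*(1/sqrt R))))"
     using C(1) E(1) pos R by (intro mult_left_mono mult_mono 1 2 mult_nonneg_nonneg) auto
    also have "... = M*(R powr (- mu')*(1/sqrt R*(1/sqrt R*(1/sqrt R))))"
     unfolding M_def by (simp only: mult_ac)
    also have "R powr (- mu')*(1/sqrt R*(1/sqrt R*(1/sqrt R))) = R powr (- (mu' + 3/2))"
    proof -
     have s: "1/sqrt R = R powr (- 1/2)" using R by (simp add: powr_minus_divide powr_half_sqrt)
     have "- (mu' + 3/2) = - mu' + (- 1/2 + (- 1/2 + - 1/2))" by simp
     then show ?thesis unfolding s by (simp only: powr_add)
    qed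
    finally show "norm (R powr (- mu')*bessel_J mu' (t * R)*(bessel_J (al + 1) (x * R)*bessel_J (al + 1) (z * R)))
     \<le> M * R powr (- (mu' + 3/2))" .
   qed
   have "((\<lambda>R. R powr (- (mu' + 3/2))) \<longlongrightarrow> 0) at_top"
    using mu by (intro tendsto_neg_powr filterlim_ident) (auto simp: mu'_def)
   from tendsto_mult_left [OF this, of M] show "((\<lambda>R. M * R powr (- (mu' + 3/2))) \<longlongrightarrow> 0) at_top" by simp
  qed
 qed
 have "((\<lambda>R. bessel_truncated mu' (al + 2) t x z R +
   2*(al + 1)/(x*z)*(R powr (- mu')*bessel_J mu' (t * R)*(bessel_J (al + 1) (x * R)*bessel_J (al + 1) (z * R))
    + t*bessel_truncated (mu' + 1) (al + 1) t x z R)) \<longlongrightarrow>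
   bessel_triple_value (al + 2) (be - 2) t x z + 2*(al + 1)/(x*z)*(0 + t*bessel_triple_value (al + 1) be t x z)) at_top"
  by (intro tendsto_add tendsto_mult l1 l2 bnd tendsto_const)
 then have "(bessel_truncated mu' al t x z \<longlongrightarrow>
   bessel_triple_value (al + 2) (be - 2) t x z + 2*(al + 1)/(x*z)*(0 + t*bessel_triple_value (al + 1) be t x z)) at_top"
  by (rule Lim_transform_eventually)
    (use bessel_truncated_lowering [OF al pos, of _ mu'] in \<open>auto intro: eventually_mono [OF eventually_gt_at_top [of 0]]\<close>)
 then show ?thesis using False by (simp add: bessel_triple_limit_value_def mu'_def)
qed

section \<open>Closed form, continuity and homogeneity of the kernel\<close>

lemma kernel_K_eq:
 assumes "al > -1" "al + be > -1/2" "t > 0" "x > 0" "z > 0" "t \<noteq> abs (x - z)" "t \<noteq> x + z"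
 shows "kernel_K al be t x z =
   2 powr (al + be)*Gamma (al + be + 1)/(t powr (al + be)*(x*z) powr al)*bessel_triple_limit_value al be t x z"
proof -
 have "Lim at_top (bessel_truncated (al + be) al t x z) = bessel_triple_limit_value al be t x z"
  using bessel_truncated_limit [OF assms] by (intro tendsto_Lim) auto
 moreover have "(\<lambda>R. LBINT y:{0<..R}. bessel_J (al + be) (t*y)*bessel_J al (x*y)*bessel_J al (z*y)*y powr (1 - al - be))
   = bessel_truncated (al + be) al t x z"
  unfolding bessel_truncated_def [abs_def] bessel_triple_def diff_diff_eq by (rule refl)
 ultimately show ?thesis unfolding kernel_K_def by (simp only:)
qed

text \<open>Taken from the series directly, because \<open>DERIV_legendre_Phi\<close> yields
  differentiability, hence continuity, only where al + be > 1/2.\<close>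

lemma isCont_legendre_Phi:
 assumes al: "al > -1" and c: "al + be + 1/2 > 0" and A: "A \<noteq> 1" "A \<noteq> -1"
 shows "isCont (legendre_Phi al be) A"
proof -
 have ser: "isCont (\<lambda>v. \<Sum>k. a k * v ^ k) v" if "\<And>k. abs (a k) \<le> C*(pochhammer si k/fact k)" "abs v < 1" for a C si and v :: real
  using DERIV_power_series_times [OF power_series_binomial_bound(1) [OF that(1)] that(2)] DERIV_isCont by blast
 consider "A < -1" | "-1 < A" "A < 1" | "A > 1" using A by linarith
 then show ?thesis
 proof cases
  case 1
  have "\<forall>\<^sub>F y in nhds A. y \<in> {..<-1}" using 1 by (intro eventually_nhds_in_open) auto
  then have "\<forall>\<^sub>F y in nhds A. legendre_Phi al be y = 0" by eventually_elim (simp add: legendre_Phi_def)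
  then show ?thesis by (subst isCont_cong) auto
 next
  case 2
  obtain C where C: "\<And>k. abs (inner_coeff al (al + be + 1/2) k) \<le> C*(pochhammer 1 k/fact k)"
   using inner_coeff_bound [of "al + be + 1/2" 1 al] c by auto
  have "\<forall>\<^sub>F y in nhds A. y \<in> {-1<..<1}" using 2 by (intro eventually_nhds_in_open) auto
  then have e: "\<forall>\<^sub>F y in nhds A. legendre_Phi al be y = 2 powr (al - 1/2)*Gamma (al + 1/2)*(1 + y) powr (al + be - 1/2) *
    (\<Sum>k. inner_coeff al (al + be + 1/2) k*((1 + y)/2) ^ k)"
   by eventually_elim (simp add: legendre_Phi_def)
  have "isCont (\<lambda>y. \<Sum>k. inner_coeff al (al + be + 1/2) k*((1 + y)/2) ^ k) A"
   by (rule isCont_o2 [where g="\<lambda>v. \<Sum>k. inner_coeff al (al + be + 1/2) k * v ^ k"]) (use 2 in \<open>auto intro!: continuous_intros ser C\<close>)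
  then show ?thesis using 2 by (subst isCont_cong [OF e]) (intro continuous_intros, auto)
 next
  case 3
  have "\<exists>C\<ge>0. \<forall>k. abs (outer_coeff al be k) \<le> C*(pochhammer (abs (1/2 - al - be) + 1) k/fact k)"
   by (intro outer_coeff_bound al) auto
  then obtain C where C: "\<And>k. abs (outer_coeff al be k) \<le> C*(pochhammer (abs (1/2 - al - be) + 1) k/fact k)"
   by blast
  have "\<forall>\<^sub>F y in nhds A. y \<in> {1<..}" using 3 by (intro eventually_nhds_in_open) auto
  then have e: "\<forall>\<^sub>F y in nhds A. legendre_Phi al be y = gegenbauer_moment al 0*y powr (be - 1)*(\<Sum>k. outer_coeff al be k*(1/y^2) ^ k)"
   by eventually_elim (simp add: legendre_Phi_def)
  have w: "abs (1/A^2) < 1" using 3 by (auto simp: power2_eq_square less_1_mult)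
  have "isCont (\<lambda>y. \<Sum>k. outer_coeff al be k*(1/y^2) ^ k) A"
   by (rule isCont_o2 [where g="\<lambda>v. \<Sum>k. outer_coeff al be k * v ^ k"]) (use 3 w in \<open>auto intro!: continuous_intros ser C\<close>)
  then show ?thesis using 3 by (subst isCont_cong [OF e]) (intro continuous_intros, auto)
 qed
qed

definition kernel_domain :: "(real \<times> real \<times> real) set" where
 "kernel_domain = {(t, x, z). 0 < t \<and> 0 < x \<and> 0 < z \<and> t \<noteq> abs (x - z) \<and> t \<noteq> x + z}"

lemma continuous_on_bessel_triple_value:
 assumes al: "al > -1" and c: "al + be + 1/2 > 0"
 shows "continuous_on kernel_domain (\<lambda>(t, x, z). bessel_triple_value al be t x z)"
proof -
 have "continuous_on {A. A \<noteq> 1 \<and> A \<noteq> -1} (legendre_Phi al be)"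
  by (intro continuous_at_imp_continuous_on ballI isCont_legendre_Phi al c) auto
 then have "continuous_on kernel_domain (\<lambda>w. legendre_Phi al be (((fst w)^2 - (fst (snd w))^2 - (snd (snd w))^2)/(2*fst (snd w) * snd (snd w))))"
 proof (rule continuous_on_compose2)
  show "continuous_on kernel_domain (\<lambda>w. ((fst w)^2 - (fst (snd w))^2 - (snd (snd w))^2)/(2*fst (snd w) * snd (snd w)))"
   by (intro continuous_intros) (auto simp: kernel_domain_def)
  show "(\<lambda>w. ((fst w)^2 - (fst (snd w))^2 - (snd (snd w))^2)/(2*fst (snd w) * snd (snd w))) ` kernel_domain \<subseteq> {A. A \<noteq> 1 \<and> A \<noteq> -1}"
  proof (intro image_subsetI)
   fix w assume "w \<in> kernel_domain"
   then show "((fst w)^2 - (fst (snd w))^2 - (snd (snd w))^2)/(2*fst (snd w) * snd (snd w)) \<in> {A. A \<noteq> 1 \<and> A \<noteq> -1}"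
    using legendre_argument(2,4) [of "fst w" "fst (snd w)" "snd (snd w)"] unfolding kernel_domain_def by auto
  qed
 qed
 then show ?thesis
  unfolding bessel_triple_value_def case_prod_unfold
  by (intro continuous_intros) (auto simp: kernel_domain_def)
qed

lemma continuous_on_kernel_K:
 assumes al: "al > -1" and mu: "al + be > -1/2"
 shows "continuous_on kernel_domain (\<lambda>(t, x, z). kernel_K al be t x z)"
proof -
 have L: "continuous_on kernel_domain (\<lambda>(t, x, z). bessel_triple_limit_value al be t x z)"
 proof (cases "al > -1/2")
  case True
  then show ?thesis using continuous_on_bessel_triple_value [of al be] al mu by (simp add: bessel_triple_limit_value_def)
 next
  case False
  have "continuous_on kernel_domain (\<lambda>w. (case w of (t, x, z) => bessel_triple_value (al + 2) (be - 2) t x z) +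
    2*(al + 1)/(fst (snd w) * snd (snd w))*(fst w*(case w of (t, x, z) => bessel_triple_value (al + 1) be t x z)))"
   using al mu by (intro continuous_intros continuous_on_bessel_triple_value) (auto simp: kernel_domain_def)
  then show ?thesis using False by (simp add: bessel_triple_limit_value_def case_prod_unfold)
 qed
 have "continuous_on kernel_domain (\<lambda>w. 2 powr (al + be)*Gamma (al + be + 1)/((fst w) powr (al + be)*(fst (snd w) * snd (snd w)) powr al) *
   (case w of (t, x, z) => bessel_triple_limit_value al be t x z))"
  by (intro continuous_intros L) (auto simp: kernel_domain_def)
 then show ?thesis
  by (rule continuous_on_eq) (auto simp: kernel_domain_def kernel_K_eq [OF al mu])
qed

lemma bessel_triple_value_scale:
 assumes "r > 0" "t > 0" "x > 0" "z > 0"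
 shows "bessel_triple_value al be (r*t) (r*x) (r*z) = r powr (al + be - 2)*bessel_triple_value al be t x z"
proof -
 have A: "((r*t)^2 - (r*x)^2 - (r*z)^2)/(2*(r*x)*(r*z)) = (t^2 - x^2 - z^2)/(2*x*z)"
 proof -
  have "((r*t)^2 - (r*x)^2 - (r*z)^2) = r^2*(t^2 - x^2 - z^2)" "2*(r*x)*(r*z) = r^2*(2*x*z)"
   by (simp_all add: power2_eq_square algebra_simps)
  then show ?thesis using assms by (metis mult_divide_mult_cancel_left power_not_zero less_irrefl)
 qed
 have e: "(r*x)*(r*z) = r*(r*(x*z))" by simp
 have "r powr (al + be - 2) = r powr (- (al + be))*(r powr (al + be - 1)*r powr (al + be - 1))"
  unfolding powr_add [symmetric] by (simp add: algebra_simps)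
 then show ?thesis
  unfolding bessel_triple_value_def A e using assms by (simp add: powr_mult)
qed

lemma kernel_K_scale:
 assumes al: "al > -1" and mu: "al + be > -1/2" and pos: "r > 0" "t > 0" "x > 0" "z > 0" and ne: "t \<noteq> abs (x - z)" "t \<noteq> x + z"
 shows "kernel_K al be (r*t) (r*x) (r*z) = r powr (- 2*al - 2) * kernel_K al be t x z"
proof -
 have ne': "r*t \<noteq> abs (r*x - r*z)" "r*t \<noteq> r*x + r*z"
  using ne pos by (auto simp: abs_mult right_diff_distrib [symmetric] distrib_left [symmetric])
 have V: "bessel_triple_limit_value al be (r*t) (r*x) (r*z) = r powr (al + be - 2)*bessel_triple_limit_value al be t x z"
 proof (cases "al > -1/2")
  case True
  then show ?thesis using pos by (simp add: bessel_triple_limit_value_def bessel_triple_value_scale)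
 next
  case False
  have p: "r powr (al + be - 2) = r powr (al + be - 1)/r" using pos by (simp add: powr_diff power2_eq_square)
  have s: "al + 2 + (be - 2) - 2 = al + be - 2" "al + 1 + be - 2 = al + be - 1" by simp_all
  have "a/r*U + k/(r*x*(r*z))*(r*t*(a*V)) = a/r*(U + k/(x*z)*(t*V))" for a k U V
   using pos by (simp add: field_simps)
  from this [of "r powr (al + be - 1)"] show ?thesis using False pos
   unfolding bessel_triple_limit_value_def bessel_triple_value_scale [OF pos] s p by simp
 qed
 have e: "(r*x)*(r*z) = r*(r*(x*z))" by simp
 have "r powr (- 2*al - 2) = r powr (al + be - 2)/(r powr (al + be)*(r powr al*r powr al))"
  using pos unfolding powr_add [symmetric] powr_diff [symmetric] by simp
 then show ?thesis
  unfolding kernel_K_eq [OF al mu mult_pos_pos [OF pos(1,2)] mult_pos_pos [OF pos(1,3)] mult_pos_pos [OF pos(1,4)] ne']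
   kernel_K_eq [OF al mu pos(2-4) ne] V e using pos by (simp add: powr_mult mult_ac)
qed

section \<open>Kernel bounds\<close>

text \<open>si is a free exponent instead of the exact order at A = 1, where
  \<open>legendre_Phi\<close> is at worst like |1 - A| powr (al + be - 1/2), logarithmic, or
  bounded, according to whether al + be is below, at or above 1/2.\<close>

definition legendre_majorant :: "real => real => real => real => real" where
 "legendre_majorant al be si A =
  (if A < -1 then 0
   else if A < 1 then ((1 + A)/2) powr (al + be - 1/2)*((1 - A)/2) powr (- si)
   else if - be \<in> \<nat> then 0 else A powr (be - 1)*(1 - 1/A^2) powr (- si))"

lemma legendre_majorant_nonneg: "legendre_majorant al be si A \<ge> 0"
 by (simp add: legendre_majorant_def)

lemma legendre_Phi_bound:
 assumes al: "al > -1" and c: "al + be + 1/2 > 0" and si: "si > 0" "si \<ge> 1/2 - al - be"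
 obtains C where "C \<ge> 0" "\<And>A. abs A \<noteq> 1 ==> abs (legendre_Phi al be A) \<le> C*legendre_majorant al be si A"
proof -
 obtain C1 where C1: "C1 \<ge> 0" "\<And>n. abs (inner_coeff al (al + be + 1/2) n) \<le> C1*(pochhammer si n/fact n)"
  using inner_coeff_bound [of "al + be + 1/2" si al] c si by auto
 obtain C2 where C2: "C2 \<ge> 0" "\<And>n. abs (outer_coeff al be n) \<le> C2*(pochhammer si n/fact n)"
  using outer_coeff_bound [of al si be] al si by auto
 define K1 where "K1 = abs (2 powr (al - 1/2)*Gamma (al + 1/2))*(2 powr (al + be - 1/2)*C1)"
 define K2 where "K2 = abs (gegenbauer_moment al 0)*C2"
 have K0: "K1 \<ge> 0" "K2 \<ge> 0" unfolding K1_def K2_def using C1(1) C2(1) by auto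
 have 1: "abs (legendre_Phi al be A) \<le> K1*(((1 + A)/2) powr (al + be - 1/2)*((1 - A)/2) powr (- si))"
  if A: "-1 < A" "A < 1" for A
 proof -
  define v where "v = (1 + A)/2"
  have v: "0 < v" "v < 1" "(1 - A)/2 = 1 - v" "1 + A = 2 * v" using A by (auto simp: v_def field_simps)
  define S where "S = (\<Sum>n. inner_coeff al (al + be + 1/2) n * v ^ n)"
  have "abs S \<le> C1*(1 - v) powr (- si)"
   unfolding S_def using v by (intro power_series_binomial_bound(2) [OF C1(2)]) auto
  then have "abs (2 powr (al - 1/2)*Gamma (al + 1/2))*(2 powr (al + be - 1/2) * v powr (al + be - 1/2))*abs S
    \<le> abs (2 powr (al - 1/2)*Gamma (al + 1/2))*(2 powr (al + be - 1/2) * v powr (al + be - 1/2))*(C1*(1 - v) powr (- si))"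
   by (intro mult_left_mono) auto
  moreover have "legendre_Phi al be A = 2 powr (al - 1/2)*Gamma (al + 1/2)*(2 powr (al + be - 1/2) * v powr (al + be - 1/2))*S"
   using A v by (simp add: legendre_Phi_def S_def powr_mult)
  ultimately show ?thesis unfolding v(3) v_def [symmetric] K1_def by (simp add: abs_mult mult_ac)
 qed
 have 2: "abs (legendre_Phi al be A) \<le> K2*(A powr (be - 1)*(1 - 1/A^2) powr (- si))" if A: "1 < A" for A
 proof -
  define w where "w = 1/A^2"
  have w: "0 < w" "w < 1" using A by (auto simp: w_def power2_eq_square less_1_mult)
  define S where "S = (\<Sum>n. outer_coeff al be n*w ^ n)"
  have "abs S \<le> C2*(1 - w) powr (- si)"
   unfolding S_def using w by (intro power_series_binomial_bound(2) [OF C2(2)]) auto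
  then have "abs (gegenbauer_moment al 0)*A powr (be - 1)*abs S \<le> abs (gegenbauer_moment al 0)*A powr (be - 1)*(C2*(1 - w) powr (- si))"
   by (intro mult_left_mono) auto
  moreover have "legendre_Phi al be A = gegenbauer_moment al 0*A powr (be - 1)*S"
   using A by (simp add: legendre_Phi_def S_def w_def)
  ultimately show ?thesis unfolding w_def [symmetric] K2_def by (simp add: abs_mult mult_ac)
 qed
 have 3: "legendre_Phi al be A = 0" if A: "1 < A" and n: "- be \<in> \<nat>" for A
 proof -
  obtain m where m: "- be = real m" using n by (auto elim: Nats_cases)
  have "rGamma (be - 2*real j) = 0" for j
  proof -
   have "be - 2*real j = - real (m + 2*j)" using m by simp
   then show ?thesis unfolding rGamma_eq_zero_iff by (metis minus_of_nat_in_nonpos_Ints)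
  qed
  then show ?thesis using A by (simp add: legendre_Phi_def outer_coeff_def)
 qed
 have "abs (legendre_Phi al be A) \<le> max K1 K2*legendre_majorant al be si A" if "abs A \<noteq> 1" for A
 proof -
  have m: "p \<le> max K1 K2*q" if "p \<le> K1*q \<or> p \<le> K2*q" "q \<ge> 0" for p q :: real
   using that mult_right_mono [of K1 "max K1 K2" q] mult_right_mono [of K2 "max K1 K2" q] by auto
  consider "A < -1" | "-1 < A" "A < 1" | "1 < A" using \<open>\<bar>A\<bar> \<noteq> 1\<close> by linarith
  then show ?thesis
  proof cases
   case 1 then show ?thesis by (simp add: legendre_Phi_def legendre_majorant_def)
  next
   case 2 with 1 [OF 2] show ?thesis by (intro m legendre_majorant_nonneg) (simp add: legendre_majorant_def)
  next
   case 3 with 2 [OF 3] \<open>1 < A ==> - be \<in> \<nat> ==> legendre_Phi al be A = 0\<close> show ?thesis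
    by (intro m legendre_majorant_nonneg) (auto simp: legendre_majorant_def)
  qed
 qed
 then show thesis using that [of "max K1 K2"] K0 by simp
qed

lemma bessel_triple_value_bound:
 assumes al: "al > -1" and c: "al + be + 1/2 > 0" and si: "si > 0" "si \<ge> 1/2 - al - be"
 obtains C where "C \<ge> 0" "\<And>t z. abs ((t^2 - 1 - z^2)/(2*z)) \<noteq> 1 ==> abs (bessel_triple_value al be t 1 z) \<le>
  C*(t powr (- (al + be))*z powr (al + be - 1)*legendre_majorant al be si ((t^2 - 1 - z^2)/(2*z)))"
proof -
 define k where "k = abs (2 powr (- al)/(gegenbauer_moment al 0*Gamma (al + 1)))"
 obtain C where C: "C \<ge> 0" "\<And>A. abs A \<noteq> 1 ==> abs (legendre_Phi al be A) \<le> C*legendre_majorant al be si A"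
  using legendre_Phi_bound [OF assms] by blast
 have "abs (bessel_triple_value al be t 1 z) \<le>
  k*C*(t powr (- (al + be))*z powr (al + be - 1)*legendre_majorant al be si ((t^2 - 1 - z^2)/(2*z)))"
  if "abs ((t^2 - 1 - z^2)/(2*z)) \<noteq> 1" for t z
 proof -
  have "abs (bessel_triple_value al be t 1 z) = k*t powr (- (al + be))*z powr (al + be - 1)*abs (legendre_Phi al be ((t^2 - 1 - z^2)/(2*z)))"
   unfolding bessel_triple_value_def k_def by (simp add: abs_mult)
  also have "... \<le> k*t powr (- (al + be))*z powr (al + be - 1)*(C*legendre_majorant al be si ((t^2 - 1 - z^2)/(2*z)))"
   by (intro mult_left_mono C(2) that) (simp add: k_def)
  finally show ?thesis by (simp only: mult_ac)
 qed
 then show thesis using that [of "k*C"] C(1) by (simp add: k_def)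
qed

text \<open>For al <= -1/2 both summands of \<open>bessel_triple_limit_value\<close> fit under the
  majorant for (al, be): with the changed parameters the inner exponent does not decrease, the outer
  one does not increase, and si stays admissible because al + be never decreases.\<close>

lemma kernel_K_bound:
 assumes al: "al > -1" and mu: "al + be > -1/2" and si: "si > 0" "si \<ge> 1/2 - al - be"
 obtains C where "C \<ge> 0" "\<And>t z. 0 < t ==> 0 < z ==> t \<noteq> abs (1 - z) ==> t \<noteq> 1 + z ==>
  abs (kernel_K al be t 1 z) \<le> C*(t powr (- 2*(al + be))*z powr (be - 1)*legendre_majorant al be si ((t^2 - 1 - z^2)/(2*z)))"
proof -
 let ?A = "\<lambda>t z::real. (t^2 - 1 - z^2)/(2*z)"
 let ?P = "\<lambda>t z. t powr (- (al + be))*z powr (al + be - 1)*legendre_majorant al be si (?A t z)"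
 have "\<exists>C\<ge>0. \<forall>t z. 0 < t --> 0 < z --> abs (?A t z) \<noteq> 1 --> abs (bessel_triple_limit_value al be t 1 z) \<le> C*?P t z"
 proof (cases "al > -1/2")
  case True
  obtain C where "C \<ge> 0" "\<And>t z. abs (?A t z) \<noteq> 1 ==> abs (bessel_triple_value al be t 1 z) \<le> C*?P t z"
   using bessel_triple_value_bound [of al be si] al mu si by auto
  then show ?thesis using True by (intro exI [of _ C]) (simp add: bessel_triple_limit_value_def)
 next
  case False
  obtain C1 where C1: "C1 \<ge> 0" "\<And>t z. abs (?A t z) \<noteq> 1 ==> abs (bessel_triple_value (al + 2) (be - 2) t 1 z) \<le>
    C1*(t powr (- (al + 2 + (be - 2)))*z powr (al + 2 + (be - 2) - 1)*legendre_majorant (al + 2) (be - 2) si (?A t z))"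
   using bessel_triple_value_bound [of "al + 2" "be - 2" si] al mu si by auto
  obtain C2 where C2: "C2 \<ge> 0" "\<And>t z. abs (?A t z) \<noteq> 1 ==> abs (bessel_triple_value (al + 1) be t 1 z) \<le>
    C2*(t powr (- (al + 1 + be))*z powr (al + 1 + be - 1)*legendre_majorant (al + 1) be si (?A t z))"
   using bessel_triple_value_bound [of "al + 1" be si] al mu si by auto
  define k where "k = 2*(al + 1)"
  have k: "k > 0" using al by (simp add: k_def)
  \<comment> \<open>al <= -1/2 and al + be > -1/2 give be > 0, so the majorant for (al, be) is in
    its nonvanishing branch for A > 1.\<close>
  have notN: "- be \<notin> \<nat>" using False mu by (auto elim: Nats_cases)
  have m: "legendre_majorant (al + 2) (be - 2) si A \<le> legendre_majorant al be si A"
    "legendre_majorant (al + 1) be si A \<le> legendre_majorant al be si A" if A: "abs A \<noteq> 1" for A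
  proof -
   consider "A < -1" | "-1 < A" "A < 1" | "1 < A" using A by linarith
   then show "legendre_majorant (al + 2) (be - 2) si A \<le> legendre_majorant al be si A"
     "legendre_majorant (al + 1) be si A \<le> legendre_majorant al be si A"
    using notN by (cases; auto simp: legendre_majorant_def intro!: mult_right_mono intro: powr_mono powr_mono')+
  qed
  have "abs (bessel_triple_limit_value al be t 1 z) \<le> (C1 + k*C2)*?P t z"
   if pos: "0 < t" "0 < z" and A: "abs (?A t z) \<noteq> 1" for t z
  proof -
   let ?T = "t powr (- (al + be))*z powr (al + be - 1)"
   have T': "t powr (- (al + 1 + be))*z powr (al + 1 + be - 1) = ?T*(z/t)"
    using pos by (simp add: powr_minus_divide powr_add powr_diff)
   have "abs (bessel_triple_value (al + 2) (be - 2) t 1 z) \<le> C1*(?T*legendre_majorant (al + 2) (be - 2) si (?A t z))"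
    using C1(2) [OF A] by simp
   also have "... \<le> C1*?P t z" using m(1) [OF A] C1(1) by (intro mult_left_mono) auto
   finally have 1: "abs (bessel_triple_value (al + 2) (be - 2) t 1 z) \<le> C1*?P t z" .
   have "k/z*(t*abs (bessel_triple_value (al + 1) be t 1 z)) \<le>
     k/z*(t*(C2*(?T*(z/t)*legendre_majorant (al + 1) be si (?A t z))))"
    using C2(2) [OF A] k pos unfolding T' by (intro mult_left_mono) auto
   also have "... = k*(C2*(?T*legendre_majorant (al + 1) be si (?A t z)))" using pos by simp
   also have "... \<le> k*(C2*?P t z)" using m(2) [OF A] C2(1) k by (intro mult_left_mono) auto
   finally have 2: "k/z*(t*abs (bessel_triple_value (al + 1) be t 1 z)) \<le> k*(C2*?P t z)" .
   have "abs (bessel_triple_limit_value al be t 1 z) \<le>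
     abs (bessel_triple_value (al + 2) (be - 2) t 1 z) + k/z*(t*abs (bessel_triple_value (al + 1) be t 1 z))"
    using abs_triangle_ineq [of "bessel_triple_value (al + 2) (be - 2) t 1 z"] False k pos
    by (simp add: bessel_triple_limit_value_def k_def abs_mult order_trans [OF abs_triangle_ineq])
   with 1 2 show ?thesis unfolding distrib_right by linarith
  qed
  then show ?thesis using C1(1) C2(1) k by (intro exI [of _ "C1 + k*C2"]) auto
 qed
 then obtain C where C: "C \<ge> 0" "\<And>t z. 0 < t ==> 0 < z ==> abs (?A t z) \<noteq> 1 ==> abs (bessel_triple_limit_value al be t 1 z) \<le> C*?P t z"
  by blast
 define k where "k = abs (2 powr (al + be)*Gamma (al + be + 1))"
 have "abs (kernel_K al be t 1 z) \<le> k*C*(t powr (- 2*(al + be))*z powr (be - 1)*legendre_majorant al be si (?A t z))"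
  if pos: "0 < t" "0 < z" and ne: "t \<noteq> abs (1 - z)" "t \<noteq> 1 + z" for t z
 proof -
  have A: "abs (?A t z) \<noteq> 1"
   using legendre_argument(2,4) [of t 1 z] pos ne by (auto simp: abs_if split: if_splits)
  have "abs (kernel_K al be t 1 z) = k*(t powr (- (al + be))*z powr (- al))*abs (bessel_triple_limit_value al be t 1 z)"
   unfolding kernel_K_eq [OF al mu pos(1) zero_less_one pos(2) ne] k_def powr_minus_divide by (simp add: abs_mult)
  also have "... \<le> k*(t powr (- (al + be))*z powr (- al))*(C*?P t z)"
   by (intro mult_left_mono C(2) pos A) (simp add: k_def)
  also have "... = k*C*((t powr (- (al + be))*t powr (- (al + be)))*(z powr (- al)*z powr (al + be - 1))*legendre_majorant al be si (?A t z))"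
   by (simp only: mult_ac)
  finally show ?thesis unfolding powr_add [symmetric] by simp
 qed
 then show thesis using that [of "k*C"] C(1) by (simp add: k_def)
qed

section \<open>Pointwise bounds for the kernel at x = 1\<close>

lemma powr_le_comparable:
 fixes x k :: real
 assumes "1/k \<le> x" "x \<le> k" "k > 0"
 shows "x powr e \<le> k powr abs e"
proof (cases "e \<ge> 0")
 case True
 have "x > 0" using assms by (meson less_le_trans zero_less_divide_1_iff)
 then show ?thesis using powr_mono2 [OF True _ assms(2)] True by simp
next
 case False
 have "x powr e \<le> (1/k) powr e" using False assms by (intro powr_mono2') auto
 also have "... = k powr abs e" using assms False by (simp add: powr_divide powr_minus_divide abs_if)
 finally show ?thesis .
qed

lemma powr_mult_le_comparable:
 fixes x y k :: real
 assumes "y/k \<le> x" "x \<le> k*y" "k > 0" "y > 0"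
 shows "x powr e \<le> k powr abs e*y powr e"
proof -
 have "(x/y) powr e \<le> k powr abs e" using assms by (intro powr_le_comparable) (auto simp: field_simps)
 then have "(x/y) powr e*y powr e \<le> k powr abs e*y powr e" by (intro mult_right_mono) auto
 then show ?thesis unfolding powr_mult [symmetric] using assms by simp
qed

lemma powr_minus_antimono:
 fixes x y si :: real
 assumes "0 < x" "x \<le> y" "si > 0"
 shows "y powr (- si) \<le> x powr (- si)"
 using assms by (intro powr_mono2') auto

lemma kernel_argument_factor:
 fixes t z :: real
 assumes "z > 0"
 defines "A \<equiv> (t^2 - 1 - z^2)/(2*z)"
 shows "1 + A = (t - abs (1 - z))*(t + abs (1 - z))/(2*z)"
  "1 - A = (1 + z - t)*(1 + z + t)/(2*z)"
proof -
 have "abs (1 - z)*abs (1 - z) = (1 - z)*(1 - z)" by (simp add: abs_mult_self_eq)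
 then have e: "(t - abs (1 - z))*(t + abs (1 - z)) = t*t - (1 - z)*(1 - z)"
  by (simp add: algebra_simps)
 show "1 + A = (t - abs (1 - z))*(t + abs (1 - z))/(2*z)"
  unfolding e A_def using assms(1) by (simp add: field_simps power2_eq_square)
 show "1 - A = (1 + z - t)*(1 + z + t)/(2*z)"
  unfolding A_def using assms(1) by (simp add: field_simps power2_eq_square)
qed

text \<open>A product becomes a sum: close to A = 1 or A = -1 the other factor is bounded. Writing 2
  + A for A avoids a further singularity. If -be is a natural number, the majorant lives on A < 1,
  where 2 + A is comparable to 1, so ep is arbitrary; this freedom supplies the decay for be = 0 at
  the end point.\<close>

lemma legendre_majorant_le:
 assumes A: "-1 < A" "A \<noteq> 1" and si: "si > 0" "si \<ge> 1/2 - al - be" and ep: "ep = be - 1 \<or> - be \<in> \<nat>"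
 shows "legendre_majorant al be si A \<le> 3 powr abs ep*4 powr si*((2 + A) powr ep*(1 + (1 + A) powr (- si) + abs (1 - A) powr (- si)))"
  (is "_ \<le> _*_*(_*?L)")
proof -
 have m: "u * v \<le> 3 powr abs ep*4 powr si*((2 + A) powr ep*?L)"
  if "u \<le> 3 powr abs ep*(2 + A) powr ep" "v \<le> 4 powr si*?L" "v \<ge> 0" for u v
  using mult_mono [OF that(1,2)] that(3) by (simp add: mult_ac)
 have half: "u powr (- si) \<le> 2 powr si" if "u \<ge> 1/2" for u :: real
  using powr_minus_antimono [of "1/2" u si] that si by (simp add: powr_divide powr_minus_divide)
 have two: "(x/2) powr (- si) = 2 powr si*x powr (- si)" for x :: real
  by (simp add: powr_divide powr_minus_divide)
 have four: "(4::real) powr si = 2 powr si*2 powr si" by (simp flip: powr_mult)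
 show ?thesis
 proof (cases "A < 1")
  case True
  let ?v = "(1 + A)/2" let ?w = "(1 - A)/2"
  \<comment> \<open>The base is at most 1 and -si <= al + be - 1/2.\<close>
  have "?v powr (al + be - 1/2)*?w powr (- si) \<le> ?v powr (- si)*?w powr (- si)"
   using A True si by (intro mult_right_mono powr_mono') auto
  also have "... \<le> 2 powr si*(?v powr (- si) + ?w powr (- si))"
  proof (cases "A \<ge> 0")
   case True
   then have "?v powr (- si)*?w powr (- si) \<le> 2 powr si*?w powr (- si)" by (intro mult_right_mono half) auto
   also have "... \<le> 2 powr si*(?v powr (- si) + ?w powr (- si))" by (intro mult_left_mono) auto
   finally show ?thesis .
  next
   case False
   then have "?v powr (- si)*?w powr (- si) \<le> ?v powr (- si)*2 powr si" by (intro mult_left_mono half) auto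
   also have "... \<le> 2 powr si*(?v powr (- si) + ?w powr (- si))" by (simp add: algebra_simps)
   finally show ?thesis .
  qed
  also have "... = 4 powr si*((1 + A) powr (- si) + abs (1 - A) powr (- si))"
   unfolding two four using True by (simp add: algebra_simps)
  also have "... \<le> 4 powr si*?L" by (intro mult_left_mono) auto
  finally have "?v powr (al + be - 1/2)*?w powr (- si) \<le> 4 powr si*?L" .
  moreover have "1 \<le> 3 powr abs ep*(2 + A) powr ep"
   using powr_mult_le_comparable [of "2 + A" 3 1 ep] A True by simp
  ultimately show ?thesis using m [of 1] A True by (simp add: legendre_majorant_def)
 next
  case False
  then have A1: "A > 1" using A by simp
  have L: "1 + (A - 1) powr (- si) \<le> ?L" using A1 by simp
  have "1/A^2 \<le> 1/A" using A1 by (simp add: field_simps power2_eq_square)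
  moreover have "1 - 1/A = (A - 1)/A" using A1 by (simp add: field_simps)
  ultimately have "(1 - 1/A^2) powr (- si) \<le> ((A - 1)/A) powr (- si)"
   using A1 si by (intro powr_minus_antimono) auto
  also have "... \<le> 2 powr si*(1 + (A - 1) powr (- si))"
  proof (cases "A \<ge> 2")
   case True
   then have "((A - 1)/A) powr (- si) \<le> 2 powr si*1" using half [of "(A - 1)/A"] by (simp add: field_simps)
   also have "... \<le> 2 powr si*(1 + (A - 1) powr (- si))" by (intro mult_left_mono) auto
   finally show ?thesis .
  next
   case False
   have "((A - 1)/A) powr (- si) \<le> ((A - 1)/2) powr (- si)"
    using A1 False si by (intro powr_minus_antimono divide_left_mono) auto
   also have "... \<le> 2 powr si*(1 + (A - 1) powr (- si))" unfolding two by (intro mult_left_mono) auto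
   finally show ?thesis .
  qed
  also have "... \<le> 4 powr si*?L"
   using si by (intro mult_mono L powr_mono2) auto
  finally have "(1 - 1/A^2) powr (- si) \<le> 4 powr si*?L" .
  moreover have "A powr (be - 1) \<le> 3 powr abs (be - 1)*(2 + A) powr (be - 1)"
   using A1 by (intro powr_mult_le_comparable) auto
  ultimately show ?thesis using m [of "A powr (be - 1)"] A1 ep by (auto simp: legendre_majorant_def)
 qed
qed

text \<open>Homogeneity reduces the kernel to x = 1 (\<open>abs_kernel_S\<close>): with z = x y the
  operator is dominated by the integral over y of kernel_N (t/x) y times |f (x y)|, the density of
  the measure being included.\<close>

definition kernel_N :: "real => real => real => real => real" where
 "kernel_N al be t y = (if (t, 1, y) \<in> kernel_domain then abs (kernel_K al be t 1 y)*y powr (2*al + 1) else 0)"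

lemma kernel_N_nonneg [simp]: "kernel_N al be t y \<ge> 0"
 by (simp add: kernel_N_def)

lemma kernel_N_bound:
 assumes al: "al > -1" and mu: "al + be > -1/2" and si: "si > 0" "si \<ge> 1/2 - al - be"
 obtains C where "C \<ge> 0"
  "\<And>t y. (t, 1, y) \<in> kernel_domain ==> kernel_N al be t y \<le>
   C*(t powr (- 2*(al + be))*y powr (2*al + be)*legendre_majorant al be si ((t^2 - 1 - y^2)/(2*y)))"
  "\<And>t y. t \<le> abs (1 - y) ==> kernel_N al be t y = 0"
  "\<And>t y. - be \<in> \<nat> ==> 1 + y \<le> t ==> kernel_N al be t y = 0"
proof -
 obtain C where C: "C \<ge> 0" "\<And>t z. 0 < t ==> 0 < z ==> t \<noteq> abs (1 - z) ==> t \<noteq> 1 + z ==>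
  abs (kernel_K al be t 1 z) \<le> C*(t powr (- 2*(al + be))*z powr (be - 1)*legendre_majorant al be si ((t^2 - 1 - z^2)/(2*z)))"
  using kernel_K_bound [OF assms] by blast
 have b: "kernel_N al be t y \<le> C*(t powr (- 2*(al + be))*y powr (2*al + be)*legendre_majorant al be si ((t^2 - 1 - y^2)/(2*y)))"
  if d: "(t, 1, y) \<in> kernel_domain" for t y
 proof -
  have "kernel_N al be t y \<le> C*(t powr (- 2*(al + be))*y powr (be - 1)*legendre_majorant al be si ((t^2 - 1 - y^2)/(2*y)))*y powr (2*al + 1)"
   using d C(2) [of t y] by (auto simp: kernel_N_def kernel_domain_def intro!: mult_right_mono)
  also have "... = C*(t powr (- 2*(al + be))*(y powr (be - 1)*y powr (2*al + 1))*legendre_majorant al be si ((t^2 - 1 - y^2)/(2*y)))"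
   by (simp only: mult_ac)
  finally show ?thesis unfolding powr_add [symmetric] by (simp add: add_ac)
 qed
 have z: "kernel_N al be t y = 0" if "(t, 1, y) \<in> kernel_domain ==> legendre_majorant al be si ((t^2 - 1 - y^2)/(2*y)) = 0" for t y
 proof (cases "(t, 1, y) \<in> kernel_domain")
  case True
  then show ?thesis using b [OF True] that by (simp add: order_antisym)
 qed (simp add: kernel_N_def)
 show thesis
 proof (rule that [OF C(1) b])
  fix t y :: real
  show "kernel_N al be t y = 0" if "t \<le> abs (1 - y)"
   using legendre_argument(1) [of t 1 y] that by (intro z) (auto simp: kernel_domain_def legendre_majorant_def)
  show "kernel_N al be t y = 0" if "- be \<in> \<nat>" "1 + y \<le> t"
   using legendre_argument(1,3) [of t 1 y] that by (intro z) (auto simp: kernel_domain_def legendre_majorant_def)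
 qed
qed

text \<open>For t <= 1/2 the kernel lives on |1 - y| < t, where y is comparable to 1 and A stays
  away from 1. The factor 1 + A is of the size t^2 (1 - |1 - y|/t), and the powers of t add up to
  1/t: an average over (1 - t, 1 + t), with singularities at the ends that are integrable once si <
  1.\<close>

lemma kernel_N_near_diagonal:
 assumes al: "al > -1" and mu: "al + be > -1/2" and si: "si > 0" "si \<ge> 1/2 - al - be"
 obtains C where "C \<ge> 0" "\<And>t y. t \<le> 1/2 ==> t \<le> abs (1 - y) ==> kernel_N al be t y = 0"
  "\<And>t y. t \<le> 1/2 ==> abs (1 - y) < t ==> kernel_N al be t y \<le> C*(1/t*(1 - abs (1 - y)/t) powr (- si))"
proof -
 obtain C where C: "C \<ge> 0" "\<And>t y. (t, 1, y) \<in> kernel_domain ==> kernel_N al be t y \<le>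
   C*(t powr (- 2*(al + be))*y powr (2*al + be)*legendre_majorant al be si ((t^2 - 1 - y^2)/(2*y)))"
  "\<And>t y. t \<le> abs (1 - y) ==> kernel_N al be t y = 0"
  using kernel_N_bound [OF assms] by metis
 define a where "a = al + be - 1/2"
 define M where "M = C*(4 powr si*(4 powr (- a)*2 powr abs (al + 1/2)))"
 have "kernel_N al be t y \<le> M*(1/t*(1 - abs (1 - y)/t) powr (- si))" if t: "t \<le> 1/2" and near: "abs (1 - y) < t" for t y
 proof -
  have t0: "0 < t" using near by linarith
  have y: "1/2 \<le> y" "y \<le> 2" "0 < y" using near t by linarith+
  define w where "w = abs (1 - y)/t"
  have w: "0 \<le> w" "w < 1" "abs (1 - y) = t*w" using near t0 by (auto simp: w_def)
  let ?A = "(t^2 - 1 - y^2)/(2*y)"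
  note A = kernel_argument_factor [OF y(3), of t]
  have d: "(t, 1, y) \<in> kernel_domain" using t0 t y near by (auto simp: kernel_domain_def)
  have v: "(1 + ?A)/2 = t^2/(4*y)*((1 - w)*(1 + w))"
   unfolding A(1) w(3) by (simp add: power2_eq_square field_simps)
  have "(1 + y)*y \<le> (1 + y + t)*(1 + y - t)" using t t0 y by (intro mult_mono) auto
  moreover have "y*1 \<le> (1 + y)*y" using y by (simp add: algebra_simps)
  ultimately have "y \<le> (1 + y - t)*(1 + y + t)" by (simp add: mult.commute)
  then have v1: "(1 - ?A)/2 \<ge> 1/4" unfolding A(2) using y by (simp add: field_simps)
  have "(1 - w)*(1 + w) > 0" "(1 - w)*(1 + w) \<le> 1" "1 - w \<le> (1 - w)*(1 + w)"
   using mult_left_le [of w w] w(1,2) by (simp_all add: algebra_simps)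
  then have "((1 - w)*(1 + w)) powr a \<le> ((1 - w)*(1 + w)) powr (- si)" "((1 - w)*(1 + w)) powr (- si) \<le> (1 - w) powr (- si)"
   using si w by (auto simp: a_def intro!: powr_mono' powr_minus_antimono)
  then have va: "((1 + ?A)/2) powr a \<le> (t^2/(4*y)) powr a*(1 - w) powr (- si)"
   unfolding v powr_mult by (intro mult_left_mono) auto
  have vs: "((1 - ?A)/2) powr (- si) \<le> 4 powr si"
   using powr_minus_antimono [OF _ v1 si(1)] by (simp add: powr_divide powr_minus_divide)
  have "t^2 = t powr 2" using t0 by simp
  then have "(t^2) powr a = t powr (2*a)" using powr_powr [of t 2 a] by presburger
  then have e1: "(t^2/(4*y)) powr a = t powr (2*a)*4 powr (- a)*y powr (- a)"
   using t0 y by (simp add: powr_divide powr_mult powr_minus_divide)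
  have e2: "t powr (- 2*(al + be))*t powr (2*a) = 1/t"
   unfolding powr_add [symmetric] using t0 by (simp add: a_def algebra_simps powr_minus_divide)
  have e3: "y powr (2*al + be)*y powr (- a) = y powr (al + 1/2)"
   unfolding powr_add [symmetric] by (simp add: a_def)
  have "-1 < ?A" "?A < 1" using legendre_argument [of t 1 y] d by (auto simp: kernel_domain_def) (use near t y in linarith)+
  then have "kernel_N al be t y \<le> C*(t powr (- 2*(al + be))*y powr (2*al + be)*(((1 + ?A)/2) powr a*((1 - ?A)/2) powr (- si)))"
   using C(2) [OF d] by (simp add: legendre_majorant_def a_def)
  also have "... \<le> C*(t powr (- 2*(al + be))*y powr (2*al + be)*(((t^2/(4*y)) powr a*(1 - w) powr (- si))*4 powr si))"
   using C(1) by (intro mult_left_mono mult_mono va vs) auto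
  also have "... = C*(4 powr si*(4 powr (- a)*(y powr (2*al + be)*y powr (- a))))*((t powr (- 2*(al + be))*t powr (2*a))*(1 - w) powr (- si))"
   unfolding e1 by (simp only: mult_ac)
  also have "... \<le> M*(1/t*(1 - w) powr (- si))"
   unfolding M_def e2 e3 using C(1) y t0 by (intro mult_right_mono mult_left_mono powr_le_comparable) auto
  finally show ?thesis by (simp add: w_def)
 qed
 then show thesis using that [of M] C by (simp add: M_def)
qed

text \<open>1 + A and |1 - A| are at least constant multiples of (y - (1 - t))/y and |y - (t -
  1)|/y, the companion factors being at least 1/2. Of the bounds t^2/7 and 7 t^2/y for 2 + A the
  upper one is used for be >= 1 and the lower one for be < 1, which produces min be 1. The surplus
  power t powr (-2 al - 2) is bounded since al > -1.\<close>

lemma kernel_N_left: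
 assumes al: "al > -1" and mu: "al + be > -1/2" and si: "si > 0" "si \<ge> 1/2 - al - be"
 obtains C where "C \<ge> 0" "\<And>t y. t \<ge> 1/2 ==> 0 < y ==> y \<le> 1 ==> kernel_N al be t y \<le>
  C*(y powr (2*al + min be 1)*(1 + (y/abs (y - (1 - t))) powr si + (y/abs (y - (t - 1))) powr si))"
proof -
 obtain C where C: "C \<ge> 0" "\<And>t y. (t, 1, y) \<in> kernel_domain ==> kernel_N al be t y \<le>
   C*(t powr (- 2*(al + be))*y powr (2*al + be)*legendre_majorant al be si ((t^2 - 1 - y^2)/(2*y)))"
  "\<And>t y. t \<le> abs (1 - y) ==> kernel_N al be t y = 0"
  using kernel_N_bound [OF assms] by metis
 define k where "k = 3 powr abs (be - 1)*4 powr si"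
 define Q where "Q = 7 powr abs (be - 1)*(1/2) powr (- 2*al - 2)"
 define M where "M = C*(k*Q*4 powr si)"
 have "kernel_N al be t y \<le> M*(y powr (2*al + min be 1)*(1 + (y/abs (y - (1 - t))) powr si + (y/abs (y - (t - 1))) powr si))"
  if t: "t \<ge> 1/2" and y: "0 < y" "y \<le> 1" for t y
 proof (cases "abs (1 - y) < t \<and> t \<noteq> 1 + y")
  case False
  then have "kernel_N al be t y = 0" using C(3) by (cases "t = 1 + y") (simp add: kernel_N_def kernel_domain_def, auto)
  then show ?thesis using C(1) y by (simp add: M_def k_def Q_def add_nonneg_nonneg)
 next
  case True
  then have ne: "1 - y < t" "t \<noteq> 1 + y" "(t, 1, y) \<in> kernel_domain" using y t by (auto simp: kernel_domain_def)
  define A where "A = (t^2 - 1 - y^2)/(2*y)"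
  have A1: "1 + A = (t - (1 - y))*(t + (1 - y))/(2*y)" and A2: "1 - A = (1 + y - t)*(1 + y + t)/(2*y)"
   using kernel_argument_factor [OF y(1), of t] y by (simp_all add: A_def)
  have "1 + A > 0" unfolding A1 using ne y by (intro divide_pos_pos mult_pos_pos) auto
  moreover have "1 - A \<noteq> 0" unfolding A2 using ne y t by simp
  ultimately have A0: "-1 < A" "A \<noteq> 1" by auto
  let ?L = "1 + (y/abs (y - (1 - t))) powr si + (y/abs (y - (t - 1))) powr si"
  have inv: "u powr (- si) \<le> 4 powr si*(y/d) powr si" if "d/(4*y) \<le> u" "d > 0" for u d
  proof -
   have "u powr (- si) \<le> (d/(4*y)) powr (- si)" using that y si by (intro powr_minus_antimono) auto
   also have "... = (4*(y/d)) powr si" using that y by (simp add: powr_divide powr_minus_divide powr_mult)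
   finally show ?thesis by (simp only: powr_mult)
  qed
  have "(t - (1 - y))*(1/2) \<le> (t - (1 - y))*(t + (1 - y))" using t y ne by (intro mult_left_mono) auto
  then have "(t - (1 - y))*(1/2)/(2*y) \<le> 1 + A" unfolding A1 using y by (intro divide_right_mono) auto
  then have s1: "(1 + A) powr (- si) \<le> 4 powr si*(y/abs (y - (1 - t))) powr si"
   using inv [of "t - (1 - y)"] ne by (simp add: algebra_simps)
  have "abs (1 + y - t)*(1/2) \<le> abs (1 + y - t)*(1 + y + t)" using t y ne by (intro mult_left_mono) auto
  then have "abs (1 + y - t)*(1/2)/(2*y) \<le> abs (1 + y - t)*(1 + y + t)/(2*y)" using y by (intro divide_right_mono) auto
  also have "... = abs (1 - A)" unfolding A2 using y t by (simp add: abs_mult)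
  finally have "abs (1 + y - t)*(1/2)/(2*y) \<le> abs (1 - A)" .
  then have s2: "abs (1 - A) powr (- si) \<le> 4 powr si*(y/abs (y - (t - 1))) powr si"
   using inv [of "abs (1 + y - t)"] ne by (simp add: algebra_simps)
  have "1 \<le> (4::real) powr si" using si by (intro ge_one_powr_ge_zero) auto
  then have L: "1 + (1 + A) powr (- si) + abs (1 - A) powr (- si) \<le> 4 powr si*?L"
   using s1 s2 by (simp add: algebra_simps)
  have X: "y powr (2*al + be)*(2 + A) powr (be - 1) \<le> 7 powr abs (be - 1)*t powr (2*(be - 1))*y powr (2*al + min be 1)"
  proof -
   have A': "2 + A = (t^2 - 1 - y^2 + 4*y)/(2*y)" using y by (simp add: A_def field_simps)
   have t2: "t^2 \<ge> 1/4" using power_mono [of "1/2" t 2] t by (simp add: power2_eq_square)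
   have y2: "y^2 \<le> y" "0 \<le> y^2" "y*t^2 \<le> t^2" using y by (auto simp: power2_eq_square mult_left_le_one_le)
   \<comment> \<open>For t >= 2 the term t^2 dominates; for smaller t the support condition t > 1 -
     y compensates the negative terms.\<close>
   have "y*t^2/2 \<le> t^2 - 1 - y^2 + 4*y"
   proof (cases "t \<ge> 2")
    case True
    then have "t^2 \<ge> 4" using power_mono [of 2 t 2] by simp
    then show ?thesis using y2 by linarith
   next
    case False
    then have "t^2 \<le> 4" using power_mono [of t 2 2] t by simp
    then have "y*t^2 \<le> y*4" using y by (intro mult_left_mono) auto
    moreover have "(1 - y)^2 \<le> t^2" using y ne by (intro power_mono) auto
    ultimately show ?thesis by (simp add: power2_diff)
   qed
   then have "y*t^2/2/(2*y) \<le> 2 + A" unfolding A' using y by (intro divide_right_mono) auto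
   then have lo: "t^2/7 \<le> 2 + A" using y t2 by simp
   have "t^2 - 1 - y^2 + 4*y \<le> 14*t^2" using y2 y t2 by linarith
   then have "2 + A \<le> 14*t^2/(2*y)" unfolding A' using y by (intro divide_right_mono) auto
   then have hi: "2 + A \<le> 7*(t^2/y)" by simp
   have sq: "(t^2) powr e = t powr (2*e)" for e
    using powr_powr [of t 2 e] t by simp
   show ?thesis
   proof (cases "be \<ge> 1")
    case True
    have "(2 + A) powr (be - 1) \<le> (7*(t^2/y)) powr (be - 1)" using hi A0 True by (intro powr_mono2) auto
    also have "... = 7 powr abs (be - 1)*t powr (2*(be - 1))*y powr (1 - be)"
     using True t y powr_minus_divide [of y "be - 1"] by (simp add: powr_mult powr_divide sq)
    finally have "y powr (2*al + be)*(2 + A) powr (be - 1) \<le> y powr (2*al + be)*(7 powr abs (be - 1)*t powr (2*(be - 1))*y powr (1 - be))"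
     by (intro mult_left_mono) auto
    also have "... = 7 powr abs (be - 1)*t powr (2*(be - 1))*(y powr (2*al + be)*y powr (1 - be))"
     by (simp only: mult_ac)
    finally show ?thesis unfolding powr_add [symmetric] using True t y by (simp add: min_def)
   next
    case False
    have "(2 + A) powr (be - 1) \<le> (t^2/7) powr (be - 1)" using lo t2 False by (intro powr_mono2') auto
    also have "... = 7 powr abs (be - 1)*t powr (2*(be - 1))"
     using False t powr_minus_divide [of 7 "be - 1"] by (simp add: powr_divide sq)
    finally have "y powr (2*al + be)*(2 + A) powr (be - 1) \<le> y powr (2*al + be)*(7 powr abs (be - 1)*t powr (2*(be - 1)))"
     by (intro mult_left_mono) auto
    then show ?thesis using False by (simp add: min_def mult_ac)
   qed
  qed
  have T: "t powr (- 2*(al + be))*t powr (2*(be - 1)) \<le> (1/2) powr (- 2*al - 2)"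
  proof -
   have "- 2*(al + be) + 2*(be - 1) = - 2*al - 2" by simp
   then show ?thesis unfolding powr_add [symmetric] using t al by (simp only:) (intro powr_mono2', auto)
  qed
  have "kernel_N al be t y \<le> C*(t powr (- 2*(al + be))*y powr (2*al + be)*(k*((2 + A) powr (be - 1)*(1 + (1 + A) powr (- si) + abs (1 - A) powr (- si)))))"
   using C(1) legendre_majorant_le [OF A0 si, of "be - 1"] unfolding k_def
   by (intro order_trans [OF C(2) [OF ne(3), folded A_def]] mult_left_mono) auto
  also have "... = C*(t powr (- 2*(al + be)) * k*(y powr (2*al + be)*(2 + A) powr (be - 1))*(1 + (1 + A) powr (- si) + abs (1 - A) powr (- si)))"
   by (simp only: mult_ac)
  also have "... \<le> C*(t powr (- 2*(al + be)) * k*(7 powr abs (be - 1)*t powr (2*(be - 1))*y powr (2*al + min be 1))*(4 powr si*?L))"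
   using C(1) by (intro mult_left_mono mult_mono X L) (auto simp: k_def add_nonneg_nonneg)
  also have "... = C*(k*(7 powr abs (be - 1)*(t powr (- 2*(al + be))*t powr (2*(be - 1))))*4 powr si)*(y powr (2*al + min be 1)*?L)"
   by (simp only: mult_ac)
  also have "... \<le> M*(y powr (2*al + min be 1)*?L)"
   unfolding M_def Q_def using C(1) by (intro mult_right_mono mult_left_mono T) (auto simp: k_def add_nonneg_nonneg)
  finally show ?thesis .
 qed
 then show thesis using that [of M] C(1) by (simp add: M_def k_def Q_def)
qed

text \<open>The natural variable is t - y > -1, with singularities at -1 and 1. In general 2 + A is
  comparable to (2 + (t - y)) t/y, which yields the exponent e = 1 - min be 1; if -be is a natural
  number the kernel vanishes for t >= y + 1, the variable is confined to (-1, 1), and e is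
  arbitrary. For be < 1 the remaining power of t/y is nonpositive by \<open>h\<close>, hence bounded
  as t/y >= 1/4.\<close>

lemma kernel_N_right:
 assumes al: "al > -1" and mu: "al + be > -1/2" and si: "si > 0" "si \<ge> 1/2 - al - be"
  and h: "2*al + be + 1 \<ge> 0" and e: "e = 1 - min be 1 \<or> - be \<in> \<nat>"
 obtains C where "C \<ge> 0" "\<And>t y. t \<ge> 1/2 ==> 1 < y ==> t \<le> y - 1 ==> kernel_N al be t y = 0"
  "\<And>t y. t \<ge> 1/2 ==> 1 < y ==> y - 1 < t ==> kernel_N al be t y \<le>
  C*(y powr (- min be 1)*(2 + (t - y)) powr (- e)*(1 + abs (1 + (t - y)) powr (- si) + abs (1 - (t - y)) powr (- si)))"
proof -
 obtain C where C: "C \<ge> 0" "\<And>t y. (t, 1, y) \<in> kernel_domain ==> kernel_N al be t y \<le>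
   C*(t powr (- 2*(al + be))*y powr (2*al + be)*legendre_majorant al be si ((t^2 - 1 - y^2)/(2*y)))"
  "\<And>t y. t \<le> abs (1 - y) ==> kernel_N al be t y = 0"
  "\<And>t y. - be \<in> \<nat> ==> 1 + y \<le> t ==> kernel_N al be t y = 0"
  using kernel_N_bound [OF assms(1-4)] by metis
 \<comment> \<open>\<open>legendre_majorant_le\<close> leaves its exponent open when -be is a
   natural number; otherwise it has to be be - 1.\<close>
 define ep where "ep = (if - be \<in> \<nat> then - e else be - 1)"
 define k where "k = 3 powr abs ep*4 powr si"
 define Q where "Q = 4 powr abs (- 2*(al + be))*3 powr abs ep*3 powr abs e + 8 powr abs ep*4 powr abs (2*al + be + 1)*3 powr abs (be - 1)"
 have Q0: "Q \<ge> 0" by (simp add: Q_def)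
 define M where "M = C*(k*Q*4 powr si)"
 have "kernel_N al be t y \<le> M*(y powr (- min be 1)*(2 + (t - y)) powr (- e)*(1 + abs (1 + (t - y)) powr (- si) + abs (1 - (t - y)) powr (- si)))"
  if t: "t \<ge> 1/2" and y: "1 < y" "y - 1 < t" for t y
 proof (cases "t \<noteq> 1 + y \<and> \<not> (- be \<in> \<nat> \<and> 1 + y \<le> t)")
  case False
  then have "kernel_N al be t y = 0" using C(4) by (cases "t = 1 + y") (simp add: kernel_N_def kernel_domain_def, auto)
  then show ?thesis using C(1) y Q0 by (simp add: M_def k_def add_nonneg_nonneg)
 next
  case True
  then have ne: "t \<noteq> 1 + y" "- be \<in> \<nat> ==> t < 1 + y" "(t, 1, y) \<in> kernel_domain" using y t by (auto simp: kernel_domain_def)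
  define D where "D = t - y"
  have D: "D > -1" "t = y + D" using y by (auto simp: D_def)
  define A where "A = (t^2 - 1 - y^2)/(2*y)"
  have y0: "y > 0" using y by simp
  have A1: "1 + A = (1 + D)*(t + (y - 1))/(2*y)" and A2: "1 - A = (1 - D)*(1 + y + t)/(2*y)"
   using kernel_argument_factor [OF y0, of t] y by (simp_all add: A_def D_def)
  have "1 + A > 0" unfolding A1 using D y t by (intro divide_pos_pos mult_pos_pos) auto
  moreover have "1 - A \<noteq> 0" unfolding A2 using ne y t by (simp add: D_def)
  ultimately have A0: "-1 < A" "A \<noteq> 1" by auto
  let ?L = "1 + abs (1 + D) powr (- si) + abs (1 - D) powr (- si)"
  have inv: "u powr (- si) \<le> 4 powr si*d powr (- si)" if "d/4 \<le> u" "d > 0" for u d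
  proof -
   have "u powr (- si) \<le> (d/4) powr (- si)" using that si by (intro powr_minus_antimono) auto
   then show ?thesis by (simp add: powr_divide powr_minus_divide)
  qed
  have "abs (1 + D)*(y/2) \<le> abs (1 + D)*(t + (y - 1))" using t y by (intro mult_left_mono) auto
  then have "abs (1 + D)*(y/2)/(2*y) \<le> 1 + A" unfolding A1 using y D(1) by (intro divide_right_mono) auto
  then have s1: "(1 + A) powr (- si) \<le> 4 powr si*abs (1 + D) powr (- si)" using inv [of "abs (1 + D)"] D y by simp
  have "abs (1 - D)*(y/2) \<le> abs (1 - D)*(1 + y + t)" using t y by (intro mult_left_mono) auto
  then have "abs (1 - D)*(y/2)/(2*y) \<le> abs (1 - D)*(1 + y + t)/(2*y)" using y by (intro divide_right_mono) auto
  also have "... = abs (1 - A)" unfolding A2 using y t by (simp add: abs_mult)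
  finally have "abs (1 - D)*(y/2)/(2*y) \<le> abs (1 - A)" .
  then have s2: "abs (1 - A) powr (- si) \<le> 4 powr si*abs (1 - D) powr (- si)" using inv [of "abs (1 - D)"] ne y by (simp add: D_def)
  have "1 \<le> (4::real) powr si" using si by (intro ge_one_powr_ge_zero) auto
  then have L: "1 + (1 + A) powr (- si) + abs (1 - A) powr (- si) \<le> 4 powr si*?L"
   using s1 s2 by (simp add: algebra_simps)
  have ty: "y/4 \<le> t" using t y by linarith
  have X: "t powr (- 2*(al + be))*y powr (2*al + be)*(2 + A) powr ep \<le> Q*(y powr (- min be 1)*(2 + D) powr (- e))"
  proof (cases "- be \<in> \<nat>")
   case True
   then have g: "min be 1 = be" by (auto elim: Nats_cases)
   have D1: "D < 1" using ne(2) True by (simp add: D_def)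
   then have "1 - A > 0" unfolding A2 using y t by (intro divide_pos_pos mult_pos_pos) auto
   then have "A < 1" by simp
   have "t powr (- 2*(al + be))*y powr (2*al + be)*(2 + A) powr ep \<le>
     (4 powr abs (- 2*(al + be))*y powr (- 2*(al + be)))*y powr (2*al + be)*3 powr abs ep"
    using ty D1 y A0 \<open>A < 1\<close> by (intro mult_mono mult_right_mono powr_mult_le_comparable powr_le_comparable) (auto simp: D_def)
   also have "... = 4 powr abs (- 2*(al + be))*3 powr abs ep*(y powr (- 2*(al + be))*y powr (2*al + be))*1"
    by (simp only: mult_ac mult_1_right)
   also have "... = 4 powr abs (- 2*(al + be))*3 powr abs ep*y powr (- min be 1)*1"
    unfolding g powr_add [symmetric] by (simp add: algebra_simps)
   also have "... \<le> 4 powr abs (- 2*(al + be))*3 powr abs ep*y powr (- min be 1)*(3 powr abs e*(2 + D) powr (- e))"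
    using powr_mult_le_comparable [of "2 + D" 3 1 "- e"] powr_mult_le_comparable [of 1 3 "2 + D" "- e"] D D1 by (intro mult_left_mono) auto
   also have "... = 4 powr abs (- 2*(al + be))*3 powr abs ep*3 powr abs e*(y powr (- min be 1)*(2 + D) powr (- e))"
    by (simp only: mult_ac)
   also have "... \<le> Q*(y powr (- min be 1)*(2 + D) powr (- e))" unfolding Q_def by (intro mult_right_mono) auto
   finally show ?thesis .
  next
   case False
   then have ep: "ep = be - 1" and e: "e = 1 - min be 1" using e by (auto simp: ep_def)
   \<comment> \<open>F - 2 D - 1 lies between F/4 and 2 F, so 2 + A is comparable to (2 + D) (t +
     y)/y, and t + y to t.\<close>
   define F where "F = (2 + D)*(t + y)"
   have A': "2 + A = (F - 2*D - 1)/(2*y)" using y by (simp add: A_def F_def D_def field_simps power2_eq_square)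
   have "(2 + D)*(3/2) \<le> F" "(2 + D)*(2 + D) \<le> F" unfolding F_def using t y D by (intro mult_left_mono; simp)+
   then have "3 + 3/2*D \<le> F" "4 + 4*D + D*D \<le> F" by (simp_all add: algebra_simps)
   moreover have "0 \<le> D*D" by simp
   ultimately have F: "F/4 \<le> F - 2*D - 1" "F - 2*D - 1 \<le> 2*F" "0 < F"
    using D(1) by (linarith, linarith, linarith)
   have F': "(2 + D)*t \<le> F" "F \<le> (2 + D)*(5*t)" unfolding F_def using D ty y by (intro mult_left_mono; simp)+
   have X1: "(2 + A) powr (be - 1) \<le> 8 powr abs (be - 1)*((2 + D)*(t/y)) powr (be - 1)"
   proof (rule powr_mult_le_comparable)
    have "(2 + D)*t/4/(2*y) \<le> (F - 2*D - 1)/(2*y)" using F F' y by (intro divide_right_mono) auto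
    then show "(2 + D)*(t/y)/8 \<le> 2 + A" unfolding A' by simp
    have "(F - 2*D - 1)/(2*y) \<le> 2*((2 + D)*(8*t))/(2*y)"
     using F(2) F' y D(1) t by (intro divide_right_mono) (auto simp: algebra_simps)
    also have "... = 8*((2 + D)*(t/y))" by (simp only: mult_divide_mult_cancel_left_if) simp
    finally show "2 + A \<le> 8*((2 + D)*(t/y))" unfolding A' .
   qed (use D t y in auto)
   have X2: "((t/y) powr (- (2*al + be + 1)))*(2 + D) powr (be - 1) \<le>
     4 powr abs (2*al + be + 1)*3 powr abs (be - 1)*(y powr (be - min be 1)*(2 + D) powr (- e))"
   proof (cases "be \<ge> 1")
    case True
    have "2 + D \<le> 3*(t/y*y)" using t y by (simp add: D_def)
    then have "(2 + D) powr (be - 1) \<le> (3*(t/y*y)) powr (be - 1)" using True D(1) by (intro powr_mono2) auto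
    then have "(t/y) powr (- (2*al + be + 1))*(2 + D) powr (be - 1) \<le>
      (t/y) powr (- (2*al + be + 1))*(3 powr (be - 1)*((t/y) powr (be - 1)*y powr (be - 1)))"
     by (intro mult_left_mono) (auto simp only: powr_mult powr_ge_zero)
    also have "... = ((t/y) powr (- (2*al + be + 1))*(t/y) powr (be - 1))*3 powr (be - 1)*y powr (be - 1)"
     by (simp only: mult_ac)
    also have "... = (t/y) powr (- (2*al + 2))*3 powr (be - 1)*y powr (be - 1)" by (simp flip: powr_add)
    also have "(t/y) powr (- (2*al + 2)) \<le> (1/4) powr (- (2*al + 2))"
     using al ty y by (intro powr_mono2') (auto simp: field_simps)
    also have "... = 4 powr (2*al + 2)" using powr_minus_divide [of 4 "2*al + 2"] by (simp add: powr_divide)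
    also have "... \<le> 4 powr abs (2*al + be + 1)" using True by (intro powr_mono) auto
    finally show ?thesis using True e D by (simp add: mult_right_mono)
   next
    case False
    have "(t/y) powr (- (2*al + be + 1)) \<le> (1/4) powr (- (2*al + be + 1))"
     using h ty y by (intro powr_mono2') (auto simp: field_simps)
    also have "... = 4 powr abs (2*al + be + 1)" using h powr_minus_divide [of 4 "2*al + be + 1"] by (simp add: powr_divide)
    also have "... \<le> 4 powr abs (2*al + be + 1)*3 powr abs (be - 1)"
     using ge_one_powr_ge_zero [of 3 "abs (be - 1)"] by simp
    finally show ?thesis using False e y by (simp add: mult_right_mono)
   qed
   have Y: "t powr (- 2*(al + be))*y powr (2*al + be)*(t/y) powr (be - 1) = (t/y) powr (- (2*al + be + 1))*y powr (- be)"
   proof -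
    have "t powr (- 2*(al + be)) = (t/y) powr (- 2*(al + be))*y powr (- 2*(al + be))"
     unfolding powr_mult [symmetric] using y by simp
    then have "t powr (- 2*(al + be))*y powr (2*al + be)*(t/y) powr (be - 1) =
      ((t/y) powr (- 2*(al + be))*(t/y) powr (be - 1))*(y powr (- 2*(al + be))*y powr (2*al + be))"
     by (simp only: mult_ac)
    then show ?thesis unfolding powr_add [symmetric] by (simp add: algebra_simps)
   qed
   have "t powr (- 2*(al + be))*y powr (2*al + be)*(2 + A) powr ep \<le>
     t powr (- 2*(al + be))*y powr (2*al + be)*(8 powr abs (be - 1)*((2 + D) powr (be - 1)*(t/y) powr (be - 1)))"
    unfolding ep using X1 [unfolded powr_mult] by (intro mult_left_mono) auto
   also have "... = 8 powr abs (be - 1)*((t/y) powr (- (2*al + be + 1))*(2 + D) powr (be - 1))*y powr (- be)"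
    using Y by (simp add: mult_ac)
   also have "... \<le> 8 powr abs (be - 1)*(4 powr abs (2*al + be + 1)*3 powr abs (be - 1)*(y powr (be - min be 1)*(2 + D) powr (- e)))*y powr (- be)"
    by (intro mult_left_mono mult_right_mono X2) auto
   also have "... = 8 powr abs ep*4 powr abs (2*al + be + 1)*3 powr abs (be - 1)*((y powr (be - min be 1)*y powr (- be))*(2 + D) powr (- e))"
    unfolding ep by (simp only: mult_ac)
   also have "y powr (be - min be 1)*y powr (- be) = y powr (- min be 1)" by (simp flip: powr_add)
   also have "8 powr abs ep*4 powr abs (2*al + be + 1)*3 powr abs (be - 1)*(y powr (- min be 1)*(2 + D) powr (- e)) \<le> Q*(y powr (- min be 1)*(2 + D) powr (- e))"
    unfolding Q_def by (intro mult_right_mono) auto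
   finally show ?thesis .
  qed
  have "kernel_N al be t y \<le> C*(t powr (- 2*(al + be))*y powr (2*al + be)*(k*((2 + A) powr ep*(1 + (1 + A) powr (- si) + abs (1 - A) powr (- si)))))"
   using C(1) legendre_majorant_le [OF A0 si, of ep] unfolding k_def
   by (intro order_trans [OF C(2) [OF ne(3), folded A_def]] mult_left_mono) (auto simp: ep_def)
  also have "... = C*(k*(t powr (- 2*(al + be))*y powr (2*al + be)*(2 + A) powr ep)*(1 + (1 + A) powr (- si) + abs (1 - A) powr (- si)))"
   by (simp only: mult_ac)
  also have "... \<le> C*(k*(Q*(y powr (- min be 1)*(2 + D) powr (- e)))*(4 powr si*?L))"
   using C(1) Q0 by (intro mult_left_mono mult_mono X L) (auto simp: k_def add_nonneg_nonneg)
  also have "... = M*(y powr (- min be 1)*(2 + D) powr (- e)*?L)" unfolding M_def by (simp only: mult_ac)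
  finally show ?thesis by (simp add: D_def)
 qed
 then show thesis using that [of M] C Q0 by (simp add: M_def k_def)
qed

section \<open>Integrable majorants with moving singularities\<close>

definition bump :: "real => real => real => real" where
 "bump e s u = (if abs u < 1 then 1 + abs u powr (- e) else abs u powr (- s))"

lemma bump_nonneg [simp]: "bump e s u \<ge> 0"
 by (simp add: bump_def)

lemma borel_measurable_bump [measurable]: "bump e s \<in> borel_measurable borel"
 unfolding bump_def [abs_def] by measurable

lemma bump_abs [simp]: "bump e s (abs u) = bump e s u"
 by (simp add: bump_def)

lemma nn_integral_translate:
 fixes f :: "real => ennreal"
 assumes [measurable]: "f \<in> borel_measurable borel"
 shows "(NN z. f (z - d)) = (NN z. f z)" "(NN z. f (d - z)) = (NN z. f z)"
 using nn_integral_real_affine [OF assms, of 1 "- d"] nn_integral_real_affine [OF assms, of "-1" d] by simp_all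

lemma nn_integral_has_bochner:
 assumes "has_bochner_integral M f c" "\<And>x. f x \<ge> 0"
 shows "(\<integral>\<^sup>+ x. ennreal (f x) \<partial>M) = ennreal c"
 using assms by (subst nn_integral_eq_integral) (auto simp: has_bochner_integral_iff)

text \<open>e < 1 is integrability at 0 and s > 1 at infinity. By translation invariance the
  integral does not depend on d, which later gives bounds uniform in t.\<close>

lemma bump_integral:
 assumes e: "e < 1" "s > 1"
 obtains J where "J \<ge> 0" "\<And>d. (NN y. ennreal (bump e s (y - d))) = ennreal J"
proof -
 let ?f = "\<lambda>y. ennreal (indicator {0<..1} y*y powr 0) + (ennreal (indicator {0<..1} y*y powr (- e)) + ennreal (indicator {1<..} y*y powr (- s)))"
 \<comment> \<open>The pieces on (0, infinity) and their reflections miss the point 0, where bump e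
   s 0 = 1.\<close>
 let ?z = "\<lambda>z. indicator {0} z :: ennreal"
 have [measurable]: "?f \<in> borel_measurable borel" by measurable
 have "(NN y. ?f y) < \<infinity>"
  using e nn_integral_has_bochner [OF powr_integral_from_0 [of 0 1]] nn_integral_has_bochner [OF powr_integral_from_0 [of "- e" 1]] nn_integral_has_bochner [OF powr_integral_to_inf [of "- s" 1]]
  by (simp add: nn_integral_add ennreal_add_less_top)
 then have "(NN z. ?z z + (?f z + ?f (0 - z))) < \<infinity>"
  by (subst nn_integral_add, (measurable)[2], subst nn_integral_add, (measurable)[2], subst nn_integral_translate(2)) (auto simp: ennreal_add_less_top)
 moreover have "(NN z. ennreal (bump e s z)) \<le> (NN z. ?z z + (?f z + ?f (0 - z)))"
  by (intro nn_integral_mono) (auto simp: bump_def indicator_def simp flip: ennreal_plus)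
 ultimately have fin: "(NN z. ennreal (bump e s z)) < \<infinity>" by (rule le_less_trans [rotated])
 then obtain J where "J \<ge> 0" "(NN z. ennreal (bump e s z)) = ennreal J"
  by (cases "NN z. ennreal (bump e s z)") auto
 moreover have "(NN z. ennreal (bump e s (z - d))) = (NN z. ennreal (bump e s z))" for d
  by (rule nn_integral_translate(1) [of "\<lambda>z. ennreal (bump e s z)"]) measurable
 ultimately show thesis using that [of J] by simp
qed

lemma powr_le_bump:
 assumes "0 \<le> e'" "e' \<le> e" "abs u < 1"
 shows "abs u powr (- e') \<le> bump e s u"
proof (cases "u = 0")
 case False
 then have "abs u powr (- e') \<le> abs u powr (- e)" using assms by (intro powr_mono') auto
 then show ?thesis using assms by (simp add: bump_def)
qed simp

lemma powr_le_1_bump: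
 assumes "0 \<le> e'" "e' \<le> e"
 shows "abs u powr (- e') \<le> 1 + bump e s u"
proof (cases "abs u < 1")
 case False
 then have "abs u powr (- e') \<le> abs u powr 0" using assms by (intro powr_mono) auto
 then show ?thesis using False by (auto split: if_splits intro: order_trans)
qed (use powr_le_bump [OF assms] in \<open>auto intro: add_increasing\<close>)

lemma powr_sum3_le:
 fixes a b c r :: real
 assumes "a \<ge> 0" "b \<ge> 0" "c \<ge> 0" "r \<ge> 0"
 shows "(a + b + c) powr r \<le> 3 powr r*(a powr r + b powr r + c powr r)"
proof -
 define m where "m = max a (max b c)"
 have "(a + b + c) powr r \<le> (3*m) powr r" using assms by (intro powr_mono2) (auto simp: m_def)
 also have "... = 3 powr r*m powr r" by (rule powr_mult)
 also have "m powr r \<le> a powr r + b powr r + c powr r" by (auto simp: m_def max_def)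
 finally show ?thesis by simp
qed

text \<open>y and |u| may be small at different rates. Since |u| enters through y/|u|, the two
  singularities do not multiply: comparing y with |u| replaces the product by a single power of
  order at most max m (-k).\<close>

lemma powr_quotient_le_bump:
 fixes y u k m e :: real
 assumes y: "0 < y" "y \<le> 1" and e: "0 \<le> m" "m \<le> e" "- k \<le> e"
 shows "y powr k*(y/abs u) powr m \<le> bump e s y + bump e s u"
proof (cases "u = 0")
 case False
 define v where "v = abs u"
 have v: "v > 0" "bump e s u = bump e s v" using False by (auto simp: v_def)
 have b1: "1 \<le> bump e s y" using y by (cases "y = 1") (auto simp: bump_def)
 have L: "y powr k*(y/v) powr m = y powr (k + m) * v powr (- m)"
  using y v by (simp add: powr_divide powr_add powr_minus_divide)
 consider "k + m \<ge> 0" | "k + m < 0" "y \<le> v" | "k + m < 0" "v < y" by linarith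
 then have "y powr (k + m) * v powr (- m) \<le> bump e s y + bump e s v"
 proof cases
  case 1
  have "y powr (k + m) \<le> 1 powr (k + m)" using y 1 by (intro powr_mono2) auto
  then have "y powr (k + m) * v powr (- m) \<le> 1 * v powr (- m)" by (intro mult_right_mono) auto
  also have "... \<le> 1 + bump e s v" using powr_le_1_bump [of m e v] e v by simp
  finally show ?thesis using b1 by simp
 next
  case 2
  have "y powr (k + m) * v powr (- m) \<le> y powr (k + m)*y powr (- m)"
   using 2 y e by (intro mult_left_mono powr_mono2') auto
  also have "... = y powr k" by (simp flip: powr_add)
  also have "... \<le> bump e s y"
  proof (cases "y = 1")
   case False
   then show ?thesis using powr_le_bump [of "- k" e y] y e 2 by simp
  qed (use b1 in simp)
  finally show ?thesis by (simp add: add_increasing2)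
 next
  case 3
  have "y powr (k + m) * v powr (- m) \<le> v powr (k + m) * v powr (- m)"
   using 3 v e by (intro mult_right_mono powr_mono2') auto
  also have "... = v powr k" by (simp flip: powr_add)
  also have "... \<le> bump e s v" using powr_le_bump [of "- k" e v] v y e 3 by simp
  finally show ?thesis by (simp add: add_increasing)
 qed
 then have "y powr k*(y/v) powr m \<le> bump e s y + bump e s u" unfolding L v(2) .
 then show ?thesis by (simp add: v_def)
qed simp

text \<open>At x = 1, t = |1 - y| or t = 1 + y means that y is 1 - t, t + 1 or t - 1. The bump at 0
  takes care of powers of y, and those at 0 and t of the decay.\<close>

definition bumps :: "real => real => real => real => real" where
 "bumps e s t y = bump e s y + bump e s (y - t) + bump e s (y - (t - 1)) + bump e s (y - (t + 1)) + bump e s (y - (1 - t))"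

lemma bumps_nonneg [simp]: "bumps e s t y \<ge> 0"
 by (simp add: bumps_def add_nonneg_nonneg)

definition weight :: "real => real => real => real" where
 "weight a b y = (if y \<le> 1 then y powr (- a) else y powr b)"

lemma weight_nonneg [simp]: "weight a b y \<ge> 0"
 by (simp add: weight_def)

text \<open>The majorant has an integral independent of t. si r < 1 and the condition on a make the
  singularities integrable, that on b the decay. C depends on tt only through the factor 1/t of the
  near-diagonal part: tt = 1/2 serves the maximal estimate, arbitrary tt the continuity in
  t.\<close>

lemma kernel_N_weight_bound:
 assumes al: "al > -1" and mu: "al + be > -1/2" and h: "2*al + be + 1 \<ge> 0" and si: "si > 0" "si \<ge> 1/2 - al - be"
  and r: "r > 0" "si*r < 1" "(2*al + min be 1 - a)*r > -1" "(b - 1)*r < -1" and b: "b \<le> be"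
 obtains e s where "e < 1" "1 < s"
  "\<And>tt. tt > 0 ==> \<exists>C\<ge>0. \<forall>t\<ge>tt. \<forall>y. (kernel_N al be t y*weight a b y) powr r \<le> C*bumps e s t y"
proof -
 define m where "m = si*r"
 define k where "k = (2*al + min be 1 - a)*r"
 define e where "e = max m (- k)"
 define s where "s = (1 - b)*r"
 have m: "0 \<le> m" "m \<le> e" and k: "- k \<le> e" using si r by (auto simp: m_def e_def)
 have es: "e < 1" "1 < s" "0 \<le> e" using r m by (auto simp: e_def s_def k_def m_def algebra_simps)
 have "b < 1" using es(2) r(1) zero_less_mult_pos2 [of "1 - b" r] by (simp add: s_def)
 then have bg: "b \<le> min be 1" using b by simp
 obtain C1 where C1: "C1 \<ge> 0" "\<And>t y. t \<ge> 1/2 ==> 0 < y ==> y \<le> 1 ==> kernel_N al be t y \<le>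
   C1*(y powr (2*al + min be 1)*(1 + (y/abs (y - (1 - t))) powr si + (y/abs (y - (t - 1))) powr si))"
  using kernel_N_left [OF al mu si] by metis
 obtain C2 where C2: "C2 \<ge> 0" "\<And>t y. t \<ge> 1/2 ==> 1 < y ==> t \<le> y - 1 ==> kernel_N al be t y = 0"
  "\<And>t y. t \<ge> 1/2 ==> 1 < y ==> y - 1 < t ==> kernel_N al be t y \<le>
   C2*(y powr (- min be 1)*(2 + (t - y)) powr (- (1 - min be 1))*(1 + abs (1 + (t - y)) powr (- si) + abs (1 - (t - y)) powr (- si)))"
  using kernel_N_right [OF al mu si h, of "1 - min be 1"] by metis
 obtain C3 where C3: "C3 \<ge> 0" "\<And>t y. t \<le> 1/2 ==> t \<le> abs (1 - y) ==> kernel_N al be t y = 0"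
  "\<And>t y. t \<le> 1/2 ==> abs (1 - y) < t ==> kernel_N al be t y \<le> C3*(1/t*(1 - abs (1 - y)/t) powr (- si))"
  using kernel_N_near_diagonal [OF al mu si] by metis
 have N3: "(C*X*(1 + p + q)) powr r \<le> C powr r*3 powr r*(X powr r*(1 + p powr r + q powr r))"
  if "p \<ge> 0" "q \<ge> 0" for C X p q :: real
  using mult_left_mono [OF powr_sum3_le [of 1 p q r], of "C powr r*X powr r"] that r by (simp add: powr_mult mult_ac)
 have left: "(kernel_N al be t y*weight a b y) powr r \<le> C1 powr r*3 powr r*(4*bumps e s t y)"
  if t: "t \<ge> 1/2" and y: "0 < y" "y \<le> 1" for t y
 proof -
  let ?p = "(y/abs (y - (1 - t))) powr si" let ?q = "(y/abs (y - (t - 1))) powr si"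
  let ?X = "y powr (2*al + min be 1 - a)"
  have b1: "bump e s 1 \<le> bump e s y" using y by (cases "y = 1") (auto simp: bump_def)
  have "kernel_N al be t y*weight a b y \<le> C1*(y powr (2*al + min be 1)*(1 + ?p + ?q))*weight a b y"
   by (intro mult_right_mono C1 t y) simp
  also have "... = C1*?X*(1 + ?p + ?q)" using y by (simp add: weight_def powr_diff powr_minus_divide)
  finally have "(kernel_N al be t y*weight a b y) powr r \<le> (C1*?X*(1 + ?p + ?q)) powr r"
   using r by (intro powr_mono2) auto
  also have "... \<le> C1 powr r*3 powr r*(?X powr r*(1 + ?p powr r + ?q powr r))" by (rule N3) auto
  also have "?X powr r*(1 + ?p powr r + ?q powr r) =
    y powr k*(y/abs 1) powr 0 + y powr k*(y/abs (y - (1 - t))) powr m + y powr k*(y/abs (y - (t - 1))) powr m"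
   using y by (simp add: powr_powr k_def m_def algebra_simps)
  also have "... \<le> (bump e s y + bump e s 1) + (bump e s y + bump e s (y - (1 - t))) + (bump e s y + bump e s (y - (t - 1)))"
   using y m k es by (intro add_mono powr_quotient_le_bump) auto
  also have "... \<le> 4*bumps e s t y" using b1 unfolding bumps_def by (smt (verit) bump_nonneg)
  finally show ?thesis by (simp add: mult_left_mono)
 qed
 have right: "(kernel_N al be t y*weight a b y) powr r \<le> C2 powr r*3 powr r*(3*bumps e s t y)"
  if t: "t \<ge> 1/2" and y: "1 < y" for t y
 proof (cases "t \<le> y - 1")
  case True
  then show ?thesis using C2(2) [OF t y] by simp
 next
  case False
  define D where "D = t - y"
  have D: "D > -1" using False by (simp add: D_def)
  let ?p = "abs (1 + D) powr (- si)" let ?q = "abs (1 - D) powr (- si)"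
  let ?X = "y powr (- (min be 1 - b))*(2 + D) powr (- (1 - min be 1))"
  have "kernel_N al be t y*weight a b y \<le> C2*(y powr (- min be 1)*(2 + D) powr (- (1 - min be 1))*(1 + ?p + ?q))*weight a b y"
   using C2(3) [OF t y] False by (intro mult_right_mono) (auto simp: D_def)
  also have "... = C2*?X*(1 + ?p + ?q)" using y by (simp add: weight_def powr_diff powr_minus_divide)
  finally have "(kernel_N al be t y*weight a b y) powr r \<le> (C2*?X*(1 + ?p + ?q)) powr r"
   using r by (intro powr_mono2) auto
  also have "... \<le> C2 powr r*3 powr r*(?X powr r*(1 + ?p powr r + ?q powr r))" by (rule N3) auto
  also have "?X powr r*(1 + ?p powr r + ?q powr r) \<le> 3*bumps e s t y"
  proof -
   \<comment> \<open>The total decay s = P + Q is shared by y and 2 + D; the smaller of the two can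
     carry it alone.\<close>
   define P where "P = (min be 1 - b)*r"
   define Q where "Q = (1 - min be 1)*r"
   have PQ: "P \<ge> 0" "Q \<ge> 0" "P + Q = s" using bg r by (auto simp: P_def Q_def s_def algebra_simps)
   have X: "?X powr r = y powr (- P)*(2 + D) powr (- Q)" by (simp add: powr_mult powr_powr P_def Q_def algebra_simps)
   have "y powr (- P)*(2 + D) powr (- Q) \<le> y powr (- s) + (2 + D) powr (- s)"
   proof (cases "y \<le> 2 + D")
    case True
    then have "y powr (- P)*(2 + D) powr (- Q) \<le> y powr (- P)*y powr (- Q)"
     using y PQ by (intro mult_left_mono powr_mono2') auto
    also have "... = y powr (- s)" by (simp flip: powr_add PQ(3))
    finally show ?thesis by (simp add: add_increasing2)
   next
    case False
    then have "y powr (- P)*(2 + D) powr (- Q) \<le> (2 + D) powr (- P)*(2 + D) powr (- Q)"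
     using D PQ by (intro mult_right_mono powr_mono2') auto
    also have "... = (2 + D) powr (- s)" by (simp flip: powr_add PQ(3))
    finally show ?thesis by (simp add: add_increasing)
   qed
   also have "y powr (- s) = bump e s y" using y by (simp add: bump_def)
   also have "(2 + D) powr (- s) \<le> bump e s (y - t)"
   proof (cases "abs (y - t) < 1")
    case True
    have "(2 + D) powr (- s) \<le> (2 + D) powr 0" using D es by (intro powr_mono) auto
    then show ?thesis using True D by (simp add: bump_def add_increasing2)
   next
    case False
    then have "abs (y - t) \<le> 2 + D" "abs (y - t) > 0" using D by (auto simp: D_def)
    then show ?thesis using False es by (simp add: bump_def powr_mono2')
   qed
   finally have X1: "?X powr r \<le> bump e s y + bump e s (y - t)" unfolding X by simp
   have "y powr (- P)*(2 + D) powr (- Q) \<le> y powr 0*(2 + D) powr 0"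
    using y D PQ by (intro mult_mono powr_mono) auto
   then have X2: "?X powr r \<le> 1" unfolding X using y D by simp
   have "?p powr r \<le> 1 + bump e s (1 + D)" "?q powr r \<le> 1 + bump e s (1 - D)"
    using powr_le_1_bump m unfolding powr_powr by (simp_all add: m_def)
   then have "?X powr r*(1 + ?p powr r + ?q powr r) \<le> ?X powr r*(1 + (1 + bump e s (1 + D)) + (1 + bump e s (1 - D)))"
    by (intro mult_left_mono add_mono) auto
   also have "... = 3*?X powr r + ?X powr r*bump e s (1 + D) + ?X powr r*bump e s (1 - D)" by (simp add: algebra_simps)
   also have "... \<le> 3*(bump e s y + bump e s (y - t)) + 1*bump e s (1 + D) + 1*bump e s (1 - D)"
    by (intro add_mono mult_right_mono mult_left_mono X1 X2) auto
   also have "bump e s (1 + D) = bump e s (y - (t + 1))" using bump_abs [of e s "1 + D"] bump_abs [of e s "y - (t + 1)"] by (simp add: D_def abs_minus_commute algebra_simps)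
   also have "bump e s (1 - D) = bump e s (y - (t - 1))" by (simp add: D_def algebra_simps)
   finally show ?thesis unfolding bumps_def by (smt (verit) bump_nonneg)
  qed
  finally show ?thesis by (simp add: mult_left_mono)
 qed
 show thesis
 proof (rule that [OF es(1,2)])
  fix tt :: real assume tt: "tt > 0"
  define C4 where "C4 = C3/tt*2 powr abs (- a)*2 powr abs b"
  have near: "(kernel_N al be t y*weight a b y) powr r \<le> C4 powr r*bumps e s t y"
   if t: "tt \<le> t" "t \<le> 1/2" for t y
  proof (cases "abs (1 - y) < t")
   case False
   then show ?thesis using C3(2) [OF t(2)] by simp
  next
   case True
   \<comment> \<open>Distance of y from the nearer end of the support (1 - t, 1 + t); v <= v/t
     because t <= 1/2.\<close>
   define v where "v = t - abs (1 - y)"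
   have t0: "t > 0" using t tt by simp
   have v: "0 < v" "v \<le> 1/2" using True t unfolding v_def by (linarith, linarith)
   have y: "1/2 \<le> y" "y \<le> 2" using True t by auto
   have one: "1 \<le> 2 powr abs c" for c :: real by (rule ge_one_powr_ge_zero) auto
   have w: "weight a b y \<le> 2 powr abs (- a)*2 powr abs b"
    using powr_le_comparable [of 2 y "- a"] powr_le_comparable [of 2 y b] y
     mult_mono [OF _ one [of b], of "y powr - a"] mult_mono [OF one [of "- a"], of "y powr b"] by (auto simp: weight_def)
   have "1 - abs (1 - y)/t = v/t" using t0 by (simp add: v_def field_simps)
   moreover have "v * t \<le> v * 1" using v t by (intro mult_left_mono) auto
   then have "v \<le> v/t" using t0 by (simp add: field_simps)
   ultimately have "(1 - abs (1 - y)/t) powr (- si) \<le> v powr (- si)" using v si by (simp add: powr_minus_antimono)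
   then have "C3*(1/t*(1 - abs (1 - y)/t) powr (- si)) \<le> C3*(1/tt * v powr (- si))"
    using t t0 tt C3(1) by (intro mult_left_mono mult_mono) (auto simp: frac_le)
   with C3(3) [OF t(2) True] have "kernel_N al be t y \<le> C3*(1/tt * v powr (- si))" by linarith
   then have "kernel_N al be t y*weight a b y \<le> C3*(1/tt * v powr (- si))*(2 powr abs (- a)*2 powr abs b)"
    using C3(1) tt by (intro mult_mono w) auto
   also have "... = C4 * v powr (- si)" by (simp add: C4_def mult_ac)
   finally have "(kernel_N al be t y*weight a b y) powr r \<le> (C4 * v powr (- si)) powr r" using r by (intro powr_mono2) auto
   also have "... = C4 powr r * v powr (- m)" by (simp add: powr_mult powr_powr m_def)
   also have "v powr (- m) \<le> bump e s v" using powr_le_bump [OF m, of v s] v by simp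
   also have "bump e s v \<le> bumps e s t y"
   proof -
    have "abs v = abs (y - (1 - t)) \<or> abs v = abs (y - (t + 1))" by (auto simp: v_def)
    then have "bump e s v = bump e s (y - (1 - t)) \<or> bump e s v = bump e s (y - (t + 1))" by (metis bump_abs)
    then show ?thesis unfolding bumps_def by (smt (verit) bump_nonneg)
   qed
   finally show ?thesis by (simp add: mult_left_mono)
  qed
  define C where "C = max (C1 powr r*3 powr r*4) (max (C2 powr r*3 powr r*3) (C4 powr r))"
  have C0: "0 \<le> C" by (simp add: C_def le_max_iff_disj)
  show "\<exists>C\<ge>0. \<forall>t\<ge>tt. \<forall>y. (kernel_N al be t y*weight a b y) powr r \<le> C*bumps e s t y"
  proof (intro exI [of _ C] conjI allI impI C0)
   fix t y :: real assume t: "tt \<le> t"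
   consider "y \<le> 0" | "t \<le> 1/2" | "t \<ge> 1/2" "0 < y" "y \<le> 1" | "t \<ge> 1/2" "1 < y" by linarith
   then have "y \<le> 0 \<or> (\<exists>c\<in>{C1 powr r*3 powr r*4, C2 powr r*3 powr r*3, C4 powr r}. (kernel_N al be t y*weight a b y) powr r \<le> c*bumps e s t y)"
    using near [OF t] left right by cases (auto simp: mult.assoc)
   then show "(kernel_N al be t y*weight a b y) powr r \<le> C*bumps e s t y"
   proof (elim disjE bexE)
    fix c assume "c \<in> {C1 powr r*3 powr r*4, C2 powr r*3 powr r*3, C4 powr r}" "(kernel_N al be t y*weight a b y) powr r \<le> c*bumps e s t y"
    moreover from this(1) have "c \<le> C" by (auto simp: C_def)
    ultimately show ?thesis by (meson bumps_nonneg mult_right_mono order_trans)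
   qed (simp add: kernel_N_def kernel_domain_def C0)
  qed
 qed
qed

section \<open>Maximal operators\<close>

lemma ennreal_powr_ennreal [simp]: "x \<ge> 0 ==> ennreal_powr (ennreal x) r = ennreal (x powr r)"
 by (simp add: ennreal_powr_def)

lemma ennreal_powr_top [simp]: "ennreal_powr top r = top"
 by (simp add: ennreal_powr_def)

lemma ennreal_powr_0 [simp]: "ennreal_powr 0 r = 0"
 by (simp add: ennreal_powr_def)

lemma ennreal_powr_eq_0_iff [simp]: "ennreal_powr u r = 0 \<longleftrightarrow> u = 0"
 by (cases u) (auto simp: ennreal_eq_0_iff)

lemma ennreal_powr_one [simp]: "ennreal_powr u 1 = u"
 by (cases u) auto

lemma ennreal_powr_mono: "u \<le> v ==> 0 \<le> r ==> ennreal_powr u r \<le> ennreal_powr v r"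
 by (cases u; cases v) (auto simp: ennreal_leI powr_mono2 top_unique)

lemma ennreal_powr_mult: "ennreal_powr (u * v) r = ennreal_powr u r*ennreal_powr v r"
 by (cases u; cases v) (auto simp: powr_mult ennreal_top_mult ennreal_mult_top ennreal_eq_0_iff simp flip: ennreal_mult)

lemma ennreal_powr_powr: "ennreal_powr (ennreal_powr u r) s = ennreal_powr u (r * s)"
 by (cases u) (auto simp: powr_powr)

lemma ennreal_powr_add_le:
 assumes "r \<ge> 0"
 shows "ennreal_powr (u + v) r \<le> ennreal (2 powr r)*(ennreal_powr u r + ennreal_powr v r)"
proof -
 have "u + v \<le> max u v + max u v" by (intro add_mono) auto
 then have "u + v \<le> ennreal 2*max u v" by (simp add: mult_2)
 then have "ennreal_powr (u + v) r \<le> ennreal_powr (ennreal 2*max u v) r" using assms by (intro ennreal_powr_mono)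
 also have "... = ennreal (2 powr r)*ennreal_powr (max u v) r" by (simp only: ennreal_powr_mult ennreal_powr_ennreal zero_le_numeral)
 also have "... \<le> ennreal (2 powr r)*(ennreal_powr u r + ennreal_powr v r)" by (intro mult_left_mono) (auto simp: max_def)
 finally show ?thesis .
qed

lemma borel_measurable_ennreal_powr [measurable]:
 assumes [measurable]: "F \<in> borel_measurable M"
 shows "(\<lambda>x. ennreal_powr (F x) r) \<in> borel_measurable M"
 unfolding ennreal_powr_def by measurable

lemma ennreal_Young:
 assumes "p > 1" "q > 1" "1/p + 1/q = 1"
 shows "u * v \<le> ennreal (1/p)*ennreal_powr u p + ennreal (1/q)*ennreal_powr v q"
proof (cases "u = top \<or> v = top")
 case True
 then show ?thesis using assms by (auto simp: ennreal_mult_top)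
next
 case False
 then obtain x y where "u = ennreal x" "v = ennreal y" "0 \<le> x" "0 \<le> y" by (cases u; cases v) auto
 then show ?thesis using Youngs_inequality [OF assms(1-3), of x y] assms
  by (simp add: ennreal_leI flip: ennreal_mult ennreal_plus)
qed

text \<open>Raised to the power p, with p - 1 on the dual factor, the inequality avoids p-th roots
  and holds throughout [0, infinity]; the degenerate cases are settled first.\<close>

lemma nn_integral_Hoelder:
 assumes p: "p > 1" and [measurable]: "f \<in> borel_measurable M" "g \<in> borel_measurable M"
 shows "ennreal_powr (\<integral>\<^sup>+ x. f x*g x \<partial>M) p \<le> ennreal_powr (\<integral>\<^sup>+ x. ennreal_powr (g x) (p/(p - 1)) \<partial>M) (p - 1)*(\<integral>\<^sup>+ x. ennreal_powr (f x) p \<partial>M)"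
proof -
 define q where "q = p/(p - 1)"
 have q: "q > 1" "1/p + 1/q = 1" "p/q = p - 1" using p by (auto simp: q_def field_simps)
 let ?B = "\<integral>\<^sup>+ x. ennreal_powr (g x) q \<partial>M" let ?a = "\<integral>\<^sup>+ x. ennreal_powr (f x) p \<partial>M"
 consider "?B = 0 \<or> ?a = 0" | "?B \<noteq> 0" "?a \<noteq> 0" "?B = top \<or> ?a = top" | b a where "?B = ennreal b" "?a = ennreal a" "b > 0" "a > 0"
  by (cases ?B; cases ?a) (auto simp: less_le)
 then have "ennreal_powr (\<integral>\<^sup>+ x. f x*g x \<partial>M) p \<le> ennreal_powr ?B (p - 1)*?a"
 proof cases
  case 1
  then have "AE x in M. f x*g x = 0" by (auto simp: nn_integral_0_iff_AE elim!: eventually_mono)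
  then have "(\<integral>\<^sup>+ x. f x*g x \<partial>M) = (\<integral>\<^sup>+ x. 0 \<partial>M)" by (intro nn_integral_cong_AE) auto
  then show ?thesis by simp
 next
  case 2
  then show ?thesis by (auto simp: ennreal_top_mult ennreal_mult_top)
 next
  case 3
  \<comment> \<open>Scaling f by l and g by 1/l balances the two terms of Young's inequality: l^p a
    = l^(-q) b.\<close>
  define l where "l = (b/a) powr (1/(p*q))"
  have l: "l > 0" using 3 by (simp add: l_def)
  have lp: "l powr p = (b/a) powr (1/q)" "l powr q = (b/a) powr (1/p)" using p q by (simp_all add: l_def powr_powr)
  have "(\<integral>\<^sup>+ x. f x*g x \<partial>M) = (\<integral>\<^sup>+ x. (ennreal l*f x)*(ennreal (1/l)*g x) \<partial>M)"
  proof (intro nn_integral_cong)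
   fix x
   have "(ennreal l*f x)*(ennreal (1/l)*g x) = (ennreal l*ennreal (1/l))*(f x*g x)" by (simp only: mult_ac)
   then show "f x*g x = (ennreal l*f x)*(ennreal (1/l)*g x)" using l by (simp flip: ennreal_mult)
  qed
  also have "... \<le> (\<integral>\<^sup>+ x. ennreal (1/p)*ennreal_powr (ennreal l*f x) p + ennreal (1/q)*ennreal_powr (ennreal (1/l)*g x) q \<partial>M)"
   by (intro nn_integral_mono ennreal_Young p q)
  also have "... = (\<integral>\<^sup>+ x. ennreal (l powr p/p)*ennreal_powr (f x) p + ennreal ((1/l) powr q/q)*ennreal_powr (g x) q \<partial>M)"
   using p q l by (simp add: ennreal_powr_mult ennreal_mult'' mult.assoc divide_ennreal_def [symmetric] flip: ennreal_mult mult.assoc)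
  also have "... = ennreal (l powr p/p*a + (1/l) powr q/q*b)"
   using 3 p q l by (simp add: nn_integral_add nn_integral_cmult flip: ennreal_mult ennreal_plus)
  also have "l powr p/p*a + (1/l) powr q/q*b = (b/a) powr (1/q)*a*(1/p + 1/q)"
  proof -
   have "(b/a) powr (1/q)*(b/a) powr (1/p) = b/a" using 3 q(2) by (simp add: add.commute flip: powr_add)
   moreover have "X/p*a + 1/Y/q*b = X*a*(1/p + 1/q)" if "X*Y = b/a" "Y > 0" for X Y
   proof -
    have "b = X*Y*a" using that(1) 3 by simp
    then show ?thesis using that(2) by (simp add: algebra_simps)
   qed
   ultimately show ?thesis using 3 by (simp add: powr_divide [of 1] lp)
  qed
  finally have "(\<integral>\<^sup>+ x. f x*g x \<partial>M) \<le> ennreal ((b/a) powr (1/q)*a)" using q by simp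
  then have "ennreal_powr (\<integral>\<^sup>+ x. f x*g x \<partial>M) p \<le> ennreal_powr (ennreal ((b/a) powr (1/q)*a)) p"
   using p by (intro ennreal_powr_mono) auto
  also have "... = ennreal (b powr (p - 1)*a)"
  proof -
   have "a powr p = a powr (p - 1)*a" using 3 by (simp add: powr_diff)
   then show ?thesis using 3 q by (simp add: powr_mult powr_powr powr_divide)
  qed
  finally show ?thesis using 3 by (simp flip: ennreal_mult)
 qed
 then show ?thesis by (simp add: q_def)
qed

section \<open>Layer cake formula and interpolation\<close>

lemma nn_integral_powr_less:
 fixes a c :: real
 assumes "a > -1" "c \<ge> 0"
 shows "(NN l. (if 0 < l \<and> l < c then ennreal (l powr a) else 0)) = ennreal (c powr (a + 1)/(a + 1))"
proof -
 have "(NN l. (if 0 < l \<and> l < c then ennreal (l powr a) else 0)) = (NN l. ennreal (indicator {0<..c} l*l powr a))"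
  using AE_lborel_singleton [of c] by (intro nn_integral_cong_AE) (auto simp: indicator_def elim!: eventually_mono)
 then show ?thesis using nn_integral_has_bochner [OF powr_integral_from_0] assms by simp
qed

text \<open>The layer cake formula. It is proved for finite c <= u first, so that u = top follows by
  letting c exceed any finite value of the integral.\<close>

lemma ennreal_powr_le_layers:
 assumes q: "q > 1"
 shows "ennreal_powr u q \<le> (NN l. (if 0 < l \<and> ennreal l < u then ennreal q*ennreal (l powr (q - 1)) else 0))" (is "_ \<le> ?I")
proof -
 have real: "ennreal (c powr q) \<le> ?I" if "c \<ge> 0" "ennreal c \<le> u" for c
 proof -
  have "ennreal (c powr q) = ennreal q*(NN l. (if 0 < l \<and> l < c then ennreal (l powr (q - 1)) else 0))"
   using that q by (subst nn_integral_powr_less) (auto simp flip: ennreal_mult)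
  also have "... = (NN l. ennreal q*(if 0 < l \<and> l < c then ennreal (l powr (q - 1)) else 0))"
   by (intro nn_integral_cmult [symmetric]) measurable
  also have "... \<le> ?I"
  proof (intro nn_integral_mono)
   fix l :: real
   have "ennreal l < u" if "0 < l" "l < c" using that ennreal_lessI [of c l] \<open>ennreal c \<le> u\<close> by (auto intro: less_le_trans)
   then show "ennreal q*(if 0 < l \<and> l < c then ennreal (l powr (q - 1)) else 0) \<le> (if 0 < l \<and> ennreal l < u then ennreal q*ennreal (l powr (q - 1)) else 0)"
    by auto
  qed
  finally show ?thesis .
 qed
 show ?thesis
 proof (cases u)
  case top
  have "?I = \<infinity>"
  proof (cases ?I)
   case (real b)
   have "ennreal ((b + 1) powr q) \<le> ?I" using real top by (intro \<open>\<And>c. c \<ge> 0 ==> ennreal c \<le> u ==> ennreal (c powr q) \<le> ?I\<close>) auto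
   moreover have "(b + 1) powr 1 \<le> (b + 1) powr q" using real q by (intro powr_mono) auto
   ultimately have "b + 1 \<le> b" using real by (simp add: ennreal_le_iff)
   then show ?thesis by simp
  qed simp
  then show ?thesis by simp
 qed (use real in simp)
qed

text \<open>The second half of Marcinkiewicz interpolation: the weak bound at height l sees only the
  part of H above l/B, so after Fubini the l-integral runs up to B * H y and yields a multiple of H
  y powr q. Convergence at l = 0 is q > 1.\<close>

lemma layer_cake_bound:
 fixes F :: "real => ennreal" and H :: "real => real"
 assumes [measurable]: "F \<in> borel_measurable borel" "H \<in> borel_measurable borel" and H: "\<And>y. H y \<ge> 0"
  and q: "q > 1" and AB: "A \<ge> 0" "B \<ge> 0"
  and weak: "\<And>l. l > 0 ==> emeasure lborel {x. ennreal l < F x} \<le> ennreal (A/l)*(NN y. (if l < B*H y then ennreal (H y) else 0))"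
 shows "(NN x. ennreal_powr (F x) q) \<le> ennreal (A*q*(B powr (q - 1)/(q - 1)))*(NN y. ennreal (H y powr q))"
proof -
 let ?L = "\<lambda>l. ennreal q*ennreal (l powr (q - 1))"
 let ?G = "\<lambda>l y. (if 0 < l \<and> l < B*H y then ennreal (A*q*H y)*ennreal (l powr (q - 2)) else 0)"
 have "(NN x. ennreal_powr (F x) q) \<le> (NN x. NN l. (if 0 < l \<and> ennreal l < F x then ?L l else 0))"
  by (intro nn_integral_mono ennreal_powr_le_layers q)
 also have "... = (NN l. NN x. (if 0 < l \<and> ennreal l < F x then ?L l else 0))"
  by (rule lborel_pair.Fubini') measurable
 also have "... \<le> (NN l. NN y. ?G l y)"
 proof (rule nn_integral_mono)
  fix l :: real
  show "(NN x. (if 0 < l \<and> ennreal l < F x then ?L l else 0)) \<le> (NN y. ?G l y)"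
  proof (cases "l > 0")
   case True
   have "(NN x. (if 0 < l \<and> ennreal l < F x then ?L l else 0)) = (NN x. ?L l*indicator {x. ennreal l < F x} x)"
    using True by (intro nn_integral_cong) (auto simp: indicator_def)
   also have "... = ?L l*emeasure lborel {x. ennreal l < F x}"
    by (intro nn_integral_cmult_indicator) measurable
   also have "... \<le> ?L l*(ennreal (A/l)*(NN y. (if l < B*H y then ennreal (H y) else 0)))"
    by (intro mult_left_mono weak True) simp
   also have "... = ennreal (q*l powr (q - 1)*(A/l))*(NN y. (if l < B*H y then ennreal (H y) else 0))"
    using q AB True by (simp only: mult.assoc [symmetric]) (simp flip: ennreal_mult)
   also have "q*l powr (q - 1)*(A/l) = A*q*l powr (q - 2)"
    using True powr_add [of l "q - 2" 1] by simp
   also have "ennreal (A*q*l powr (q - 2))*(NN y. (if l < B*H y then ennreal (H y) else 0)) =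
     (NN y. ennreal (A*q*l powr (q - 2))*(if l < B*H y then ennreal (H y) else 0))"
    by (intro nn_integral_cmult [symmetric]) measurable
   also have "... = (NN y. ?G l y)"
    using True AB q H by (intro nn_integral_cong) (auto simp: mult_ac simp flip: ennreal_mult)
   finally show ?thesis .
  qed simp
 qed
 also have "... = (NN y. NN l. ?G l y)"
  by (rule lborel_pair.Fubini') measurable
 also have "... = (NN y. ennreal (A*q*(B powr (q - 1)/(q - 1)))*ennreal (H y powr q))"
 proof (intro nn_integral_cong)
  fix y
  have "(NN l. ?G l y) = (NN l. ennreal (A*q*H y)*(if 0 < l \<and> l < B*H y then ennreal (l powr (q - 2)) else 0))"
   by (intro nn_integral_cong) auto
  also have "... = ennreal (A*q*H y)*ennreal ((B*H y) powr (q - 2 + 1)/(q - 2 + 1))"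
   using q AB H by (subst nn_integral_cmult, measurable, subst nn_integral_powr_less) auto
  also have "... = ennreal (A*q*(B powr (q - 1)/(q - 1))*(H y powr (q - 1)*H y))"
   using q AB H by (simp add: powr_mult mult_ac flip: ennreal_mult)
  also have "H y powr (q - 1)*H y = H y powr q" using powr_add [of "H y" "q - 1" 1] H [of y] by simp
  finally show "(NN l. ?G l y) = ennreal (A*q*(B powr (q - 1)/(q - 1)))*ennreal (H y powr q)"
   using q AB by (simp flip: ennreal_mult)
 qed
 also have "... = ennreal (A*q*(B powr (q - 1)/(q - 1)))*(NN y. ennreal (H y powr q))"
  by (intro nn_integral_cmult) measurable
 finally show ?thesis .
qed

lemma SUP_integral_measurable:
 fixes k :: "'j => real => real => ennreal"
 assumes "countable J" "\<And>j. case_prod (k j) \<in> borel_measurable (borel \<Otimes>\<^sub>M borel)"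
 shows "(\<lambda>x. SUP j\<in>J. NN z. k j x z) \<in> borel_measurable borel"
proof (intro borel_measurable_SUP assms(1))
 fix j
 note [measurable] = assms(2) [of j]
 show "(\<lambda>x. NN z. k j x z) \<in> borel_measurable borel" by measurable
qed

text \<open>Marcinkiewicz interpolation for a countable family of averages.\<close>

lemma maximal_strong:
 fixes k :: "'j => real => real => ennreal"
 assumes J: "countable J" and k: "\<And>j. case_prod (k j) \<in> borel_measurable (borel \<Otimes>\<^sub>M borel)"
  and M: "M > 0" "\<And>j x. j \<in> J ==> (NN z. k j x z) \<le> ennreal M"
  and W: "W \<ge> 0" "\<And>H l. H \<in> borel_measurable borel ==> (\<And>y. H y \<ge> (0::real)) ==> l > 0 ==>
   emeasure lborel {x. ennreal l < (SUP j\<in>J. NN z. k j x z*ennreal (H z))} \<le> ennreal (W/l)*(NN y. ennreal (H y))"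
  and q: "q > 1" and H: "H \<in> borel_measurable borel" "\<And>y. H y \<ge> (0::real)"
 shows "(NN x. ennreal_powr (SUP j\<in>J. NN z. k j x z*ennreal (H z)) q) \<le>
  ennreal (2*W*q*((2*M) powr (q - 1)/(q - 1)))*(NN y. ennreal (H y powr q))"
proof (rule layer_cake_bound [OF _ H q])
 note [measurable] = H(1) k
 define T where "T H x = (SUP j\<in>J. NN z. k j x z*ennreal (H z))" for H x
 have T [measurable]: "T H \<in> borel_measurable borel" if [measurable]: "H \<in> borel_measurable borel" for H
  unfolding T_def [abs_def] by (rule SUP_integral_measurable [OF J]) measurable
 then show "(\<lambda>x. SUP j\<in>J. NN z. k j x z*ennreal (H z)) \<in> borel_measurable borel"
  using H(1) by (simp add: T_def [abs_def])
 fix l :: real assume l: "l > 0"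
 \<comment> \<open>The large part of H. The rest is at most l/(2 M), and its averages are at most
   l/2 since the kernels have mass at most M.\<close>
 define H' where "H' = (\<lambda>y. if l < 2*M*H y then H y else 0)"
 have [measurable]: "H' \<in> borel_measurable borel" unfolding H'_def by measurable
 have H': "H' y \<ge> 0" for y using H by (simp add: H'_def)
 have avg: "(NN z. k j x z*ennreal (H z)) \<le> T H' x + ennreal (l/2)" if j: "j \<in> J" for j x
 proof -
  have "(NN z. k j x z*ennreal (H z)) \<le> (NN z. k j x z*ennreal (H' z) + ennreal (l/(2*M)) * k j x z)"
  proof (intro nn_integral_mono)
   fix z
   have "H z \<le> H' z + l/(2*M)" using l M(1) H(2) [of z] by (auto simp: H'_def field_simps)
   then have "k j x z*ennreal (H z) \<le> k j x z*ennreal (H' z + l/(2*M))" by (intro mult_left_mono ennreal_leI) auto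
   then show "k j x z*ennreal (H z) \<le> k j x z*ennreal (H' z) + ennreal (l/(2*M)) * k j x z"
    using l M(1) H' by (simp add: distrib_left mult.commute)
  qed
  also have "... = (NN z. k j x z*ennreal (H' z)) + ennreal (l/(2*M))*(NN z. k j x z)"
   by (simp add: nn_integral_add nn_integral_cmult)
  also have "... \<le> T H' x + ennreal (l/(2*M))*ennreal M"
   unfolding T_def using j by (intro add_mono mult_left_mono M(2) SUP_upper) auto
  finally show ?thesis using l M(1) by (simp flip: ennreal_mult)
 qed
 have "{x. ennreal l < T H x} \<subseteq> {x. ennreal (l/2) < T H' x}"
 proof (rule subsetI, unfold mem_Collect_eq)
  fix x
  assume "ennreal l < T H x"
  also have "... \<le> T H' x + ennreal (l/2)" unfolding T_def [of H] by (intro SUP_least avg)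
  finally have "ennreal (l/2) + ennreal (l/2) < T H' x + ennreal (l/2)" using l by (simp flip: ennreal_plus)
  then show "ennreal (l/2) < T H' x" by (metis add_right_mono not_le)
 qed
 then have "emeasure lborel {x. ennreal l < T H x} \<le> emeasure lborel {x. ennreal (l/2) < T H' x}"
  by (intro emeasure_mono) auto
 also have "... \<le> ennreal (W/(l/2))*(NN y. ennreal (H' y))"
  unfolding T_def using l H' by (intro W(2)) auto
 also have "(NN y. ennreal (H' y)) = (NN y. (if l < 2*M*H y then ennreal (H y) else 0))"
  by (intro nn_integral_cong) (simp add: H'_def)
 finally show "emeasure lborel {x. ennreal l < (SUP j\<in>J. NN z. k j x z*ennreal (H z))} \<le>
   ennreal (2*W/l)*(NN y. (if l < 2*M*H y then ennreal (H y) else 0))"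
  by (simp add: T_def mult.commute)
qed (use W(1) M(1) in auto)

text \<open>With the unbounded factor S the averages escape \<open>maximal_strong\<close>. Hoelder
  with respect to the measure k j x z dz trades S, through its q'-means bounded by B, for v powr q,
  and \<open>maximal_strong\<close> applies with exponent p/q > 1. Hence the wish for some q
  strictly between 1 and p.\<close>

lemma maximal_average:
 fixes k S :: "'j => real => real => ennreal"
 assumes J: "countable J" and k: "\<And>j. case_prod (k j) \<in> borel_measurable (borel \<Otimes>\<^sub>M borel)"
  and M: "M > 0" "\<And>j x. j \<in> J ==> (NN z. k j x z) \<le> ennreal M"
  and W: "W \<ge> 0" "\<And>H l. H \<in> borel_measurable borel ==> (\<And>y. H y \<ge> (0::real)) ==> l > 0 ==>
   emeasure lborel {x. ennreal l < (SUP j\<in>J. NN z. k j x z*ennreal (H z))} \<le> ennreal (W/l)*(NN y. ennreal (H y))"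
  and S: "\<And>j. case_prod (S j) \<in> borel_measurable (borel \<Otimes>\<^sub>M borel)"
  and B: "B \<ge> 0" "\<And>j x. j \<in> J ==> (NN z. k j x z*ennreal_powr (S j x z) (q/(q - 1))) \<le> ennreal B"
  and q: "1 < q" "q < p"
 obtains C where "C \<ge> 0" "\<And>v. v \<in> borel_measurable borel ==> (\<And>z. v z \<ge> (0::real)) ==>
  (NN x. ennreal_powr (SUP j\<in>J. NN z. k j x z*S j x z*ennreal (v z)) p) \<le> ennreal C*(NN z. ennreal (v z powr p))"
proof -
 define r where "r = p/q"
 have r: "r > 1" "q*r = p" using q by (auto simp: r_def)
 define C where "C = 2*W*r*((2*M) powr (r - 1)/(r - 1))"
 have C: "C \<ge> 0" using W(1) M(1) r by (simp add: C_def)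
 have "(NN x. ennreal_powr (SUP j\<in>J. NN z. k j x z*S j x z*ennreal (v z)) p)
   \<le> ennreal ((B powr (q - 1)) powr r*C)*(NN z. ennreal (v z powr p))"
  if [measurable]: "v \<in> borel_measurable borel" and v: "\<And>z. v z \<ge> 0" for v :: "real => real"
 proof -
  let ?X = "\<lambda>j x. NN z. k j x z*S j x z*ennreal (v z)"
  let ?T = "\<lambda>x. SUP j\<in>J. NN z. k j x z*ennreal (v z powr q)"
  have pw: "ennreal_powr (?X j x) q \<le> ennreal (B powr (q - 1))*?T x" if j: "j \<in> J" for j x
  proof -
   note [measurable] = k [of j] S [of j]
   let ?D = "density lborel (k j x)"
   have kx [measurable]: "k j x \<in> borel_measurable borel" "S j x \<in> borel_measurable borel"
    using measurable_compose [OF measurable_Pair1' [of x borel borel] k] measurable_compose [OF measurable_Pair1' [of x borel borel] S] by simp_all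
   have "?X j x = (\<integral>\<^sup>+ z. ennreal (v z)*S j x z \<partial>?D)" by (subst nn_integral_density) (auto simp: mult_ac)
   then have "ennreal_powr (?X j x) q \<le> ennreal_powr (\<integral>\<^sup>+ z. ennreal_powr (S j x z) (q/(q - 1)) \<partial>?D) (q - 1)*(\<integral>\<^sup>+ z. ennreal_powr (ennreal (v z)) q \<partial>?D)"
    using q by (simp add: nn_integral_Hoelder)
   also have "... \<le> ennreal_powr (ennreal B) (q - 1)*(NN z. k j x z*ennreal (v z powr q))"
    using q B j v by (intro mult_mono ennreal_powr_mono) (auto simp: nn_integral_density)
   also have "... \<le> ennreal (B powr (q - 1))*?T x"
    using B j by (intro mult_mono SUP_upper) auto
   finally show ?thesis .
  qed
  have root: "ennreal_powr (ennreal_powr u q) (1/q) = u" "ennreal_powr (ennreal_powr u (1/q)) q = u" for u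
   using q by (simp_all add: ennreal_powr_powr)
  have "(SUP j\<in>J. ?X j x) \<le> ennreal_powr (ennreal (B powr (q - 1))*?T x) (1/q)" for x
  proof (intro SUP_least)
   fix j assume "j \<in> J"
   from ennreal_powr_mono [OF pw [OF this], of "1/q" x] show "?X j x \<le> ennreal_powr (ennreal (B powr (q - 1))*?T x) (1/q)"
    using q by (simp add: root)
  qed
  then have "ennreal_powr (SUP j\<in>J. ?X j x) p \<le> ennreal_powr (ennreal_powr (ennreal (B powr (q - 1))*?T x) (1/q)) p" for x
   using q by (intro ennreal_powr_mono) auto
  also have "ennreal_powr (ennreal_powr (ennreal (B powr (q - 1))*?T x) (1/q)) p = ennreal ((B powr (q - 1)) powr r)*ennreal_powr (?T x) r" for x
   by (simp add: ennreal_powr_powr r_def ennreal_powr_mult powr_powr)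
  finally have "(NN x. ennreal_powr (SUP j\<in>J. ?X j x) p) \<le> (NN x. ennreal ((B powr (q - 1)) powr r)*ennreal_powr (?T x) r)"
   by (intro nn_integral_mono)
  also have "... = ennreal ((B powr (q - 1)) powr r)*(NN x. ennreal_powr (?T x) r)"
  proof (intro nn_integral_cmult borel_measurable_ennreal_powr)
   note [measurable] = k
   show "?T \<in> borel_measurable lborel" using SUP_integral_measurable [OF J, of "\<lambda>j x z. k j x z*ennreal (v z powr q)"] by simp
  qed
  also have "... \<le> ennreal ((B powr (q - 1)) powr r)*(ennreal C*(NN z. ennreal ((v z powr q) powr r)))"
   unfolding C_def using r by (intro mult_left_mono maximal_strong [OF J k M W]) auto
  finally show ?thesis using C r by (simp add: powr_powr ennreal_mult mult.assoc)
 qed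
 then show thesis using that [of "(B powr (q - 1)) powr r*C"] C by simp
qed

section \<open>Maximal operators commuting with dilations\<close>

definition power_weight :: "real => real => ennreal" where
 "power_weight dl x = ennreal (indicator {0<..} x*x powr dl)"

lemma borel_measurable_power_weight [measurable]: "power_weight dl \<in> borel_measurable borel"
 unfolding power_weight_def [abs_def] by measurable

text \<open>Restricting to rational radii makes the supremum measurable; continuity in the radius removes the restriction.\<close>

definition dilation_maximal :: "(real => real => real) => (real => real) => real => ennreal" where
 "dilation_maximal k u x = (SUP t\<in>\<rat> \<inter> {0<..}. NN y. ennreal (k (t/x) y*u (x*y)))"

text \<open>Nonnegative Borel functions u keep all integrals in [0, infinity], so that no
  integrability has to be settled beforehand.\<close>

definition maximal_bounded :: "real => real => (real => real => real) => bool" where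
 "maximal_bounded p dl k \<longleftrightarrow> (\<exists>C\<ge>0. \<forall>u. u \<in> borel_measurable borel --> (\<forall>z. 0 \<le> u z) -->
  (NN x. ennreal_powr (dilation_maximal k u x) p*power_weight dl x) \<le> ennreal C*(NN z. ennreal (u z powr p)*power_weight dl z))"

lemma countable_positive_rationals: "countable (\<rat> \<inter> {0<..} :: real set)"
 by (intro countable_Int1 countable_rat)

lemma borel_measurable_dilation_maximal:
 assumes [measurable]: "case_prod k \<in> borel_measurable (borel \<Otimes>\<^sub>M borel)" "u \<in> borel_measurable borel"
 shows "dilation_maximal k u \<in> borel_measurable borel"
 unfolding dilation_maximal_def [abs_def]
 by (rule SUP_integral_measurable [OF countable_positive_rationals]) measurable

lemma nn_integral_scale:
 fixes F :: "real => ennreal"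
 assumes [measurable]: "F \<in> borel_measurable borel" and x: "x > 0"
 shows "(NN y. F y) = ennreal (1/x)*(NN z. F (z/x))"
 using nn_integral_real_affine [OF assms(1), of "1/x" 0] x by simp

lemma maximal_bounded_add:
 assumes m: "case_prod k1 \<in> borel_measurable (borel \<Otimes>\<^sub>M borel)" "case_prod k2 \<in> borel_measurable (borel \<Otimes>\<^sub>M borel)"
  and nn: "\<And>t y. k1 t y \<ge> 0" "\<And>t y. k2 t y \<ge> 0" and le: "\<And>t y. t > 0 ==> k t y \<le> k1 t y + k2 t y"
  and b: "maximal_bounded p dl k1" "maximal_bounded p dl k2" and p: "p > 0"
 shows "maximal_bounded p dl k"
proof -
 let ?I = "\<lambda>k u. NN x. ennreal_powr (dilation_maximal k u x) p*power_weight dl x"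
 let ?U = "\<lambda>u. NN z. ennreal (u z powr p)*power_weight dl z"
 obtain C1 where C1: "C1 \<ge> 0" "\<And>u. u \<in> borel_measurable borel ==> (\<forall>z. 0 \<le> u z) ==> ?I k1 u \<le> ennreal C1*?U u"
  using b(1) unfolding maximal_bounded_def by blast
 obtain C2 where C2: "C2 \<ge> 0" "\<And>u. u \<in> borel_measurable borel ==> (\<forall>z. 0 \<le> u z) ==> ?I k2 u \<le> ennreal C2*?U u"
  using b(2) unfolding maximal_bounded_def by blast
 show ?thesis unfolding maximal_bounded_def
 proof (intro exI [of _ "2 powr p*(C1 + C2)"] conjI allI impI)
  fix u :: "real => real" assume u [measurable]: "u \<in> borel_measurable borel" and u0: "\<forall>z. 0 \<le> u z"
  note [measurable] = m borel_measurable_dilation_maximal [OF m(1) u] borel_measurable_dilation_maximal [OF m(2) u]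
  have D: "dilation_maximal k u x \<le> dilation_maximal k1 u x + dilation_maximal k2 u x" if x: "x > 0" for x
   unfolding dilation_maximal_def
  proof (rule SUP_least)
   fix t :: real assume t: "t \<in> \<rat> \<inter> {0<..}"
   have "(NN y. ennreal (k (t/x) y*u (x*y))) \<le> (NN y. ennreal (k1 (t/x) y*u (x*y)) + ennreal (k2 (t/x) y*u (x*y)))"
   proof (intro nn_integral_mono)
    fix y
    have "k (t/x) y*u (x*y) \<le> (k1 (t/x) y + k2 (t/x) y)*u (x*y)" using t x u0 by (intro mult_right_mono le) auto
    then show "ennreal (k (t/x) y*u (x*y)) \<le> ennreal (k1 (t/x) y*u (x*y)) + ennreal (k2 (t/x) y*u (x*y))"
     using nn u0 by (simp add: distrib_right ennreal_leI flip: ennreal_plus)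
   qed
   also have "... = (NN y. ennreal (k1 (t/x) y*u (x*y))) + (NN y. ennreal (k2 (t/x) y*u (x*y)))"
    by (intro nn_integral_add) measurable
   finally show "(NN y. ennreal (k (t/x) y*u (x*y))) \<le>
     (SUP t\<in>\<rat> \<inter> {0<..}. NN y. ennreal (k1 (t/x) y*u (x*y))) + (SUP t\<in>\<rat> \<inter> {0<..}. NN y. ennreal (k2 (t/x) y*u (x*y)))"
    by (rule order_trans) (intro add_mono SUP_upper t)
  qed
  have "?I k u \<le> (NN x. ennreal (2 powr p)*(ennreal_powr (dilation_maximal k1 u x) p*power_weight dl x + ennreal_powr (dilation_maximal k2 u x) p*power_weight dl x))"
  proof (intro nn_integral_mono)
   fix x :: real
   show "ennreal_powr (dilation_maximal k u x) p*power_weight dl x \<le> ennreal (2 powr p)*(ennreal_powr (dilation_maximal k1 u x) p*power_weight dl x + ennreal_powr (dilation_maximal k2 u x) p*power_weight dl x)"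
   proof (cases "x > 0")
    case True
    then have "ennreal_powr (dilation_maximal k u x) p \<le> ennreal (2 powr p)*(ennreal_powr (dilation_maximal k1 u x) p + ennreal_powr (dilation_maximal k2 u x) p)"
     using p by (intro order_trans [OF ennreal_powr_mono ennreal_powr_add_le] D) auto
    from mult_right_mono [OF this, of "power_weight dl x"] show ?thesis by (simp add: mult.assoc distrib_right)
   qed (simp add: power_weight_def)
  qed
  also have "... = ennreal (2 powr p)*(?I k1 u + ?I k2 u)" by (simp add: nn_integral_cmult nn_integral_add)
  also have "... \<le> ennreal (2 powr p)*(ennreal C1*?U u + ennreal C2*?U u)" by (intro mult_left_mono add_mono C1 C2 u u0) simp
  also have "... = ennreal (2 powr p*(C1 + C2))*?U u"
   using C1(1) C2(1) by (simp add: ennreal_mult mult.assoc distrib_right)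
  finally show "?I k u \<le> ennreal (2 powr p*(C1 + C2))*?U u" .
 qed (use C1(1) C2(1) in simp)
qed

text \<open>Hoelder in y puts the supremum over t entirely on the p'-norm of the kernel times w,
  bounded by \<open>B\<close>. What remains is free of t: for each y a dilation turns the weighted
  p-norm of u (x y) in x into y powr (-dl - 1) times that of u, and \<open>D\<close> sums this
  up.\<close>

lemma maximal_bounded_Hoelder:
 assumes [measurable]: "case_prod k \<in> borel_measurable (borel \<Otimes>\<^sub>M borel)" "w \<in> borel_measurable borel"
  and k: "\<And>t y. k t y \<ge> 0" "\<And>t y. y \<le> 0 ==> k t y = 0" and w: "\<And>y. y > 0 ==> w y > (0::real)" and p: "p > 1"
  and B: "B \<ge> 0" "\<And>t. t > 0 ==> (NN y. ennreal ((k t y*w y) powr (p/(p - 1)))) \<le> ennreal B"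
  and D: "(NN y. power_weight (- dl - 1) y*ennreal (w y powr (- p))) < top"
 shows "maximal_bounded p dl k"
proof -
 let ?U = "\<lambda>u. NN z. ennreal (u z powr p)*power_weight dl z"
 obtain d where d: "d \<ge> 0" "(NN y. power_weight (- dl - 1) y*ennreal (w y powr (- p))) = ennreal d"
  using D by (cases "NN y. power_weight (- dl - 1) y*ennreal (w y powr (- p))") auto
 show ?thesis unfolding maximal_bounded_def
 proof (intro exI [of _ "B powr (p - 1)*d"] conjI allI impI)
  show "0 \<le> B powr (p - 1)*d" using d by simp
  fix u :: "real => real" assume u [measurable]: "u \<in> borel_measurable borel" and u0: "\<forall>z. 0 \<le> u z"
  let ?g = "\<lambda>x y. ennreal (indicator {0<..} y*(u (x*y) powr p*w y powr (- p)))"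
  have pw: "ennreal_powr (dilation_maximal k u x) p \<le> ennreal (B powr (p - 1))*(NN y. ?g x y)" if x: "x > 0" for x
  proof -
   have "ennreal_powr (NN y. ennreal (k (t/x) y*u (x*y))) p \<le> ennreal (B powr (p - 1))*(NN y. ?g x y)"
    if t: "t \<in> \<rat> \<inter> {0<..}" for t
   proof -
    have "(NN y. ennreal (k (t/x) y*u (x*y))) =
      (NN y. ennreal (indicator {0<..} y*(u (x*y)/w y))*ennreal (indicator {0<..} y*(k (t/x) y*w y)))"
    proof (intro nn_integral_cong)
     fix y
     show "ennreal (k (t/x) y*u (x*y)) = ennreal (indicator {0<..} y*(u (x*y)/w y))*ennreal (indicator {0<..} y*(k (t/x) y*w y))"
      using w [of y] k u0 by (cases "y > 0") (auto simp flip: ennreal_mult)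
    qed
    then have "ennreal_powr (NN y. ennreal (k (t/x) y*u (x*y))) p \<le>
      ennreal_powr (NN y. ennreal_powr (ennreal (indicator {0<..} y*(k (t/x) y*w y))) (p/(p - 1))) (p - 1) *
      (NN y. ennreal_powr (ennreal (indicator {0<..} y*(u (x*y)/w y))) p)"
     using p by (simp add: nn_integral_Hoelder)
    also have "... \<le> ennreal_powr (ennreal B) (p - 1)*(NN y. ?g x y)"
    proof (intro mult_mono ennreal_powr_mono)
     show "(NN y. ennreal_powr (ennreal (indicator {0<..} y*(k (t/x) y*w y))) (p/(p - 1))) \<le> ennreal B"
     proof (rule order_trans [OF nn_integral_mono B(2) [of "t/x"]])
      fix y
      show "ennreal_powr (ennreal (indicator {0<..} y*(k (t/x) y*w y))) (p/(p - 1)) \<le> ennreal ((k (t/x) y*w y) powr (p/(p - 1)))"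
       using w [of y] k by (cases "y > 0") auto
     qed (use t x in simp)
     show "(NN y. ennreal_powr (ennreal (indicator {0<..} y*(u (x*y)/w y))) p) \<le> (NN y. ?g x y)"
     proof (intro nn_integral_mono)
      fix y
      show "ennreal_powr (ennreal (indicator {0<..} y*(u (x*y)/w y))) p \<le> ?g x y"
       using w [of y] u0 by (cases "y > 0") (auto simp: powr_divide powr_minus_divide)
     qed
    qed (use p in auto)
    finally show ?thesis using B by simp
   qed
   note e = ennreal_powr_mono [OF this, of _ "1/p"]
   have "dilation_maximal k u x \<le> ennreal_powr (ennreal (B powr (p - 1))*(NN y. ?g x y)) (1/p)"
    unfolding dilation_maximal_def using e p by (intro SUP_least) (auto simp: ennreal_powr_powr)
   then show ?thesis
    using ennreal_powr_mono [of _ "ennreal_powr (ennreal (B powr (p - 1))*(NN y. ?g x y)) (1/p)" p] p by (simp add: ennreal_powr_powr)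
  qed
  have "(NN x. ennreal_powr (dilation_maximal k u x) p*power_weight dl x) \<le>
    (NN x. ennreal (B powr (p - 1))*(NN y. ?g x y*power_weight dl x))"
  proof (rule nn_integral_mono)
   fix x :: real
   have "(NN y. ?g x y*power_weight dl x) = (NN y. ?g x y)*power_weight dl x" by (intro nn_integral_multc) measurable
   then show "ennreal_powr (dilation_maximal k u x) p*power_weight dl x \<le> ennreal (B powr (p - 1))*(NN y. ?g x y*power_weight dl x)"
    using pw [of x] by (cases "x > 0") (auto simp: power_weight_def mult_right_mono mult.assoc [symmetric])
  qed
  also have "... = ennreal (B powr (p - 1))*(NN x. NN y. ?g x y*power_weight dl x)"
   by (intro nn_integral_cmult) measurable
  also have "(NN x. NN y. ?g x y*power_weight dl x) = (NN y. NN x. ?g x y*power_weight dl x)"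
   by (rule lborel_pair.Fubini') measurable
  also have "... = (NN y. power_weight (- dl - 1) y*ennreal (w y powr (- p))*?U u)"
  proof (rule nn_integral_cong)
   fix y :: real
   show "(NN x. ?g x y*power_weight dl x) = power_weight (- dl - 1) y*ennreal (w y powr (- p))*?U u"
   proof (cases "y > 0")
    case y: True
    have "?U u = ennreal y*(NN x. ennreal (u (x*y) powr p)*power_weight dl (x*y))"
     using nn_integral_scale [of "\<lambda>z. ennreal (u z powr p)*power_weight dl z" "1/y"] y by simp
    then have "power_weight (- dl - 1) y*ennreal (w y powr (- p))*?U u =
      (NN x. power_weight (- dl - 1) y*ennreal (w y powr (- p))*ennreal y*(ennreal (u (x*y) powr p)*power_weight dl (x*y)))"
     by (simp add: nn_integral_cmult mult.assoc)
    also have "... = (NN x. ?g x y*power_weight dl x)"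
    proof (rule nn_integral_cong)
     fix x :: real
     have "y powr (- dl - 1)*(y*(x powr dl*y powr dl)) = x powr dl"
      using y by (simp add: powr_diff powr_minus_divide field_simps)
     then have "y powr (- dl - 1)*W*y*(V*(x powr dl*y powr dl)) = V*W*x powr dl" for V W
      by (metis (no_types, lifting) mult.assoc mult.commute)
     then show "power_weight (- dl - 1) y*ennreal (w y powr (- p))*ennreal y*(ennreal (u (x*y) powr p)*power_weight dl (x*y)) = ?g x y*power_weight dl x"
      using y by (cases "x > 0") (auto simp: power_weight_def powr_mult zero_less_mult_iff simp flip: ennreal_mult)
    qed
    finally show ?thesis by simp
   qed (simp add: power_weight_def)
  qed
  also have "... = ennreal d*?U u" by (simp add: nn_integral_multc d(2))
  finally show "(NN x. ennreal_powr (dilation_maximal k u x) p*power_weight dl x) \<le> ennreal (B powr (p - 1)*d)*?U u"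
   using d(1) by (simp add: ennreal_mult mult.assoc)
 qed
qed

lemma maximal_bounded_average:
 fixes K :: "real => real => real => ennreal"
 assumes km [measurable]: "case_prod k \<in> borel_measurable (borel \<Otimes>\<^sub>M borel)" and k: "\<And>t y. y \<le> 0 ==> k t y = 0" "\<And>t y. k t y \<ge> 0"
  and Km: "\<And>t. case_prod (K t) \<in> borel_measurable (borel \<Otimes>\<^sub>M borel)"
  and C: "C \<ge> 0" "\<And>v. v \<in> borel_measurable borel ==> (\<And>z. v z \<ge> (0::real)) ==>
   (NN x. ennreal_powr (SUP t\<in>\<rat> \<inter> {0<..}. NN z. K t x z*ennreal (v z)) p) \<le> ennreal C*(NN z. ennreal (v z powr p))"
  and c: "c \<ge> 0" "\<And>t x z. 0 < t ==> 0 < x ==> 0 < z ==> ennreal (k (t/x) (z/x)/x) \<le> ennreal c*(K t x z*ennreal ((z/x) powr (dl/p)))"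
  and p: "p > 0"
 shows "maximal_bounded p dl k"
 unfolding maximal_bounded_def
proof (intro exI [of _ "c powr p*C"] conjI allI impI)
 show "0 \<le> c powr p*C" using C(1) by simp
 fix u :: "real => real" assume u [measurable]: "u \<in> borel_measurable borel" and u0: "\<forall>z. 0 \<le> u z"
 define v where "v z = indicator {0<..} z*(u z*z powr (dl/p))" for z :: real
 have [measurable]: "v \<in> borel_measurable borel" unfolding v_def [abs_def] by measurable
 have v: "v z \<ge> 0" for z using u0 by (simp add: v_def)
 let ?T = "\<lambda>x. SUP t\<in>\<rat> \<inter> {0<..}. NN z. K t x z*ennreal (v z)"
 have "ennreal_powr (dilation_maximal k u x) p*power_weight dl x \<le> ennreal (c powr p)*ennreal_powr (?T x) p" for x
 proof (cases "x > 0")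
  case x: True
  have "dilation_maximal k u x*ennreal (x powr (dl/p)) \<le> ennreal c*?T x"
   unfolding dilation_maximal_def SUP_mult_right_ennreal
  proof (rule SUP_least)
   fix t :: real assume t: "t \<in> \<rat> \<inter> {0<..}"
   note [measurable] = Km [of t]
   have [measurable]: "K t x \<in> borel_measurable borel" using measurable_compose [OF measurable_Pair1' [of x borel borel] Km] by simp
   have "(NN y. ennreal (k (t/x) y*u (x*y))) = (NN z. ennreal (k (t/x) (z/x)*u z/x))"
    using x u0 k by (subst nn_integral_scale [OF _ x], measurable, subst nn_integral_cmult [symmetric], measurable)
     (auto intro!: nn_integral_cong simp flip: ennreal_mult)
   then have "(NN y. ennreal (k (t/x) y*u (x*y)))*ennreal (x powr (dl/p)) =
     (NN z. ennreal (k (t/x) (z/x)*u z/x)*ennreal (x powr (dl/p)))"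
    by (simp add: nn_integral_multc)
   also have "... \<le> (NN z. ennreal c*(K t x z*ennreal (v z)))"
   proof (rule nn_integral_mono)
    fix z :: real
    show "ennreal (k (t/x) (z/x)*u z/x)*ennreal (x powr (dl/p)) \<le> ennreal c*(K t x z*ennreal (v z))"
    proof (cases "z > 0")
     case z: True
     have "ennreal (k (t/x) (z/x)*u z/x)*ennreal (x powr (dl/p)) = ennreal (k (t/x) (z/x)/x)*ennreal (u z*x powr (dl/p))"
      using k x u0 by (simp flip: ennreal_mult)
     also have "... \<le> ennreal c*(K t x z*ennreal ((z/x) powr (dl/p)))*ennreal (u z*x powr (dl/p))"
      using t x z by (intro mult_right_mono c) auto
     also have "... = ennreal c*(K t x z*(ennreal ((z/x) powr (dl/p))*ennreal (u z*x powr (dl/p))))" by (simp only: mult.assoc)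
     also have "ennreal ((z/x) powr (dl/p))*ennreal (u z*x powr (dl/p)) = ennreal (v z)"
      using x z u0 by (simp add: v_def powr_divide flip: ennreal_mult)
     finally show ?thesis .
    next
     case False
     then have "k (t/x) (z/x) = 0" using x by (intro k) (auto simp: divide_nonpos_pos)
     then show ?thesis by simp
    qed
   qed
   also have "... = ennreal c*(NN z. K t x z*ennreal (v z))" by (intro nn_integral_cmult) measurable
   also have "... \<le> ennreal c*?T x" by (intro mult_left_mono SUP_upper t) simp
   finally show "(NN y. ennreal (k (t/x) y*u (x*y)))*ennreal (x powr (dl/p)) \<le> ennreal c*?T x" .
  qed
  then have "ennreal_powr (dilation_maximal k u x*ennreal (x powr (dl/p))) p \<le> ennreal_powr (ennreal c*?T x) p"
   using p by (intro ennreal_powr_mono) auto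
  then show ?thesis using x c(1) p by (simp add: ennreal_powr_mult powr_powr power_weight_def)
 qed (simp add: power_weight_def)
 then have "(NN x. ennreal_powr (dilation_maximal k u x) p*power_weight dl x) \<le> (NN x. ennreal (c powr p)*ennreal_powr (?T x) p)"
  by (intro nn_integral_mono)
 also have "... = ennreal (c powr p)*(NN x. ennreal_powr (?T x) p)"
 proof (intro nn_integral_cmult borel_measurable_ennreal_powr)
  note [measurable] = Km
  show "?T \<in> borel_measurable lborel"
   using SUP_integral_measurable [OF countable_positive_rationals, of "\<lambda>t x z. K t x z*ennreal (v z)"] by simp
 qed
 also have "... \<le> ennreal (c powr p)*(ennreal C*(NN z. ennreal (v z powr p)))"
  by (intro mult_left_mono C(2) v) auto
 also have "(NN z. ennreal (v z powr p)) = (NN z. ennreal (u z powr p)*power_weight dl z)"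
 proof (rule nn_integral_cong)
  fix z :: real
  show "ennreal (v z powr p) = ennreal (u z powr p)*power_weight dl z"
   using p by (cases "z > 0") (auto simp: v_def power_weight_def powr_mult powr_powr simp flip: ennreal_mult)
 qed
 finally show "(NN x. ennreal_powr (dilation_maximal k u x) p*power_weight dl x) \<le>
   ennreal (c powr p*C)*(NN z. ennreal (u z powr p)*power_weight dl z)"
  using C(1) by (simp add: ennreal_mult mult.assoc)
qed

section \<open>Weak type bounds for two families of averages\<close>

definition hl_kernel :: "real => real => real => ennreal" where
 "hl_kernel t x z = (if abs (x - z) < t then ennreal (1/t) else 0)"

lemma hl_kernel_measurable: "case_prod (hl_kernel t) \<in> borel_measurable (borel \<Otimes>\<^sub>M borel)"
 unfolding hl_kernel_def [abs_def] by measurable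

lemma hl_kernel_integral:
 assumes [measurable]: "f \<in> borel_measurable borel" and t: "t > 0"
 shows "(NN z. hl_kernel t x z*f z) = (NN y. (if abs y < 1 then f (x + t*y) else 0))"
proof -
 have "(NN z. hl_kernel t x z*f z) = ennreal t*(NN y. hl_kernel t x (x + t*y)*f (x + t*y))"
  using t nn_integral_real_affine [of "\<lambda>z. hl_kernel t x z*f z" t x] by (simp add: hl_kernel_def [abs_def])
 also have "... = (NN y. ennreal t*(hl_kernel t x (x + t*y)*f (x + t*y)))"
  by (intro nn_integral_cmult [symmetric]) (simp add: hl_kernel_def [abs_def])
 also have "... = (NN y. (if abs y < 1 then f (x + t*y) else 0))"
  using t by (intro nn_integral_cong) (auto simp: hl_kernel_def abs_mult mult.assoc [symmetric] simp flip: ennreal_mult)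
 finally show ?thesis .
qed

text \<open>Vitali covering: each point of the set is the centre of a ball of radius r over which
  the integral of H is at least l r, and disjoint balls are chosen whose fivefold enlargements cover
  the set. A ball of radius 5 r has length 10 r, hence the constant 10.\<close>

lemma hl_maximal_weak:
 assumes [measurable]: "H \<in> borel_measurable borel" and H: "\<And>y. H y \<ge> (0::real)" and l: "l > 0"
 shows "emeasure lborel {x. ennreal l < (SUP t\<in>\<rat> \<inter> {0<..}. NN z. hl_kernel t x z*ennreal (H z))} \<le> ennreal (10/l)*(NN y. ennreal (H y))"
proof (cases "NN y. ennreal (H y)")
 case top
 then show ?thesis using l by (simp add: ennreal_mult_top)
next
 case (real h)
 let ?I = "\<lambda>x r. NN y. ennreal (H y)*indicator (ball x r) y"
 define E where "E = {x. ennreal l < (SUP t\<in>\<rat> \<inter> {0<..}. NN z. hl_kernel t x z*ennreal (H z))}"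
 have "\<exists>r>0. ennreal (l*r) \<le> ?I x r" if x: "x \<in> E" for x
 proof -
  obtain r where r: "r > 0" "ennreal l < (NN z. hl_kernel r x z*ennreal (H z))"
   using x by (auto simp: E_def less_SUP_iff)
  have "(NN z. hl_kernel r x z*ennreal (H z)) = (NN y. ennreal (1/r)*(ennreal (H y)*indicator (ball x r) y))"
   by (intro nn_integral_cong) (auto simp: hl_kernel_def indicator_def dist_real_def)
  also have "... = ennreal (1/r)*?I x r"
   by (intro nn_integral_cmult borel_measurable_times_ennreal borel_measurable_indicator) auto
  finally have "ennreal r*ennreal l \<le> ennreal r*(ennreal (1/r)*?I x r)" using r(2) by (intro mult_left_mono) auto
  then show ?thesis using r(1) l by (intro exI [of _ r]) (simp add: mult.assoc [symmetric] ennreal_mult [symmetric] mult.commute)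
 qed
 then obtain r where r: "\<And>x. x \<in> E ==> r x > 0" "\<And>x. x \<in> E ==> ennreal (l*r x) \<le> ?I x (r x)" by metis
 \<comment> \<open>l r is at most the total integral h; the covering lemma requires bounded
   radii.\<close>
 have bound: "0 < r x \<and> r x \<le> h/l" if "x \<in> E" for x
 proof -
  have "ennreal (l*r x) \<le> (NN y. ennreal (H y))"
   by (rule order_trans [OF r(2) [OF that]]) (intro nn_integral_mono, auto simp: indicator_def)
  then have "l*r x \<le> h" using real by (simp add: ennreal_le_iff)
  then show ?thesis using r(1) [OF that] l by (simp add: field_simps)
 qed
 have "E \<subseteq> (\<Union>x\<in>E. ball x (r x))" using r(1) by auto
 then obtain C where C: "countable C" "C \<subseteq> E" "pairwise (\<lambda>i j. disjnt (ball i (r i)) (ball j (r j))) C"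
  "E \<subseteq> (\<Union>i\<in>C. ball i (5*r i))"
  by (rule Vitali_covering_lemma_balls [where a="\<lambda>x. x" and r=r, OF _ bound]) auto
 have dj: "disjoint_family_on (\<lambda>i. ball i (r i)) C"
  using C(3) by (auto simp: disjoint_family_on_def pairwise_def disjnt_def)
 have "emeasure lborel E \<le> (NN x. indicator (\<Union>i\<in>C. ball i (5*r i)) x)"
  using C(1) by (subst nn_integral_indicator) (auto intro!: emeasure_mono C(4))
 also have "... \<le> (NN x. \<integral>\<^sup>+ i. indicator (ball i (5*r i)) x \<partial>count_space C)"
 proof (rule nn_integral_mono)
  fix x :: real
  show "indicator (\<Union>i\<in>C. ball i (5*r i)) x \<le> (\<integral>\<^sup>+ i. indicator (ball i (5*r i)) x \<partial>count_space C)"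
  proof (cases "x \<in> (\<Union>i\<in>C. ball i (5*r i))")
   case True
   then obtain i where i: "i \<in> C" "x \<in> ball i (5*r i)" by blast
   show ?thesis using nn_integral_ge_point [OF i(1), of "\<lambda>i. indicator (ball i (5*r i)) x"] i by (simp add: indicator_def)
  qed simp
 qed
 also have "... = (\<integral>\<^sup>+ i. emeasure lborel (ball i (5*r i)) \<partial>count_space C)"
  using C(1) by (subst nn_integral_count_space_nn_integral) (auto intro!: borel_measurable_indicator)
 also have "... \<le> (\<integral>\<^sup>+ i. ennreal (10/l)*?I i (r i) \<partial>count_space C)"
 proof (rule nn_integral_mono)
  fix i assume "i \<in> space (count_space C)"
  then have i: "i \<in> E" using C(2) by auto
  have "ball i (5*r i) = {i - 5*r i<..<i + 5*r i}" by (auto simp: dist_real_def)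
  then have "emeasure lborel (ball i (5*r i)) = ennreal (10/l)*ennreal (l*r i)"
   using r(1) [OF i] l by (simp flip: ennreal_mult)
  also have "... \<le> ennreal (10/l)*?I i (r i)" by (intro mult_left_mono r(2) i) simp
  finally show "emeasure lborel (ball i (5*r i)) \<le> ennreal (10/l)*?I i (r i)" .
 qed
 also have "... = ennreal (10/l)*(\<integral>\<^sup>+ i. emeasure (density lborel (\<lambda>y. ennreal (H y))) (ball i (r i)) \<partial>count_space C)"
  by (simp add: nn_integral_cmult emeasure_density)
 also have "(\<integral>\<^sup>+ i. emeasure (density lborel (\<lambda>y. ennreal (H y))) (ball i (r i)) \<partial>count_space C) =
   emeasure (density lborel (\<lambda>y. ennreal (H y))) (\<Union>i\<in>C. ball i (r i))"
  by (intro emeasure_UN_countable [symmetric] C(1) dj) auto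
 also have "... \<le> emeasure (density lborel (\<lambda>y. ennreal (H y))) UNIV"
  by (intro emeasure_mono) auto
 also have "... = (NN y. ennreal (H y))" by (simp add: emeasure_density)
 finally show ?thesis by (simp add: E_def mult_left_mono)
qed

text \<open>For e > 1 this is, up to a constant, a mean over a window of width about x around t: the
  radius t shifts the window while x fixes its width.\<close>

definition shift_kernel :: "real => real => real => real => ennreal" where
 "shift_kernel e t x z = (if x > 0 then ennreal (1/x*(1 + abs ((t - z)/x)) powr (- e)) else 0)"

lemma shift_kernel_measurable: "case_prod (shift_kernel e t) \<in> borel_measurable (borel \<Otimes>\<^sub>M borel)"
 unfolding shift_kernel_def [abs_def] by measurable

lemma one_plus_powr_le_1: "e \<ge> 0 ==> (1 + abs d) powr (- e) \<le> (1::real)"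
 using powr_mono [of "- e" 0 "1 + abs d"] by (simp add: add_pos_nonneg less_imp_neq [symmetric])

text \<open>Whatever t is, the kernel is at most 1/x. So the supremum is at most h/x, h the integral
  of H, and exceeds l only for x < h/l.\<close>

lemma shift_maximal_weak:
 assumes [measurable]: "H \<in> borel_measurable borel" and H: "\<And>y. H y \<ge> (0::real)" and l: "l > 0" and e: "e \<ge> 0"
 shows "emeasure lborel {x. ennreal l < (SUP t\<in>\<rat> \<inter> {0<..}. NN z. shift_kernel e t x z*ennreal (H z))} \<le> ennreal (1/l)*(NN y. ennreal (H y))"
proof (cases "NN y. ennreal (H y)")
 case top
 then show ?thesis using l by (simp add: ennreal_mult_top)
next
 case (real h)
 have "{x. ennreal l < (SUP t\<in>\<rat> \<inter> {0<..}. NN z. shift_kernel e t x z*ennreal (H z))} \<subseteq> {0<..<h/l}"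
 proof
  fix x assume "x \<in> {x. ennreal l < (SUP t\<in>\<rat> \<inter> {0<..}. NN z. shift_kernel e t x z*ennreal (H z))}"
  then obtain t where t: "ennreal l < (NN z. shift_kernel e t x z*ennreal (H z))" by (auto simp: less_SUP_iff)
  then have x0: "x > 0" by (cases "x > 0") (auto simp: shift_kernel_def)
  have "(NN z. shift_kernel e t x z*ennreal (H z)) \<le> (NN z. ennreal (1/x)*ennreal (H z))"
  proof (intro nn_integral_mono mult_right_mono)
   fix z
   show "shift_kernel e t x z \<le> ennreal (1/x)"
    using x0 mult_left_mono [OF one_plus_powr_le_1 [OF e, of "(t - z)/x"], of "1/x"] by (simp add: shift_kernel_def ennreal_leI)
  qed auto
  also have "... = ennreal (1/x*h)" using x0 real by (simp add: nn_integral_cmult flip: ennreal_mult)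
  finally have "l < 1/x*h" using t l by (meson ennreal_less_iff less_imp_le less_le_trans)
  then show "x \<in> {0<..<h/l}" using x0 l by (simp add: field_simps)
 qed
 then have "emeasure lborel {x. ennreal l < (SUP t\<in>\<rat> \<inter> {0<..}. NN z. shift_kernel e t x z*ennreal (H z))} \<le> emeasure lborel {0<..<h/l}"
  by (intro emeasure_mono) auto
 also have "... = ennreal (1/l)*ennreal h" using real l by (simp flip: ennreal_mult)
 finally show ?thesis using real by simp
qed

section \<open>Bounds for the parts of the kernel\<close>

lemma kernel_N_measurable:
 assumes al: "al > -1" and mu: "al + be > -1/2"
 shows "case_prod (kernel_N al be) \<in> borel_measurable (borel \<Otimes>\<^sub>M borel)"
proof -
 let ?D = "(\<lambda>(t, y). (t, 1, y)) -` kernel_domain :: (real \<times> real) set"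
 have D: "?D = {w. 0 < fst w} \<inter> {w. 0 < snd w} \<inter> {w. fst w \<noteq> abs (1 - snd w)} \<inter> {w. fst w \<noteq> 1 + snd w}"
  by (auto simp: kernel_domain_def)
 have "open ?D" unfolding D by (intro open_Int open_Collect_less open_Collect_neq continuous_intros)
 then have "?D \<in> sets borel" by (rule borel_open)
 moreover have "continuous_on ?D (\<lambda>w. case (fst w, 1, snd w) of (t, x, z) => kernel_K al be t x z)"
  by (rule continuous_on_compose2 [OF continuous_on_kernel_K [OF al mu]]) (auto intro!: continuous_intros)
 then have "continuous_on ?D (\<lambda>w. kernel_K al be (fst w) 1 (snd w))" by simp
 ultimately have "(\<lambda>w. indicator ?D w *\<^sub>R kernel_K al be (fst w) 1 (snd w)) \<in> borel_measurable borel"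
  by (rule borel_measurable_continuous_on_indicator)
 then have [measurable]: "(\<lambda>w. indicator ?D w *\<^sub>R kernel_K al be (fst w) 1 (snd w)) \<in> borel_measurable (borel \<Otimes>\<^sub>M borel)"
  by (simp add: borel_prod)
 have "case_prod (kernel_N al be) = (\<lambda>w. abs (indicator ?D w *\<^sub>R kernel_K al be (fst w) 1 (snd w)) * snd w powr (2*al + 1))"
  by (auto simp: kernel_N_def fun_eq_iff indicator_def)
 then show ?thesis by (simp only:) measurable
qed

text \<open>In the variable z = x y the bound of \<open>kernel_N_near_diagonal\<close> is the
  Hardy-Littlewood kernel times S, and S has bounded q'-means because si q' < 1. On the support z
  lies between x/2 and 2 x, so the power weight costs a constant.\<close>

lemma maximal_bounded_near_diagonal:
 assumes al: "al > -1" and mu: "al + be > -1/2" and si: "si > 0" "si \<ge> 1/2 - al - be"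
  and q: "1 < q" "q < p" "si*(q/(q - 1)) < 1"
 shows "maximal_bounded p dl (\<lambda>t y. if t \<le> 1/2 then kernel_N al be t y else 0)"
proof -
 note [measurable] = kernel_N_measurable [OF al mu] hl_kernel_measurable
 obtain C where C: "C \<ge> 0" "\<And>t y. t \<le> 1/2 ==> t \<le> abs (1 - y) ==> kernel_N al be t y = 0"
  "\<And>t y. t \<le> 1/2 ==> abs (1 - y) < t ==> kernel_N al be t y \<le> C*(1/t*(1 - abs (1 - y)/t) powr (- si))"
  using kernel_N_near_diagonal [OF al mu si] by metis
 define m where "m = si*(q/(q - 1))"
 have m: "0 \<le> m" "m < 1" using si q by (auto simp: m_def)
 obtain J where J: "J \<ge> 0" "\<And>d. (NN y. ennreal (bump m 2 (y - d))) = ennreal J"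
  using bump_integral [OF m(2), of 2] by auto
 define S where "S t x z = ennreal ((1 - abs (x - z)/t) powr (- si))" for t x z :: real
 have S [measurable]: "case_prod (S t) \<in> borel_measurable (borel \<Otimes>\<^sub>M borel)" for t unfolding S_def [abs_def] by measurable
 have mass: "(NN z. hl_kernel t x z) \<le> ennreal 2" if "t \<in> \<rat> \<inter> {0<..}" for t x
 proof -
  have "(NN z. hl_kernel t x z) = (NN y. (if abs (y::real) < 1 then 1 else 0))"
   using hl_kernel_integral [of "\<lambda>_. 1" t x] that by simp
  also have "... = (NN y. indicator {-1<..<1::real} y)" by (intro nn_integral_cong) (auto simp: indicator_def)
  finally show ?thesis by simp
 qed
 \<comment> \<open>After rescaling the singularities sit at y = 1 and y = -1, one bump for
   each.\<close>
 have B: "(NN z. hl_kernel t x z*ennreal_powr (S t x z) (q/(q - 1))) \<le> ennreal (J + J)" if t: "t \<in> \<rat> \<inter> {0<..}" for t x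
 proof -
  have "(NN z. hl_kernel t x z*ennreal_powr (S t x z) (q/(q - 1))) =
    (NN y. (if abs y < 1 then ennreal_powr (S t x (x + t*y)) (q/(q - 1)) else 0))"
   using t by (intro hl_kernel_integral) (auto simp: S_def)
  also have "... \<le> (NN y. ennreal (bump m 2 (y - 1)) + ennreal (bump m 2 (y - (-1))))"
  proof (rule nn_integral_mono)
   fix y :: real
   show "(if abs y < 1 then ennreal_powr (S t x (x + t*y)) (q/(q - 1)) else 0) \<le> ennreal (bump m 2 (y - 1)) + ennreal (bump m 2 (y - (-1)))"
   proof (cases "abs y < 1")
    case True
    have "ennreal_powr (S t x (x + t*y)) (q/(q - 1)) = ennreal ((1 - abs y) powr (- m))"
     using t by (simp add: S_def abs_mult powr_powr m_def)
    also have "(1 - abs y) powr (- m) \<le> bump m 2 (1 - abs y)"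
     using powr_le_bump [of m m "1 - abs y" 2] True m by (cases "y = 0") (auto simp: bump_def)
    also have "... \<le> bump m 2 (y - 1) + bump m 2 (y - (-1))"
     using bump_abs [of m 2 "y - 1"] bump_abs [of m 2 "1 - y"] by (cases "y \<ge> 0") (auto simp: abs_minus_commute add.commute)
    finally show ?thesis using True by (simp add: ennreal_leI flip: ennreal_plus)
   qed simp
  qed
  also have "... = ennreal J + ennreal J" by (subst nn_integral_add) (simp_all add: J(2) [of 1] J(2) [of "-1", simplified])
  also have "... = ennreal (J + J)" using J(1) by (simp flip: ennreal_plus)
  finally show ?thesis .
 qed
 obtain C' where C': "C' \<ge> 0" "\<And>v. v \<in> borel_measurable borel ==> (\<And>z. v z \<ge> (0::real)) ==>
  (NN x. ennreal_powr (SUP t\<in>\<rat> \<inter> {0<..}. NN z. hl_kernel t x z*S t x z*ennreal (v z)) p) \<le> ennreal C'*(NN z. ennreal (v z powr p))"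
  by (rule maximal_average [where k = hl_kernel and S = S and M = 2 and W = 10 and B = "J + J", OF countable_positive_rationals hl_kernel_measurable _ mass _ hl_maximal_weak S _ B q(1,2)])
    (use J(1) in auto)
 show ?thesis
 proof (rule maximal_bounded_average [where K = "\<lambda>t x z. hl_kernel t x z*S t x z" and c = "C*2 powr abs (dl/p)", OF _ _ _ _ C'])
  fix t x z :: real assume pos: "0 < t" "0 < x" "0 < z"
  show "ennreal ((if t/x \<le> 1/2 then kernel_N al be (t/x) (z/x) else 0)/x) \<le>
   ennreal (C*2 powr abs (dl/p))*(hl_kernel t x z*S t x z*ennreal ((z/x) powr (dl/p)))"
  proof (cases "t/x \<le> 1/2 \<and> abs (1 - z/x) < t/x")
   case False
   then have "(if t/x \<le> 1/2 then kernel_N al be (t/x) (z/x) else 0) = 0" using C(2) [of "t/x" "z/x"] by auto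
   then show ?thesis by (simp only:) simp
  next
   case True
   have "1 - z/x = (x - z)/x" using pos by (simp add: field_simps)
   then have xz: "abs (1 - z/x) = abs (x - z)/x" using pos by simp
   have yb: "y/2 \<le> 1" "1 \<le> 2*y" if "s \<le> 1/2" "abs (1 - y) < s" for s y :: real using that by (linarith, linarith)
   have "1 \<le> 2 powr abs (dl/p)*(z/x) powr (dl/p)"
    using powr_mult_le_comparable [of "z/x" 2 1 "dl/p"] yb [OF conjunct1 conjunct2, OF True True] pos by simp
   then have "C*(1/t*(1 - abs (x - z)/t) powr (- si))*1 \<le> C*(1/t*(1 - abs (x - z)/t) powr (- si))*(2 powr abs (dl/p)*(z/x) powr (dl/p))"
    using C(1) pos by (intro mult_left_mono) auto
   moreover have "kernel_N al be (t/x) (z/x)/x \<le> C*(1/(t/x)*(1 - abs (1 - z/x)/(t/x)) powr (- si))/x"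
    using C(3) [of "t/x" "z/x"] True pos by (intro divide_right_mono) auto
   ultimately have "kernel_N al be (t/x) (z/x)/x \<le> C*2 powr abs (dl/p)*(1/t*(1 - abs (x - z)/t) powr (- si)*(z/x) powr (dl/p))"
    unfolding xz using pos by (simp add: mult_ac)
   moreover have "abs (x - z) < t" using True pos unfolding xz by (simp add: field_simps)
   ultimately show ?thesis using True C(1) pos by (simp add: hl_kernel_def S_def ennreal_leI flip: ennreal_mult)
  qed
 qed (use q C(1) in \<open>auto simp: kernel_N_def kernel_domain_def\<close>)
qed

text \<open>The end point dl = - be * p. For y > 1 the power y powr (-be) in the kernel bound is
  exactly the factor (z/x) powr (dl/p) that \<open>maximal_bounded_average\<close> admits; the rest
  depends on t - y alone and is a shifted mean with integrable singularities.\<close>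

lemma maximal_bounded_shift:
 assumes al: "al > -1" and mu: "al + be > -1/2" and si: "si > 0" "si \<ge> 1/2 - al - be"
  and q: "1 < q" "q < p" "si*(q/(q - 1)) < 1" and be: "be \<le> 0" and h: "2*al + be + 1 \<ge> 0"
 shows "maximal_bounded p (- be*p) (\<lambda>t y. if t \<ge> 1/2 \<and> 1 < y then kernel_N al be t y else 0)"
proof -
 note [measurable] = kernel_N_measurable [OF al mu] shift_kernel_measurable
 \<comment> \<open>For be < 0 the exponent 1 - be > 1 gives integrable decay. For be = 0 it would be
   1, but then -be is a natural number and any e is allowed.\<close>
 define e where "e = (if be = 0 then 2 else 1 - be)"
 have e: "e > 1" "e = 1 - min be 1 \<or> - be \<in> \<nat>" using be by (auto simp: e_def)
 obtain C where C: "C \<ge> 0" "\<And>t y. t \<ge> 1/2 ==> 1 < y ==> t \<le> y - 1 ==> kernel_N al be t y = 0"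
  "\<And>t y. t \<ge> 1/2 ==> 1 < y ==> y - 1 < t ==> kernel_N al be t y \<le>
   C*(y powr (- min be 1)*(2 + (t - y)) powr (- e)*(1 + abs (1 + (t - y)) powr (- si) + abs (1 - (t - y)) powr (- si)))"
  using kernel_N_right [OF al mu si h e(2)] by metis
 define m where "m = si*(q/(q - 1))"
 have m: "0 \<le> m" "m < 1" using si q by (auto simp: m_def)
 obtain J where J: "J \<ge> 0" "\<And>d. (NN y. ennreal (bump m e (y - d))) = ennreal J"
  using bump_integral [OF m(2) e(1)] by auto
 define g where "g d = 1 + abs (1 + d) powr (- si) + abs (1 - d) powr (- si)" for d :: real
 have g: "g d \<ge> 0" for d by (simp add: g_def add_nonneg_nonneg)
 define S where "S t x z = ennreal (g ((t - z)/x))" for t x z :: real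
 have S [measurable]: "case_prod (S t) \<in> borel_measurable (borel \<Otimes>\<^sub>M borel)" for t unfolding S_def [abs_def] g_def by measurable
 have decay: "(1 + abs d) powr (- e) \<le> bump m e d" for d
 proof (cases "abs d < 1")
  case True
  then show ?thesis using one_plus_powr_le_1 [of e d] e by (simp add: bump_def add_increasing2)
 qed (use e in \<open>auto simp: bump_def intro!: powr_mono2'\<close>)
 have pw: "(1 + abs d) powr (- e)*g d powr (q/(q - 1)) \<le> 3 powr (q/(q - 1))*(3*bump m e d + bump m e (1 + d) + bump m e (1 - d))" for d
 proof -
  let ?k = "(1 + abs d) powr (- e)"
  have k: "?k \<le> 1" using one_plus_powr_le_1 e by simp
  have "g d powr (q/(q - 1)) \<le> 3 powr (q/(q - 1))*(1 + abs (1 + d) powr (- m) + abs (1 - d) powr (- m))"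
   using powr_sum3_le [of 1 "abs (1 + d) powr (- si)" "abs (1 - d) powr (- si)" "q/(q - 1)"] q by (simp add: g_def powr_powr m_def)
  also have "... \<le> 3 powr (q/(q - 1))*(1 + (1 + bump m e (1 + d)) + (1 + bump m e (1 - d)))"
   using m by (intro mult_left_mono add_mono powr_le_1_bump) auto
  finally have "?k*g d powr (q/(q - 1)) \<le> ?k*(3 powr (q/(q - 1))*(1 + (1 + bump m e (1 + d)) + (1 + bump m e (1 - d))))"
   by (intro mult_left_mono) auto
  also have "... = 3 powr (q/(q - 1))*(3*?k + ?k*bump m e (1 + d) + ?k*bump m e (1 - d))" by (simp add: algebra_simps)
  also have "... \<le> 3 powr (q/(q - 1))*(3*bump m e d + 1*bump m e (1 + d) + 1*bump m e (1 - d))"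
   by (intro mult_left_mono add_mono mult_right_mono decay k) auto
  finally show ?thesis by simp
 qed
 have shift: "(NN z. shift_kernel e t x z*ennreal (f ((t - z)/x))) = (NN y. ennreal ((1 + abs (t/x - y)) powr (- e)*f (t/x - y)))"
  if [measurable]: "f \<in> borel_measurable borel" and f: "\<And>d. f d \<ge> 0" and x: "x > 0" for f :: "real => real" and t x
 proof -
  define F where "F y = ennreal ((1 + abs (t/x - y)) powr (- e)*f (t/x - y))" for y
  have [measurable]: "F \<in> borel_measurable borel" unfolding F_def [abs_def] by measurable
  have "(NN y. F y) = ennreal (1/x)*(NN z. F (z/x))" by (rule nn_integral_scale [OF _ x]) measurable
  also have "... = (NN z. ennreal (1/x)*F (z/x))" by (intro nn_integral_cmult [symmetric]) measurable
  also have "... = (NN z. shift_kernel e t x z*ennreal (f ((t - z)/x)))"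
   using x f by (intro nn_integral_cong) (simp add: F_def shift_kernel_def diff_divide_distrib flip: ennreal_mult)
  finally show ?thesis by (simp add: F_def)
 qed
 have bd: "(NN y. ennreal (bump m e (c + (s - y)))) = ennreal J" "(NN y. ennreal (bump m e (c - (s - y)))) = ennreal J" for c s
 proof -
  have "bump m e (c + (s - y)) = bump m e (y - (c + s))" "bump m e (c - (s - y)) = bump m e (y - (s - c))" for y
   using bump_abs [of m e "c + (s - y)"] bump_abs [of m e "y - (c + s)"] by (simp_all add: abs_minus_commute algebra_simps)
  then show "(NN y. ennreal (bump m e (c + (s - y)))) = ennreal J" "(NN y. ennreal (bump m e (c - (s - y)))) = ennreal J"
   by (simp_all only: J(2))
 qed
 have mass: "(NN z. shift_kernel e t x z) \<le> ennreal (J + 1)" for t x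
 proof (cases "x > 0")
  case True
  have "(NN z. shift_kernel e t x z) \<le> (NN y. ennreal (bump m e (0 + (t/x - y))))"
   using shift [of "\<lambda>_. 1" x t] True decay by (simp add: nn_integral_mono ennreal_leI)
  then show ?thesis unfolding bd(1) using order_trans ennreal_leI [of J "J + 1"] by auto
 qed (simp add: shift_kernel_def)
 define B where "B = 3 powr (q/(q - 1))*(3*J + J + J)"
 have B: "(NN z. shift_kernel e t x z*ennreal_powr (S t x z) (q/(q - 1))) \<le> ennreal B" for t x
 proof (cases "x > 0")
  case True
  have [measurable]: "g \<in> borel_measurable borel" unfolding g_def [abs_def] by measurable
  have "(NN z. shift_kernel e t x z*ennreal_powr (S t x z) (q/(q - 1))) =
    (NN y. ennreal ((1 + abs (t/x - y)) powr (- e)*g (t/x - y) powr (q/(q - 1))))"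
   using shift [of "\<lambda>d. g d powr (q/(q - 1))" x t] True g by (simp add: S_def)
  also have "... \<le> (NN y. ennreal (3 powr (q/(q - 1)))*(ennreal 3*ennreal (bump m e (0 + (t/x - y))) + ennreal (bump m e (1 + (t/x - y))) + ennreal (bump m e (1 - (t/x - y)))))"
   using pw by (intro nn_integral_mono) (simp add: ennreal_leI del: ennreal_numeral flip: ennreal_mult ennreal_plus)
  also have "... = ennreal (3 powr (q/(q - 1)))*(ennreal 3*ennreal J + ennreal J + ennreal J)"
   by (subst nn_integral_cmult, measurable, subst nn_integral_add, measurable, subst nn_integral_add, measurable, subst nn_integral_cmult, measurable) (simp only: bd)
  also have "... = ennreal B" using J(1) by (simp add: B_def del: ennreal_numeral flip: ennreal_mult ennreal_plus)
  finally show ?thesis .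
 qed (simp add: shift_kernel_def)
 obtain C' where C': "C' \<ge> 0" "\<And>v. v \<in> borel_measurable borel ==> (\<And>z. v z \<ge> (0::real)) ==>
  (NN x. ennreal_powr (SUP t\<in>\<rat> \<inter> {0<..}. NN z. shift_kernel e t x z*S t x z*ennreal (v z)) p) \<le> ennreal C'*(NN z. ennreal (v z powr p))"
  by (rule maximal_average [where k = "shift_kernel e" and S = S and M = "J + 1" and W = 1 and B = B, OF countable_positive_rationals shift_kernel_measurable _ mass _ shift_maximal_weak S _ B q(1,2)])
    (use J(1) e in \<open>auto simp: B_def\<close>)
 show ?thesis
 proof (rule maximal_bounded_average [where K = "\<lambda>t x z. shift_kernel e t x z*S t x z" and c = "C*2 powr e", OF _ _ _ _ C'])
  fix t x z :: real assume pos: "0 < t" "0 < x" "0 < z"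
  let ?D = "t/x - z/x"
  show "ennreal ((if t/x \<ge> 1/2 \<and> 1 < z/x then kernel_N al be (t/x) (z/x) else 0)/x) \<le>
   ennreal (C*2 powr e)*(shift_kernel e t x z*S t x z*ennreal ((z/x) powr (- be*p/p)))"
  proof (cases "t/x \<ge> 1/2 \<and> 1 < z/x \<and> z/x - 1 < t/x")
   case False
   then have "(if t/x \<ge> 1/2 \<and> 1 < z/x then kernel_N al be (t/x) (z/x) else 0) = 0" using C(2) [of "t/x" "z/x"] by auto
   then show ?thesis by (simp only:) simp
  next
   case True
   then have D: "?D > -1" by simp
   have half: "(1 + abs d)/2 \<le> 2 + d" if "d > -1" for d :: real using that by (cases "d \<ge> 0") simp_all
   have "(2 + ?D) powr (- e) \<le> ((1 + abs ?D)/2) powr (- e)" using e(1) by (intro powr_mono2' half D) (simp_all add: add_pos_nonneg)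
   also have "... = 2 powr e*(1 + abs ?D) powr (- e)" by (simp add: powr_divide powr_minus_divide)
   finally have d: "(2 + ?D) powr (- e) \<le> 2 powr e*(1 + abs ?D) powr (- e)" .
   have "kernel_N al be (t/x) (z/x)/x \<le> C*((z/x) powr (- be)*(2 + ?D) powr (- e)*g ?D)/x"
    using C(3) [of "t/x" "z/x"] True pos be by (intro divide_right_mono) (auto simp: g_def min_def)
   also have "... \<le> C*((z/x) powr (- be)*(2 powr e*(1 + abs ?D) powr (- e))*g ?D)/x"
    using C(1) pos g by (intro divide_right_mono mult_left_mono mult_right_mono d) auto
   also have "... = C*2 powr e*(1/x*(1 + abs ((t - z)/x)) powr (- e)*g ((t - z)/x)*(z/x) powr (- be))"
    by (simp add: diff_divide_distrib mult_ac)
   finally show ?thesis using True C(1) pos q g by (simp add: shift_kernel_def S_def ennreal_leI flip: ennreal_mult)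
  qed
 qed (use q C(1) in \<open>auto simp: kernel_N_def kernel_domain_def\<close>)
qed

lemma borel_measurable_bumps [measurable]: "bumps e s t \<in> borel_measurable borel"
 unfolding bumps_def [abs_def] by measurable

lemma borel_measurable_weight [measurable]: "weight a b \<in> borel_measurable borel"
 unfolding weight_def [abs_def] by measurable

lemma bumps_integral:
 assumes e: "e < 1" "s > 1"
 obtains J where "J \<ge> 0" "\<And>t. (NN y. ennreal (bumps e s t y)) = ennreal J"
proof -
 obtain J where J: "J \<ge> 0" "\<And>d. (NN y. ennreal (bump e s (y - d))) = ennreal J"
  using bump_integral [OF e] by auto
 have "(NN y. ennreal (bumps e s t y)) = ennreal J + ennreal J + ennreal J + ennreal J + ennreal J" for t
  using J(2) [of 0] by (simp add: bumps_def nn_integral_add J(2) del: ennreal_plus add: ennreal_plus)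
 then show thesis using that [of "J + J + J + J + J"] J(1) by (simp flip: ennreal_plus)
qed

text \<open>dl/p < a is integrability at 0, and - dl/p < b integrability at infinity.\<close>

lemma weight_power_integral:
 assumes "p > 0" "dl/p < a" "- dl/p < b"
 shows "(NN y. power_weight (- dl - 1) y*ennreal (weight a b y powr (- p))) < top"
proof -
 let ?f = "\<lambda>y::real. ennreal (indicator {0<..1} y*y powr (a*p - dl - 1))"
 let ?g = "\<lambda>y::real. ennreal (indicator {1<..} y*y powr (- (b*p) - dl - 1))"
 have e: "a*p - dl - 1 > -1" "- (b*p) - dl - 1 < -1" using assms by (simp_all add: field_simps)
 have "(NN y. power_weight (- dl - 1) y*ennreal (weight a b y powr (- p))) \<le> (NN y. ?f y + ?g y)"
 proof (rule nn_integral_mono)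
  fix y :: real
  consider "y \<le> 0" | "0 < y" "y \<le> 1" | "1 < y" by linarith
  then show "power_weight (- dl - 1) y*ennreal (weight a b y powr (- p)) \<le> ?f y + ?g y"
  proof cases
   case 2
   then have "y powr (- dl - 1)*(y powr (- a)) powr (- p) = y powr (a*p - dl - 1)"
    unfolding powr_powr powr_add [symmetric] by (intro arg_cong [where f = "(powr) y"]) simp
   then show ?thesis using 2 by (simp add: power_weight_def weight_def flip: ennreal_mult)
  next
   case 3
   then have "y powr (- dl - 1)*(y powr b) powr (- p) = y powr (- (b*p) - dl - 1)"
    unfolding powr_powr powr_add [symmetric] by (intro arg_cong [where f = "(powr) y"]) simp
   then show ?thesis using 3 by (simp add: power_weight_def weight_def flip: ennreal_mult)
  qed (simp add: power_weight_def)
 qed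
 also have "... < top"
  using nn_integral_has_bochner [OF powr_integral_from_0 [OF e(1), of 1]] nn_integral_has_bochner [OF powr_integral_to_inf [OF e(2), of 1]]
  by (simp add: nn_integral_add)
 finally show ?thesis .
qed

text \<open>Radii t <= 1/2 form the near-diagonal part. For t >= 1/2 Hoelder with
  \<open>weight a b\<close> requires - dl/p < b strictly; at the end point the region y > 1 goes to
  \<open>maximal_bounded_shift\<close>, while on y <= 1 the exponent b does not enter the weight and
  can be replaced.\<close>

lemma maximal_bounded_kernel_N:
 assumes al: "al > -1" and mu: "al + be > -1/2" and h: "2*al + be + 1 \<ge> 0" and si: "si > 0" "si \<ge> 1/2 - al - be"
  and q: "1 < q" "q < p" "si*(q/(q - 1)) < 1"
  and r: "si*(p/(p - 1)) < 1" "(2*al + min be 1 - a)*(p/(p - 1)) > -1" "(b - 1)*(p/(p - 1)) < -1"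
  and a: "dl/p < a" and b: "b \<le> be" "- dl/p < b \<or> be \<le> 0 \<and> b = be \<and> dl = - be*p"
 shows "maximal_bounded p dl (kernel_N al be)"
proof -
 note [measurable] = kernel_N_measurable [OF al mu]
 have p: "p > 1" using q by simp
 obtain e s where es: "e < 1" "1 < s"
  "\<And>tt. tt > 0 ==> \<exists>C\<ge>0. \<forall>t\<ge>tt. \<forall>y. (kernel_N al be t y*weight a b y) powr (p/(p - 1)) \<le> C*bumps e s t y"
  using kernel_N_weight_bound [OF al mu h si _ r b(1)] p by auto
 obtain C where C: "C \<ge> 0" "\<And>t y. t \<ge> 1/2 ==> (kernel_N al be t y*weight a b y) powr (p/(p - 1)) \<le> C*bumps e s t y"
  using es(3) [of "1/2"] by auto
 obtain J where J: "J \<ge> 0" "\<And>t. (NN y. ennreal (bumps e s t y)) = ennreal J"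
  using bumps_integral [OF es(1,2)] by auto
 have H: "maximal_bounded p dl (\<lambda>t y. if t \<ge> 1/2 \<and> y \<in> Y then kernel_N al be t y else 0)"
  if [measurable]: "Y \<in> sets borel" and Y: "\<And>y. y \<in> Y ==> weight a b' y = weight a b y" and b': "- dl/p < b'" for Y b'
 proof (rule maximal_bounded_Hoelder [where w = "weight a b'" and B = "C*J"])
  show "(NN y. ennreal (((if t \<ge> 1/2 \<and> y \<in> Y then kernel_N al be t y else 0)*weight a b' y) powr (p/(p - 1)))) \<le> ennreal (C*J)" for t
  proof -
   have "(NN y. ennreal (((if t \<ge> 1/2 \<and> y \<in> Y then kernel_N al be t y else 0)*weight a b' y) powr (p/(p - 1)))) \<le> (NN y. ennreal C*ennreal (bumps e s t y))"
    using C Y by (intro nn_integral_mono) (auto simp: ennreal_leI simp flip: ennreal_mult)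
   then show ?thesis using C(1) J by (simp add: nn_integral_cmult ennreal_mult)
  qed
  show "(NN y. power_weight (- dl - 1) y*ennreal (weight a b' y powr (- p))) < top"
   using p a b' by (intro weight_power_integral) auto
 qed (use p C(1) J(1) in \<open>auto simp: weight_def kernel_N_def kernel_domain_def\<close>)
 have near: "maximal_bounded p dl (\<lambda>t y. if t \<le> 1/2 then kernel_N al be t y else 0)"
  by (rule maximal_bounded_near_diagonal [OF al mu si q])
 have "maximal_bounded p dl (\<lambda>t y. if t \<ge> 1/2 then kernel_N al be t y else 0)"
  using b(2)
 proof
  assume "- dl/p < b"
  then show ?thesis using H [of UNIV b] by simp
 next
  assume e: "be \<le> 0 \<and> b = be \<and> dl = - be*p"
  \<comment> \<open>On y <= 1 any b' > - dl/p is allowed, and here - dl/p = be <= 0 < 1.\<close>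
  have "maximal_bounded p dl (\<lambda>t y. if t \<ge> 1/2 \<and> y \<in> {..1} then kernel_N al be t y else 0)"
   using e p by (intro H [where b' = 1]) (auto simp: weight_def)
  moreover have "maximal_bounded p dl (\<lambda>t y. if t \<ge> 1/2 \<and> 1 < y then kernel_N al be t y else 0)"
   using maximal_bounded_shift [OF al mu si q _ h] e by simp
  ultimately show ?thesis
   by (rule maximal_bounded_add [rotated 5]) (use p in auto)
 qed
 with near show ?thesis
  by (rule maximal_bounded_add [rotated 5]) (use p in auto)
qed

text \<open>The hypotheses on be and delta are condensed here: apart from the end point be <= 0, dl
  = - be * p, all three cases yield -1 < dl and - be * p < dl, and the upper bounds merge into dl <
  (2 al + min be 1 + 1) p - 1.\<close>

lemma maximal_parameters:
 fixes al be p dl :: real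
 assumes al: "al > -1" and p: "1 < p" "1/p < al + be + 1/2"
  and "be \<ge> 1 ==> -1 < dl \<and> dl < (2*al + 2)*p - 1"
  and "0 < be \<and> be < 1 ==>
   (- be/min (max be (al + be + 1/2)) 1 < dl \<or>
    (al + be > 1/2 \<and> - be/min (max be (al + be + 1/2)) 1 \<le> dl)) \<and>
   dl < (2*al + be + 1)*p - 1"
  and "be \<le> 0 ==>
   (- be*p < dl \<or> ((- be \<in> \<nat> \<or> al + be > 1/2) \<and> - be*p \<le> dl)) \<and>
   dl < (2*al + be + 1)*p - 1"
 obtains si q a b where "si > 0" "si \<ge> 1/2 - al - be" "1 < q" "q < p" "si*(q/(q - 1)) < 1"
  "si*(p/(p - 1)) < 1" "(2*al + min be 1 - a)*(p/(p - 1)) > -1" "(b - 1)*(p/(p - 1)) < -1"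
  "dl/p < a" "b \<le> be" "- dl/p < b \<or> be \<le> 0 \<and> b = be \<and> dl = - be*p" "2*al + be + 1 \<ge> 0"
proof -
 have p0: "p > 0" using p by simp
 have up: "dl/p < 2*al + min be 1 + 1 - 1/p"
 proof -
  have "dl < (2*al + min be 1 + 1)*p - 1" using assms(4-6) by (cases "be \<ge> 1"; cases "be \<le> 0") (auto simp: add.commute)
  then show ?thesis using p0 by (simp add: field_simps)
 qed
 have lo: "(-1 < dl \<and> - (be*p) < dl) \<or> be \<le> 0 \<and> dl = - be*p"
 proof -
  consider "be \<ge> 1" | "0 < be" "be < 1" | "be \<le> 0" by linarith
  then show ?thesis
  proof cases
   case 1
   have "1*1 \<le> be*p" using 1 p by (intro mult_mono) auto
   then show ?thesis using assms(4) 1 by linarith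
  next
   case 2
   define m where "m = min (max be (al + be + 1/2)) 1"
   have pc: "1 < (al + be + 1/2)*p" using p(2) p0 by (simp add: field_simps)
   have m: "0 < m" "be \<le> m" using 2 by (auto simp: m_def)
   \<comment> \<open>This gives be/m < be * p, while be <= m gives be/m <= 1: the lower bound on dl
     for 0 < be < 1 implies - be * p < dl and -1 < dl. In the nonstrict case m = 1, and be < 1 keeps
     both strict.\<close>
   have "m*p > 1"
   proof (cases "max be (al + be + 1/2) \<le> 1")
    case True
    have "(al + be + 1/2)*p \<le> max be (al + be + 1/2)*p" using p0 by (intro mult_right_mono) auto
    then show ?thesis using True pc by (simp add: m_def)
   qed (use p(1) in \<open>auto simp: m_def min_def\<close>)
   then have "be*1 < be*(m*p)" using 2 by (intro mult_strict_left_mono) auto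
   then have l1: "be/m < be*p" using m by (simp add: field_simps)
   have l2: "be/m \<le> 1" using m by simp
   have d: "- (be/m) < dl \<or> al + be > 1/2 \<and> - (be/m) \<le> dl" using assms(5) 2 by (auto simp: m_def)
   then have "-1 < dl \<and> - (be*p) < dl"
   proof
    assume "al + be > 1/2 \<and> - (be/m) \<le> dl"
    moreover from this have "m = 1" using 2 by (auto simp: m_def)
    ultimately have "- be \<le> dl" by simp
    with l1 \<open>m = 1\<close> 2 show ?thesis by (simp only: div_by_1) linarith
   qed (use l1 l2 in linarith)
   then show ?thesis ..
  next
   case 3
   have "- (be*p) \<ge> 0" using 3 p0 by (simp add: mult_nonpos_nonneg)
   then show ?thesis using assms(6) 3 by auto
  qed
 qed
 \<comment> \<open>Midpoint of the required lower bound and 1 - 1/p; the interval is nonempty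
   because 1/p < al + be + 1/2 and p > 1.\<close>
 define si where "si = (max 0 (1/2 - al - be) + (1 - 1/p))/2"
 have "1/p < 1" using p by simp
 then have si: "si > 0" "si \<ge> 1/2 - al - be" "si < 1 - 1/p" using p(2) by (auto simp: si_def)
 \<comment> \<open>1/q is the midpoint of 1/p and 1 - si, which yields q < p and si q/(q - 1) < 1 at
   once.\<close>
 define q where "q = 2/(1/p + (1 - si))"
 have "1/p > 0" using p0 by simp
 then have s0: "1/p + (1 - si) > 0" using si(3) by linarith
 have q: "1 < q" "q < p" "si*(q/(q - 1)) < 1"
 proof -
  have "1/p + (1 - si) < 2" using si \<open>1/p < 1\<close> by linarith
  then show q1: "1 < q" using s0 by (simp add: q_def field_simps)
  have "2*(1/p) < 1/p + (1 - si)" using si by simp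
  then have "p*(2*(1/p)) < p*(1/p + (1 - si))" using p0 by (intro mult_strict_left_mono) auto
  then have "2 < p*(1/p + (1 - si))" using p0 by simp
  then show "q < p" using s0 by (simp add: q_def pos_divide_less_eq)
  have "1/q < 1 - si" using si s0 by (simp add: q_def)
  then have "si*q < q - 1" using q1 by (simp add: field_simps)
  then show "si*(q/(q - 1)) < 1" using q1 by (simp add: field_simps)
 qed
 obtain a where a: "dl/p < a" "a < 2*al + min be 1 + 1 - 1/p" using dense [OF up] by blast
 \<comment> \<open>b < 1/p is the decay condition and b > - dl/p the integrability of the weight;
   the end point forces b = be.\<close>
 obtain b where b: "b \<le> be" "b < 1/p" "- dl/p < b \<or> be \<le> 0 \<and> b = be \<and> dl = - be*p" "- dl/p \<le> b"
  using lo
 proof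
  assume d: "-1 < dl \<and> - (be*p) < dl"
  then have "- dl/p < 1/p" using p0 by (intro divide_strict_right_mono) auto
  then obtain c where "- dl/p < c" "c < 1/p" using dense by blast
  moreover have "- dl < be*p" using d by linarith
  then have "- dl/p < be" using p0 by (simp only: pos_divide_less_eq)
  ultimately show ?thesis using that [of "min be c"] by (simp add: min_less_iff_disj)
 next
  assume d: "be \<le> 0 \<and> dl = - be*p"
  have "0 < 1/p" using p0 by simp
  then have "be < 1/p" using d by linarith
  then show ?thesis using that [of be] d p0 by simp
 qed
 \<comment> \<open>For be < 1 the bounds on b give - 1/p < dl/p, to be combined with the upper bound
   on dl/p; for be >= 1 it is al > -1.\<close>
 have h: "2*al + be + 1 \<ge> 0"
  using up b(2,4) al by (cases "be \<ge> 1") (auto simp: min_def)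
 show thesis
 proof (rule that [OF si(1,2) q _ _ _ a(1) b(1,3) h])
  show "si*(p/(p - 1)) < 1" using si(3) p by (simp add: field_simps)
  show "(2*al + min be 1 - a)*(p/(p - 1)) > -1" using a(2) p by (simp add: field_simps)
  show "(b - 1)*(p/(p - 1)) < -1" using b(2) p by (simp add: field_simps)
 qed
qed

section \<open>Continuity in the radius\<close>

text \<open>Dominated convergence with a moving majorant: the bumps travel with t, so no fixed
  integrable function dominates them near a given t. All g n and G have the same integral J, and
  Fatou's lemma for g n + G - |f n - F| gives convergence in mean.\<close>

lemma tendsto_integral_Pratt:
 fixes f :: "nat => 'a => 'b::{banach, second_countable_topology}" and g :: "nat => 'a => real"
 assumes [measurable]: "\<And>n. f n \<in> borel_measurable M" "F \<in> borel_measurable M" "\<And>n. g n \<in> borel_measurable M" "G \<in> borel_measurable M"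
  and lim: "AE x in M. (\<lambda>n. f n x) \<longlonglongrightarrow> F x" "AE x in M. (\<lambda>n. g n x) \<longlonglongrightarrow> G x"
  and dom: "\<And>n. AE x in M. norm (f n x) \<le> g n x"
  and J: "J \<ge> 0" "\<And>n. (\<integral>\<^sup>+ x. ennreal (g n x) \<partial>M) = ennreal J" "(\<integral>\<^sup>+ x. ennreal (G x) \<partial>M) = ennreal J"
 shows "(\<lambda>n. integral\<^sup>L M (f n)) \<longlonglongrightarrow> integral\<^sup>L M F"
proof -
 have "AE x in M. \<forall>n. norm (f n x) \<le> g n x" using dom by (simp add: AE_all_countable)
 then have G: "AE x in M. norm (F x) \<le> G x"
  using lim by eventually_elim (auto intro: LIMSEQ_le [OF tendsto_norm])
 have "integrable M h" if [measurable]: "h \<in> borel_measurable M" and h: "AE x in M. norm (h x) \<le> k x" "(\<integral>\<^sup>+ x. ennreal (k x) \<partial>M) = ennreal J" for h :: "'a => 'b" and k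
 proof (rule integrableI_bounded)
  have "(\<integral>\<^sup>+ x. ennreal (norm (h x)) \<partial>M) \<le> (\<integral>\<^sup>+ x. ennreal (k x) \<partial>M)"
   using h(1) by (intro nn_integral_mono_AE) (auto simp: ennreal_leI elim!: eventually_mono)
  then show "(\<integral>\<^sup>+ x. ennreal (norm (h x)) \<partial>M) < \<infinity>" unfolding h(2) by (rule le_less_trans) simp
 qed simp
 from this [OF _ dom J(2)] this [OF _ G J(3)] have "integrable M (f n)" "integrable M F" for n by simp_all
 note int [simp] = this
 define b where "b n = (\<integral>x. norm (f n x - F x) \<partial>M)" for n
 let ?u = "\<lambda>n x. ennreal (g n x + G x - norm (f n x - F x))"
 have b: "b n \<ge> 0" "(\<integral>\<^sup>+ x. ennreal (norm (f n x - F x)) \<partial>M) = ennreal (b n)" for n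
  by (simp_all add: b_def nn_integral_eq_integral)
 have sum: "(\<integral>\<^sup>+ x. ?u n x \<partial>M) + ennreal (b n) = ennreal (2*J)" for n
 proof -
  have "(\<integral>\<^sup>+ x. ?u n x \<partial>M) + ennreal (b n) = (\<integral>\<^sup>+ x. ?u n x + ennreal (norm (f n x - F x)) \<partial>M)"
   unfolding b(2) [symmetric] by (rule nn_integral_add [symmetric]) measurable
  also have "... = (\<integral>\<^sup>+ x. ennreal (g n x) + ennreal (G x) \<partial>M)"
  proof (rule nn_integral_cong_AE, use dom [of n] G in eventually_elim)
   case (elim x)
   have "norm (f n x - F x) \<le> g n x + G x" using elim norm_triangle_ineq4 [of "f n x" "F x"] by linarith
   moreover have "0 \<le> g n x" "0 \<le> G x" using elim by (auto intro: order_trans [OF norm_ge_zero])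
   ultimately show ?case by (simp flip: ennreal_plus)
  qed
  also have "... = ennreal (2*J)" using J by (simp add: nn_integral_add flip: ennreal_plus)
  finally show ?thesis .
 qed
 have "ennreal (2*J) = (\<integral>\<^sup>+ x. 2*ennreal (G x) \<partial>M)" using J by (simp add: nn_integral_cmult ennreal_mult)
 also have "... = (\<integral>\<^sup>+ x. liminf (\<lambda>n. ?u n x) \<partial>M)"
 proof (rule nn_integral_cong_AE, use lim G in eventually_elim)
  case (elim x)
  then have "(\<lambda>n. ?u n x) \<longlonglongrightarrow> ennreal (G x + G x - norm (F x - F x))" by (intro tendsto_ennrealI tendsto_intros)
  moreover have "0 \<le> G x" by (rule order_trans [OF norm_ge_zero elim(3)])
  then have "2*ennreal (G x) = ennreal (G x + G x - norm (F x - F x))" using ennreal_mult [of 2 "G x"] by simp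
  ultimately show ?case by (simp only: lim_imp_Liminf [OF sequentially_bot])
 qed
 also have "... \<le> liminf (\<lambda>n. \<integral>\<^sup>+ x. ?u n x \<partial>M)" by (intro nn_integral_liminf) measurable
 finally have L: "ennreal (2*J) \<le> liminf (\<lambda>n. \<integral>\<^sup>+ x. ?u n x \<partial>M)" .
 have "b \<longlonglongrightarrow> 0"
 proof (rule LIMSEQ_I)
  fix ep :: real assume ep: "ep > 0"
  have b2: "b n \<le> 2*J" for n
   using sum [of n] J(1) b(1) by (metis ennreal_le_iff le_iff_add add.commute mult_nonneg_nonneg zero_le_numeral)
  have "\<forall>\<^sub>F n in sequentially. b n < ep"
  proof (cases "2*J < ep")
   case False
   then have "ennreal (2*J - ep) < ennreal (2*J)" using ep by (intro ennreal_lessI) auto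
   from less_LiminfD [OF less_le_trans [OF this L]] show ?thesis
   proof eventually_elim
    case (elim n)
    obtain U where U: "U \<ge> 0" "(\<integral>\<^sup>+ x. ?u n x \<partial>M) = ennreal U"
     using sum [of n] by (cases "\<integral>\<^sup>+ x. ?u n x \<partial>M") auto
    then have "U + b n = 2*J" using sum [of n] b(1) [of n] J(1) by (simp flip: ennreal_plus)
    moreover have "2*J - ep < U" using elim U False ep by (simp add: ennreal_less_iff)
    ultimately show ?case by simp
   qed
  qed (use b2 in \<open>auto intro!: always_eventually intro: le_less_trans\<close>)
  then show "\<exists>no. \<forall>n\<ge>no. norm (b n - 0) < ep" using b(1) by (auto simp: eventually_sequentially)
 qed
 moreover have "norm (integral\<^sup>L M (f n) - integral\<^sup>L M F) \<le> b n" for n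
  unfolding b_def by (simp flip: Bochner_Integration.integral_diff)
 ultimately show ?thesis using Lim_null_comparison [of "\<lambda>n. integral\<^sup>L M (f n) - integral\<^sup>L M F" b sequentially] by (simp add: LIM_zero_iff)
qed

text \<open>Excluded are the possible pole at 0 and the jumps at |u| = 1.\<close>

lemma tendsto_bump:
 assumes "X \<longlonglongrightarrow> u" "u \<noteq> 0" "abs u \<noteq> 1"
 shows "(\<lambda>n. bump e s (X n)) \<longlonglongrightarrow> bump e s u"
proof (cases "abs u < 1")
 case True
 have "\<forall>\<^sub>F n in sequentially. abs (X n) < 1" using order_tendstoD(2) [OF tendsto_rabs [OF assms(1)] True] .
 moreover have "(\<lambda>n. 1 + abs (X n) powr (- e)) \<longlonglongrightarrow> 1 + abs u powr (- e)" using assms by (intro tendsto_intros) auto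
 ultimately show ?thesis using True by (auto simp: bump_def elim!: Lim_transform_eventually eventually_mono)
next
 case False
 then have "1 < abs u" using assms by simp
 then have "\<forall>\<^sub>F n in sequentially. 1 < abs (X n)" using order_tendstoD(1) [OF tendsto_rabs [OF assms(1)]] by auto
 moreover have "(\<lambda>n. abs (X n) powr (- s)) \<longlonglongrightarrow> abs u powr (- s)" using assms by (intro tendsto_intros) auto
 ultimately show ?thesis using False by (auto simp: bump_def elim!: Lim_transform_eventually eventually_mono)
qed

lemma AE_tendsto_bumps:
 assumes "T \<longlonglongrightarrow> t" and x: "x > 0"
 shows "AE z in lborel. (\<lambda>n. bumps e s (T n) (z/x)) \<longlonglongrightarrow> bumps e s t (z/x)"
proof -
 \<comment> \<open>The centres of the five bumps for the limit t, together with their jump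
   points.\<close>
 define N where "N = (\<Union>d\<in>{0, t, t - 1, t + 1, 1 - t}. {d, d - 1, d + 1})"
 have "AE z in lborel. z \<notin> (\<lambda>y. x*y) ` N" by (intro AE_not_in finite_imp_null_set_lborel) (auto simp: N_def)
 then show ?thesis
 proof eventually_elim
  case (elim z)
  define y where "y = z/x"
  have y: "y \<notin> N" using elim x by (auto simp: y_def image_iff)
  have lim: "(\<lambda>n. bump e s (y - D n)) \<longlonglongrightarrow> bump e s (y - d)" if "D \<longlonglongrightarrow> d" "d \<in> {0, t, t - 1, t + 1, 1 - t}" for D d
  proof (intro tendsto_bump tendsto_intros that(1))
   have "y \<noteq> d" "y \<noteq> d - 1" "y \<noteq> d + 1" using y that(2) unfolding N_def by blast+
   then show "y - d \<noteq> 0" "abs (y - d) \<noteq> 1" by (auto simp: abs_if)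
  qed
  show ?case unfolding bumps_def y_def [symmetric] by (intro tendsto_add lim) (auto intro!: tendsto_intros assms)
 qed
qed

text \<open>The signed kernel times the density of the measure, set to 0 where the kernel is
  unspecified; this makes it jointly Borel measurable in (x, z) and leaves lborel as the measure of
  integration.\<close>

definition kernel_S :: "real => real => real => real => real => real" where
 "kernel_S al be t x z = (if (t, x, z) \<in> kernel_domain then kernel_K al be t x z*z powr (2*al + 1) else 0)"

lemma open_kernel_domain: "open kernel_domain"
proof -
 have *: "kernel_domain = {w. 0 < fst w} \<inter> {w. 0 < fst (snd w)} \<inter> {w. 0 < snd (snd w)} \<inter>
   {w. fst w \<noteq> abs (fst (snd w) - snd (snd w))} \<inter> {w. fst w \<noteq> fst (snd w) + snd (snd w)}"
  by (auto simp: kernel_domain_def)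
 show ?thesis unfolding * by (intro open_Int open_Collect_less open_Collect_neq continuous_intros)
qed

lemma kernel_S_measurable:
 assumes al: "al > -1" and mu: "al + be > -1/2"
 shows "case_prod (kernel_S al be t) \<in> borel_measurable (borel \<Otimes>\<^sub>M borel)"
proof -
 have "(\<lambda>w. indicator kernel_domain w *\<^sub>R (case w of (t, x, z) => kernel_K al be t x z)) \<in> borel_measurable borel"
  by (intro borel_measurable_continuous_on_indicator continuous_on_kernel_K al mu borel_open open_kernel_domain)
 then have [measurable]: "(\<lambda>w. indicator kernel_domain w *\<^sub>R (case w of (t, x, z) => kernel_K al be t x z)) \<in> borel_measurable (borel \<Otimes>\<^sub>M (borel \<Otimes>\<^sub>M borel))"
  by (simp add: borel_prod)
 have "case_prod (kernel_S al be t) = (\<lambda>w. (indicator kernel_domain (t, fst w, snd w) *\<^sub>R (case (t, fst w, snd w) of (t, x, z) => kernel_K al be t x z)) * snd w powr (2*al + 1))"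
  by (auto simp: kernel_S_def fun_eq_iff)
 also have "... \<in> borel_measurable (borel \<Otimes>\<^sub>M borel)" by measurable
 finally show ?thesis .
qed

text \<open>The degree -2 al - 2 of the kernel and the degree 2 al + 1 of the density combine to
  1/x.\<close>

lemma abs_kernel_S:
 assumes al: "al > -1" and mu: "al + be > -1/2" and x: "x > 0"
 shows "abs (kernel_S al be t x z) = kernel_N al be (t/x) (z/x)/x"
proof -
 have "1 - z/x = (x - z)/x" using x by (simp add: field_simps)
 then have "abs (1 - z/x) = abs (x - z)/x" using x by simp
 then have d: "(t/x, 1, z/x) \<in> kernel_domain \<longleftrightarrow> (t, x, z) \<in> kernel_domain"
  using x by (auto simp: kernel_domain_def zero_less_divide_iff divide_eq_eq add_divide_distrib [symmetric]) (auto simp: field_simps)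
 show ?thesis
 proof (cases "(t, x, z) \<in> kernel_domain")
  case True
  then have pos: "t > 0" "z > 0" by (auto simp: kernel_domain_def)
  have ne: "t/x \<noteq> abs (1 - z/x)" "t/x \<noteq> 1 + z/x" using True unfolding d [symmetric] by (auto simp: kernel_domain_def)
  have "kernel_K al be (x*(t/x)) (x*1) (x*(z/x)) = x powr (- 2*al - 2) * kernel_K al be (t/x) 1 (z/x)"
   using pos x ne by (intro kernel_K_scale al mu) auto
  then have "abs (kernel_S al be t x z) = (x powr (- 2*al - 2)*x powr (2*al + 1))*(abs (kernel_K al be (t/x) 1 (z/x))*(z/x) powr (2*al + 1))"
   using True x pos by (simp add: kernel_S_def abs_mult powr_divide)
  also have "x powr (- 2*al - 2)*x powr (2*al + 1) = 1/x" unfolding powr_add [symmetric] using x by (simp add: powr_minus_divide)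
  finally show ?thesis using True d by (simp add: kernel_N_def)
 qed (use d in \<open>simp add: kernel_S_def kernel_N_def\<close>)
qed

section \<open>From Lebesgue measurable functions to Borel representatives\<close>

lemma borel_representative:
 fixes f :: "real => complex"
 assumes f: "f \<in> borel_measurable (power_measure dl)"
 obtains F where "F \<in> borel_measurable borel" "AE z in lborel. 0 < z --> f z = F z" "\<And>z. z \<le> 0 ==> F z = 0"
proof -
 have "f \<in> borel_measurable (lebesgue_on {0<..})" using f by (simp add: power_measure_def)
 then have m: "(\<lambda>z. if z \<in> {0<..} then f z else 0) \<in> borel_measurable lebesgue"
  by (subst (asm) borel_measurable_if [symmetric]) auto
 then have "(\<lambda>z. Re (if z \<in> {0<..} then f z else 0)) \<in> borel_measurable lebesgue" "(\<lambda>z. Im (if z \<in> {0<..} then f z else 0)) \<in> borel_measurable lebesgue"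
  by (simp_all add: borel_measurable_complex_iff)
 then obtain a b where ab: "a \<in> borel_measurable borel" "b \<in> borel_measurable borel"
  "AE z in lborel. Re (if z \<in> {0<..} then f z else 0) = a z" "AE z in lborel. Im (if z \<in> {0<..} then f z else 0) = b z"
  by (auto dest!: completion_ex_borel_measurable_real)
 note [measurable] = ab(1,2)
 define F where "F z = indicator {0<..} z *\<^sub>R (complex_of_real (a z) + \<i>*complex_of_real (b z))" for z
 have "F \<in> borel_measurable borel"
  unfolding F_def [abs_def] by measurable
 moreover have "AE z in lborel. 0 < z --> f z = F z"
  using ab(3,4) by eventually_elim (auto simp: F_def complex_eq_iff)
 moreover have "F z = 0" if "z \<le> 0" for z using that by (simp add: F_def)
 ultimately show thesis by (rule that)
qed

lemma nn_integral_power_measure: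
 assumes ph: "ph \<in> borel_measurable (power_measure dl)" and e: "AE z in lborel. 0 < z --> ph z = ps z"
 shows "(\<integral>\<^sup>+ z. ph z \<partial>power_measure dl) = (NN z. ps z*power_weight dl z)"
proof -
 have [measurable]: "ph \<in> borel_measurable (lebesgue_on {0<..})" using ph by (simp add: power_measure_def)
 have [measurable]: "(\<lambda>x. x powr dl) \<in> borel_measurable (lebesgue_on {0<..})"
  by (intro measurable_restrict_space1 measurable_completion) simp
 have "(\<integral>\<^sup>+ z. ph z \<partial>power_measure dl) = (NN z. ennreal (z powr dl)*ph z*indicator {0<..} z)"
  unfolding power_measure_def by (simp add: nn_integral_density nn_integral_restrict_space nn_integral_completion)
 also have "... = (NN z. ps z*power_weight dl z)"
  using e by (intro nn_integral_cong_AE) (auto simp: power_weight_def indicator_def mult.commute elim!: eventually_mono)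
 finally show ?thesis .
qed

text \<open>For fixed t and x the domain of the kernel omits only those z > 0 with t = |x - z| or t
  = x + z, at most three points. They are negligible for the integral, and a finite change of values
  also gives the measurability of \<open>kernel_K\<close>.\<close>

lemma mean_M_representation:
 fixes f F :: "real => complex"
 assumes al: "al > -1" and mu: "al + be > -1/2" and f: "f \<in> borel_measurable (power_measure dl)"
  and F [measurable]: "F \<in> borel_measurable borel" and fF: "AE z in lborel. 0 < z --> f z = F z" and t: "t > 0" and x: "x > 0"
 shows "integrable (power_measure (2*al + 1)) (\<lambda>z. kernel_K al be t x z *\<^sub>R f z) \<longleftrightarrow> integrable lborel (\<lambda>z. kernel_S al be t x z *\<^sub>R F z)"
  "mean_M al be t f x = (\<integral>z. kernel_S al be t x z *\<^sub>R F z \<partial>lborel)"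
proof -
 let ?M = "lebesgue_on {0<..} :: real measure"
 have [measurable]: "f \<in> borel_measurable ?M" using f by (simp add: power_measure_def)
 have w [measurable]: "(\<lambda>z. z powr (2*al + 1)) \<in> borel_measurable ?M" "(\<lambda>z. z powr (- (2*al + 1))) \<in> borel_measurable ?M"
  by (intro measurable_restrict_space1 measurable_completion; simp)+
 have S [measurable]: "kernel_S al be t x \<in> borel_measurable borel"
  using measurable_compose [OF measurable_Pair1' [of x borel borel] kernel_S_measurable [OF al mu]] by simp
 have "(\<lambda>z. kernel_S al be t x z*z powr (- (2*al + 1))) \<in> borel_measurable ?M"
  by (intro borel_measurable_times w measurable_restrict_space1 measurable_completion) simp
 then have K [measurable]: "kernel_K al be t x \<in> borel_measurable ?M"
 proof (rule measurable_discrete_difference [of _ _ _ "{z. 0 < z \<and> (t = abs (x - z) \<or> t = x + z)}"])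
  have "{z. 0 < z \<and> (t = abs (x - z) \<or> t = x + z)} \<subseteq> {x - t, x + t, t - x}" by auto
  then show "countable {z. 0 < z \<and> (t = abs (x - z) \<or> t = x + z)}" by (rule countable_subset) simp
  fix z assume "z \<in> space ?M" "z \<notin> {z. 0 < z \<and> (t = abs (x - z) \<or> t = x + z)}"
  then show "kernel_S al be t x z*z powr (- (2*al + 1)) = kernel_K al be t x z"
   using t x by (simp add: kernel_S_def kernel_domain_def flip: powr_add)
 qed (auto simp: sets_restrict_space_iff)
 let ?g = "\<lambda>z. indicator {0<..} z *\<^sub>R (z powr (2*al + 1)) *\<^sub>R kernel_K al be t x z *\<^sub>R f z"
 let ?h = "\<lambda>z. kernel_S al be t x z *\<^sub>R F z"
 have g: "?g \<in> borel_measurable lebesgue"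
 proof -
  have "(\<lambda>z. (z powr (2*al + 1)) *\<^sub>R kernel_K al be t x z *\<^sub>R f z) \<in> borel_measurable ?M" by measurable
  then show ?thesis by (subst (asm) borel_measurable_restrict_space_iff) auto
 qed
 have h: "?h \<in> borel_measurable lebesgue" by (intro measurable_completion) simp
 have "AE z in lborel. z \<notin> {x - t, x + t, t - x}" by (intro AE_not_in finite_imp_null_set_lborel) simp
 then have "AE z in lborel. ?g z = ?h z"
  using fF by eventually_elim (auto simp: kernel_S_def kernel_domain_def indicator_def t x)
 then have e: "AE z in lebesgue. ?g z = ?h z" by (rule AE_completion)
 have p: "power_measure (2*al + 1) = density ?M (\<lambda>z. z powr (2*al + 1))" by (simp add: power_measure_def)
 have "integrable (power_measure (2*al + 1)) (\<lambda>z. kernel_K al be t x z *\<^sub>R f z) \<longleftrightarrow> integrable lebesgue ?g"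
  unfolding p by (subst integrable_density) (auto simp: integrable_restrict_space)
 also have "... \<longleftrightarrow> integrable lebesgue ?h" using g h e by (rule integrable_cong_AE)
 also have "... \<longleftrightarrow> integrable lborel ?h" by (intro integrable_completion) simp
 finally show "integrable (power_measure (2*al + 1)) (\<lambda>z. kernel_K al be t x z *\<^sub>R f z) \<longleftrightarrow> integrable lborel ?h" .
 have "mean_M al be t f x = integral\<^sup>L lebesgue ?g"
  unfolding mean_M_def p by (subst integral_density) (auto simp: integral_restrict_space)
 also have "... = integral\<^sup>L lebesgue ?h" using g h e by (rule integral_cong_AE)
 also have "... = integral\<^sup>L lborel ?h" by (intro integral_completion) simp
 finally show "mean_M al be t f x = integral\<^sup>L lborel ?h" .
qed

text \<open>Young's inequality splits the product: the p'-th power of kernel times weight is below a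
  multiple of \<open>bumps\<close>, and (|F|/weight)^p is below |F|^p y powr dl, for which nonstrict
  inequalities for a and b are enough, so the end point is included. The resulting majorants have
  integrals independent of the radius, as \<open>tendsto_integral_Pratt\<close> asks.\<close>

lemma kernel_S_integral_continuous:
 fixes F :: "real => complex"
 assumes al: "al > -1" and mu: "al + be > -1/2" and h: "2*al + be + 1 \<ge> 0" and si: "si > 0" "si \<ge> 1/2 - al - be" and p: "p > 1"
  and r: "si*(p/(p - 1)) < 1" "(2*al + min be 1 - a)*(p/(p - 1)) > -1" "(b - 1)*(p/(p - 1)) < -1"
  and ab: "dl/p \<le> a" "b \<le> be" "- dl/p \<le> b"
  and F [measurable]: "F \<in> borel_measurable borel" and fin: "(NN z. ennreal (cmod (F z) powr p)*power_weight dl z) < top"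
  and x: "x > 0" and T: "T \<longlonglongrightarrow> t" "\<And>n. T n \<ge> t/2" and t: "t > 0"
 shows "integrable lborel (\<lambda>z. kernel_S al be t x z *\<^sub>R F z)"
  "(\<lambda>n. \<integral>z. kernel_S al be (T n) x z *\<^sub>R F z \<partial>lborel) \<longlonglongrightarrow> (\<integral>z. kernel_S al be t x z *\<^sub>R F z \<partial>lborel)"
proof -
 obtain e s where es: "e < 1" "1 < s"
  "\<And>tt. tt > 0 ==> \<exists>C\<ge>0. \<forall>t\<ge>tt. \<forall>y. (kernel_N al be t y*weight a b y) powr (p/(p - 1)) \<le> C*bumps e s t y"
  using kernel_N_weight_bound [OF al mu h si _ r ab(2)] p by auto
 obtain C where C: "C \<ge> 0" "\<And>t' y. t' \<ge> t/2/x ==> (kernel_N al be t' y*weight a b y) powr (p/(p - 1)) \<le> C*bumps e s t' y"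
  using es(3) [of "t/2/x"] t x by auto
 obtain J where J: "J \<ge> 0" "\<And>t. (NN y. ennreal (bumps e s t y)) = ennreal J"
  using bumps_integral [OF es(1,2)] by auto
 define W where "W y = indicator {0<..} y*(cmod (F (x*y)) powr p*y powr dl)" for y
 have [measurable]: "W \<in> borel_measurable borel" unfolding W_def [abs_def] by measurable
 have W0: "W y \<ge> 0" for y by (simp add: W_def)
 define g where "g T z = (C*bumps e s (T/x) (z/x) + W (z/x))/x" for T z
 have [measurable]: "g T \<in> borel_measurable borel" for T unfolding g_def [abs_def] by measurable
 have "(NN y. ennreal (W y)) = (NN z. ennreal (x powr (- dl)/x)*(ennreal (cmod (F z) powr p)*power_weight dl z))"
 proof -
  have "(NN y. ennreal (W y)) = (NN z. ennreal (1/x)*ennreal (W (z/x)))"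
   by (subst nn_integral_scale [OF _ x], measurable) (simp add: nn_integral_cmult)
  also have "... = (NN z. ennreal (x powr (- dl)/x)*(ennreal (cmod (F z) powr p)*power_weight dl z))"
  proof (rule nn_integral_cong)
   fix z :: real
   show "ennreal (1/x)*ennreal (W (z/x)) = ennreal (x powr (- dl)/x)*(ennreal (cmod (F z) powr p)*power_weight dl z)"
    using x by (cases "z > 0") (auto simp: W_def power_weight_def powr_divide powr_minus_divide zero_less_divide_iff mult_ac simp flip: ennreal_mult)
  qed
  finally show ?thesis .
 qed
 then have "(NN y. ennreal (W y)) < top" using fin by (simp add: nn_integral_cmult ennreal_mult_less_top)
 then obtain K where K: "K \<ge> 0" "(NN y. ennreal (W y)) = ennreal K"
  by (cases "NN y. ennreal (W y)") auto
 have gJ: "(NN z. ennreal (g T z)) = ennreal (C*J + K)" for T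
 proof -
  have "(NN z. ennreal (g T z)) = (NN z. ennreal (1/x)*ennreal (C*bumps e s (T/x) (z/x) + W (z/x)))"
   using x C(1) W0 by (intro nn_integral_cong) (simp add: g_def add_nonneg_nonneg del: ennreal_plus flip: ennreal_mult)
  also have "... = (NN y. ennreal (C*bumps e s (T/x) y + W y))"
   by (subst nn_integral_scale [OF _ x, of "\<lambda>y. ennreal (C*bumps e s (T/x) y + W y)"], measurable) (simp add: nn_integral_cmult)
  also have "... = (NN y. ennreal C*ennreal (bumps e s (T/x) y) + ennreal (W y))"
   using C(1) W0 by (intro nn_integral_cong) (simp flip: ennreal_mult)
  also have "... = ennreal C*ennreal J + ennreal K" by (simp add: nn_integral_add nn_integral_cmult J(2) K(2))
  finally show ?thesis using C(1) J(1) K(1) by (simp flip: ennreal_mult)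
 qed
 have dom: "norm (kernel_S al be T x z *\<^sub>R F z) \<le> g T z" if T: "T \<ge> t/2" for T z
 proof (cases "z > 0")
  case True
  define y where "y = z/x"
  define w where "w = weight a b y"
  have y: "y > 0" "z = x*y" using True x by (auto simp: y_def)
  have w: "w > 0" using y by (auto simp: w_def weight_def)
  have wd: "w powr (- p) \<le> y powr dl"
  proof (cases "y \<le> 1")
   case True
   have "dl \<le> a*p" using ab(1) p by (simp add: field_simps)
   then have "y powr (a*p) \<le> y powr dl" using True y by (intro powr_mono') auto
   then show ?thesis using True by (simp add: w_def weight_def powr_powr)
  next
   case False
   have "- (b*p) \<le> dl" using ab(3) p by (simp add: field_simps)
   then have "y powr (- (b*p)) \<le> y powr dl" using False by (intro powr_mono) auto
   then show ?thesis using False by (simp add: w_def weight_def powr_powr)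
  qed
  let ?q = "p/(p - 1)"
  have "kernel_N al be (T/x) y*cmod (F z) = (kernel_N al be (T/x) y*w)*(cmod (F z)/w)" using w by simp
  also have "... \<le> (kernel_N al be (T/x) y*w) powr ?q/?q + (cmod (F z)/w) powr p/p"
   using w p by (intro Youngs_inequality) (auto simp: field_simps)
  also have "... \<le> (kernel_N al be (T/x) y*w) powr ?q/1 + (cmod (F z)/w) powr p/1"
   using p by (intro add_mono divide_left_mono) auto
  also have "(cmod (F z)/w) powr p = cmod (F z) powr p*w powr (- p)" using w by (simp add: powr_divide powr_minus_divide)
  also have "(kernel_N al be (T/x) y*w) powr ?q/1 + cmod (F z) powr p*w powr (- p)/1 \<le> C*bumps e s (T/x) y + cmod (F z) powr p*y powr dl"
   unfolding div_by_1 using C(2) [OF divide_right_mono [OF T less_imp_le [OF x]], of y] by (intro add_mono mult_left_mono wd) (auto simp: w_def)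
  also have "... = C*bumps e s (T/x) y + W y" using y by (simp add: W_def)
  finally have "kernel_N al be (T/x) y*cmod (F z)/x \<le> (C*bumps e s (T/x) y + W y)/x" using x by (intro divide_right_mono) auto
  then show ?thesis by (simp add: abs_kernel_S [OF al mu x] g_def y_def)
 next
  case False
  then show ?thesis using x C(1) W0 by (simp add: kernel_S_def kernel_domain_def g_def add_nonneg_nonneg)
 qed
 note [measurable] = kernel_S_measurable [OF al mu]
 have [measurable]: "kernel_S al be T x \<in> borel_measurable borel" for T
  using measurable_compose [OF measurable_Pair1' [of x borel borel] kernel_S_measurable [OF al mu]] by simp
 show "integrable lborel (\<lambda>z. kernel_S al be t x z *\<^sub>R F z)"
 proof (rule integrableI_bounded)
  have "(NN z. ennreal (norm (kernel_S al be t x z *\<^sub>R F z))) \<le> (NN z. ennreal (g t z))"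
   using t by (intro nn_integral_mono ennreal_leI dom) simp
  then show "(NN z. ennreal (norm (kernel_S al be t x z *\<^sub>R F z))) < \<infinity>" unfolding gJ by (rule le_less_trans) simp
 qed simp
 show "(\<lambda>n. \<integral>z. kernel_S al be (T n) x z *\<^sub>R F z \<partial>lborel) \<longlonglongrightarrow> (\<integral>z. kernel_S al be t x z *\<^sub>R F z \<partial>lborel)"
 proof (rule tendsto_integral_Pratt [where g = "\<lambda>n. g (T n)" and G = "g t" and J = "C*J + K"])
  have "AE z in lborel. z \<notin> {x - t, x + t, t - x}" by (intro AE_not_in finite_imp_null_set_lborel) simp
  then show "AE z in lborel. (\<lambda>n. kernel_S al be (T n) x z *\<^sub>R F z) \<longlonglongrightarrow> kernel_S al be t x z *\<^sub>R F z"
  proof eventually_elim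
   case (elim z)
   show ?case
   proof (cases "z > 0")
    case True
    then have d: "(t, x, z) \<in> kernel_domain" using elim t x by (auto simp: kernel_domain_def abs_if split: if_splits)
    have lim: "(\<lambda>n. (T n, x, z)) \<longlonglongrightarrow> (t, x, z)" by (intro tendsto_Pair T tendsto_const)
    have "isCont (\<lambda>(t, x, z). kernel_K al be t x z) (t, x, z)"
     using continuous_on_kernel_K [OF al mu] open_kernel_domain d continuous_on_eq_continuous_at by blast
    from isCont_tendsto_compose [OF this lim] have "(\<lambda>n. kernel_K al be (T n) x z) \<longlonglongrightarrow> kernel_K al be t x z" by simp
    then have "(\<lambda>n. kernel_K al be (T n) x z*z powr (2*al + 1)) \<longlonglongrightarrow> kernel_S al be t x z" using d by (simp add: kernel_S_def tendsto_mult_right)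
    moreover have "\<forall>\<^sub>F n in sequentially. (T n, x, z) \<in> kernel_domain" using topological_tendstoD [OF lim open_kernel_domain d] .
    then have "\<forall>\<^sub>F n in sequentially. kernel_K al be (T n) x z*z powr (2*al + 1) = kernel_S al be (T n) x z" by eventually_elim (simp add: kernel_S_def)
    ultimately have "(\<lambda>n. kernel_S al be (T n) x z) \<longlonglongrightarrow> kernel_S al be t x z" by (rule Lim_transform_eventually)
    then show ?thesis by (intro tendsto_intros)
   qed (simp add: kernel_S_def kernel_domain_def)
  qed
  have "(\<lambda>n. T n/x) \<longlonglongrightarrow> t/x" using x by (intro tendsto_intros T) auto
  then have "AE z in lborel. (\<lambda>n. bumps e s (T n/x) (z/x)) \<longlonglongrightarrow> bumps e s (t/x) (z/x)" using x by (rule AE_tendsto_bumps)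
  then show "AE z in lborel. (\<lambda>n. g (T n) z) \<longlonglongrightarrow> g t z"
   by eventually_elim (use x in \<open>auto simp: g_def intro!: tendsto_intros\<close>)
 qed (use dom T gJ C(1) J(1) K(1) in auto)
qed

theorem theorem1p5:
 fixes \<alpha> \<beta> p \<delta> :: real
 assumes "\<alpha> > -1"
  and "\<alpha> + \<beta> > -1/2"
  and "1 < p"
  and "1 / p < \<alpha> + \<beta> + 1/2"
  and "\<beta> \<ge> 1 \<Longrightarrow> -1 < \<delta> \<and> \<delta> < (2 * \<alpha> + 2) * p - 1"
  and "0 < \<beta> \<and> \<beta> < 1 \<Longrightarrow>
   (- \<beta> / min (max \<beta> (\<alpha> + \<beta> + 1/2)) 1 < \<delta> \<or>
    (\<alpha> + \<beta> > 1/2 \<and> - \<beta> / min (max \<beta> (\<alpha> + \<beta> + 1/2)) 1 \<le> \<delta>)) \<and>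
   \<delta> < (2 * \<alpha> + \<beta> + 1) * p - 1"
  and "\<beta> \<le> 0 \<Longrightarrow>
   (- \<beta> * p < \<delta> \<or> ((- \<beta> \<in> \<nat> \<or> \<alpha> + \<beta> > 1/2) \<and> - \<beta> * p \<le> \<delta>)) \<and>
   \<delta> < (2 * \<alpha> + \<beta> + 1) * p - 1"
 shows "maximal_M_bounded \<alpha> \<beta> p \<delta>"
proof -
 note \<alpha> = assms(1) and \<mu> = assms(2) and p = assms(3)
 obtain \<sigma> q a b where par: "\<sigma> > 0" "\<sigma> \<ge> 1/2 - \<alpha> - \<beta>" "1 < q" "q < p" "\<sigma>*(q/(q - 1)) < 1"
  "\<sigma>*(p/(p - 1)) < 1" "(2*\<alpha> + min \<beta> 1 - a)*(p/(p - 1)) > -1" "(b - 1)*(p/(p - 1)) < -1"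
  "\<delta>/p < a" "b \<le> \<beta>" "- \<delta>/p < b \<or> \<beta> \<le> 0 \<and> b = \<beta> \<and> \<delta> = - \<beta>*p" "2*\<alpha> + \<beta> + 1 \<ge> 0"
  by (rule maximal_parameters [OF \<alpha> p assms(4-7)])
 \<comment> \<open>Equality occurs only at the end point; the continuity lemma takes the nonstrict
   form in either case.\<close>
 have b: "- \<delta>/p \<le> b" using par(11) p by auto
 obtain C where C: "C \<ge> 0" "\<And>u. u \<in> borel_measurable borel \<Longrightarrow> \<forall>z. 0 \<le> u z \<Longrightarrow>
   (NN x. ennreal_powr (dilation_maximal (kernel_N \<alpha> \<beta>) u x) p*power_weight \<delta> x) \<le> ennreal C*(NN z. ennreal (u z powr p)*power_weight \<delta> z)"
  using maximal_bounded_kernel_N [OF \<alpha> \<mu> par(12,1-11)] unfolding maximal_bounded_def by blast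
 have main: "(\<forall>t>0. \<forall>x>0. integrable (power_measure (2*\<alpha> + 1)) (\<lambda>z. kernel_K \<alpha> \<beta> t x z *\<^sub>R f z)) \<and>
   maximal_M \<alpha> \<beta> f \<in> borel_measurable (power_measure \<delta>) \<and>
   Lp_norm (power_measure \<delta>) p (maximal_M \<alpha> \<beta> f) \<le> ennreal (C powr (1/p))*Lp_norm (power_measure \<delta>) p (\<lambda>x. ennreal (cmod (f x)))"
  if "f \<in> Lp_space (power_measure \<delta>) p" for f
 proof -
  have f [measurable]: "f \<in> borel_measurable (power_measure \<delta>)" and Lp: "Lp_norm (power_measure \<delta>) p (\<lambda>x. ennreal (cmod (f x))) < top"
   using that by (auto simp: Lp_space_def)
  obtain F where F [measurable]: "F \<in> borel_measurable borel" and fF: "AE z in lborel. 0 < z \<longrightarrow> f z = F z" and F0: "\<And>z. z \<le> 0 \<Longrightarrow> F z = 0"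
   using borel_representative [OF f] by metis
  define I where "I = (NN z. ennreal (cmod (F z) powr p)*power_weight \<delta> z)"
  have I: "(\<integral>\<^sup>+ z. ennreal_powr (ennreal (cmod (f z))) p \<partial>power_measure \<delta>) = I"
   unfolding I_def using fF by (intro nn_integral_power_measure) (auto elim!: eventually_mono)
  have fin: "I < top" using Lp unfolding Lp_norm_def I by (cases I) auto
  note rep = mean_M_representation [OF \<alpha> \<mu> f F fF]
  note cont = kernel_S_integral_continuous [OF \<alpha> \<mu> par(12,1,2) p par(6-8) less_imp_le [OF par(9)] par(10) b F fin [unfolded I_def]]
  have int: "integrable lborel (\<lambda>z. kernel_S \<alpha> \<beta> t x z *\<^sub>R F z)" if "t > 0" "x > 0" for t x
   using cont(1) [OF that(2) tendsto_const _ that(1)] that by simp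
  \<comment> \<open>A countable supremum of integrals of Borel functions, hence Borel measurable in
    x; continuity in t identifies it with the maximal function.\<close>
  define R where "R x = (SUP t\<in>\<rat> \<inter> {0<..}. ennreal (cmod (\<integral>z. kernel_S \<alpha> \<beta> t x z *\<^sub>R F z \<partial>lborel)))" for x
  have R: "maximal_M \<alpha> \<beta> f x = R x" if x: "x > 0" for x
  proof -
   have "ennreal (cmod (mean_M \<alpha> \<beta> t f x)) \<le> R x" if t: "t > 0" for t
   proof -
    \<comment> \<open>The rational radii are taken above t, which keeps them positive and at least
      t/2.\<close>
    have "\<exists>r\<in>\<rat>. t < r \<and> r < t + 1/real (Suc n)" for n by (intro Rats_dense_in_real) simp
    then obtain T where T: "\<And>n. T n \<in> \<rat>" "\<And>n. t < T n" "\<And>n. T n < t + 1/real (Suc n)" by metis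
    have "T \<longlonglongrightarrow> t"
     by (rule tendsto_sandwich [OF _ _ tendsto_const LIMSEQ_inverse_real_of_nat_add [of t]]) (use T in \<open>auto intro!: always_eventually less_imp_le simp: inverse_eq_divide\<close>)
    then have "(\<lambda>n. ennreal (cmod (\<integral>z. kernel_S \<alpha> \<beta> (T n) x z *\<^sub>R F z \<partial>lborel))) \<longlonglongrightarrow> ennreal (cmod (mean_M \<alpha> \<beta> t f x))"
     unfolding rep(2) [OF t x]
    proof (intro tendsto_ennrealI tendsto_norm cont(2) x t)
     show "t/2 \<le> T n" for n using T(2) [of n] t by simp
    qed
    then show ?thesis
     by (rule LIMSEQ_le_const2) (use T t in \<open>auto simp: R_def intro!: exI SUP_upper intro: less_trans\<close>)
   qed
   then have "maximal_M \<alpha> \<beta> f x \<le> R x" unfolding maximal_M_def by (intro SUP_least) simp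
   moreover have "R x \<le> maximal_M \<alpha> \<beta> f x"
    unfolding R_def maximal_M_def using rep(2) [OF _ x] by (intro SUP_mono) auto
   ultimately show ?thesis by (rule order_antisym)
  qed
  have Rm: "R \<in> borel_measurable borel"
   unfolding R_def [abs_def]
  proof (intro borel_measurable_SUP countable_positive_rationals)
   fix t
   note [measurable] = kernel_S_measurable [OF \<alpha> \<mu>, of t]
   show "(\<lambda>x. ennreal (cmod (\<integral>z. kernel_S \<alpha> \<beta> t x z *\<^sub>R F z \<partial>lborel))) \<in> borel_measurable borel" by measurable
  qed
  have sp: "space (power_measure \<delta>) = {0<..}" "sets (power_measure \<delta>) = sets (lebesgue_on {0<..})" by (auto simp: power_measure_def)
  have "R \<in> borel_measurable (power_measure \<delta>)"
   unfolding measurable_cong_sets [OF sp(2) refl] using Rm by (intro measurable_restrict_space1 measurable_completion) simp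
  then have mm: "maximal_M \<alpha> \<beta> f \<in> borel_measurable (power_measure \<delta>)"
   using R by (subst measurable_cong [of _ _ R]) (auto simp: sp)
  have "R x \<le> dilation_maximal (kernel_N \<alpha> \<beta>) (\<lambda>z. cmod (F z)) x" if x: "x > 0" for x
   unfolding R_def dilation_maximal_def
  proof (rule SUP_mono)
   fix t :: real assume t: "t \<in> \<rat> \<inter> {0<..}"
   note [measurable] = kernel_N_measurable [OF \<alpha> \<mu>]
   have "ennreal (cmod (\<integral>z. kernel_S \<alpha> \<beta> t x z *\<^sub>R F z \<partial>lborel)) \<le> (NN z. ennreal (norm (kernel_S \<alpha> \<beta> t x z *\<^sub>R F z)))"
    using t x by (intro integral_norm_bound_ennreal int) auto
   also have "\<dots> = (NN z. ennreal (1/x)*ennreal (kernel_N \<alpha> \<beta> (t/x) (z/x)*cmod (F (x*(z/x)))))"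
    using x by (intro nn_integral_cong) (simp add: abs_kernel_S [OF \<alpha> \<mu>] flip: ennreal_mult)
   also have "\<dots> = (NN y. ennreal (kernel_N \<alpha> \<beta> (t/x) y*cmod (F (x*y))))"
    by (subst nn_integral_scale [OF _ x, of "\<lambda>y. ennreal (kernel_N \<alpha> \<beta> (t/x) y*cmod (F (x*y)))"], measurable) (simp add: nn_integral_cmult)
   finally show "\<exists>t'\<in>\<rat> \<inter> {0<..}. ennreal (cmod (\<integral>z. kernel_S \<alpha> \<beta> t x z *\<^sub>R F z \<partial>lborel)) \<le> (NN y. ennreal (kernel_N \<alpha> \<beta> (t'/x) y*cmod (F (x*y))))"
    using t by blast
  qed
  then have "ennreal_powr (R x) p*power_weight \<delta> x \<le> ennreal_powr (dilation_maximal (kernel_N \<alpha> \<beta>) (\<lambda>z. cmod (F z)) x) p*power_weight \<delta> x" for x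
   using p by (cases "x > 0") (auto simp: power_weight_def intro!: mult_right_mono ennreal_powr_mono)
  then have "(NN x. ennreal_powr (R x) p*power_weight \<delta> x) \<le> ennreal C*I"
   unfolding I_def by (intro order_trans [OF nn_integral_mono C(2)]) auto
  moreover have "(\<integral>\<^sup>+ x. ennreal_powr (maximal_M \<alpha> \<beta> f x) p \<partial>power_measure \<delta>) = (NN x. ennreal_powr (R x) p*power_weight \<delta> x)"
   using mm R by (intro nn_integral_power_measure) auto
  ultimately have "Lp_norm (power_measure \<delta>) p (maximal_M \<alpha> \<beta> f) \<le> ennreal_powr (ennreal C*I) (1/p)"
   unfolding Lp_norm_def using p by (intro ennreal_powr_mono) auto
  also have "\<dots> = ennreal (C powr (1/p))*Lp_norm (power_measure \<delta>) p (\<lambda>x. ennreal (cmod (f x)))"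
   unfolding Lp_norm_def I ennreal_powr_mult using C(1) by simp
  finally show ?thesis using mm int rep(1) by auto
 qed
 then show ?thesis
  unfolding maximal_M_bounded_def maximal_M_well_defined_def by (intro conjI exI [of _ "C powr (1/p)"]) auto
qed

end
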